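(* Let $V$ be a real vector space of dimension $d$ with lattice $\Lambda$, let $\mathfrak c\subset V$ be a full-dimensional rational polyhedral cone with vertex $0$ and edge generators $v_1,\dots,v_N$, and let $L\subseteq V$ be a rational linear subspace. For every $m\in\mathbb Z$, consider $s\mapsto M^L(s,\mathfrak c)_{[m]}(\xi)$ as a $\Lambda$-periodic function of $s\in V$ with values in the finite-dimensional space of rational functions in $\xi$ of homogeneous degree $m$ whose denominator divides $\prod_{j=1}^N\langle\xi,v_j\rangle$. Then its Fourier series is $$M^L(s,\mathfrak c)_{[m]}(\xi)=\sum_{\gamma\in\Lambda^*\cap L^\perp}e^{\langle2i\pi\gamma,s\rangle}\,I(\mathfrak c)(\xi+2i\pi\gamma)_{[m]},$$ i.e. for $\gamma\in\Lambda^*$ the $\gamma$-th Fourier coefficient $\int_{V/\Lambda}e^{-\langle2i\pi\gamma,s\rangle}M^L(s,\mathfrak c)_{[m]}(\xi)\,ds$ equals $I(\mathfrak c)(\xi+2i\pi\gamma)_{[m]}$ if $\gamma\in L^\perp$ and $0$ otherwise, and the series converges to $M^L(s,\mathfrak c)_{[m]}(\xi)$ in the $L^2$ sense in $s$.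
   Context: $V$ is a real vector space of dimension $d$ with a lattice $\Lambda$; $\Lambda^*=\{\gamma\in V^*:\langle\gamma,\Lambda\rangle\subseteq\mathbb Z\}$; $L^\perp\subseteq V^*$ is the annihilator of $L$. $V/\Lambda$ carries the Lebesgue measure of total mass $1$. A rational subspace $L$ is one with $L\cap\Lambda$ a lattice in $L$; it carries the Lebesgue measure for which $L/(L\cap\Lambda)$ has volume $1$; $\Lambda_{V/L}$ is the image of $\Lambda$ in $V/L$. Edge generators of a pointed cone are vectors spanning its one-dimensional faces. A semi-rational polyhedron is a finite intersection of closed halfspaces $\{\langle\mu,x\rangle\le b\}$, $\mu\in\Lambda^*$, $b\in\mathbb R$. $\mathcal M_\ell(V^* )$: meromorphic functions near $0\in V^*_{\mathbb C}$ of the form $\phi(\xi)/\prod_j\langle\xi,w_j\rangle$, $\phi$ holomorphic near $0$, $w_j\in V\setminus\{0\}$; homogeneous components are defined by the Laurent expansion $\phi(\tau\xi)=\sum_{m\ge m_0}\tau^m\phi_{[m]}(\xi)$ in $\tau$. The intermediate generating function $S^L(\mathfrak p)\in\mathcal M_\ell(V^* )$ is given by the unique valuation on semi-rational polyhedra (preserving linear relations among indicator functions) that vanishes on polyhedra containing a line and equals $\sum_{y\in\Lambda_{V/L}}\int_{\mathfrak p\cap(y+L)}e^{\langle\xi,x\rangle}dx$ wherever convergent. $I(\mathfrak c)(\xi)$ is the rational function obtained as the meromorphic continuation of $\int_{\mathfrak c}e^{\langle\xi,x\rangle}dx$; for $\gamma\in\Lambda^*$, $\xi\mapsto I(\mathfrak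 c)(\xi+2i\pi\gamma)$ is an element of $\mathcal M_\ell(V^* )$ and $I(\mathfrak c)(\xi+2i\pi\gamma)_{[m]}$ denotes its homogeneous component of degree $m$ in $\xi$. $M^L(s,\mathfrak c)(\xi)=e^{-\langle\xi,s\rangle}S^L(s+\mathfrak c)(\xi)$. *)

theory Defs
  imports "HOL-Complex_Analysis.Complex_Analysis"
begin

text \<open>
  The real vector space \<open>V\<close> is a type \<open>'a\<close> of class \<open>euclidean_space\<close>; its inner product plays no
  role. The dual space \<open>V\<^sup>*\<close> is \<open>'a \<Rightarrow>\<^sub>L real\<close>, and the complexified dual space is the space
  \<open>'a \<Rightarrow>\<^sub>L complex\<close> of real-linear maps into the complex numbers, so that the pairing
  \<open>\<langle>\<xi>, x\<rangle>\<close> is application of \<open>\<xi>\<close> to \<open>x\<close>.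
\<close>

type_synonym 'a cdual = "'a \<Rightarrow>\<^sub>L complex"

lift_definition cscale :: "complex \<Rightarrow> ('a::real_normed_vector) cdual \<Rightarrow> 'a cdual"
  is "\<lambda>c \<xi> x. c * \<xi> x"
  by (rule bounded_linear_const_mult)

lift_definition complexify :: "('a::real_normed_vector \<Rightarrow>\<^sub>L real) \<Rightarrow> 'a cdual"
  is "\<lambda>\<gamma> x. complex_of_real (\<gamma> x)"
  by (rule bounded_linear_compose[OF bounded_linear_of_real])

definition lattice_basis :: "'a::real_vector set \<Rightarrow> 'a set \<Rightarrow> bool" where
  "lattice_basis B \<Gamma> \<longleftrightarrow>
     finite B \<and> independent B \<and> \<Gamma> = range (\<lambda>k::'a \<Rightarrow> int. \<Sum>b\<in>B. real_of_int (k b) *\<^sub>R b)"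

definition lattice_in :: "'a::real_vector set \<Rightarrow> 'a set \<Rightarrow> bool" where
  "lattice_in \<Gamma> L \<longleftrightarrow> (\<exists>B. lattice_basis B \<Gamma> \<and> span B = L)"

definition rational_subspace :: "'a::real_vector set \<Rightarrow> 'a set \<Rightarrow> bool" where
  "rational_subspace \<Lambda> L \<longleftrightarrow> subspace L \<and> lattice_in (L \<inter> \<Lambda>) L"

definition some_basis :: "'a::real_vector set \<Rightarrow> 'a set" where
  "some_basis \<Gamma> = (SOME B. lattice_basis B \<Gamma>)"

text \<open>
  The Lebesgue measure on the span of a lattice \<open>\<Gamma>\<close> for which \<open>span \<Gamma> / \<Gamma>\<close> has volume 1, as a
  measure on the ambient space: the image of the standard Lebesgue measure under coordinates
  with respect to a lattice basis. It does not depend on the basis, since base changes are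
  unimodular. For \<open>\<Gamma> = {0}\<close> it is the unit mass at 0.
\<close>

definition lattice_measure :: "'a::euclidean_space set \<Rightarrow> 'a measure" where
  "lattice_measure \<Gamma> =
     distr (Pi\<^sub>M (some_basis \<Gamma>) (\<lambda>_. lborel)) borel (\<lambda>t. \<Sum>b\<in>some_basis \<Gamma>. t b *\<^sub>R b)"

text \<open>
  Integration over \<open>V / \<Lambda>\<close> is integration of a \<open>\<Lambda>\<close>-periodic function over the following
  fundamental domain, with respect to \<open>lattice_measure \<Lambda>\<close>.
\<close>

definition fundamental_domain :: "'a::real_vector set \<Rightarrow> 'a set" where
  "fundamental_domain \<Gamma> =
     {\<Sum>b\<in>some_basis \<Gamma>. t b *\<^sub>R b | t. \<forall>b\<in>some_basis \<Gamma>. 0 \<le> t b \<and> t b < 1}"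

definition dual_lattice :: "'a::real_normed_vector set \<Rightarrow> ('a \<Rightarrow>\<^sub>L real) set" where
  "dual_lattice \<Lambda> = {\<gamma> :: 'a \<Rightarrow>\<^sub>L real. \<forall>x\<in>\<Lambda>. \<gamma> x \<in> \<int>}"

definition annihilator :: "'a::real_normed_vector set \<Rightarrow> ('a \<Rightarrow>\<^sub>L real) set" where
  "annihilator L = {\<gamma> :: 'a \<Rightarrow>\<^sub>L real. \<forall>x\<in>L. \<gamma> x = 0}"

definition semi_rational_polyhedron :: "'a::real_normed_vector set \<Rightarrow> 'a set \<Rightarrow> bool" where
  "semi_rational_polyhedron \<Lambda> p \<longleftrightarrow>
     (\<exists>H. finite H \<and> fst ` H \<subseteq> dual_lattice \<Lambda> \<and> p = {x. \<forall>(\<mu>, b)\<in>H. \<mu> x \<le> b})"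

definition rational_cone :: "'a::real_normed_vector set \<Rightarrow> 'a set \<Rightarrow> bool" where
  "rational_cone \<Lambda> c \<longleftrightarrow>
     (\<exists>H. finite H \<and> H \<subseteq> dual_lattice \<Lambda> \<and> c = {x. \<forall>\<mu>\<in>H. \<mu> x \<le> 0})"

definition contains_line :: "'a::real_vector set \<Rightarrow> bool" where
  "contains_line p \<longleftrightarrow> (\<exists>x w. w \<noteq> 0 \<and> (\<forall>t. x + t *\<^sub>R w \<in> p))"

definition edge_generators :: "'a::euclidean_space set \<Rightarrow> nat \<Rightarrow> (nat \<Rightarrow> 'a) \<Rightarrow> bool" where
  "edge_generators c N v \<longleftrightarrow> bij_betw (\<lambda>j. cone hull {v j}) {1..N} {e. e edge_of c}"

text \<open>
  Germs at 0 of meromorphic functions whose poles lie on finitely many hyperplanes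
  \<open>\<langle>\<xi>, w\<rangle> = 0\<close> are represented by total functions on the complexified dual space, with
  irrelevant values on finitely many such hyperplanes. Two functions represent the same germ iff
  they are equal eventually with respect to the following filter.
\<close>

definition off_hyperplanes :: "'a::real_normed_vector set \<Rightarrow> 'a cdual set" where
  "off_hyperplanes W = {\<xi> :: 'a cdual. \<forall>w\<in>W. \<xi> w \<noteq> 0}"

definition germ0 :: "('a::real_normed_vector) cdual filter" where
  "germ0 = (INF W\<in>{W. finite W \<and> 0 \<notin> W}. inf (nhds 0) (principal (off_hyperplanes W)))"

lemma eventually_germ0:
  "eventually P germ0 \<longleftrightarrow>
     (\<exists>U W. open U \<and> 0 \<in> U \<and> finite W \<and> 0 \<notin> W \<and> (\<forall>\<xi>\<in>U \<inter> off_hyperplanes W. P \<xi>))"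
  unfolding germ0_def
proof (subst eventually_INF_base)
  show "{W. finite W \<and> (0::'a) \<notin> W} \<noteq> {}" by blast
next
  fix A B :: "'a set"
  assume "A \<in> {W. finite W \<and> 0 \<notin> W}" "B \<in> {W. finite W \<and> 0 \<notin> W}"
  then show "\<exists>C\<in>{W. finite W \<and> 0 \<notin> W}.
      inf (nhds 0) (principal (off_hyperplanes C))
      \<le> inf (inf (nhds 0) (principal (off_hyperplanes A)))
            (inf (nhds 0) (principal (off_hyperplanes B)))"
    by (intro bexI[of _ "A \<union> B"] inf_mono order_refl le_infI)
       (auto simp: off_hyperplanes_def intro!: le_infI2)
next
  show "(\<exists>W\<in>{W. finite W \<and> 0 \<notin> W}. eventually P (inf (nhds 0) (principal (off_hyperplanes W))))
    \<longleftrightarrow> (\<exists>U W. open U \<and> 0 \<in> U \<and> finite W \<and> 0 \<notin> W \<and> (\<forall>\<xi>\<in>U \<inter> off_hyperplanes W. P \<xi>))"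
    by (auto simp: eventually_inf_principal eventually_nhds)
qed

text \<open>Several complex variables: real differentiability with complex-linear derivative.\<close>

definition cdual_holomorphic_on :: "(('a::real_normed_vector) cdual \<Rightarrow> complex) \<Rightarrow> 'a cdual set \<Rightarrow> bool"
  where
  "cdual_holomorphic_on \<phi> U \<longleftrightarrow>
     (\<forall>\<xi>\<in>U. \<exists>D. (\<phi> has_derivative D) (at \<xi>) \<and> (\<forall>c \<eta>. D (cscale c \<eta>) = c * D \<eta>))"

text \<open>The space \<open>\<M>\<^sub>\<ell>(V\<^sup>*)\<close>; the list \<open>ws\<close> allows repeated factors.\<close>

definition Ml :: "(('a::real_normed_vector) cdual \<Rightarrow> complex) set" where
  "Ml = {f. \<exists>\<phi> U ws. open U \<and> 0 \<in> U \<and> cdual_holomorphic_on \<phi> U \<and> 0 \<notin> set ws \<and>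
              (\<forall>\<^sub>F \<xi> in germ0. f \<xi> = \<phi> \<xi> / (\<Prod>w\<leftarrow>ws. blinfun_apply \<xi> w))}"

text \<open>
  The coefficient of \<open>\<tau>\<^sup>m\<close> in the Laurent expansion of \<open>f(\<tau>\<xi>)\<close> at \<open>\<tau> = 0\<close>. For \<open>f\<close> in \<open>Ml\<close>
  it is meaningful for \<open>\<xi>\<close> off finitely many hyperplanes.
\<close>

definition homogeneous_component ::
    "int \<Rightarrow> (('a::real_normed_vector) cdual \<Rightarrow> complex) \<Rightarrow> 'a cdual \<Rightarrow> complex" where
  "homogeneous_component m f \<xi> = fls_nth (laurent_expansion (\<lambda>\<tau>. f (cscale \<tau> \<xi>)) 0) m"

inductive polynomial_fun :: "(('a::real_normed_vector) cdual \<Rightarrow> complex) \<Rightarrow> bool" where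
  const: "polynomial_fun (\<lambda>_. a)"
| pairing: "polynomial_fun (\<lambda>\<xi>. blinfun_apply \<xi> x)"
| add: "polynomial_fun p \<Longrightarrow> polynomial_fun q \<Longrightarrow> polynomial_fun (\<lambda>\<xi>. p \<xi> + q \<xi>)"
| mult: "polynomial_fun p \<Longrightarrow> polynomial_fun q \<Longrightarrow> polynomial_fun (\<lambda>\<xi>. p \<xi> * q \<xi>)"

text \<open>
  The rational functions, homogeneous of degree \<open>m\<close>, whose denominator divides the product of
  the \<open>\<langle>\<xi>, v j\<rangle>\<close>. Their value is 0 wherever that product vanishes (division by zero), hence two
  members of this space representing the same germ are equal.
\<close>

definition rational_space ::
    "nat \<Rightarrow> (nat \<Rightarrow> 'a::real_normed_vector) \<Rightarrow> int \<Rightarrow> ('a cdual \<Rightarrow> complex) set" where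
  "rational_space N v m =
     {f. (\<exists>p. polynomial_fun p \<and> f = (\<lambda>\<xi>. p \<xi> / (\<Prod>j=1..N. blinfun_apply \<xi> (v j)))) \<and>
         (\<forall>\<tau> \<xi>. \<tau> \<noteq> 0 \<longrightarrow> f (cscale \<tau> \<xi>) = \<tau> powi m * f \<xi>)}"

text \<open>The lattice of \<open>V / L\<close> is the set of cosets \<open>y + L\<close> with \<open>y\<close> in \<open>\<Lambda>\<close>.\<close>

definition quotient_lattice :: "'a::real_vector set \<Rightarrow> 'a set \<Rightarrow> 'a set set" where
  "quotient_lattice \<Lambda> L = (\<lambda>y. (+) y ` L) ` \<Lambda>"

definition coset_measure :: "'a::euclidean_space set \<Rightarrow> 'a set \<Rightarrow> 'a set \<Rightarrow> 'a measure" where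
  "coset_measure \<Lambda> L Y = distr (lattice_measure (L \<inter> \<Lambda>)) borel ((+) (SOME y. y \<in> Y))"

definition intermediate_sum ::
    "'a::euclidean_space set \<Rightarrow> 'a set \<Rightarrow> 'a set \<Rightarrow> 'a cdual \<Rightarrow> complex" where
  "intermediate_sum \<Lambda> L p \<xi> =
     (\<Sum>\<^sub>\<infinity>Y\<in>quotient_lattice \<Lambda> L. LINT x:p|coset_measure \<Lambda> L Y. exp (\<xi> x))"

text \<open>Absolute convergence; for real \<open>\<xi>\<close> all terms are nonnegative.\<close>

definition intermediate_sum_converges ::
    "'a::euclidean_space set \<Rightarrow> 'a set \<Rightarrow> 'a set \<Rightarrow> 'a cdual \<Rightarrow> bool" where
  "intermediate_sum_converges \<Lambda> L p \<xi> \<longleftrightarrow>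
     (\<forall>Y\<in>quotient_lattice \<Lambda> L. set_integrable (coset_measure \<Lambda> L Y) p (\<lambda>x. exp (\<xi> x))) \<and>
     (\<lambda>Y. LINT x:p|coset_measure \<Lambda> L Y. norm (exp (\<xi> x))) summable_on quotient_lattice \<Lambda> L"

definition intermediate_valuation ::
    "'a::euclidean_space set \<Rightarrow> 'a set \<Rightarrow> ('a set \<Rightarrow> 'a cdual \<Rightarrow> complex) \<Rightarrow> bool" where
  "intermediate_valuation \<Lambda> L S \<longleftrightarrow>
     (\<forall>p. semi_rational_polyhedron \<Lambda> p \<longrightarrow> S p \<in> Ml) \<and>
     (\<forall>\<P> r. finite \<P> \<and> (\<forall>p\<in>\<P>. semi_rational_polyhedron \<Lambda> p) \<and>
         (\<forall>x. (\<Sum>p\<in>\<P>. r p * indicator p x :: real) = 0) \<longrightarrow>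
         (\<forall>\<^sub>F \<xi> in germ0. (\<Sum>p\<in>\<P>. complex_of_real (r p) * S p \<xi>) = 0)) \<and>
     (\<forall>p. semi_rational_polyhedron \<Lambda> p \<and> contains_line p \<longrightarrow> (\<forall>\<^sub>F \<xi> in germ0. S p \<xi> = 0)) \<and>
     (\<forall>p. semi_rational_polyhedron \<Lambda> p \<longrightarrow>
         (\<forall>\<^sub>F \<xi> in germ0. intermediate_sum_converges \<Lambda> L p \<xi> \<longrightarrow> S p \<xi> = intermediate_sum \<Lambda> L p \<xi>))"

text \<open>\<open>S\<^sup>L(p)\<close>; as a germ it does not depend on the choice.\<close>

definition intermediate_gf ::
    "'a::euclidean_space set \<Rightarrow> 'a set \<Rightarrow> 'a set \<Rightarrow> 'a cdual \<Rightarrow> complex" where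
  "intermediate_gf \<Lambda> L = (SOME S. intermediate_valuation \<Lambda> L S)"

definition shifted_gf ::
    "'a::euclidean_space set \<Rightarrow> 'a set \<Rightarrow> 'a \<Rightarrow> 'a set \<Rightarrow> 'a cdual \<Rightarrow> complex" where
  "shifted_gf \<Lambda> L s c \<xi> = exp (- \<xi> s) * intermediate_gf \<Lambda> L ((+) s ` c) \<xi>"

text \<open>
  \<open>I(c)\<close>: the denominator of the rational function is a product of linear forms, so that the
  translates of \<open>I(c)\<close> are determined off finitely many hyperplanes near 0.
\<close>

definition is_cone_integral ::
    "'a::euclidean_space set \<Rightarrow> 'a set \<Rightarrow> ('a cdual \<Rightarrow> complex) \<Rightarrow> bool" where
  "is_cone_integral \<Lambda> c f \<longleftrightarrow>
     (\<exists>p ws. polynomial_fun p \<and> 0 \<notin> set ws \<and>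
        f = (\<lambda>\<xi>. p \<xi> / (\<Prod>w\<leftarrow>ws. blinfun_apply \<xi> w)) \<and>
        (\<forall>\<xi>\<in>off_hyperplanes (set ws). set_integrable (lattice_measure \<Lambda>) c (\<lambda>x. exp (blinfun_apply \<xi> x)) \<longrightarrow>
           f \<xi> = (LINT x:c|lattice_measure \<Lambda>. exp (blinfun_apply \<xi> x))))"

definition cone_integral :: "'a::euclidean_space set \<Rightarrow> 'a set \<Rightarrow> 'a cdual \<Rightarrow> complex" where
  "cone_integral \<Lambda> c = (SOME f. is_cone_integral \<Lambda> c f)"

definition translated_cone_integral ::
    "'a::euclidean_space set \<Rightarrow> 'a set \<Rightarrow> ('a \<Rightarrow>\<^sub>L real) \<Rightarrow> 'a cdual \<Rightarrow> complex" where
  "translated_cone_integral \<Lambda> c \<gamma> \<xi> =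
     cone_integral \<Lambda> c (\<xi> + cscale (2 * \<i> * pi) (complexify \<gamma>))"

definition character :: "('a::real_normed_vector \<Rightarrow>\<^sub>L real) \<Rightarrow> 'a \<Rightarrow> complex" where
  "character \<gamma> s = exp (2 * \<i> * pi * complex_of_real (\<gamma> s))"

definition fourier_coefficient ::
    "'a::euclidean_space set \<Rightarrow> ('a \<Rightarrow> complex) \<Rightarrow> ('a \<Rightarrow>\<^sub>L real) \<Rightarrow> complex" where
  "fourier_coefficient \<Lambda> f \<gamma> =
     (LINT s:fundamental_domain \<Lambda>|lattice_measure \<Lambda>. character (- \<gamma>) s * f s)"

definition square_integrable_torus :: "'a::euclidean_space set \<Rightarrow> ('a \<Rightarrow> complex) \<Rightarrow> bool" where
  "square_integrable_torus \<Lambda> f \<longleftrightarrow> f \<in> borel_measurable borel \<and>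
     set_integrable (lattice_measure \<Lambda>) (fundamental_domain \<Lambda>) (\<lambda>s. (norm (f s))\<^sup>2)"

text \<open>Unconditional convergence in \<open>L\<^sup>2(V / \<Lambda>)\<close> of the series \<open>\<Sum>\<gamma>\<in>A. a \<gamma> exp \<langle>2 \<i> \<pi> \<gamma>, s\<rangle>\<close> to \<open>f\<close>\<close>

definition L2_has_fourier_sum ::
    "'a::euclidean_space set \<Rightarrow> (('a \<Rightarrow>\<^sub>L real) \<Rightarrow> complex) \<Rightarrow> ('a \<Rightarrow>\<^sub>L real) set
       \<Rightarrow> ('a \<Rightarrow> complex) \<Rightarrow> bool" where
  "L2_has_fourier_sum \<Lambda> a A f \<longleftrightarrow> square_integrable_torus \<Lambda> f \<and>
     ((\<lambda>T. LINT s:fundamental_domain \<Lambda>|lattice_measure \<Lambda>.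
              (norm (f s - (\<Sum>\<gamma>\<in>T. character \<gamma> s * a \<gamma>)))\<^sup>2) \<longlongrightarrow> 0) (finite_subsets_at_top A)"

end

theory Submission
  imports Defs
begin

text \<open>
  No triangulation of the cone is needed. If \<open>w\<^sub>1, \<dots>, w\<^sub>N\<close> are lattice vectors that generate the
  recession cone of a polyhedron \<open>p\<close>, the iterated difference \<open>h = \<Prod>\<^sub>j (1 - T\<^sub>j) 1\<^sub>p\<close>, where \<open>T\<^sub>j\<close>
  translates by \<open>w\<^sub>j\<close>, has bounded support: far away, membership in \<open>p\<close> is not affected by some
  \<open>T\<^sub>j\<close>. The intermediate sum is integration against one \<open>\<Lambda>\<close>-invariant locally finite measure
  \<open>\<nu>\<close>, so that \<open>S\<^sup>L(p)(\<xi>) = \<integral> h(x) exp \<langle>\<xi>, x\<rangle> d\<nu> / \<Prod>\<^sub>j (1 - exp \<langle>\<xi>, w\<^sub>j\<rangle>)\<close>. This formula gives the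
  existence of the valuation by pure algebra (apply all the differences that occur in a linear
  relation), the denominators of \<open>M\<^sup>L(s, c)\<close> when the \<open>w\<^sub>j\<close> are edge generators of \<open>c\<close>, and, for
  Lebesgue measure in place of \<open>\<nu>\<close>, the function \<open>I(c)\<close>.

  Each homogeneous component of \<open>M\<^sup>L(s, c)\<close> is therefore a periodization \<open>\<integral> k(x - s) d\<nu>(x)\<close> of a bounded kernel
  \<open>k\<close> of bounded support, whose Fourier coefficient at \<open>\<gamma>\<close> is \<open>\<integral> k(x) exp \<langle>2 \<i> \<pi> \<gamma>, x\<rangle> dx\<close> times the
  Fourier coefficient of \<open>\<nu>\<close>; the latter is 1 on \<open>L\<^sup>\<bottom>\<close> and 0 elsewhere because \<open>\<nu>\<close> is invariant under
  \<open>L\<close>. Convergence in \<open>L\<^sup>2\<close> is completeness of the characters.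
\<close>

section \<open>Bounded kernels\<close>

text \<open>The obstacle is that \<open>M\<^sup>L(s, c)\<close> is an actual convergent sum only
  where every \<open>Re \<langle>\<xi>, w\<^sub>j\<rangle>\<close> is negative, a region that
  contains no neighbourhood of 0, whereas homogeneous components are read off at 0. Multiplication
  by the product of the factors \<open>1 - exp \<langle>\<xi>, w\<^sub>j\<rangle>\<close> replaces
  the sum by an entire function; dividing again costs only the series of
  \<open>z / (1 - exp z)\<close>. All exchanges of sums and integrals then concern kernels of
  bounded support and finite sets of lattice vectors. The translates of \<open>I(c)\<close> appear
  because \<gamma> is integral on the \<open>w\<^sub>j\<close>: replacing \<xi> by \<xi> + 2 i pi
  \<gamma> leaves the denominator unchanged and multiplies the kernel by a character. The
  \<open>w\<^sub>j\<close> must lie in \<Lambda>, for the invariance of the measure, and on the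
  edges of the cone, for the denominators. Edge generators are arbitrary positive multiples of such
  vectors, so they are compared with a minimal set of lattice generators. \<open>S\<^sup>L\<close>
  and \<open>I(c)\<close> are arbitrary choices among the functions with the defining properties;
  the identity theorem, applied from the region of convergence, makes the choices
  irrelevant.\<close>

definition locally_finite_borel :: "'a::euclidean_space measure \<Rightarrow> bool" where
  "locally_finite_borel M \<longleftrightarrow> sets M = sets borel \<and> (\<forall>r. emeasure M (cball 0 r) < \<infinity>)"

text \<open>Boundedness and measurability are asked instead of continuity because differences of
  indicator functions jump. Bounded support takes the place of decay: every continuous weight stays
  integrable against a locally finite measure.\<close>

definition bounded_kernel :: "('a::euclidean_space \<Rightarrow> complex) \<Rightarrow> bool" where
  "bounded_kernel g \<longleftrightarrow> g \<in> borel_measurable borel \<and> (\<exists>C. \<forall>x. norm (g x) \<le> C) \<and>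
     (\<exists>r. \<forall>x. g x \<noteq> 0 \<longrightarrow> norm x \<le> r)"

lemma locally_finite_borel_space: "locally_finite_borel M \<Longrightarrow> space M = UNIV"
  using sets_eq_imp_space_eq[of M borel] by (simp add: locally_finite_borel_def)

lemma locally_finite_borel_measurable:
  "locally_finite_borel M \<Longrightarrow> borel_measurable M = borel_measurable borel"
  by (intro measurable_cong_sets) (simp_all add: locally_finite_borel_def)

lemma bounded_kernelE:
  assumes "bounded_kernel g"
  obtains C r where "g \<in> borel_measurable borel" "0 \<le> C" "\<And>x. norm (g x) \<le> C" "0 \<le> r"
    "\<And>x. r < norm x \<Longrightarrow> g x = 0"
proof -
  obtain C r where *: "g \<in> borel_measurable borel" "\<And>x. norm (g x) \<le> C"
     "\<And>x. g x \<noteq> 0 \<Longrightarrow> norm x \<le> r"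
    using assms by (auto simp: bounded_kernel_def)
  have "0 \<le> C" using order_trans[OF norm_ge_zero *(2)[of 0]] .
  moreover have "g x = 0" if "max r 0 < norm x" for x
    using *(3)[of x] that by force
  ultimately show thesis
    using * by (intro that[of C "max r 0"]) auto
qed

lemma bounded_kernelI:
  assumes "g \<in> borel_measurable borel" "\<And>x. norm (g x) \<le> C" "\<And>x. g x \<noteq> 0 \<Longrightarrow> norm x \<le> r"
  shows "bounded_kernel g"
  using assms by (auto simp: bounded_kernel_def)

lemma bounded_kernel_borel [measurable]: "bounded_kernel g \<Longrightarrow> g \<in> borel_measurable borel"
  by (simp add: bounded_kernel_def)

lemma integrable_bounded_kernel:
  assumes M: "locally_finite_borel M" and g: "bounded_kernel g"
  shows "integrable M g"
proof -
  obtain C r where Cr: "g \<in> borel_measurable borel" "0 \<le> C" "\<And>x. norm (g x) \<le> C" "0 \<le> r"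
    "\<And>x. r < norm x \<Longrightarrow> g x = 0" using bounded_kernelE[OF g] by blast
  have "integrable M (\<lambda>x. C * indicator (cball 0 r) x :: real)"
    using M by (intro integrable_mult_right integrable_real_indicator)
      (auto simp: locally_finite_borel_def)
  then show ?thesis
  proof (rule Bochner_Integration.integrable_bound)
    show "g \<in> borel_measurable M" using Cr(1) M by (simp add: locally_finite_borel_measurable)
    have "norm (g x) \<le> C * indicator (cball 0 r) x" for x
      using Cr(3)[of x] Cr(5)[of x] by (cases "r < norm x") (auto simp: indicator_def)
    then show "AE x in M. norm (g x) \<le> norm (C * indicator (cball 0 r) x)"
      using Cr(2) by (auto simp: abs_mult)
  qed
qed

text \<open>Only the values of \<open>k\<close> on a ball that supports \<open>g\<close> matter, and
  compactness bounds them. Exponentials, moments and characters enter a kernel in this way.\<close>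

lemma bounded_kernel_mult:
  assumes g: "bounded_kernel g" and k: "continuous_on UNIV k"
  shows "bounded_kernel (\<lambda>x. g x * k x)"
proof -
  obtain C r where Cr: "g \<in> borel_measurable borel" "0 \<le> C" "\<And>x. norm (g x) \<le> C" "0 \<le> r"
    "\<And>x. r < norm x \<Longrightarrow> g x = 0" using bounded_kernelE[OF g] by blast
  have "bounded (k ` cball 0 r)"
    using k by (intro compact_imp_bounded compact_continuous_image)
      (auto intro: continuous_on_subset)
  then obtain B where "\<forall>y\<in>k ` cball 0 r. norm y \<le> B"
    unfolding bounded_iff by blast
  then have B: "norm (k x) \<le> B" if "norm x \<le> r" for x
    using that by simp
  show ?thesis
  proof (rule bounded_kernelI)
    show "(\<lambda>x. g x * k x) \<in> borel_measurable borel"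
      by (intro borel_measurable_times Cr(1) borel_measurable_continuous_onI[OF k])
    show "norm (g x * k x) \<le> C * max B 0" for x
    proof (cases "r < norm x")
      case False
      then have "norm (k x) \<le> max B 0" using B[of x] by auto
      then show ?thesis using Cr(2,3) by (auto simp: norm_mult intro!: mult_mono)
    qed (use Cr in auto)
    show "norm x \<le> r" if "g x * k x \<noteq> 0" for x using that Cr(5)[of x] by force
  qed
qed

lemma bounded_kernel_cmult: "bounded_kernel g \<Longrightarrow> bounded_kernel (\<lambda>x. g x * c)"
  by (rule bounded_kernel_mult) auto

lemma bounded_kernel_add:
  assumes "bounded_kernel g" "bounded_kernel h"
  shows "bounded_kernel (\<lambda>x. g x + h x)"
proof -
  obtain C r where 1: "g \<in> borel_measurable borel" "0 \<le> C" "\<And>x. norm (g x) \<le> C" "0 \<le> r"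
    "\<And>x. r < norm x \<Longrightarrow> g x = 0" using bounded_kernelE[OF assms(1)] by blast
  obtain C' r' where 2: "h \<in> borel_measurable borel" "0 \<le> C'" "\<And>x. norm (h x) \<le> C'" "0 \<le> r'"
    "\<And>x. r' < norm x \<Longrightarrow> h x = 0" using bounded_kernelE[OF assms(2)] by blast
  show ?thesis
  proof (rule bounded_kernelI)
    show "(\<lambda>x. g x + h x) \<in> borel_measurable borel" by (intro borel_measurable_add 1 2)
    show "norm (g x + h x) \<le> C + C'" for x by (intro norm_triangle_mono 1 2)
    show "norm x \<le> max r r'" if "g x + h x \<noteq> 0" for x
      using 1(5)[of x] 2(5)[of x] that by force
  qed
qed

text \<open>The case \<open>c = -1\<close> is the reflection that
  \<open>fourier_periodization\<close> needs; \<open>c = 1\<close> gives translations.\<close>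

lemma bounded_kernel_affine:
  fixes a :: "'a::euclidean_space"
  assumes "bounded_kernel g" "c \<noteq> 0"
  shows "bounded_kernel (\<lambda>x. g (a + c *\<^sub>R x))"
proof -
  obtain C r where 1: "g \<in> borel_measurable borel" "0 \<le> C" "\<And>x. norm (g x) \<le> C" "0 \<le> r"
    "\<And>x. r < norm x \<Longrightarrow> g x = 0" using bounded_kernelE[OF assms(1)] by blast
  show ?thesis
  proof (rule bounded_kernelI)
    show "(\<lambda>x. g (a + c *\<^sub>R x)) \<in> borel_measurable borel"
      by (rule measurable_compose[OF _ 1(1)]) simp
    show "norm (g (a + c *\<^sub>R x)) \<le> C" for x by (rule 1)
    show "norm x \<le> (r + norm a) / \<bar>c\<bar>" if "g (a + c *\<^sub>R x) \<noteq> 0" for x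
    proof -
      have "norm (a + c *\<^sub>R x) \<le> r" using 1(5) that by force
      moreover have "norm (c *\<^sub>R x) \<le> norm (a + c *\<^sub>R x) + norm a"
        using norm_triangle_ineq4[of "a + c *\<^sub>R x" a] by simp
      ultimately show ?thesis using assms(2) by (simp add: pos_le_divide_eq mult.commute)
    qed
  qed
qed

lemma bounded_kernel_shift: "bounded_kernel g \<Longrightarrow> bounded_kernel (\<lambda>x. g (x - a))"
  using bounded_kernel_affine[of g 1 "- a"] by simp

lemma bounded_kernel_diff:
  assumes "bounded_kernel g" "bounded_kernel h"
  shows "bounded_kernel (\<lambda>x. g x - h x)"
  using bounded_kernel_add[OF assms(1) bounded_kernel_cmult[OF assms(2), of "-1"]] by simp

section \<open>Holomorphic functions on the complexified dual\<close>

lemma cscale_apply [simp]: "blinfun_apply (cscale c \<xi>) x = c * blinfun_apply \<xi> x"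
  by transfer simp

lemma complexify_apply [simp]: "blinfun_apply (complexify \<gamma>) x = complex_of_real (blinfun_apply \<gamma> x)"
  by transfer simp

lemma cscale_simps [simp]: "cscale 0 \<xi> = 0" "cscale 1 \<xi> = \<xi>" "cscale a (cscale b \<xi>) = cscale (a * b) \<xi>"
  by (auto intro!: blinfun_eqI simp: blinfun.bilinear_simps)

lemma bounded_linear_cscale_left: "bounded_linear (\<lambda>t. cscale t \<xi>)"
proof (rule bounded_linear_intro)
  show "cscale (x + y) \<xi> = cscale x \<xi> + cscale y \<xi>" for x y
    by (auto intro!: blinfun_eqI simp: blinfun.bilinear_simps algebra_simps)
  show "cscale (r *\<^sub>R x) \<xi> = r *\<^sub>R cscale x \<xi>" for r x
    by (auto intro!: blinfun_eqI simp: blinfun.bilinear_simps algebra_simps)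
  show "norm (cscale x \<xi>) \<le> norm x * norm \<xi>" for x
    by (rule norm_blinfun_bound)
       (auto simp: norm_mult mult.assoc intro!: mult_left_mono norm_blinfun)
qed

lemma cdual_holomorphic_onD:
  assumes "cdual_holomorphic_on \<phi> U" "\<xi> \<in> U"
  obtains D where "(\<phi> has_derivative D) (at \<xi>)" "\<And>c \<eta>. D (cscale c \<eta>) = c * D \<eta>"
  using assms unfolding cdual_holomorphic_on_def by blast

lemma cdual_holomorphic_on_subset:
  "cdual_holomorphic_on \<phi> U \<Longrightarrow> V \<subseteq> U \<Longrightarrow> cdual_holomorphic_on \<phi> V"
  unfolding cdual_holomorphic_on_def by blast

lemma cdual_holomorphic_on_const: "cdual_holomorphic_on (\<lambda>_. a) U"
  unfolding cdual_holomorphic_on_def by (auto intro!: exI[of _ "\<lambda>_. 0"])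

lemma cdual_holomorphic_on_pairing: "cdual_holomorphic_on (\<lambda>\<xi>. blinfun_apply \<xi> w) U"
  unfolding cdual_holomorphic_on_def
  by (auto intro!: exI[of _ "\<lambda>\<eta>. blinfun_apply \<eta> w"] bounded_linear_imp_has_derivative
        blinfun.bounded_linear_left)

lemma cdual_holomorphic_on_add:
  assumes "cdual_holomorphic_on f U" "cdual_holomorphic_on g U"
  shows "cdual_holomorphic_on (\<lambda>\<xi>. f \<xi> + g \<xi>) U"
  unfolding cdual_holomorphic_on_def
proof
  fix \<xi> assume "\<xi> \<in> U"
  obtain D where D: "(f has_derivative D) (at \<xi>)" "\<And>c \<eta>. D (cscale c \<eta>) = c * D \<eta>"
    using cdual_holomorphic_onD[OF assms(1) \<open>\<xi> \<in> U\<close>] by blast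
  obtain E where E: "(g has_derivative E) (at \<xi>)" "\<And>c \<eta>. E (cscale c \<eta>) = c * E \<eta>"
    using cdual_holomorphic_onD[OF assms(2) \<open>\<xi> \<in> U\<close>] by blast
  show "\<exists>D. ((\<lambda>\<xi>. f \<xi> + g \<xi>) has_derivative D) (at \<xi>) \<and> (\<forall>c \<eta>. D (cscale c \<eta>) = c * D \<eta>)"
    using D E by (intro exI[of _ "\<lambda>\<eta>. D \<eta> + E \<eta>"]) (auto intro!: has_derivative_add simp: algebra_simps)
qed

lemma cdual_holomorphic_on_mult:
  assumes "cdual_holomorphic_on f U" "cdual_holomorphic_on g U"
  shows "cdual_holomorphic_on (\<lambda>\<xi>. f \<xi> * g \<xi>) U"
  unfolding cdual_holomorphic_on_def
proof
  fix \<xi> assume "\<xi> \<in> U"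
  obtain D where D: "(f has_derivative D) (at \<xi>)" "\<And>c \<eta>. D (cscale c \<eta>) = c * D \<eta>"
    using cdual_holomorphic_onD[OF assms(1) \<open>\<xi> \<in> U\<close>] by blast
  obtain E where E: "(g has_derivative E) (at \<xi>)" "\<And>c \<eta>. E (cscale c \<eta>) = c * E \<eta>"
    using cdual_holomorphic_onD[OF assms(2) \<open>\<xi> \<in> U\<close>] by blast
  show "\<exists>D. ((\<lambda>\<xi>. f \<xi> * g \<xi>) has_derivative D) (at \<xi>) \<and> (\<forall>c \<eta>. D (cscale c \<eta>) = c * D \<eta>)"
    by (intro exI[of _ "\<lambda>\<eta>. f \<xi> * E \<eta> + D \<eta> * g \<xi>"] conjI allI)
       (rule has_derivative_mult[OF D(1) E(1)], simp add: D(2) E(2) algebra_simps)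
qed

lemma cdual_holomorphic_on_diff:
  assumes "cdual_holomorphic_on f U" "cdual_holomorphic_on g U"
  shows "cdual_holomorphic_on (\<lambda>\<xi>. f \<xi> - g \<xi>) U"
  using cdual_holomorphic_on_add[OF assms(1)
      cdual_holomorphic_on_mult[OF cdual_holomorphic_on_const[of "-1"] assms(2)]] by simp

lemma cdual_holomorphic_on_prod_list:
  assumes "\<And>w. w \<in> set ws \<Longrightarrow> cdual_holomorphic_on (f w) U"
  shows "cdual_holomorphic_on (\<lambda>\<xi>. \<Prod>w\<leftarrow>ws. f w \<xi>) U"
  using assms by (induction ws) (auto intro: cdual_holomorphic_on_const cdual_holomorphic_on_mult)

lemma cdual_holomorphic_on_polynomial_fun: "polynomial_fun p \<Longrightarrow> cdual_holomorphic_on p U"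
  by (induction rule: polynomial_fun.induct)
     (auto intro: cdual_holomorphic_on_const cdual_holomorphic_on_pairing
        cdual_holomorphic_on_add cdual_holomorphic_on_mult)

lemma cdual_holomorphic_on_compose:
  assumes "h holomorphic_on S" "open S" "\<And>\<xi>. \<xi> \<in> U \<Longrightarrow> blinfun_apply \<xi> w \<in> S"
  shows "cdual_holomorphic_on (\<lambda>\<xi>. h (blinfun_apply \<xi> w)) U"
  unfolding cdual_holomorphic_on_def
proof
  fix \<xi> assume "\<xi> \<in> U"
  then have "(h has_field_derivative deriv h (\<xi> w)) (at (\<xi> w))"
    using assms by (intro holomorphic_derivI[of h S]) auto
  then have 1: "(h has_derivative (*) (deriv h (\<xi> w))) (at (\<xi> w))"
    by (simp add: has_field_derivative_def)
  have 2: "((\<lambda>\<xi>. blinfun_apply \<xi> w) has_derivative (\<lambda>\<eta>. blinfun_apply \<eta> w)) (at \<xi>)"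
    by (intro bounded_linear_imp_has_derivative blinfun.bounded_linear_left)
  show "\<exists>D. ((\<lambda>\<xi>. h (blinfun_apply \<xi> w)) has_derivative D) (at \<xi>) \<and>
         (\<forall>c \<eta>. D (cscale c \<eta>) = c * D \<eta>)"
    using has_derivative_compose[OF 2 1]
    by (intro exI[of _ "\<lambda>\<eta>. deriv h (\<xi> w) * blinfun_apply \<eta> w"]) auto
qed

text \<open>Complex linearity of the derivative turns the chain rule along a complex line into
  multiplication by \<open>D \<eta>\<close>, which makes one-variable theory available.\<close>

lemma holomorphic_on_line:
  assumes "cdual_holomorphic_on \<phi> U" "\<And>\<tau>. \<tau> \<in> T \<Longrightarrow> \<xi> + cscale \<tau> \<eta> \<in> U"
  shows "(\<lambda>\<tau>. \<phi> (\<xi> + cscale \<tau> \<eta>)) holomorphic_on T"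
  unfolding holomorphic_on_def
proof
  fix \<tau> assume "\<tau> \<in> T"
  obtain D where D: "(\<phi> has_derivative D) (at (\<xi> + cscale \<tau> \<eta>))" "\<And>c \<eta>. D (cscale c \<eta>) = c * D \<eta>"
    using cdual_holomorphic_onD[OF assms(1) assms(2)[OF \<open>\<tau> \<in> T\<close>]] by blast
  have "((\<lambda>\<tau>. \<xi> + cscale \<tau> \<eta>) has_derivative (\<lambda>t. cscale t \<eta>)) (at \<tau>)"
    by (rule derivative_eq_intros bounded_linear_imp_has_derivative bounded_linear_cscale_left refl)+ simp
  from has_derivative_compose[OF this D(1)]
  have "((\<lambda>\<tau>. \<phi> (\<xi> + cscale \<tau> \<eta>)) has_derivative (*) (D \<eta>)) (at \<tau>)"
    by (simp add: D(2) mult.commute[of _ "D \<eta>"])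
  then show "(\<lambda>\<tau>. \<phi> (\<xi> + cscale \<tau> \<eta>)) field_differentiable at \<tau> within T"
    unfolding field_differentiable_def has_field_derivative_def
    using has_derivative_at_withinI by blast
qed

text \<open>Identity theorem in several variables, reduced to one: the complex line from a point of
  \<open>Q\<close> to \<xi> meets the convex set \<open>U\<close> in a connected open set of
  parameters, on which the restriction of \<open>E\<close> is holomorphic and vanishes near the
  parameter 0.\<close>

lemma cdual_identity:
  assumes E: "cdual_holomorphic_on E U" and U: "open U" "convex U"
    and Q: "open Q" "Q \<noteq> {}" "Q \<subseteq> U" and 0: "\<And>\<xi>. \<xi> \<in> Q \<Longrightarrow> E \<xi> = 0" and \<xi>: "\<xi> \<in> U"
  shows "E \<xi> = 0"
proof -
  obtain \<xi>0 where \<xi>0: "\<xi>0 \<in> Q" using Q by blast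
  let ?l = "\<lambda>\<tau>. \<xi>0 + cscale \<tau> (\<xi> - \<xi>0)"
  have cont: "continuous_on UNIV ?l"
    by (intro continuous_intros linear_continuous_on bounded_linear_cscale_left)
  define T where "T = ?l -` U"
  have T: "open T" unfolding T_def using cont U(1) by (simp add: continuous_on_open_vimage)
  have OT: "open (?l -` Q)" using cont Q(1) by (simp add: continuous_on_open_vimage)
  have "convex T"
  proof (rule convexI)
    fix x y and u v :: real assume *: "x \<in> T" "y \<in> T" "0 \<le> u" "0 \<le> v" "u + v = 1"
    have "u *\<^sub>R ?l x + v *\<^sub>R ?l y = (u + v) *\<^sub>R \<xi>0 + cscale (u *\<^sub>R x + v *\<^sub>R y) (\<xi> - \<xi>0)"
      by (rule blinfun_eqI) (simp add: blinfun.bilinear_simps scaleR_conv_of_real algebra_simps)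
    then have "?l (u *\<^sub>R x + v *\<^sub>R y) = u *\<^sub>R ?l x + v *\<^sub>R ?l y"
      using * by simp
    then show "u *\<^sub>R x + v *\<^sub>R y \<in> T"
      using * U(2) unfolding T_def by (auto intro: convexD)
  qed
  then have "connected T" by (rule convex_connected)
  have "E (?l 1) = 0"
  proof (rule analytic_continuation_open[of "?l -` Q" T "\<lambda>\<tau>. E (?l \<tau>)" "\<lambda>_. 0" 1])
    show "?l -` Q \<noteq> {}" using \<xi>0 vimageI2[of ?l 0 Q] by (simp only: cscale_simps add_0_right) blast
    show "(\<lambda>\<tau>. E (?l \<tau>)) holomorphic_on T"
      using E by (rule holomorphic_on_line) (auto simp: T_def)
    show "1 \<in> T" using \<xi> by (simp add: T_def)
  qed (use OT T \<open>connected T\<close> Q 0 in \<open>auto simp: T_def\<close>)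
  then show ?thesis by simp
qed

section \<open>Transforms of bounded kernels\<close>

text \<open>For a bounded kernel this is an entire function of \<xi>: the easy half of
  Paley-Wiener.\<close>

definition laplace :: "'a::euclidean_space measure \<Rightarrow> ('a \<Rightarrow> complex) \<Rightarrow> 'a cdual \<Rightarrow> complex" where
  "laplace M g \<xi> = (LINT x|M. g x * exp (blinfun_apply \<xi> x))"

lemma continuous_on_cexp_blinfun: "continuous_on UNIV (\<lambda>x. exp (blinfun_apply (\<xi> :: 'a::euclidean_space cdual) x))"
  by (intro continuous_intros)

lemma bounded_kernel_exp: "bounded_kernel g \<Longrightarrow> bounded_kernel (\<lambda>x. g x * exp (blinfun_apply \<xi> x))"
  by (rule bounded_kernel_mult) (auto intro: continuous_on_cexp_blinfun)

lemma bounded_kernel_pow: "bounded_kernel g \<Longrightarrow> bounded_kernel (\<lambda>x. g x * blinfun_apply \<xi> x ^ n)"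
  by (rule bounded_kernel_mult) (auto intro!: continuous_intros)

lemma bounded_kernel_pairing: "bounded_kernel g \<Longrightarrow> bounded_kernel (\<lambda>x. g x * blinfun_apply \<xi> x)"
  by (rule bounded_kernel_mult) (auto intro!: continuous_intros)

text \<open>Differentiation under the integral sign. On a support of radius \<open>r\<close> the
  second-order Taylor remainder of exp is at most \<open>exp r * (r * norm h)\<^sup>2\<close>,
  uniformly in the integration variable, so the error is quadratic in \<open>h\<close>.\<close>

lemma has_derivative_laplace:
  assumes M: "locally_finite_borel M" and g: "bounded_kernel g"
  shows "(laplace M g has_derivative (\<lambda>\<eta>. laplace M (\<lambda>x. g x * blinfun_apply \<eta> x) \<xi>)) (at \<xi>)"
proof -
  obtain C r where Cr: "0 \<le> r" "\<And>x. r < norm x \<Longrightarrow> g x = 0" using bounded_kernelE[OF g] by metis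
  let ?k = "\<lambda>x. g x * exp (blinfun_apply \<xi> x)"
  let ?D = "\<lambda>\<eta>. laplace M (\<lambda>x. g x * blinfun_apply \<eta> x) \<xi>"
  define K where "K = (LINT x|M. norm (?k x))"
  have k: "bounded_kernel ?k" by (rule bounded_kernel_exp[OF g])
  have intk: "integrable M (\<lambda>x. norm (?k x))" using integrable_bounded_kernel[OF M k] by (rule integrable_norm)
  have intD: "integrable M (\<lambda>x. g x * blinfun_apply \<eta> x * exp (blinfun_apply \<xi> x))" for \<eta>
    by (intro integrable_bounded_kernel[OF M] bounded_kernel_exp bounded_kernel_pairing g)
  have intE: "integrable M (\<lambda>x. g x * exp (blinfun_apply \<eta> x))" for \<eta>
    by (intro integrable_bounded_kernel[OF M] bounded_kernel_exp g)
  have bd: "norm (blinfun_apply \<eta> x) \<le> r * norm \<eta>" if "norm x \<le> r" for \<eta> :: "'a cdual" and x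
    using norm_blinfun[of \<eta> x] mult_right_mono[OF that norm_ge_zero[of \<eta>]] by (simp add: mult.commute)
  have bl: "bounded_linear ?D"
  proof (rule bounded_linear_intro)
    show "?D (x + y) = ?D x + ?D y" for x y
      unfolding laplace_def Bochner_Integration.integral_add[OF intD intD, symmetric]
      by (simp add: blinfun.bilinear_simps algebra_simps)
    show "?D (c *\<^sub>R x) = c *\<^sub>R ?D x" for c x
      unfolding laplace_def integral_scaleR_right[symmetric]
      by (intro arg_cong[where f="integral\<^sup>L M"]) (auto simp: blinfun.bilinear_simps algebra_simps)
    show "norm (?D x) \<le> norm x * (K * r)" for x
    proof -
      have "norm (?D x) \<le> (LINT y|M. norm (?k y) * (r * norm x))"
        unfolding laplace_def
      proof (rule Bochner_Integration.integral_norm_bound_integral[OF intD])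
        show "integrable M (\<lambda>y. norm (?k y) * (r * norm x))"
          by (intro integrable_mult_left intk)
        show "norm (g y * blinfun_apply x y * exp (blinfun_apply \<xi> y)) \<le> norm (?k y) * (r * norm x)" for y
        proof (cases "r < norm y")
          case False
          then have "norm (?k y) * norm (blinfun_apply x y) \<le> norm (?k y) * (r * norm x)"
            by (intro mult_left_mono bd) auto
          then show ?thesis by (simp add: norm_mult mult_ac)
        qed (auto simp: Cr)
      qed
      then show ?thesis by (simp add: K_def mult_ac)
    qed
  qed
  \<comment> \<open>The restriction to \<open>norm h \<le> 1\<close> bounds the pairing of
    \<open>h\<close> with the support by \<open>r\<close>, hence the exponential in the Taylor
    remainder by \<open>exp r\<close>. \<open>K\<close> is the total mass of the weighted
    kernel.\<close>
  have main: "norm (laplace M g (\<xi> + h) - laplace M g \<xi> - ?D h) \<le> (K * exp r * r\<^sup>2) * norm h ^ 2"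
    if "norm h \<le> 1" for h
  proof -
    have "laplace M g (\<xi> + h) - laplace M g \<xi> - ?D h
       = (LINT x|M. ?k x * (exp (blinfun_apply h x) - (1 + blinfun_apply h x)))"
      unfolding laplace_def Bochner_Integration.integral_diff[OF intE intE, symmetric]
        Bochner_Integration.integral_diff[OF Bochner_Integration.integrable_diff[OF intE intE] intD, symmetric]
      by (intro arg_cong[where f="integral\<^sup>L M"]) (auto simp: blinfun.bilinear_simps algebra_simps exp_add)
    also have "norm \<dots> \<le> (LINT x|M. norm (?k x) * (exp r * (r * norm h)^2))"
    proof (rule Bochner_Integration.integral_norm_bound_integral)
      show "integrable M (\<lambda>x. ?k x * (exp (blinfun_apply h x) - (1 + blinfun_apply h x)))"
        by (intro integrable_bounded_kernel[OF M] bounded_kernel_mult[OF k]) (auto intro!: continuous_intros)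
      show "integrable M (\<lambda>x. norm (?k x) * (exp r * (r * norm h)^2))"
        by (intro integrable_mult_left intk)
      show "norm (?k x * (exp (blinfun_apply h x) - (1 + blinfun_apply h x)))
         \<le> norm (?k x) * (exp r * (r * norm h)^2)" for x
      proof (cases "r < norm x")
        case False
        let ?z = "blinfun_apply h x"
        have z: "norm ?z \<le> r * norm h" using bd[of x h] False by simp
        have z': "norm ?z \<le> r" using z that mult_left_mono[OF that Cr(1)] by simp
        have "norm (exp ?z - (\<Sum>k\<le>1. ?z ^ k / fact k)) \<le> exp \<bar>Re ?z\<bar> * norm ?z ^ Suc 1 / fact 1"
          by (rule Taylor_exp)
        then have "norm (exp ?z - (1 + ?z)) \<le> exp \<bar>Re ?z\<bar> * norm ?z ^ 2"
          by (simp add: power2_eq_square)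
        also have "\<dots> \<le> exp r * (r * norm h)^2"
          using z z' abs_Re_le_cmod[of ?z] by (intro mult_mono power_mono) auto
        finally show ?thesis by (auto simp: norm_mult intro!: mult_left_mono)
      qed (auto simp: Cr)
    qed
    finally show ?thesis by (simp add: K_def power_mult_distrib mult_ac)
  qed
  show ?thesis
    unfolding has_derivative_at
  proof (intro conjI bl)
    have "((\<lambda>h. (K * exp r * r\<^sup>2) * norm (h :: 'a cdual)) \<longlongrightarrow> (K * exp r * r\<^sup>2) * norm (0 :: 'a cdual)) (at 0)"
      by (intro tendsto_intros)
    then have lim: "((\<lambda>h. (K * exp r * r\<^sup>2) * norm (h :: 'a cdual)) \<longlongrightarrow> 0) (at 0)" by simp
    show "((\<lambda>h. norm (laplace M g (\<xi> + h) - laplace M g \<xi> - ?D h) / norm h) \<longlongrightarrow> 0) (at 0)"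
    proof (rule tendsto_sandwich[OF _ _ tendsto_const lim])
      have "\<forall>\<^sub>F h in at (0 :: 'a cdual). norm h < 1"
        by (rule order_tendstoD(2)[OF tendsto_norm_zero[OF tendsto_ident_at]]) simp
      then show "\<forall>\<^sub>F h in at 0. norm (laplace M g (\<xi> + h) - laplace M g \<xi> - ?D h) / norm h
          \<le> (K * exp r * r\<^sup>2) * norm h"
      proof eventually_elim
        case (elim h)
        then show ?case using main[of h]
          by (cases "h = 0") (simp_all add: pos_divide_le_eq power2_eq_square mult.assoc)
      qed
    qed auto
  qed
qed

lemma cdual_holomorphic_on_laplace:
  assumes "locally_finite_borel M" "bounded_kernel g"
  shows "cdual_holomorphic_on (laplace M g) U"
  unfolding cdual_holomorphic_on_def
proof
  fix \<xi>
  have "laplace M (\<lambda>x. g x * blinfun_apply (cscale c \<eta>) x) \<xi> = c * laplace M (\<lambda>x. g x * blinfun_apply \<eta> x) \<xi>" for c and \<eta> :: "'a cdual"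
    unfolding laplace_def integral_mult_right_zero[symmetric]
    by (intro arg_cong[where f="integral\<^sup>L M"]) (simp add: mult_ac)
  then show "\<exists>D. (laplace M g has_derivative D) (at \<xi>) \<and> (\<forall>c \<eta>. D (cscale c \<eta>) = c * D \<eta>)"
    by (intro exI conjI allI) (rule has_derivative_laplace[OF assms])
qed

lemma has_field_derivative_laplace_line:
  assumes M: "locally_finite_borel M" and g: "bounded_kernel g"
  shows "((\<lambda>\<tau>. laplace M g (cscale \<tau> \<xi>)) has_field_derivative
     laplace M (\<lambda>x. g x * blinfun_apply \<xi> x) (cscale \<tau> \<xi>)) (at \<tau>)"
proof -
  have 1: "((\<lambda>\<tau>. cscale \<tau> \<xi>) has_derivative (\<lambda>t. cscale t \<xi>)) (at \<tau>)"
    by (intro bounded_linear_imp_has_derivative bounded_linear_cscale_left)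
  have "laplace M (\<lambda>x. g x * blinfun_apply (cscale t \<xi>) x) \<zeta> = laplace M (\<lambda>x. g x * blinfun_apply \<xi> x) \<zeta> * t" for t \<zeta>
    unfolding laplace_def integral_mult_left_zero[symmetric]
    by (intro arg_cong[where f="integral\<^sup>L M"]) (simp add: mult_ac)
  then have 2: "(\<lambda>t. laplace M (\<lambda>x. g x * blinfun_apply (cscale t \<xi>) x) \<zeta>)
      = (*) (laplace M (\<lambda>x. g x * blinfun_apply \<xi> x) \<zeta>)" for \<zeta>
    by (rule ext)
  show ?thesis
    using has_derivative_compose[OF 1 has_derivative_laplace[OF M g]]
    unfolding has_field_derivative_def 2 .
qed

text \<open>Each derivative in \<tau> brings down one factor \<open>blinfun_apply \<xi> x\<close>,
  and at \<tau> = 0 the exponential is 1, so the Taylor coefficients are the moments of the kernel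
  divided by factorials.\<close>

lemma laplace_line_fps_expansion:
  assumes M: "locally_finite_borel M" and g: "bounded_kernel g"
  shows "(\<lambda>\<tau>. laplace M g (cscale \<tau> \<xi>)) has_fps_expansion
           Abs_fps (\<lambda>n. LINT x|M. g x * blinfun_apply \<xi> x ^ n / fact n)"
proof -
  let ?f = "\<lambda>\<tau>. laplace M g (cscale \<tau> \<xi>)"
  have hol: "?f holomorphic_on UNIV"
    unfolding holomorphic_on_def field_differentiable_def
    by (intro ballI exI) (rule has_field_derivative_laplace_line[OF M g])
  have d: "(deriv ^^ n) ?f = (\<lambda>\<tau>. laplace M (\<lambda>x. g x * blinfun_apply \<xi> x ^ n) (cscale \<tau> \<xi>))" for n
  proof (induction n)
    case (Suc n)
    show ?case
    proof
      fix \<tau>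
      have "(deriv ^^ Suc n) ?f \<tau> = deriv (\<lambda>\<tau>. laplace M (\<lambda>x. g x * blinfun_apply \<xi> x ^ n) (cscale \<tau> \<xi>)) \<tau>"
        by (simp only: funpow.simps comp_apply Suc)
      also have "\<dots> = laplace M (\<lambda>x. g x * blinfun_apply \<xi> x ^ n * blinfun_apply \<xi> x) (cscale \<tau> \<xi>)"
        by (rule DERIV_imp_deriv[OF has_field_derivative_laplace_line[OF M bounded_kernel_pow[OF g]]])
      finally show "(deriv ^^ Suc n) ?f \<tau> = laplace M (\<lambda>x. g x * blinfun_apply \<xi> x ^ Suc n) (cscale \<tau> \<xi>)"
        by (simp only: power_Suc2 mult.assoc)
    qed
  qed simp
  have "?f has_fps_expansion fps_expansion ?f 0"
    by (rule has_fps_expansion_fps_expansion[OF open_UNIV UNIV_I hol])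
  also have "fps_expansion ?f 0 = Abs_fps (\<lambda>n. LINT x|M. g x * blinfun_apply \<xi> x ^ n / fact n)"
    unfolding fps_expansion_def d by (rule fps_ext) (simp add: laplace_def)
  finally show ?thesis .
qed

section \<open>Iterated differences of polyhedra\<close>

text \<open>The composition of the operators \<open>1 - T_w\<close>, with \<open>T_w\<close> the
  translation by \<open>w\<close>. Lists are used because the lists of several polyhedra will be
  concatenated and repetitions must count.\<close>

fun bdiff :: "'a::ab_group_add list \<Rightarrow> ('a \<Rightarrow> 'b::ab_group_add) \<Rightarrow> 'a \<Rightarrow> 'b" where
  "bdiff [] f = f"
| "bdiff (w # ws) f = (\<lambda>x. bdiff ws f x - bdiff ws f (x - w))"

lemma bdiff_append: "bdiff (us @ ws) f = bdiff us (bdiff ws f)"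
  by (induction us) auto

lemma bdiff_move: "bdiff (us @ w # ws) f = bdiff (w # us @ ws) f"
proof (induction us)
  case (Cons u us)
  show ?case unfolding append_Cons bdiff.simps(2)[of u] Cons by (simp add: fun_eq_iff algebra_simps)
qed simp

text \<open>The operators \<open>1 - T_w\<close> commute. Hence any chosen factor can be applied
  first, and a list can be split off from a longer one.\<close>

lemma bdiff_mset: "mset us = mset ws \<Longrightarrow> bdiff us f = bdiff ws f"
proof (induction us arbitrary: ws)
  case (Cons u us)
  then have "u \<in> set ws" by (metis list.set_intros(1) set_mset_mset)
  then obtain as bs where ws: "ws = as @ u # bs" by (meson split_list)
  then have "mset us = mset (as @ bs)" using Cons.prems by simp
  then have "bdiff us f = bdiff (as @ bs) f" by (rule Cons.IH)
  then show ?case unfolding ws bdiff_move by simp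
qed simp

lemma bdiff_sum:
  fixes f :: "'i \<Rightarrow> 'a::ab_group_add \<Rightarrow> complex"
  shows "bdiff ws (\<lambda>x. \<Sum>p\<in>P. r p * f p x) x = (\<Sum>p\<in>P. r p * bdiff ws (f p) x)"
  by (induction ws arbitrary: x) (auto simp: sum_subtractf algebra_simps)

lemma bdiff_shift: "bdiff ws (\<lambda>x. f (x - s)) x = bdiff ws f (x - s)"
  by (induction ws arbitrary: x) (auto simp: algebra_simps)

lemma bdiff_norm_le:
  fixes f :: "'a::ab_group_add \<Rightarrow> complex"
  assumes "\<And>x. norm (f x) \<le> C"
  shows "norm (bdiff ws f x) \<le> 2 ^ length ws * C"
proof (induction ws arbitrary: x)
  case (Cons w ws)
  have "norm (bdiff (w # ws) f x) \<le> norm (bdiff ws f x) + norm (bdiff ws f (x - w))"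
    by (simp add: norm_triangle_ineq4)
  then show ?case using Cons[of x] Cons[of "x - w"] by simp
qed (simp add: assms)

lemma bdiff_borel:
  fixes f :: "'a::euclidean_space \<Rightarrow> complex"
  assumes f: "f \<in> borel_measurable borel"
  shows "bdiff ws f \<in> borel_measurable borel"
proof (induction ws)
  case (Cons w ws)
  have "(\<lambda>x. bdiff ws f (x - w)) \<in> borel_measurable borel"
    by (rule measurable_compose[OF _ Cons]) simp
  then show ?case using Cons by (simp add: borel_measurable_diff)
qed (simp add: f)

text \<open>\<open>bdiff ws f\<close> is a signed sum of translates of \<open>f\<close> by partial
  sums of \<open>ws\<close>; the total length of \<open>ws\<close> bounds every such shift.\<close>

lemma bdiff_nonzeroE:
  fixes f :: "'a::real_normed_vector \<Rightarrow> complex"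
  assumes "bdiff ws f x \<noteq> 0"
  obtains y where "norm y \<le> (\<Sum>w\<leftarrow>ws. norm w)" "f (x - y) \<noteq> 0"
  using assms
proof (induction ws arbitrary: x thesis)
  case Nil
  then show ?case by (auto intro: Nil(1)[of 0])
next
  case (Cons w ws)
  consider "bdiff ws f x \<noteq> 0" | "bdiff ws f (x - w) \<noteq> 0" using Cons.prems(2) by fastforce
  then show ?case
  proof cases
    case 1
    then obtain y where "norm y \<le> (\<Sum>w\<leftarrow>ws. norm w)" "f (x - y) \<noteq> 0" by (rule Cons.IH[rotated])
    then show ?thesis by (intro Cons.prems(1)[of y]) (auto intro: order_trans)
  next
    case 2
    then obtain y where y: "norm y \<le> (\<Sum>w\<leftarrow>ws. norm w)" "f (x - w - y) \<noteq> 0" by (rule Cons.IH[rotated])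
    have "norm (w + y) \<le> norm w + (\<Sum>w\<leftarrow>ws. norm w)"
      using y(1) norm_triangle_ineq[of w y] by linarith
    with y show ?thesis by (intro Cons.prems(1)[of "w + y"]) (simp_all add: diff_diff_eq)
  qed
qed

text \<open>Apply the factor \<open>1 - T_w\<close> first. The remaining differences only look at
  points within the total length of \<open>ws\<close>, and there \<open>f\<close> does not notice
  the translation by \<open>w\<close>.\<close>

lemma bdiff_eq_0:
  fixes f :: "'a::real_normed_vector \<Rightarrow> complex"
  assumes "w \<in> set ws"
    and "\<And>y. norm y \<le> (\<Sum>w\<leftarrow>ws. norm w) \<Longrightarrow> f (x - y) = f (x - y - w)"
  shows "bdiff ws f x = 0"
proof -
  obtain as bs where ws: "ws = as @ w # bs" using assms(1) by (meson split_list)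
  have *: "bdiff ws f x = bdiff (as @ bs) (\<lambda>x. f x - f (x - w)) x"
  proof -
    have "bdiff ws f = bdiff ((as @ bs) @ [w]) f"
      unfolding ws by (rule bdiff_mset) simp
    then show ?thesis unfolding bdiff_append by simp
  qed
  show ?thesis
  proof (rule ccontr)
    assume "bdiff ws f x \<noteq> 0"
    then obtain y where y: "norm y \<le> (\<Sum>w\<leftarrow>as @ bs. norm w)" "f (x - y) - f (x - y - w) \<noteq> 0"
      unfolding * by (rule bdiff_nonzeroE)
    moreover have "(\<Sum>w\<leftarrow>as @ bs. norm w) \<le> (\<Sum>w\<leftarrow>ws. norm w)"
      unfolding ws by simp
    ultimately show False using assms(2)[of y] by simp
  qed
qed

section \<open>Finitely generated cones, and the support of the iterated difference of a
  polyhedron\<close>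

definition ncone :: "'a::real_vector set \<Rightarrow> 'a set" where
  "ncone W = {\<Sum>w\<in>W. t w *\<^sub>R w | t. \<forall>w\<in>W. 0 \<le> t w}"

lemma ncone_add: "x \<in> ncone W \<Longrightarrow> y \<in> ncone W \<Longrightarrow> x + y \<in> ncone W"
proof -
  assume "x \<in> ncone W" "y \<in> ncone W"
  then obtain s t where "x = (\<Sum>w\<in>W. s w *\<^sub>R w)" "\<forall>w\<in>W. 0 \<le> s w"
    "y = (\<Sum>w\<in>W. t w *\<^sub>R w)" "\<forall>w\<in>W. 0 \<le> t w" unfolding ncone_def by blast
  then show ?thesis unfolding ncone_def
    by (intro CollectI exI[of _ "\<lambda>w. s w + t w"]) (simp add: scaleR_left_distrib sum.distrib)
qed

lemma ncone_scaleR: "x \<in> ncone W \<Longrightarrow> 0 \<le> a \<Longrightarrow> a *\<^sub>R x \<in> ncone W"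
proof -
  assume "x \<in> ncone W" and a: "0 \<le> a"
  then obtain s where "x = (\<Sum>w\<in>W. s w *\<^sub>R w)" "\<forall>w\<in>W. 0 \<le> s w" unfolding ncone_def by blast
  then show ?thesis unfolding ncone_def using a
    by (intro CollectI exI[of _ "\<lambda>w. a * s w"]) (simp add: scaleR_sum_right)
qed

lemma ncone_0: "0 \<in> ncone W"
  unfolding ncone_def by (intro CollectI exI[of _ "\<lambda>_. 0"]) simp

lemma ncone_base: "finite W \<Longrightarrow> w \<in> W \<Longrightarrow> w \<in> ncone W"
  unfolding ncone_def
  by (intro CollectI exI[of _ "\<lambda>u. if u = w then 1 else 0"])
     (simp add: if_distrib[of "\<lambda>a. a *\<^sub>R _"] cong: if_cong)

lemma ncone_sum: "(\<And>i. i \<in> I \<Longrightarrow> f i \<in> ncone W) \<Longrightarrow> sum f I \<in> ncone W"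
  by (induction I rule: infinite_finite_induct) (simp_all add: ncone_0 ncone_add)

lemma ncone_subset_iff: "finite V \<Longrightarrow> ncone V \<subseteq> ncone W \<longleftrightarrow> V \<subseteq> ncone W"
proof
  assume V: "finite V" "V \<subseteq> ncone W"
  show "ncone V \<subseteq> ncone W"
  proof
    fix x assume "x \<in> ncone V"
    then obtain s where "x = (\<Sum>w\<in>V. s w *\<^sub>R w)" "\<forall>w\<in>V. 0 \<le> s w" unfolding ncone_def by blast
    then show "x \<in> ncone W" using V by (auto intro!: ncone_sum ncone_scaleR)
  qed
qed (use ncone_base in blast)

lemma ncone_remove_0: "ncone (W - {0}) = ncone W" if "finite W"
proof
  show "ncone (W - {0}) \<subseteq> ncone W"
    using that by (subst ncone_subset_iff) (auto intro: ncone_base)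
  show "ncone W \<subseteq> ncone (W - {0})"
    using that ncone_base[of "W - {0}"] ncone_0[of "W - {0}"] by (subst ncone_subset_iff) blast+
qed

text \<open>A compactness argument. If the support were unbounded, some points \<open>x n\<close> of
  it would go to infinity in a limit direction \<open>u\<close>. As the \<open>x n\<close> stay near
  \<open>p\<close>, \<open>u\<close> lies in the recession cone, so some nonzero generator
  \<open>w\<close> occurs in \<open>u\<close> with positive weight. A constraint \<mu> with
  \<open>\<mu> w = 0\<close> ignores the translation by \<open>w\<close>; any other one has
  \<open>\<mu> u < 0\<close> and becomes slack along the sequence. Thus membership in
  \<open>p\<close> near a far \<open>x n\<close> is unaffected by \<open>w\<close>, and
  \<open>bdiff_eq_0\<close> contradicts the choice of \<open>x n\<close>.\<close>

lemma bdiff_polyhedron_support: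
  fixes H :: "(('a::euclidean_space \<Rightarrow>\<^sub>L real) \<times> real) set"
  assumes H: "finite H" and p: "p = {x. \<forall>(\<mu>, b)\<in>H. \<mu> x \<le> b}"
    and rec: "{x. \<forall>(\<mu>, b)\<in>H. blinfun_apply \<mu> x \<le> 0} = ncone (set ws)"
  obtains r where "\<And>x. bdiff ws (indicator p :: 'a \<Rightarrow> complex) x \<noteq> 0 \<Longrightarrow> norm x \<le> r"
proof (rule ccontr)
  assume "\<not> thesis"
  let ?f = "indicator p :: 'a \<Rightarrow> complex"
  have p': "z \<in> p \<longleftrightarrow> (\<forall>(\<mu>, b)\<in>H. blinfun_apply \<mu> z \<le> b)" for z
    unfolding p by (simp add: split_beta)
  have "\<exists>x. bdiff ws ?f x \<noteq> 0 \<and> real n < norm x" for n :: nat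
    using \<open>\<not> thesis\<close> that[of "real n"] by (meson not_le)
  then obtain x where x: "\<And>n. bdiff ws ?f (x n) \<noteq> 0" "\<And>n. real n < norm (x n)" by metis
  define R where "R = (\<Sum>w\<leftarrow>ws. norm w)"
  have \<mu>_bd: "\<bar>blinfun_apply \<mu> y\<bar> \<le> norm \<mu> * c" if "norm y \<le> c" for \<mu> :: "'a \<Rightarrow>\<^sub>L real" and y c
    using norm_blinfun[of \<mu> y] mult_left_mono[OF that norm_ge_zero[of \<mu>]] by simp
  \<comment> \<open>A nonzero difference puts a point of \<open>p\<close> within distance
    \<open>R\<close> of \<open>x n\<close>.\<close>
  have upper: "blinfun_apply \<mu> (x n) \<le> b + norm \<mu> * R" if "(\<mu>, b) \<in> H" for \<mu> b n
  proof -
    obtain y where y: "norm y \<le> R" "?f (x n - y) \<noteq> 0"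
      using bdiff_nonzeroE[OF x(1)[of n]] unfolding R_def by blast
    then have "x n - y \<in> p" by (simp add: indicator_def split: if_splits)
    then have "blinfun_apply \<mu> (x n - y) \<le> b" using that by (auto simp: p)
    then show ?thesis using \<mu>_bd[OF y(1), of \<mu>] by (simp add: blinfun.bilinear_simps)
  qed
  have xn0: "norm (x n) > 0" for n using x(2)[of n] of_nat_0_le_iff[of n] by linarith
  then have "sgn (x n) \<in> sphere 0 1" for n by (simp add: norm_sgn)
  then obtain u \<rho> where u: "u \<in> sphere 0 1" "strict_mono (\<rho> :: nat \<Rightarrow> nat)" "((\<lambda>n. sgn (x n)) \<circ> \<rho>) \<longlonglongrightarrow> u"
    using compact_sphere[of "0 :: 'a" 1] unfolding compact_def by (metis (no_types, lifting))
  have big: "filterlim (\<lambda>n. norm (x (\<rho> n))) at_top sequentially"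
  proof (rule filterlim_at_top_mono[OF filterlim_real_sequentially])
    show "\<forall>\<^sub>F n in sequentially. real n \<le> norm (x (\<rho> n))"
      using x(2)[of "\<rho> _"] seq_suble[OF u(2)] by (intro always_eventually allI) (meson less_imp_le of_nat_mono order_trans)
  qed
  have lim: "(\<lambda>n. blinfun_apply \<mu> (sgn (x (\<rho> n)))) \<longlonglongrightarrow> blinfun_apply \<mu> u" for \<mu> :: "'a \<Rightarrow>\<^sub>L real"
    using u(3) by (intro tendsto_intros) (simp add: o_def)
  have sgn: "blinfun_apply \<mu> (x n) = norm (x n) * blinfun_apply \<mu> (sgn (x n))" for \<mu> :: "'a \<Rightarrow>\<^sub>L real" and n
    using xn0[of n] by (simp add: sgn_div_norm blinfun.scaleR_right)
  have uneg: "blinfun_apply \<mu> u \<le> 0" if "(\<mu>, b) \<in> H" for \<mu> b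
  proof -
    have "(\<lambda>n. (b + norm \<mu> * R) / norm (x (\<rho> n))) \<longlonglongrightarrow> 0"
      by (rule real_tendsto_divide_at_top[OF tendsto_const big])
    moreover have "blinfun_apply \<mu> (sgn (x (\<rho> n))) \<le> (b + norm \<mu> * R) / norm (x (\<rho> n))" for n
      using upper[OF that, of "\<rho> n"] xn0[of "\<rho> n"] by (simp add: sgn pos_le_divide_eq mult.commute)
    ultimately show ?thesis
      using lim[of \<mu>] by (intro LIMSEQ_le[of _ "blinfun_apply \<mu> u" _ 0]) auto
  qed
  then have "u \<in> {x. \<forall>(\<mu>, b)\<in>H. blinfun_apply \<mu> x \<le> 0}" by auto
  then have "u \<in> ncone (set ws)" unfolding rec .
  then obtain t where t: "u = (\<Sum>w\<in>set ws. t w *\<^sub>R w)" "\<forall>w\<in>set ws. 0 \<le> t w"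
    unfolding ncone_def by blast
  obtain w where w: "w \<in> set ws" "t w > 0" "w \<noteq> 0"
  proof -
    have "u \<noteq> 0" using u(1) by auto
    then obtain w where "w \<in> set ws" "t w *\<^sub>R w \<noteq> 0" unfolding t(1) by (meson sum.neutral)
    then show thesis using t(2) that[of w] by (auto simp: less_le)
  qed
  have wH: "blinfun_apply \<mu> v \<le> 0" if "(\<mu>, b) \<in> H" "v \<in> set ws" for \<mu> b v
    using ncone_base[of "set ws" v] that unfolding rec[symmetric] by auto
  \<comment> \<open>The margin \<open>norm \<mu> * (R + norm w)\<close> leaves room for a shift by
    any \<open>y\<close> of norm at most \<open>R\<close>, followed by a shift by
    \<open>w\<close>.\<close>
  have ev: "\<forall>\<^sub>F n in sequentially. blinfun_apply \<mu> w = 0 \<or>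
      blinfun_apply \<mu> (x (\<rho> n)) \<le> b - norm \<mu> * (R + norm w)" if "(\<mu>, b) \<in> H" for \<mu> b
  proof (cases "blinfun_apply \<mu> w = 0")
    case False
    then have "blinfun_apply \<mu> w < 0" using wH[OF that w(1)] by simp
    have "blinfun_apply \<mu> u = (\<Sum>v\<in>set ws. t v * blinfun_apply \<mu> v)"
      unfolding t(1) by (simp add: blinfun.sum_right blinfun.scaleR_right)
    also have "\<dots> = t w * blinfun_apply \<mu> w + (\<Sum>v\<in>set ws - {w}. t v * blinfun_apply \<mu> v)"
      using w(1) by (simp add: sum.remove)
    also have "\<dots> \<le> t w * blinfun_apply \<mu> w + 0"
      using t(2) wH[OF that] by (intro add_left_mono sum_nonpos mult_nonneg_nonpos) auto
    also have "\<dots> < 0" using w(2) \<open>blinfun_apply \<mu> w < 0\<close> by (simp add: mult_pos_neg)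
    finally have neg: "blinfun_apply \<mu> u < 0" .
    have "filterlim (\<lambda>n. blinfun_apply \<mu> (sgn (x (\<rho> n))) * norm (x (\<rho> n))) at_bot sequentially"
      by (rule filterlim_tendsto_neg_mult_at_bot[OF lim neg big])
    then have "filterlim (\<lambda>n. blinfun_apply \<mu> (x (\<rho> n))) at_bot sequentially"
      by (simp add: sgn mult.commute)
    then show ?thesis unfolding filterlim_at_bot by (auto elim: eventually_mono)
  qed simp
  have "\<forall>\<^sub>F n in sequentially. \<forall>h\<in>H. blinfun_apply (fst h) w = 0 \<or>
      blinfun_apply (fst h) (x (\<rho> n)) \<le> snd h - norm (fst h) * (R + norm w)"
    using H ev by (intro eventually_ball_finite) auto
  then obtain n where "\<forall>h\<in>H. blinfun_apply (fst h) w = 0 \<or>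
      blinfun_apply (fst h) (x (\<rho> n)) \<le> snd h - norm (fst h) * (R + norm w)"
    using eventually_happens'[OF sequentially_bot] by blast
  then have n: "blinfun_apply \<mu> w = 0 \<or> blinfun_apply \<mu> (x (\<rho> n)) \<le> b - norm \<mu> * (R + norm w)"
    if "(\<mu>, b) \<in> H" for \<mu> b using that by fastforce
  have "bdiff ws ?f (x (\<rho> n)) = 0"
  proof (rule bdiff_eq_0[OF w(1)])
    fix y :: 'a assume "norm y \<le> (\<Sum>w\<leftarrow>ws. norm w)"
    then have y: "norm y \<le> R" by (simp add: R_def)
    have "blinfun_apply \<mu> (x (\<rho> n) - y) \<le> b \<longleftrightarrow> blinfun_apply \<mu> (x (\<rho> n) - y - w) \<le> b"
      if "(\<mu>, b) \<in> H" for \<mu> b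
    proof (cases "blinfun_apply \<mu> w = 0")
      case False
      then have *: "blinfun_apply \<mu> (x (\<rho> n)) \<le> b - norm \<mu> * (R + norm w)" using n[OF that] by simp
      have "0 \<le> norm \<mu> * norm w" by simp
      moreover have "\<bar>blinfun_apply \<mu> y\<bar> \<le> norm \<mu> * R" "\<bar>blinfun_apply \<mu> w\<bar> \<le> norm \<mu> * norm w"
        using \<mu>_bd[OF y, of \<mu>] \<mu>_bd[of w "norm w" \<mu>] by auto
      ultimately have "blinfun_apply \<mu> (x (\<rho> n) - y) \<le> b" "blinfun_apply \<mu> (x (\<rho> n) - y - w) \<le> b"
        using * unfolding blinfun.diff_right distrib_left by linarith+
      then show ?thesis by simp
    qed (simp add: blinfun.bilinear_simps)
    then have "x (\<rho> n) - y \<in> p \<longleftrightarrow> x (\<rho> n) - y - w \<in> p" unfolding p' by auto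
    then show "?f (x (\<rho> n) - y) = ?f (x (\<rho> n) - y - w)" by (simp add: indicator_def)
  qed
  then show False using x(1) by blast
qed

section \<open>Generators of rational cones\<close>

lemma lattice_inE:
  assumes "lattice_in \<Lambda> L"
  obtains B where "finite B" "independent B" "span B = L"
    "\<Lambda> = range (\<lambda>k::'a::real_vector \<Rightarrow> int. \<Sum>b\<in>B. real_of_int (k b) *\<^sub>R b)"
  using assms unfolding lattice_in_def lattice_basis_def by blast

lemma lattice_scale:
  assumes "lattice_in \<Lambda> L" "x \<in> \<Lambda>" shows "real_of_int n *\<^sub>R x \<in> \<Lambda>"
proof -
  obtain B where B: "\<Lambda> = range (\<lambda>k::'a \<Rightarrow> int. \<Sum>b\<in>B. real_of_int (k b) *\<^sub>R b)"
    using lattice_inE[OF assms(1)] by blast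
  obtain k where "x = (\<Sum>b\<in>B. real_of_int (k b) *\<^sub>R b)" using assms(2) B by blast
  then show ?thesis unfolding B
    by (intro range_eqI[of _ _ "\<lambda>b. n * k b"]) (simp add: scaleR_sum_right)
qed

lemma lattice_add:
  assumes "lattice_in \<Lambda> L" "x \<in> \<Lambda>" "y \<in> \<Lambda>" shows "x + y \<in> \<Lambda>"
proof -
  obtain B where B: "\<Lambda> = range (\<lambda>k::'a \<Rightarrow> int. \<Sum>b\<in>B. real_of_int (k b) *\<^sub>R b)"
    using lattice_inE[OF assms(1)] by blast
  obtain k l where "x = (\<Sum>b\<in>B. real_of_int (k b) *\<^sub>R b)" "y = (\<Sum>b\<in>B. real_of_int (l b) *\<^sub>R b)"
    using assms(2,3) B by blast
  then show ?thesis unfolding B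
    by (intro range_eqI[of _ _ "\<lambda>b. k b + l b"]) (simp add: sum.distrib scaleR_left_distrib)
qed

lemma lattice_minus: "lattice_in \<Lambda> L \<Longrightarrow> x \<in> \<Lambda> \<Longrightarrow> - x \<in> \<Lambda>"
  using lattice_scale[of \<Lambda> L x "-1"] by simp

lemma lattice_diff: "lattice_in \<Lambda> L \<Longrightarrow> x \<in> \<Lambda> \<Longrightarrow> y \<in> \<Lambda> \<Longrightarrow> x - y \<in> \<Lambda>"
  using lattice_add[of \<Lambda> L x "- y"] lattice_minus[of \<Lambda> L y] by simp

text \<open>One step of Motzkin's double description method.\<close>

lemma ncone_halfspace:
  fixes \<mu> :: "'a::real_normed_vector \<Rightarrow>\<^sub>L real"
  assumes \<Lambda>: "lattice_in \<Lambda> L" and \<mu>: "\<mu> \<in> dual_lattice \<Lambda>" and W: "finite W" "W \<subseteq> \<Lambda>"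
  obtains W' where "finite W'" "W' \<subseteq> \<Lambda>" "ncone W' = ncone W \<inter> {x. \<mu> x \<le> 0}"
proof
  define P where "P = {w\<in>W. 0 < \<mu> w}"
  define N where "N = {w\<in>W. \<mu> w < 0}"
  define Z where "Z = {w\<in>W. \<mu> w = 0}"
  \<comment> \<open>A positive generator \<open>a\<close> and a negative one \<open>b\<close> are
    combined into the point of the hyperplane \<open>\<mu> = 0\<close> between them; the
    coefficients are integers on \<Lambda>, so the combination stays in the lattice.\<close>
  define W' where "W' = N \<union> Z \<union> (\<lambda>(a, b). \<mu> a *\<^sub>R b - \<mu> b *\<^sub>R a) ` (P \<times> N)"
  have fin: "finite P" "finite N" "finite Z" using W by (auto simp: P_def N_def Z_def)
  show finW': "finite W'" unfolding W'_def using fin by auto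
  have "\<mu> a *\<^sub>R b - \<mu> b *\<^sub>R a \<in> \<Lambda>" if ab: "a \<in> W" "b \<in> W" for a b
  proof -
    obtain m n where "\<mu> a = real_of_int m" "\<mu> b = real_of_int n"
      using \<mu> ab W(2) unfolding dual_lattice_def by (metis (mono_tags, lifting) Ints_cases mem_Collect_eq subsetD)
    then show ?thesis using ab W(2)
      by (simp) (intro lattice_diff[OF \<Lambda>] lattice_scale[OF \<Lambda>]; blast)
  qed
  then show "W' \<subseteq> \<Lambda>" using W(2) by (auto simp: W'_def P_def N_def Z_def)
  have in1: "w \<in> ncone W'" if "w \<in> N \<union> Z" for w using that finW' by (intro ncone_base) (auto simp: W'_def)
  have in2: "\<mu> a *\<^sub>R b - \<mu> b *\<^sub>R a \<in> ncone W'" if "a \<in> P" "b \<in> N" for a b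
    using that finW' by (intro ncone_base) (auto simp: W'_def)
  show "ncone W' = ncone W \<inter> {x. \<mu> x \<le> 0}"
  proof (intro equalityI subsetI)
    fix x assume x: "x \<in> ncone W'"
    have "W' \<subseteq> ncone W"
    proof
      fix w assume "w \<in> W'"
      then consider "w \<in> W" | a b where "w = \<mu> a *\<^sub>R b + (- \<mu> b) *\<^sub>R a" "a \<in> P" "b \<in> N"
        by (auto simp: W'_def N_def Z_def)
      then show "w \<in> ncone W"
      proof cases
        case 2
        then show ?thesis unfolding 2(1) using W(1)
          by (intro ncone_add ncone_scaleR ncone_base) (auto simp: P_def N_def)
      qed (use W ncone_base in blast)
    qed
    then have "ncone W' \<subseteq> ncone W" using finW' by (simp add: ncone_subset_iff)
    moreover have "\<mu> x \<le> 0"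
    proof -
      obtain t where t: "x = (\<Sum>w\<in>W'. t w *\<^sub>R w)" "\<forall>w\<in>W'. 0 \<le> t w" using x unfolding ncone_def by blast
      have "\<mu> w \<le> 0" if "w \<in> W'" for w
        using that by (auto simp: W'_def N_def Z_def blinfun.bilinear_simps)
      then show ?thesis unfolding t(1) using t(2)
        by (auto simp: blinfun.sum_right blinfun.scaleR_right intro!: sum_nonpos mult_nonneg_nonpos)
    qed
    ultimately show "x \<in> ncone W \<inter> {x. \<mu> x \<le> 0}" using x by blast
  next
    fix x assume x: "x \<in> ncone W \<inter> {x. \<mu> x \<le> 0}"
    then obtain t where t: "x = (\<Sum>w\<in>W. t w *\<^sub>R w)" "\<forall>w\<in>W. 0 \<le> t w" unfolding ncone_def by blast
    \<comment> \<open>\<open>a\<close> is the positive and \<open>b\<close> the negative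
      contribution to \<open>\<mu> x\<close>; the halfspace condition says
      \<open>a \<le> b\<close>.\<close>
    define a where "a = (\<Sum>w\<in>P. t w * \<mu> w)"
    define b where "b = (\<Sum>w\<in>N. t w * - \<mu> w)"
    have WPNZ: "W = P \<union> N \<union> Z" "P \<inter> N = {}" "(P \<union> N) \<inter> Z = {}" by (auto simp: P_def N_def Z_def)
    have split: "(\<Sum>w\<in>W. f w) = (\<Sum>w\<in>P. f w) + (\<Sum>w\<in>N. f w) + (\<Sum>w\<in>Z. f w)" for f :: "'a \<Rightarrow> 'b::comm_monoid_add"
      unfolding WPNZ(1) using fin WPNZ(2,3) by (simp add: sum.union_disjoint)
    have a0: "0 \<le> a" unfolding a_def using t(2) by (intro sum_nonneg) (auto simp: P_def)
    have b0: "0 \<le> b" unfolding b_def using t(2) by (intro sum_nonneg mult_nonneg_nonneg) (auto simp: N_def)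
    have "\<mu> x = a - b + (\<Sum>w\<in>Z. t w * \<mu> w)"
      unfolding t(1) a_def b_def split by (simp add: blinfun.bilinear_simps blinfun.sum_right sum_negf)
    also have "(\<Sum>w\<in>Z. t w * \<mu> w) = 0" by (auto simp: Z_def)
    finally have ab: "a \<le> b" using x by simp
    have xZ: "(\<Sum>w\<in>Z. t w *\<^sub>R w) \<in> ncone W'"
      using t(2) by (intro ncone_sum ncone_scaleR in1) (auto simp: Z_def)
    show "x \<in> ncone W'"
    proof (cases "a = 0")
      case True
      have "t w * \<mu> w = 0" if "w \<in> P" for w
      proof (rule sum_nonneg_0[OF fin(1) _ _ that])
        show "0 \<le> t w * \<mu> w" if "w \<in> P" for w using t(2) that by (auto simp: P_def)
        show "(\<Sum>w\<in>P. t w * \<mu> w) = 0" using True by (simp add: a_def)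
      qed
      then have "(\<Sum>w\<in>P. t w *\<^sub>R w) = 0" by (intro sum.neutral) (auto simp: P_def)
      moreover have "(\<Sum>w\<in>N. t w *\<^sub>R w) \<in> ncone W'"
        using t(2) by (intro ncone_sum ncone_scaleR in1) (auto simp: N_def)
      ultimately show ?thesis using xZ unfolding t(1) split by (auto intro: ncone_add)
    next
      case False
      then have b: "0 < b" using a0 ab by simp
      \<comment> \<open>Pairing each positive generator with each negative one, with weight
        proportional to the product of their coefficients, uses up the positive part completely and
        exactly the fraction \<open>a / b\<close> of the negative part. The rest has the nonnegative
        factor \<open>1 - a / b\<close>.\<close>
      have 1: "(\<Sum>p\<in>P. \<Sum>n\<in>N. (t p * t n / b) *\<^sub>R (\<mu> p *\<^sub>R n - \<mu> n *\<^sub>R p))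
        = (a / b) *\<^sub>R (\<Sum>n\<in>N. t n *\<^sub>R n) + (\<Sum>p\<in>P. t p *\<^sub>R p)"
      proof -
        have "(\<Sum>p\<in>P. \<Sum>n\<in>N. (t p * t n / b) *\<^sub>R (\<mu> p *\<^sub>R n))
            = (\<Sum>n\<in>N. \<Sum>p\<in>P. ((t p * \<mu> p) * (t n / b)) *\<^sub>R n)"
          by (subst sum.swap) (simp add: mult_ac)
        also have "\<dots> = (\<Sum>n\<in>N. (a * (t n / b)) *\<^sub>R n)"
          by (simp only: a_def sum_distrib_right scaleR_left.sum)
        also have "\<dots> = (a / b) *\<^sub>R (\<Sum>n\<in>N. t n *\<^sub>R n)"
          by (simp add: scaleR_sum_right)
        finally have A: "(\<Sum>p\<in>P. \<Sum>n\<in>N. (t p * t n / b) *\<^sub>R (\<mu> p *\<^sub>R n)) = (a / b) *\<^sub>R (\<Sum>n\<in>N. t n *\<^sub>R n)" .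
        have "(\<Sum>p\<in>P. \<Sum>n\<in>N. (t p * t n / b) *\<^sub>R (\<mu> n *\<^sub>R p))
            = (\<Sum>p\<in>P. \<Sum>n\<in>N. ((t n * - \<mu> n) * (- t p / b)) *\<^sub>R p)"
          by (simp add: mult_ac)
        also have "\<dots> = (\<Sum>p\<in>P. (b * (- t p / b)) *\<^sub>R p)"
          by (simp only: b_def sum_distrib_right scaleR_left.sum)
        also have "\<dots> = - (\<Sum>p\<in>P. t p *\<^sub>R p)" using b by (simp add: sum_negf)
        finally have B: "(\<Sum>p\<in>P. \<Sum>n\<in>N. (t p * t n / b) *\<^sub>R (\<mu> n *\<^sub>R p)) = - (\<Sum>p\<in>P. t p *\<^sub>R p)" .
        show ?thesis by (simp only: scaleR_diff_right sum_subtractf A B) simp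
      qed
      have "x = (\<Sum>p\<in>P. \<Sum>n\<in>N. (t p * t n / b) *\<^sub>R (\<mu> p *\<^sub>R n - \<mu> n *\<^sub>R p))
          + ((1 - a / b) *\<^sub>R (\<Sum>n\<in>N. t n *\<^sub>R n) + (\<Sum>w\<in>Z. t w *\<^sub>R w))"
        unfolding 1 t(1) split by (simp add: algebra_simps)
      also have "\<dots> \<in> ncone W'"
      proof (intro ncone_add xZ ncone_sum ncone_scaleR in2)
        show "0 \<le> t p * t n / b" if "p \<in> P" "n \<in> N" for p n
          using that t(2) b by (auto simp: P_def N_def)
        show "0 \<le> 1 - a / b" using ab b by simp
        show "n \<in> ncone W'" if "n \<in> N" for n using in1 that by blast
        show "0 \<le> t n" if "n \<in> N" for n using that t(2) by (auto simp: N_def)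
      qed
      finally show ?thesis .
    qed
  qed
qed

text \<open>The Minkowski-Weyl theorem with generators in the lattice: a lattice basis and its
  negatives generate the whole space, and each halfspace is then cut out by
  \<open>ncone_halfspace\<close>. The generator 0 is dropped because each generator must give a
  hyperplane of \<xi>.\<close>

lemma rational_cone_generators:
  fixes \<Lambda> :: "'a::real_normed_vector set"
  assumes \<Lambda>: "lattice_in \<Lambda> UNIV" and H: "finite H" "H \<subseteq> dual_lattice \<Lambda>"
  obtains W where "finite W" "W \<subseteq> \<Lambda> - {0}" "ncone W = {x. \<forall>\<mu>\<in>H. blinfun_apply \<mu> x \<le> 0}"
proof -
  have "\<exists>W. finite W \<and> W \<subseteq> \<Lambda> \<and> ncone W = {x. \<forall>\<mu>\<in>H. blinfun_apply \<mu> x \<le> 0}"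
    using H
  proof (induction H rule: finite_induct)
    case empty
    obtain B where B: "finite B" "span B = UNIV"
       "\<Lambda> = range (\<lambda>k::'a \<Rightarrow> int. \<Sum>b\<in>B. real_of_int (k b) *\<^sub>R b)"
      by (rule lattice_inE[OF \<Lambda>])
    have b: "b \<in> \<Lambda>" if "b \<in> B" for b
    proof -
      have "(\<Sum>u\<in>B. real_of_int (if u = b then 1 else 0) *\<^sub>R u) = (\<Sum>u\<in>B. if u = b then u else 0)"
        by (rule sum.cong) auto
      also have "\<dots> = b" using that B(1) by simp
      finally show ?thesis unfolding B(3)
        by (intro range_eqI[of _ _ "\<lambda>u. if u = b then 1 else 0"]) (rule sym)
    qed
    let ?W = "B \<union> uminus ` B"
    have "ncone ?W = UNIV"
    proof (intro equalityI subsetI)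
      fix x :: 'a
      have "x \<in> span B" using B(2) by simp
      then have "x \<in> range (\<lambda>u. \<Sum>b\<in>B. u b *\<^sub>R b)" by (simp only: span_finite[OF B(1)])
      then obtain u where x: "x = (\<Sum>b\<in>B. u b *\<^sub>R b)" by blast
      have "u b *\<^sub>R b \<in> ncone ?W" if "b \<in> B" for b
      proof (cases "0 \<le> u b")
        case True
        then show ?thesis using that B(1) by (intro ncone_scaleR ncone_base) auto
      next
        case False
        have "(- u b) *\<^sub>R (- b) \<in> ncone ?W" using that B(1) False by (intro ncone_scaleR ncone_base) auto
        then show ?thesis by simp
      qed
      then show "x \<in> ncone ?W" unfolding x by (rule ncone_sum)
    qed simp
    moreover have "finite ?W" using B(1) by simp
    moreover have "?W \<subseteq> \<Lambda>"
    proof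
      fix x assume "x \<in> ?W"
      then show "x \<in> \<Lambda>"
        using b lattice_minus[OF \<Lambda> b] by (elim UnE imageE) simp_all
    qed
    ultimately show ?case by (intro exI[of _ ?W] conjI) simp_all
  next
    case (insert \<mu> H)
    then obtain W where W: "finite W" "W \<subseteq> \<Lambda>" "ncone W = {x. \<forall>\<mu>\<in>H. blinfun_apply \<mu> x \<le> 0}" by blast
    have \<mu>: "\<mu> \<in> dual_lattice \<Lambda>" using insert.prems by simp
    obtain W' where "finite W'" "W' \<subseteq> \<Lambda>" "ncone W' = ncone W \<inter> {x. blinfun_apply \<mu> x \<le> 0}"
      by (rule ncone_halfspace[OF \<Lambda> \<mu> W(1,2)])
    moreover have "{x. \<forall>\<mu>\<in>H. blinfun_apply \<mu> x \<le> 0} \<inter> {x. blinfun_apply \<mu> x \<le> 0}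
        = {x. \<forall>\<mu>\<in>insert \<mu> H. blinfun_apply \<mu> x \<le> 0}" by auto
    ultimately show ?case by (intro exI[of _ W'] conjI) (simp_all only: W(3))
  qed
  then obtain W where W: "finite W" "W \<subseteq> \<Lambda>" "ncone W = {x. \<forall>\<mu>\<in>H. blinfun_apply \<mu> x \<le> 0}" by blast
  show thesis
  proof (rule that[of "W - {0}"])
    show "finite (W - {0})" "W - {0} \<subseteq> \<Lambda> - {0}" using W by blast+
    show "ncone (W - {0}) = {x. \<forall>\<mu>\<in>H. blinfun_apply \<mu> x \<le> 0}" by (simp only: ncone_remove_0[OF W(1)] W(3))
  qed
qed

section \<open>Edges of pointed cones and their lattice generators\<close>

lemma cone_hull_singleton: "cone hull {w} = {t *\<^sub>R w | t. 0 \<le> t}"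
  by (auto simp: cone_hull_expl)

text \<open>Suppose a multiple of \<open>w\<close> lies between \<open>a\<close> and
  \<open>b\<close> in the cone. After splitting off the \<open>w\<close>-parts, the same convex
  combination \<open>y\<close> of the remainders is a multiple \<open>q\<close> of \<open>w\<close>.
  If \<open>q > 0\<close>, \<open>w\<close> would be redundant; if \<open>q \<le> 0\<close>, both
  \<open>y\<close> and \<open>- y\<close> lie in the cone, so pointedness gives \<open>y = 0\<close>
  and then kills both remainders.\<close>

lemma edge_of_ncone:
  fixes W :: "'a::euclidean_space set"
  assumes W: "finite W" "w \<in> W" and irr: "w \<notin> ncone (W - {w})"
    and pointed: "\<And>y. y \<in> ncone W \<Longrightarrow> - y \<in> ncone W \<Longrightarrow> y = 0"
  shows "(cone hull {w}) edge_of ncone W"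
  unfolding edge_of_def face_of_def
proof (intro conjI ballI impI)
  have w0: "w \<noteq> 0" using irr ncone_0 by metis
  have sub: "ncone (W - {w}) \<subseteq> ncone W" using W(1) ncone_base[OF W(1)] by (subst ncone_subset_iff) auto
  have ww: "w \<in> ncone W" using W by (rule ncone_base)
  show "cone hull {w} \<subseteq> ncone W" unfolding cone_hull_singleton using ncone_scaleR[OF ww] by blast
  show "convex (cone hull {w})" by (simp add: convex_cone_hull)
  have dim: "dim (cone hull {w}) = dim {w}"
  proof -
    have "span (cone hull {w}) = span {w}"
    proof
      show "span (cone hull {w}) \<subseteq> span {w}"
        by (intro span_minimal) (auto simp: cone_hull_singleton intro: span_base span_scale)
      show "span {w} \<subseteq> span (cone hull {w})" by (intro span_mono hull_subset)
    qed
    then show ?thesis using dim_span[of "cone hull {w}"] dim_span[of "{w}"] by simp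
  qed
  have "0 \<in> affine hull (cone hull {w})"
    by (rule hull_inc) (auto simp: cone_hull_singleton intro!: exI[of _ "0::real"])
  then show "aff_dim (cone hull {w}) = 1" using w0 by (simp add: aff_dim_zero dim)
  fix a b x assume a: "a \<in> ncone W" and b: "b \<in> ncone W" and "x \<in> cone hull {w}" and seg: "x \<in> open_segment a b"
  obtain t where x: "x = t *\<^sub>R w" using \<open>x \<in> cone hull {w}\<close> by (auto simp: cone_hull_singleton)
  obtain u where u: "0 < u" "u < 1" "x = (1 - u) *\<^sub>R a + u *\<^sub>R b" using seg by (auto simp: in_segment)
  have split: "\<exists>\<alpha> y. z = \<alpha> *\<^sub>R w + y \<and> 0 \<le> \<alpha> \<and> y \<in> ncone (W - {w})" if z: "z \<in> ncone W" for z
  proof -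
    obtain s where s: "z = (\<Sum>w\<in>W. s w *\<^sub>R w)" "\<forall>w\<in>W. 0 \<le> s w" using z unfolding ncone_def by blast
    have "z = s w *\<^sub>R w + (\<Sum>w\<in>W - {w}. s w *\<^sub>R w)" unfolding s(1) using W by (simp add: sum.remove)
    moreover have "(\<Sum>w\<in>W - {w}. s w *\<^sub>R w) \<in> ncone (W - {w})" unfolding ncone_def using s(2) by blast
    ultimately show ?thesis using s(2) W(2) by blast
  qed
  obtain \<alpha> a' where a': "a = \<alpha> *\<^sub>R w + a'" "0 \<le> \<alpha>" "a' \<in> ncone (W - {w})" using split[OF a] by blast
  obtain \<beta> b' where b': "b = \<beta> *\<^sub>R w + b'" "0 \<le> \<beta>" "b' \<in> ncone (W - {w})" using split[OF b] by blast
  define y where "y = (1 - u) *\<^sub>R a' + u *\<^sub>R b'"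
  define q where "q = t - (1 - u) * \<alpha> - u * \<beta>"
  have y: "y \<in> ncone (W - {w})" unfolding y_def using u a' b' by (intro ncone_add ncone_scaleR) auto
  have yq: "y = q *\<^sub>R w" using u(3) unfolding x a'(1) b'(1) y_def q_def by (simp add: algebra_simps)
  have "q \<le> 0"
  proof (rule ccontr)
    assume "\<not> q \<le> 0"
    then have "w = (1 / q) *\<^sub>R y" by (simp add: yq)
    then have "w \<in> ncone (W - {w})" using y \<open>\<not> q \<le> 0\<close> by (metis linear ncone_scaleR zero_le_divide_1_iff)
    then show False using irr by blast
  qed
  then have "(- q) *\<^sub>R w \<in> ncone W" using ww by (intro ncone_scaleR) auto
  then have y0: "y = 0" using y sub by (intro pointed) (auto simp: yq)
  \<comment> \<open>A vanishing combination with positive coefficients makes \<open>- z\<close> a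
    positive multiple of \<open>z'\<close>, so both \<open>z\<close> and \<open>- z\<close> are in
    the cone.\<close>
  have z: "z = 0" if "z \<in> ncone (W - {w})" "c *\<^sub>R z + d *\<^sub>R z' = 0" "0 < c" "0 < d" "z' \<in> ncone (W - {w})" for z z' c d
  proof (rule pointed)
    show "z \<in> ncone W" using that sub by blast
    have "c *\<^sub>R (- z) = d *\<^sub>R z'" using that(2) by (simp add: add_eq_0_iff)
    then have "(1 / c) *\<^sub>R (c *\<^sub>R (- z)) = (1 / c) *\<^sub>R (d *\<^sub>R z')" by (rule arg_cong)
    then have "- z = (d / c) *\<^sub>R z'" using that(3) by simp
    then show "- z \<in> ncone W" using that sub by (metis divide_nonneg_pos less_imp_le ncone_scaleR subsetD)
  qed
  have "a' = 0" using z[of a' "1 - u" u b'] u a' b' y0 by (simp add: y_def)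
  moreover have "b' = 0" using z[of b' u "1 - u" a'] u a' b' y0 by (simp add: y_def add.commute)
  ultimately show "a \<in> cone hull {w}" "b \<in> cone hull {w}"
    using a' b' by (auto simp: cone_hull_singleton)
qed

text \<open>A generating set of lattice vectors of least cardinality is irredundant, so each of its
  members spans an edge. Conversely, an edge generator is a nonnegative combination of them, and the
  face property puts a term of that combination on its edge. This links the given
  \<open>v j\<close>, which fix the denominators, with lattice vectors, along which differences may
  be taken.\<close>

lemma edge_generators_lattice:
  fixes \<Lambda> c :: "'a::euclidean_space set"
  assumes \<Lambda>: "lattice_in \<Lambda> UNIV" and c: "rational_cone \<Lambda> c" "\<not> contains_line c"
    and v: "edge_generators c N v"
  obtains w s where "\<And>j. j \<in> {1..N} \<Longrightarrow> w j \<in> \<Lambda> - {0}" "\<And>j. j \<in> {1..N} \<Longrightarrow> 0 < s j"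
    "\<And>j. j \<in> {1..N} \<Longrightarrow> v j = s j *\<^sub>R w j" "c = ncone (w ` {1..N})"
proof -
  obtain H where H: "finite H" "H \<subseteq> dual_lattice \<Lambda>" "c = {x. \<forall>\<mu>\<in>H. blinfun_apply \<mu> x \<le> 0}"
    using c(1) unfolding rational_cone_def by blast
  define Q where "Q W \<longleftrightarrow> finite W \<and> W \<subseteq> \<Lambda> - {0} \<and> ncone W = c" for W
  obtain W0 where "finite W0" "W0 \<subseteq> \<Lambda> - {0}" "ncone W0 = c"
    using rational_cone_generators[OF \<Lambda> H(1,2)] unfolding H(3) .
  then have "Q W0" by (simp add: Q_def)
  then obtain W where W: "Q W" "\<And>W'. Q W' \<Longrightarrow> card W \<le> card W'"
    using ex_has_least_nat[of Q W0 card] by blast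
  have finW: "finite W" and W\<Lambda>: "W \<subseteq> \<Lambda> - {0}" and Wc: "ncone W = c" using W(1) by (auto simp: Q_def)
  have irr: "w \<notin> ncone (W - {w})" if "w \<in> W" for w
  proof
    assume *: "w \<in> ncone (W - {w})"
    have "ncone (W - {w}) = ncone W"
    proof
      show "ncone (W - {w}) \<subseteq> ncone W" using finW ncone_base[OF finW] by (subst ncone_subset_iff) auto
      have "W \<subseteq> ncone (W - {w})" using * finW ncone_base[of "W - {w}"] by blast
      then show "ncone W \<subseteq> ncone (W - {w})" using finW by (simp add: ncone_subset_iff)
    qed
    then have "Q (W - {w})" using finW W\<Lambda> Wc by (auto simp: Q_def)
    then show False using W(2)[of "W - {w}"] that finW by (metis card_Diff1_less not_le)
  qed
  have pointed: "y = 0" if "y \<in> c" "- y \<in> c" for y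
  proof (rule ccontr)
    assume "y \<noteq> 0"
    have "blinfun_apply \<mu> y = 0" if "\<mu> \<in> H" for \<mu>
      using \<open>y \<in> c\<close> \<open>- y \<in> c\<close> that unfolding H(3) by (force simp: blinfun.minus_right)
    then have "contains_line c" unfolding contains_line_def H(3)
      using \<open>y \<noteq> 0\<close> by (intro exI[of _ 0] exI[of _ y]) (simp add: blinfun.scaleR_right)
    then show False using c(2) by blast
  qed
  have edge: "(cone hull {w}) edge_of c" if "w \<in> W" for w
    using edge_of_ncone[OF finW that irr[OF that]] pointed Wc by blast
  have bij: "bij_betw (\<lambda>j. cone hull {v j}) {1..N} {e. e edge_of c}"
    using v by (simp add: edge_generators_def)
  have "\<exists>w\<in>W. \<exists>s>0. v j = s *\<^sub>R w" if j: "j \<in> {1..N}" for j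
  proof -
    have e: "(cone hull {v j}) edge_of c" using bij j by (auto dest: bij_betwE)
    then have face: "(cone hull {v j}) face_of c" and dim: "aff_dim (cone hull {v j}) = 1" by (auto simp: edge_of_def)
    have v0: "v j \<noteq> 0"
    proof
      assume "v j = 0"
      then have "cone hull {v j} = {0}" by (auto simp: cone_hull_singleton)
      then show False using dim by simp
    qed
    have vin: "v j \<in> cone hull {v j}" by (simp add: hull_inc)
    then have "v j \<in> ncone W" using face_of_imp_subset[OF face] Wc by blast
    then obtain t where t: "v j = (\<Sum>w\<in>W. t w *\<^sub>R w)" "\<forall>w\<in>W. 0 \<le> t w" unfolding ncone_def by blast
    then obtain w where w: "w \<in> W" "t w *\<^sub>R w \<noteq> 0" using v0 by (metis (no_types, lifting) sum.neutral)
    define z where "z = (\<Sum>w\<in>W - {w}. t w *\<^sub>R w)"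
    have vz: "v j = t w *\<^sub>R w + z" unfolding t(1) z_def using w(1) finW by (simp add: sum.remove)
    have zc: "z \<in> ncone W" unfolding z_def using t(2) finW by (intro ncone_sum ncone_scaleR ncone_base) auto
    have tw: "0 < t w" using t(2) w by (auto simp: less_le)
    \<comment> \<open>\<open>v j\<close> is the midpoint of twice its \<open>w\<close>-part and
      twice the rest. Unless these coincide, it is an interior point of a segment in the cone, so
      the face through \<open>v j\<close> contains the ends.\<close>
    have "t w *\<^sub>R w \<in> cone hull {v j}"
    proof (cases "z = t w *\<^sub>R w")
      case True
      then have "t w *\<^sub>R w = (1 / 2) *\<^sub>R v j" using vz by (simp add: scaleR_2[symmetric])
      then show ?thesis by (auto simp: cone_hull_singleton intro!: exI[of _ "1/2::real"])
    next
      case False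
      have "2 *\<^sub>R (t w *\<^sub>R w) \<noteq> 2 *\<^sub>R z" using False by (simp del: scaleR_scaleR)
      moreover have "v j = (1 - 1 / 2) *\<^sub>R (2 *\<^sub>R (t w *\<^sub>R w)) + (1 / 2 :: real) *\<^sub>R (2 *\<^sub>R z)"
        using vz by simp
      ultimately have "v j \<in> open_segment (2 *\<^sub>R (t w *\<^sub>R w)) (2 *\<^sub>R z)"
        unfolding in_segment by (intro conjI exI[of _ "1/2::real"]) (assumption | simp)+
      moreover have "2 *\<^sub>R (t w *\<^sub>R w) \<in> c" "2 *\<^sub>R z \<in> c"
        unfolding Wc[symmetric] using tw ncone_base[OF finW w(1)]
        by (intro ncone_scaleR zc; simp)+
      ultimately have "2 *\<^sub>R (t w *\<^sub>R w) \<in> cone hull {v j}"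
        using face vin unfolding face_of_def by blast
      then obtain q where "2 *\<^sub>R (t w *\<^sub>R w) = q *\<^sub>R v j" "0 \<le> q" by (auto simp: cone_hull_singleton)
      then have "(1 / 2) *\<^sub>R (2 *\<^sub>R (t w *\<^sub>R w)) = (1 / 2 :: real) *\<^sub>R (q *\<^sub>R v j)" by (simp only:)
      then have "t w *\<^sub>R w = (q / 2) *\<^sub>R v j" by simp
      then show ?thesis using \<open>0 \<le> q\<close> by (auto simp: cone_hull_singleton intro!: exI[of _ "q/2"])
    qed
    then obtain q where q: "t w *\<^sub>R w = q *\<^sub>R v j" "0 \<le> q" by (auto simp: cone_hull_singleton)
    then have "0 < q" using w(2) by (auto simp: less_le)
    have "(1 / q) *\<^sub>R (t w *\<^sub>R w) = (1 / q) *\<^sub>R (q *\<^sub>R v j)" using q(1) by (rule arg_cong)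
    then have "v j = (t w / q) *\<^sub>R w" using \<open>0 < q\<close> by simp
    then show ?thesis using \<open>0 < q\<close> tw w(1) by (intro bexI[of _ w] exI[of _ "t w / q"]) auto
  qed
  then obtain w s where ws: "\<And>j. j \<in> {1..N} \<Longrightarrow> w j \<in> W \<and> 0 < s j \<and> v j = s j *\<^sub>R w j" by metis
  have "W \<subseteq> ncone (w ` {1..N})"
  proof
    fix x assume x: "x \<in> W"
    then obtain j where j: "j \<in> {1..N}" "cone hull {x} = cone hull {v j}"
      using edge[OF x] bij unfolding bij_betw_def by (metis (no_types, lifting) image_iff mem_Collect_eq)
    then have "x \<in> cone hull {v j}" using hull_inc[of x "{x}" cone] by simp
    then obtain q where "x = q *\<^sub>R v j" "0 \<le> q" by (auto simp: cone_hull_singleton)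
    then have "x = (q * s j) *\<^sub>R w j" "0 \<le> q * s j" using ws[OF j(1)] by auto
    moreover have "w j \<in> ncone (w ` {1..N})" using j(1) by (intro ncone_base) simp_all
    ultimately show "x \<in> ncone (w ` {1..N})" by (simp only:) (rule ncone_scaleR)
  qed
  moreover have "w ` {1..N} \<subseteq> ncone W" using ws ncone_base[OF finW] by auto
  ultimately have "c = ncone (w ` {1..N})"
    unfolding Wc[symmetric] using finW by (intro equalityI) (simp_all add: ncone_subset_iff)
  with ws W\<Lambda> show thesis by (intro that[of w s]) auto
qed

section \<open>Lattice measures\<close>

lemma lattice_basis_span:
  assumes "lattice_basis B \<Gamma>" shows "span \<Gamma> = span B"
proof
  have fin: "finite B" and \<Gamma>: "\<Gamma> = range (\<lambda>k::'a \<Rightarrow> int. \<Sum>b\<in>B. real_of_int (k b) *\<^sub>R b)"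
    using assms by (auto simp: lattice_basis_def)
  show "span \<Gamma> \<subseteq> span B" unfolding \<Gamma>
    by (rule span_minimal) (auto intro!: span_sum span_scale intro: span_base)
  show "span B \<subseteq> span \<Gamma>"
  proof (rule span_mono, rule subsetI)
    fix b assume "b \<in> B"
    have "(\<Sum>u\<in>B. real_of_int (if u = b then 1 else 0) *\<^sub>R u) = (\<Sum>u\<in>B. if u = b then u else 0)"
      by (rule sum.cong) auto
    also have "\<dots> = b" using \<open>b \<in> B\<close> fin by simp
    finally show "b \<in> \<Gamma>" unfolding \<Gamma>
      by (intro range_eqI[of _ _ "\<lambda>u. if u = b then 1 else 0"]) (rule sym)
  qed
qed

lemma some_basis:
  assumes "lattice_in \<Gamma> L"
  shows "finite (some_basis \<Gamma>)" "independent (some_basis \<Gamma>)" "span (some_basis \<Gamma>) = L"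
    "\<Gamma> = range (\<lambda>k::'a::real_vector \<Rightarrow> int. \<Sum>b\<in>some_basis \<Gamma>. real_of_int (k b) *\<^sub>R b)"
proof -
  obtain B where B: "lattice_basis B \<Gamma>" "span B = L" using assms unfolding lattice_in_def by blast
  then have *: "lattice_basis (some_basis \<Gamma>) \<Gamma>" unfolding some_basis_def by (rule_tac someI)
  show "span (some_basis \<Gamma>) = L" using lattice_basis_span[OF *] lattice_basis_span[OF B(1)] B(2) by simp
  show "finite (some_basis \<Gamma>)" "independent (some_basis \<Gamma>)"
    "\<Gamma> = range (\<lambda>k::'a::real_vector \<Rightarrow> int. \<Sum>b\<in>some_basis \<Gamma>. real_of_int (k b) *\<^sub>R b)"
    by (rule *[unfolded lattice_basis_def, THEN conjunct1] *[unfolded lattice_basis_def, THEN conjunct2, THEN conjunct1]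
          *[unfolded lattice_basis_def, THEN conjunct2, THEN conjunct2])+
qed

lemma some_basis_memI:
  assumes "lattice_in \<Gamma> L"
  shows "(\<Sum>b\<in>some_basis \<Gamma>. real_of_int (k b) *\<^sub>R b) \<in> \<Gamma>"
proof -
  have "(\<Sum>b\<in>some_basis \<Gamma>. real_of_int (k b) *\<^sub>R b)
      \<in> range (\<lambda>k. \<Sum>b\<in>some_basis \<Gamma>. real_of_int (k b) *\<^sub>R b)" by (rule rangeI)
  then show ?thesis unfolding some_basis(4)[OF assms, symmetric] .
qed

lemma some_basis_memE:
  assumes "lattice_in \<Gamma> L" "x \<in> \<Gamma>"
  obtains k :: "'a::real_vector \<Rightarrow> int" where "x = (\<Sum>b\<in>some_basis \<Gamma>. real_of_int (k b) *\<^sub>R b)"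
proof -
  have "x \<in> range (\<lambda>k::'a \<Rightarrow> int. \<Sum>b\<in>some_basis \<Gamma>. real_of_int (k b) *\<^sub>R b)"
    unfolding some_basis(4)[OF assms(1), symmetric] by (rule assms(2))
  then show thesis by (elim rangeE) (rule that)
qed

lemma lattice_subset_span: "lattice_in \<Gamma> L \<Longrightarrow> \<Gamma> \<subseteq> L"
proof
  fix x assume \<Gamma>: "lattice_in \<Gamma> L" and "x \<in> \<Gamma>"
  obtain k where x: "x = (\<Sum>b\<in>some_basis \<Gamma>. real_of_int (k b) *\<^sub>R b)"
    by (rule some_basis_memE[OF \<Gamma> \<open>x \<in> \<Gamma>\<close>])
  show "x \<in> L" unfolding some_basis(3)[OF \<Gamma>, symmetric] x by (intro span_sum span_scale span_base)
qed

text \<open>Coordinate functionals extended linearly to the whole space, since \<open>B\<close> may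
  only span a subspace; outside \<open>span B\<close> the values depend on the choice.\<close>

definition coord :: "'a::euclidean_space set \<Rightarrow> 'a \<Rightarrow> 'a \<Rightarrow> real" where
  "coord B b = (SOME g. linear g \<and> (\<forall>x\<in>B. g x = (if x = b then 1 else 0)))"

lemma coord:
  assumes "independent B"
  shows "linear (coord B b)" "x \<in> B \<Longrightarrow> coord B b x = (if x = b then 1 else 0)"
proof -
  have "\<exists>g. linear g \<and> (\<forall>x\<in>B. g x = (if x = b then 1 else 0 :: real))"
    by (rule linear_independent_extend[OF assms])
  then have "linear (coord B b) \<and> (\<forall>x\<in>B. coord B b x = (if x = b then 1 else 0))"
    unfolding coord_def by (rule someI_ex)
  then show "linear (coord B b)" "x \<in> B \<Longrightarrow> coord B b x = (if x = b then 1 else 0)" by blast+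
qed

lemma coord_sum:
  assumes "independent B" "finite B" "b \<in> B"
  shows "coord B b (\<Sum>u\<in>B. t u *\<^sub>R u) = t b"
proof -
  have "coord B b (\<Sum>u\<in>B. t u *\<^sub>R u) = (\<Sum>u\<in>B. t u * coord B b u)"
    using coord(1)[OF assms(1)] by (simp add: linear_sum linear_scale)
  also have "\<dots> = (\<Sum>u\<in>B. if u = b then t u else 0)"
    by (intro sum.cong) (auto simp: coord(2)[OF assms(1)])
  also have "\<dots> = t b" using assms by simp
  finally show ?thesis .
qed

lemma coord_borel [measurable]:
  assumes "independent B" shows "coord B b \<in> borel_measurable borel"
  using coord(1)[OF assms] by (intro borel_measurable_continuous_onI linear_continuous_on)
    (simp add: linear_conv_bounded_linear)

lemma sum_coord:
  assumes "independent B" "finite B" "x \<in> span B"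
  shows "(\<Sum>b\<in>B. coord B b x *\<^sub>R b) = x"
proof -
  obtain t where x: "x = (\<Sum>b\<in>B. t b *\<^sub>R b)" using assms(3) unfolding span_finite[OF assms(2)] by blast
  show ?thesis unfolding x by (rule sum.cong) (simp_all add: coord_sum assms(1,2))
qed

lemma coord_norm_bound:
  assumes "independent B" "finite B"
  obtains K where "0 \<le> K" "\<And>b x. b \<in> B \<Longrightarrow> \<bar>coord B b x\<bar> \<le> K * norm x"
proof -
  have "\<exists>K. \<forall>x. \<bar>coord B b x\<bar> \<le> K * norm x" for b
    using coord(1)[OF assms(1), of b] linear_bounded[of "coord B b"] by auto
  then obtain K where K: "\<And>b x. \<bar>coord B b x\<bar> \<le> K b * norm x" by metis
  show thesis
  proof (rule that[of "\<Sum>b\<in>B. \<bar>K b\<bar>"])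
    fix b x assume "b \<in> B"
    have "\<bar>coord B b x\<bar> \<le> \<bar>K b\<bar> * norm x"
      using K[of b x] by (meson abs_ge_self mult_right_mono norm_ge_zero order_trans)
    also have "\<dots> \<le> (\<Sum>b\<in>B. \<bar>K b\<bar>) * norm x"
      using \<open>b \<in> B\<close> assms(2) by (intro mult_right_mono member_le_sum) auto
    finally show "\<bar>coord B b x\<bar> \<le> (\<Sum>b\<in>B. \<bar>K b\<bar>) * norm x" .
  qed (simp add: sum_nonneg)
qed

text \<open>Lattice points have integer coordinates, and these are bounded by a multiple of the
  norm.\<close>

lemma finite_lattice_cball:
  fixes \<Gamma> :: "'a::euclidean_space set"
  assumes "lattice_in \<Gamma> L" shows "finite (\<Gamma> \<inter> cball 0 r)"
proof -
  let ?B = "some_basis \<Gamma>"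
  note B = some_basis[OF assms]
  obtain K where K: "\<And>b x. b \<in> ?B \<Longrightarrow> \<bar>coord ?B b x\<bar> \<le> K * norm x" "0 \<le> K"
    using coord_norm_bound[OF B(2,1)] by metis
  let ?k = "\<lceil>K * \<bar>r\<bar>\<rceil>"
  let ?T = "\<lambda>k::'a \<Rightarrow> int. \<Sum>b\<in>?B. real_of_int (k b) *\<^sub>R b"
  have "\<Gamma> \<inter> cball 0 r \<subseteq> ?T ` (PiE ?B (\<lambda>_. {- ?k .. ?k}))"
  proof
    fix x assume x: "x \<in> \<Gamma> \<inter> cball 0 r"
    then have "x \<in> \<Gamma>" by simp
    then obtain k :: "'a \<Rightarrow> int" where k: "x = ?T k" by (rule some_basis_memE[OF assms])
    have "k b \<in> {- ?k .. ?k}" if "b \<in> ?B" for b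
    proof -
      have "coord ?B b x = real_of_int (k b)" unfolding k by (rule coord_sum[OF B(2,1) that])
      moreover have "K * norm x \<le> K * \<bar>r\<bar>" using x K(2) by (intro mult_left_mono) auto
      ultimately have "\<bar>real_of_int (k b)\<bar> \<le> real_of_int ?k"
        using K(1)[OF that, of x] by (metis le_of_int_ceiling order_trans)
      then have "\<bar>k b\<bar> \<le> ?k" by (simp flip: of_int_abs)
      then show ?thesis by auto
    qed
    moreover have "x = ?T (restrict k ?B)" unfolding k by (rule sum.cong) simp_all
    ultimately show "x \<in> ?T ` (PiE ?B (\<lambda>_. {- ?k .. ?k}))"
      by (intro image_eqI[of _ _ "restrict k ?B"]) auto
  qed
  then show ?thesis by (rule finite_subset) (intro finite_imageI finite_PiE B(1); simp)
qed

lemma countable_lattice: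
  fixes \<Gamma> :: "'a::euclidean_space set"
  assumes "lattice_in \<Gamma> L" shows "countable \<Gamma>"
proof -
  have "\<Gamma> \<subseteq> (\<Union>n::nat. \<Gamma> \<inter> cball 0 (real n))"
    using real_arch_simple by auto
  moreover have "countable (\<Union>n::nat. \<Gamma> \<inter> cball 0 (real n))"
    using finite_lattice_cball[OF assms] by (intro countable_UN) (simp_all add: countable_finite)
  ultimately show ?thesis by (rule countable_subset)
qed

text \<open>Inequalities between linear functionals make the domain visibly Borel and decide
  membership, in place of the existential form of the definition.\<close>

lemma fundamental_domain_eq:
  assumes "lattice_in \<Gamma> (L :: 'a::euclidean_space set)"
  shows "fundamental_domain \<Gamma> =
    {x \<in> L. \<forall>b\<in>some_basis \<Gamma>. 0 \<le> coord (some_basis \<Gamma>) b x \<and> coord (some_basis \<Gamma>) b x < 1}"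
proof (intro equalityI subsetI)
  note B = some_basis[OF assms]
  fix x assume "x \<in> fundamental_domain \<Gamma>"
  then obtain t where t: "x = (\<Sum>b\<in>some_basis \<Gamma>. t b *\<^sub>R b)" "\<forall>b\<in>some_basis \<Gamma>. 0 \<le> t b \<and> t b < 1"
    unfolding fundamental_domain_def by blast
  have "x \<in> L" unfolding B(3)[symmetric] t(1) by (intro span_sum span_scale span_base)
  moreover have "coord (some_basis \<Gamma>) b x = t b" if "b \<in> some_basis \<Gamma>" for b
    unfolding t(1) by (rule coord_sum[OF B(2,1) that])
  ultimately show "x \<in> {x \<in> L. \<forall>b\<in>some_basis \<Gamma>. 0 \<le> coord (some_basis \<Gamma>) b x \<and> coord (some_basis \<Gamma>) b x < 1}"
    using t(2) by simp
next
  note B = some_basis[OF assms]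
  fix x assume x: "x \<in> {x \<in> L. \<forall>b\<in>some_basis \<Gamma>. 0 \<le> coord (some_basis \<Gamma>) b x \<and> coord (some_basis \<Gamma>) b x < 1}"
  then have "x = (\<Sum>b\<in>some_basis \<Gamma>. coord (some_basis \<Gamma>) b x *\<^sub>R b)"
    using sum_coord[OF B(2,1), of x] B(3) by simp
  then show "x \<in> fundamental_domain \<Gamma>" unfolding fundamental_domain_def using x
    by (intro CollectI exI[of _ "\<lambda>b. coord (some_basis \<Gamma>) b x"] conjI) simp_all
qed

lemma fundamental_domain_borel [measurable]:
  assumes "lattice_in \<Gamma> (L :: 'a::euclidean_space set)"
  shows "fundamental_domain \<Gamma> \<in> sets borel"
proof -
  note B = some_basis[OF assms]
  have "L \<in> sets borel" unfolding B(3)[symmetric] by simp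
  then have "{x \<in> space borel. x \<in> L \<and> (\<forall>b\<in>some_basis \<Gamma>. 0 \<le> coord (some_basis \<Gamma>) b x \<and> coord (some_basis \<Gamma>) b x < 1)} \<in> sets borel"
    using B(1) coord_borel[OF B(2)] by measurable
  then show ?thesis unfolding fundamental_domain_eq[OF assms] by simp
qed

lemma fundamental_domain_bounded:
  assumes "lattice_in \<Gamma> (L :: 'a::euclidean_space set)" "x \<in> fundamental_domain \<Gamma>"
  shows "norm x \<le> (\<Sum>b\<in>some_basis \<Gamma>. norm b)"
proof -
  obtain t where t: "x = (\<Sum>b\<in>some_basis \<Gamma>. t b *\<^sub>R b)" "\<forall>b\<in>some_basis \<Gamma>. 0 \<le> t b \<and> t b < 1"
    using assms(2) unfolding fundamental_domain_def by blast
  show ?thesis unfolding t(1)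
  proof (rule sum_norm_le)
    fix b assume "b \<in> some_basis \<Gamma>"
    then have "\<bar>t b\<bar> * norm b \<le> 1 * norm b" using t(2) by (intro mult_right_mono) auto
    then show "norm (t b *\<^sub>R b) \<le> norm b" by simp
  qed
qed

text \<open>The unique tile containing \<open>x\<close> is found by rounding all coordinates
  down.\<close>

lemma fundamental_domain_tiling:
  assumes \<Gamma>: "lattice_in \<Gamma> (L :: 'a::euclidean_space set)" and x: "x \<in> L"
  obtains l where "l \<in> \<Gamma>" "\<And>l'. l' \<in> \<Gamma> \<Longrightarrow> x - l' \<in> fundamental_domain \<Gamma> \<longleftrightarrow> l' = l"
proof -
  let ?B = "some_basis \<Gamma>"
  note B = some_basis[OF \<Gamma>]
  define l where "l = (\<Sum>b\<in>?B. real_of_int \<lfloor>coord ?B b x\<rfloor> *\<^sub>R b)"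
  have l: "l \<in> \<Gamma>" unfolding l_def by (rule some_basis_memI[OF \<Gamma>])
  moreover have "x - l' \<in> fundamental_domain \<Gamma> \<longleftrightarrow> l' = l" if l': "l' \<in> \<Gamma>" for l'
  proof -
    obtain k :: "'a \<Rightarrow> int" where k: "l' = (\<Sum>b\<in>?B. real_of_int (k b) *\<^sub>R b)" by (rule some_basis_memE[OF \<Gamma> l'])
    have "l' \<in> L" using lattice_subset_span[OF \<Gamma>] l' by blast
    then have "x - l' \<in> L" using x span_diff[of x ?B l'] unfolding B(3) by simp
    then have "x - l' \<in> fundamental_domain \<Gamma> \<longleftrightarrow> (\<forall>b\<in>?B. 0 \<le> coord ?B b (x - l') \<and> coord ?B b (x - l') < 1)"
      unfolding fundamental_domain_eq[OF \<Gamma>] by simp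
    also have "\<dots> \<longleftrightarrow> (\<forall>b\<in>?B. k b = \<lfloor>coord ?B b x\<rfloor>)"
    proof (intro ball_cong refl)
      fix b assume b: "b \<in> ?B"
      have "coord ?B b (x - l') = coord ?B b x - real_of_int (k b)"
        using coord_sum[OF B(2,1) b, of "\<lambda>b. real_of_int (k b)"] coord(1)[OF B(2), of b] unfolding k
        by (simp add: linear_diff)
      then show "(0 \<le> coord ?B b (x - l') \<and> coord ?B b (x - l') < 1) \<longleftrightarrow> k b = \<lfloor>coord ?B b x\<rfloor>"
        by linarith
    qed
    also have "\<dots> \<longleftrightarrow> l' = l"
    proof
      assume "\<forall>b\<in>?B. k b = \<lfloor>coord ?B b x\<rfloor>"
      then show "l' = l" unfolding k l_def by (intro sum.cong) simp_all
    next
      assume "l' = l"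
      show "\<forall>b\<in>?B. k b = \<lfloor>coord ?B b x\<rfloor>"
      proof
        fix b assume b: "b \<in> ?B"
        have "real_of_int (k b) = coord ?B b l'" unfolding k by (rule coord_sum[OF B(2,1) b, symmetric])
        also have "\<dots> = real_of_int \<lfloor>coord ?B b x\<rfloor>" unfolding \<open>l' = l\<close> l_def by (rule coord_sum[OF B(2,1) b])
        finally show "k b = \<lfloor>coord ?B b x\<rfloor>" by simp
      qed
    qed
    finally show ?thesis .
  qed
  ultimately show thesis by (rule that)
qed

subsection \<open>Affine behaviour\<close>

text \<open>Measures agreeing on boxes are equal, and on boxes the claim is one-dimensional scaling
  in each coordinate, with one factor \<open>\<bar>c\<bar>\<close> each. Later uses are
  \<open>c = 1\<close> (translation), \<open>c = -1\<close> (reflection) and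
  \<open>c = t > 0\<close> (homogeneity).\<close>

lemma PiM_lborel_affine:
  fixes a :: "'i \<Rightarrow> real"
  assumes "finite I" "c \<noteq> 0"
  shows "Pi\<^sub>M I (\<lambda>_. lborel) =
    density (distr (Pi\<^sub>M I (\<lambda>_. lborel)) (Pi\<^sub>M I (\<lambda>_. lborel)) (\<lambda>t. \<lambda>i\<in>I. a i + c * t i))
      (\<lambda>_. ennreal (\<bar>c\<bar> ^ card I))" (is "?P = ?Q")
proof -
  interpret product_sigma_finite "\<lambda>_::'i. lborel :: real measure" ..
  have m: "(\<lambda>t. \<lambda>i\<in>I. a i + c * t i) \<in> measurable ?P ?P"
  proof (rule measurable_restrict)
    fix i assume "i \<in> I"
    then have "(\<lambda>t. t i) \<in> borel_measurable ?P"
      using measurable_component_singleton[of i I "\<lambda>_. lborel"] by simp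
    then show "(\<lambda>t. a i + c * t i) \<in> measurable ?P lborel" by simp
  qed
  have "?Q = ?P"
  proof (rule PiM_eqI[OF assms(1)])
    fix A :: "'i \<Rightarrow> real set" assume A: "\<And>i. i \<in> I \<Longrightarrow> A i \<in> sets lborel"
    let ?h = "\<lambda>i x. a i + c * x"
    have A': "?h i -` A i \<in> sets lborel" if "i \<in> I" for i
      using measurable_sets[of "?h i" lborel lborel "A i"] A[OF that] by simp
    have PiA: "PiE I A \<in> sets ?P" using A by (intro sets_PiM_I_finite assms(1)) auto
    have vim: "(\<lambda>t. \<lambda>i\<in>I. a i + c * t i) -` PiE I A \<inter> space ?P = PiE I (\<lambda>i. ?h i -` A i)"
      by (auto simp: space_PiM PiE_iff extensional_def)
    have one: "emeasure lborel (A i) = ennreal \<bar>c\<bar> * emeasure lborel (?h i -` A i)" if "i \<in> I" for i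
    proof -
      have "emeasure lborel (A i) = emeasure (density (distr lborel borel (?h i)) (\<lambda>_. ennreal \<bar>c\<bar>)) (A i)"
        by (simp flip: lborel_real_affine[OF assms(2), of "a i"])
      also have "\<dots> = ennreal \<bar>c\<bar> * emeasure lborel (?h i -` A i)"
        using A[OF that] by (simp add: emeasure_density_const emeasure_distr)
      finally show ?thesis .
    qed
    have "emeasure ?Q (PiE I A) = ennreal (\<bar>c\<bar> ^ card I) * emeasure ?P (PiE I (\<lambda>i. ?h i -` A i))"
      using PiA m by (simp add: emeasure_density_const emeasure_distr vim)
    also have "emeasure ?P (PiE I (\<lambda>i. ?h i -` A i)) = (\<Prod>i\<in>I. emeasure lborel (?h i -` A i))"
      using A' by (intro emeasure_PiM assms(1)) auto
    also have "ennreal (\<bar>c\<bar> ^ card I) * \<dots> = (\<Prod>i\<in>I. ennreal \<bar>c\<bar> * emeasure lborel (?h i -` A i))"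
      by (simp add: prod.distrib ennreal_power)
    also have "\<dots> = (\<Prod>i\<in>I. emeasure lborel (A i))"
      by (intro prod.cong refl) (simp add: one)
    finally show "emeasure ?Q (PiE I A) = (\<Prod>i\<in>I. emeasure lborel (A i))" .
  qed simp
  then show ?thesis by simp
qed

lemma lattice_measure_coords_measurable:
  fixes B :: "'a::euclidean_space set"
  assumes "finite B"
  shows "(\<lambda>t. \<Sum>b\<in>B. t b *\<^sub>R b) \<in> borel_measurable (Pi\<^sub>M B (\<lambda>_. lborel))"
proof (rule borel_measurable_sum)
  fix b assume "b \<in> B"
  then have "(\<lambda>t. t b) \<in> borel_measurable (Pi\<^sub>M B (\<lambda>_. lborel))"
    using measurable_component_singleton[of b B "\<lambda>_. lborel"] by simp
  then show "(\<lambda>t. t b *\<^sub>R b) \<in> borel_measurable (Pi\<^sub>M B (\<lambda>_. lborel))"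
    by (rule borel_measurable_scaleR) (rule measurable_const, simp)
qed

lemma lattice_measure_sets [simp, measurable_cong]: "sets (lattice_measure \<Gamma>) = sets borel"
  by (simp add: lattice_measure_def)

lemma lattice_measure_space [simp]: "space (lattice_measure \<Gamma>) = UNIV"
  by (simp add: lattice_measure_def)

lemma measurable_lattice_measure [simp]: "measurable (lattice_measure \<Gamma>) N = measurable borel N"
  by (rule measurable_cong_sets) simp_all

text \<open>The coordinate map carries the affine map of coordinates \<open>?h\<close> to the affine
  map of \<open>L\<close>, so the statement is transported from the product measure.\<close>

lemma lattice_measure_affine:
  fixes \<Gamma> :: "'a::euclidean_space set"
  assumes \<Gamma>: "lattice_in \<Gamma> L" and x: "x \<in> L" and c: "c \<noteq> 0"
  shows "lattice_measure \<Gamma> = density (distr (lattice_measure \<Gamma>) borel (\<lambda>z. x + c *\<^sub>R z))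
    (\<lambda>_. ennreal (\<bar>c\<bar> ^ card (some_basis \<Gamma>)))" (is "_ = ?Q")
proof (rule measure_eqI)
  let ?B = "some_basis \<Gamma>"
  let ?P = "Pi\<^sub>M ?B (\<lambda>_. lborel :: real measure)"
  let ?T = "\<lambda>t. \<Sum>b\<in>?B. t b *\<^sub>R b"
  let ?h = "\<lambda>t. \<lambda>b\<in>?B. coord ?B b x + c * t b"
  note B = some_basis[OF \<Gamma>]
  note T = lattice_measure_coords_measurable[OF B(1)]
  show "sets (lattice_measure \<Gamma>) = sets ?Q" by simp
  fix A assume "A \<in> sets (lattice_measure \<Gamma>)"
  then have A: "A \<in> sets borel" by simp
  have h: "?h \<in> measurable ?P ?P"
  proof (rule measurable_restrict)
    fix i assume "i \<in> ?B"
    then have "(\<lambda>t. t i) \<in> borel_measurable ?P"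
      using measurable_component_singleton[of i ?B "\<lambda>_. lborel"] by simp
    then show "(\<lambda>t. coord ?B i x + c * t i) \<in> measurable ?P lborel" by simp
  qed
  have Th: "?T (?h t) = x + c *\<^sub>R ?T t" for t
  proof -
    have "?T (?h t) = (\<Sum>b\<in>?B. coord ?B b x *\<^sub>R b) + c *\<^sub>R ?T t"
      by (simp add: scaleR_left_distrib sum.distrib scaleR_sum_right)
    then show ?thesis using sum_coord[OF B(2,1), of x] x B(3) by simp
  qed
  have TA: "?T -` A \<inter> space ?P \<in> sets ?P" using T A by (rule measurable_sets)
  have "emeasure (lattice_measure \<Gamma>) A = emeasure ?P (?T -` A \<inter> space ?P)"
    unfolding lattice_measure_def using T A by (simp add: emeasure_distr)
  also have "\<dots> = emeasure (density (distr ?P ?P ?h) (\<lambda>_. ennreal (\<bar>c\<bar> ^ card ?B))) (?T -` A \<inter> space ?P)"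
    by (simp flip: PiM_lborel_affine[OF B(1) c])
  also have "\<dots> = ennreal (\<bar>c\<bar> ^ card ?B) * emeasure ?P (?h -` (?T -` A \<inter> space ?P) \<inter> space ?P)"
    using TA h by (simp add: emeasure_density_const emeasure_distr)
  also have "?h -` (?T -` A \<inter> space ?P) \<inter> space ?P = ?T -` ((\<lambda>z. x + c *\<^sub>R z) -` A) \<inter> space ?P"
    using measurable_space[OF h] Th by auto
  also have "emeasure ?P \<dots> = emeasure (lattice_measure \<Gamma>) ((\<lambda>z. x + c *\<^sub>R z) -` A)"
  proof -
    have "(\<lambda>z. x + c *\<^sub>R z) -` A \<in> sets borel"
      using measurable_sets[of "\<lambda>z. x + c *\<^sub>R z" borel borel A] A by simp
    then show ?thesis unfolding lattice_measure_def using T by (simp add: emeasure_distr)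
  qed
  finally show "emeasure (lattice_measure \<Gamma>) A = emeasure ?Q A"
    using A by (simp add: emeasure_density_const emeasure_distr)
qed

lemma lattice_measure_translate:
  fixes \<Gamma> :: "'a::euclidean_space set"
  assumes "lattice_in \<Gamma> L" "x \<in> L"
  shows "distr (lattice_measure \<Gamma>) borel ((+) x) = lattice_measure \<Gamma>"
  using lattice_measure_affine[OF assms, of 1] by (simp add: density_1)

lemma integral_lattice_measure_affine:
  fixes \<Gamma> :: "'a::euclidean_space set" and f :: "'a \<Rightarrow> complex"
  assumes \<Gamma>: "lattice_in \<Gamma> L" and x: "x \<in> L" and c: "c \<noteq> 0" and f: "f \<in> borel_measurable borel"
  shows "(LINT z|lattice_measure \<Gamma>. f z)
    = \<bar>c\<bar> ^ card (some_basis \<Gamma>) *\<^sub>R (LINT z|lattice_measure \<Gamma>. f (x + c *\<^sub>R z))"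
proof -
  have "(LINT z|lattice_measure \<Gamma>. f z) = (LINT z|density (distr (lattice_measure \<Gamma>) borel (\<lambda>z. x + c *\<^sub>R z))
    (\<lambda>_. ennreal (\<bar>c\<bar> ^ card (some_basis \<Gamma>))). f z)"
    by (simp flip: lattice_measure_affine[OF \<Gamma> x c])
  also have "\<dots> = (LINT z|distr (lattice_measure \<Gamma>) borel (\<lambda>z. x + c *\<^sub>R z). \<bar>c\<bar> ^ card (some_basis \<Gamma>) *\<^sub>R f z)"
    using f by (intro integral_density) simp_all
  also have "\<dots> = \<bar>c\<bar> ^ card (some_basis \<Gamma>) *\<^sub>R (LINT z|distr (lattice_measure \<Gamma>) borel (\<lambda>z. x + c *\<^sub>R z). f z)"
    by (rule integral_scaleR_right)
  also have "(LINT z|distr (lattice_measure \<Gamma>) borel (\<lambda>z. x + c *\<^sub>R z). f z) = (LINT z|lattice_measure \<Gamma>. f (x + c *\<^sub>R z))"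
    by (rule integral_distr[OF _ f]) simp
  finally show ?thesis .
qed

text \<open>In coordinates the domain is the half-open unit cube.\<close>

lemma emeasure_fundamental_domain:
  fixes \<Gamma> :: "'a::euclidean_space set"
  assumes \<Gamma>: "lattice_in \<Gamma> L"
  shows "emeasure (lattice_measure \<Gamma>) (fundamental_domain \<Gamma>) = 1"
proof -
  let ?B = "some_basis \<Gamma>"
  let ?P = "Pi\<^sub>M ?B (\<lambda>_. lborel :: real measure)"
  let ?T = "\<lambda>t. \<Sum>b\<in>?B. t b *\<^sub>R b"
  interpret product_sigma_finite "\<lambda>_::'a. lborel :: real measure" ..
  note B = some_basis[OF \<Gamma>]
  have "?T t \<in> fundamental_domain \<Gamma> \<longleftrightarrow> (\<forall>b\<in>?B. t b \<in> {0..<1})" for t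
  proof -
    have "?T t \<in> L" unfolding B(3)[symmetric] by (intro span_sum span_scale span_base)
    then show ?thesis unfolding fundamental_domain_eq[OF \<Gamma>] by (simp add: coord_sum[OF B(2,1)])
  qed
  then have "?T -` fundamental_domain \<Gamma> \<inter> space ?P = PiE ?B (\<lambda>_. {0..<1})"
    by (auto simp: space_PiM PiE_iff)
  then have "emeasure (lattice_measure \<Gamma>) (fundamental_domain \<Gamma>) = emeasure ?P (PiE ?B (\<lambda>_. {0..<1}))"
    unfolding lattice_measure_def
    using lattice_measure_coords_measurable[OF B(1)] fundamental_domain_borel[OF \<Gamma>] by (simp add: emeasure_distr)
  also have "\<dots> = (\<Prod>b\<in>?B. emeasure lborel {0..<1::real})"
    by (rule emeasure_PiM[OF B(1)]) simp
  finally show ?thesis by simp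
qed

lemma locally_finite_lattice_measure:
  fixes \<Gamma> :: "'a::euclidean_space set"
  assumes \<Gamma>: "lattice_in \<Gamma> L"
  shows "locally_finite_borel (lattice_measure \<Gamma>)"
  unfolding locally_finite_borel_def
proof (intro conjI allI)
  let ?B = "some_basis \<Gamma>"
  let ?P = "Pi\<^sub>M ?B (\<lambda>_. lborel :: real measure)"
  let ?T = "\<lambda>t. \<Sum>b\<in>?B. t b *\<^sub>R b"
  interpret product_sigma_finite "\<lambda>_::'a. lborel :: real measure" ..
  note B = some_basis[OF \<Gamma>]
  fix r :: real
  obtain K where K: "\<And>b x. b \<in> ?B \<Longrightarrow> \<bar>coord ?B b x\<bar> \<le> K * norm x" "0 \<le> K"
    using coord_norm_bound[OF B(2,1)] by metis
  have sub: "?T -` cball 0 r \<inter> space ?P \<subseteq> PiE ?B (\<lambda>_. {- (K * \<bar>r\<bar>) .. K * \<bar>r\<bar>})"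
  proof
    fix t assume t: "t \<in> ?T -` cball 0 r \<inter> space ?P"
    have "t b \<in> {- (K * \<bar>r\<bar>) .. K * \<bar>r\<bar>}" if "b \<in> ?B" for b
    proof -
      have "K * norm (?T t) \<le> K * \<bar>r\<bar>" using t K(2) by (intro mult_left_mono) auto
      then have "\<bar>t b\<bar> \<le> K * \<bar>r\<bar>" using K(1)[OF that, of "?T t"] coord_sum[OF B(2,1) that, of t] by simp
      then show ?thesis by auto
    qed
    then show "t \<in> PiE ?B (\<lambda>_. {- (K * \<bar>r\<bar>) .. K * \<bar>r\<bar>})" using t by (auto simp: space_PiM PiE_iff)
  qed
  have "emeasure (lattice_measure \<Gamma>) (cball 0 r) = emeasure ?P (?T -` cball 0 r \<inter> space ?P)"
    unfolding lattice_measure_def using lattice_measure_coords_measurable[OF B(1)] by (simp add: emeasure_distr)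
  also have "\<dots> \<le> emeasure ?P (PiE ?B (\<lambda>_. {- (K * \<bar>r\<bar>) .. K * \<bar>r\<bar>}))"
    by (rule emeasure_mono[OF sub]) (intro sets_PiM_I_finite B(1); simp)
  also have "\<dots> = (\<Prod>b\<in>?B. emeasure lborel {- (K * \<bar>r\<bar>) .. K * \<bar>r\<bar>})"
    by (rule emeasure_PiM[OF B(1)]) simp
  also have "\<dots> = ennreal (2 * (K * \<bar>r\<bar>)) ^ card ?B" using K(2) by simp
  also have "\<dots> < \<infinity>" by (simp add: power_less_top_ennreal)
  finally show "emeasure (lattice_measure \<Gamma>) (cball 0 r) < \<infinity>" .
qed simp

lemma AE_lattice_measure:
  fixes \<Gamma> :: "'a::euclidean_space set"
  assumes \<Gamma>: "lattice_in \<Gamma> L"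
  shows "AE x in lattice_measure \<Gamma>. x \<in> L"
proof -
  note B = some_basis[OF \<Gamma>]
  have "(\<Sum>b\<in>some_basis \<Gamma>. t b *\<^sub>R b) \<in> L" for t
    unfolding B(3)[symmetric] by (intro span_sum span_scale span_base)
  moreover have "{x \<in> space borel. x \<in> L} \<in> sets borel" unfolding B(3)[symmetric] by simp
  ultimately show ?thesis unfolding lattice_measure_def
    by (subst AE_distr_iff[OF lattice_measure_coords_measurable[OF B(1)]]) simp_all
qed

text \<open>The first argument need not be a lattice: it is also taken to be a subspace or a single
  vector.\<close>

definition invariant_measure :: "'a::euclidean_space set \<Rightarrow> 'a measure \<Rightarrow> bool" where
  "invariant_measure \<Lambda> M \<longleftrightarrow> (\<forall>l\<in>\<Lambda>. distr M borel ((+) l) = M)"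

lemma nn_integral_invariant:
  assumes "invariant_measure \<Lambda> M" "sets M = sets borel" "l \<in> \<Lambda>" "f \<in> borel_measurable borel"
  shows "(\<integral>\<^sup>+x. f (x + l) \<partial>M) = (\<integral>\<^sup>+x. f x \<partial>M)"
proof -
  have m: "(+) l \<in> measurable M borel" by (rule measurable_cong_sets[OF assms(2) refl, THEN equalityD2, THEN subsetD]) simp
  have "(\<integral>\<^sup>+x. f x \<partial>M) = (\<integral>\<^sup>+x. f x \<partial>distr M borel ((+) l))"
    using assms(1,3) by (simp add: invariant_measure_def)
  also have "\<dots> = (\<integral>\<^sup>+x. f (l + x) \<partial>M)" using m assms(4) by (intro nn_integral_distr) simp_all
  finally show ?thesis by (simp add: add.commute)
qed

lemma integral_invariant:
  fixes f :: "'a::euclidean_space \<Rightarrow> complex"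
  assumes "invariant_measure \<Lambda> M" "sets M = sets borel" "l \<in> \<Lambda>" "f \<in> borel_measurable borel"
  shows "(LINT x|M. f (x + l)) = (LINT x|M. f x)" "integrable M (\<lambda>x. f (x + l)) \<longleftrightarrow> integrable M f"
proof -
  have m: "(+) l \<in> measurable M borel" by (rule measurable_cong_sets[OF assms(2) refl, THEN equalityD2, THEN subsetD]) simp
  have e: "distr M borel ((+) l) = M" using assms(1,3) by (simp add: invariant_measure_def)
  have "(LINT x|M. f x) = (LINT x|distr M borel ((+) l). f x)" by (simp add: e)
  also have "\<dots> = (LINT x|M. f (l + x))" by (intro integral_distr m assms(4))
  finally show "(LINT x|M. f (x + l)) = (LINT x|M. f x)" by (simp add: add.commute)
  have "integrable (distr M borel ((+) l)) f \<longleftrightarrow> integrable M (\<lambda>x. f (l + x))" by (intro integrable_distr_eq m assms(4))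
  then show "integrable M (\<lambda>x. f (x + l)) \<longleftrightarrow> integrable M f" by (simp add: e add.commute)
qed

text \<open>Almost every point lies in exactly one tile \<open>l + D\<close>, where \<open>D\<close>
  is the fundamental domain; Tonelli exchanges the sum over tiles with the integral, and invariance
  moves each tile back to \<open>D\<close>.\<close>

lemma nn_integral_unfold:
  fixes \<Gamma> :: "'a::euclidean_space set"
  assumes \<Gamma>: "lattice_in \<Gamma> L" and M: "invariant_measure \<Gamma> M" "sets M = sets borel" "AE x in M. x \<in> L"
    and f: "f \<in> borel_measurable borel"
  shows "(\<integral>\<^sup>+x. f x \<partial>M) = (\<integral>\<^sup>+l. \<integral>\<^sup>+x. f (x + l) * indicator (fundamental_domain \<Gamma>) x \<partial>M \<partial>count_space \<Gamma>)"
proof -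
  let ?D = "fundamental_domain \<Gamma>"
  note D = fundamental_domain_borel[OF \<Gamma>]
  have mM: "borel_measurable M = borel_measurable borel" by (rule measurable_cong_sets[OF M(2) refl])
  have "(\<integral>\<^sup>+x. f x \<partial>M) = (\<integral>\<^sup>+x. \<integral>\<^sup>+l. f x * indicator ?D (x - l) \<partial>count_space \<Gamma> \<partial>M)"
  proof (rule nn_integral_cong_AE, use M(3) in eventually_elim)
    case (elim x)
    obtain l where l: "l \<in> \<Gamma>" "\<And>l'. l' \<in> \<Gamma> \<Longrightarrow> x - l' \<in> ?D \<longleftrightarrow> l' = l"
      using fundamental_domain_tiling[OF \<Gamma> elim] by metis
    have "(\<integral>\<^sup>+l. f x * indicator ?D (x - l) \<partial>count_space \<Gamma>) = (\<Sum>l\<in>{l}. f x * indicator ?D (x - l))"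
      using l by (intro nn_integral_count_space') auto
    then show ?case using l by simp
  qed
  also have "\<dots> = (\<integral>\<^sup>+l. \<integral>\<^sup>+x. f x * indicator ?D (x - l) \<partial>M \<partial>count_space \<Gamma>)"
    using f D unfolding mM by (intro nn_integral_count_space_nn_integral countable_lattice[OF \<Gamma>]) (simp add: mM)
  also have "\<dots> = (\<integral>\<^sup>+l. \<integral>\<^sup>+x. f (x + l) * indicator ?D x \<partial>M \<partial>count_space \<Gamma>)"
  proof (rule nn_integral_cong)
    fix l assume "l \<in> space (count_space \<Gamma>)"
    then have l: "l \<in> \<Gamma>" by simp
    have "(\<lambda>x. f x * indicator ?D (x - l)) \<in> borel_measurable borel" using f D by measurable
    from nn_integral_invariant[OF M(1,2) l this]
    show "(\<integral>\<^sup>+x. f x * indicator ?D (x - l) \<partial>M) = (\<integral>\<^sup>+x. f (x + l) * indicator ?D x \<partial>M)" by simp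
  qed
  finally show ?thesis .
qed

section \<open>The measure of an intermediate sum\<close>

text \<open>The sum of all coset measures, with the representatives used in
  \<open>coset_measure\<close>. Presenting it as an image of a product with counting measure makes
  sums of slice integrals instances of Fubini.\<close>

definition slice_measure :: "'a::euclidean_space set \<Rightarrow> 'a set \<Rightarrow> 'a measure" where
  "slice_measure \<Lambda> L = distr (count_space (quotient_lattice \<Lambda> L) \<Otimes>\<^sub>M lattice_measure (L \<inter> \<Lambda>)) borel
     (\<lambda>(Y, u). (SOME y. y \<in> Y) + u)"

lemma sigma_finite_locally_finite_borel:
  assumes "locally_finite_borel M" shows "sigma_finite_measure M"
proof
  show "\<exists>A. countable A \<and> A \<subseteq> sets M \<and> \<Union> A = space M \<and> (\<forall>a\<in>A. emeasure M a \<noteq> \<infinity>)"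
  proof (intro exI[of _ "range (\<lambda>n::nat. cball 0 (real n))"] conjI)
    show "range (\<lambda>n::nat. cball (0::'a) (real n)) \<subseteq> sets M"
      using assms by (auto simp: locally_finite_borel_def)
    have "x \<in> \<Union> (range (\<lambda>n::nat. cball (0::'a) (real n)))" for x
      using real_arch_simple[of "norm x"] by simp
    then show "\<Union> (range (\<lambda>n::nat. cball (0::'a) (real n))) = space M"
      unfolding locally_finite_borel_space[OF assms] by blast
    show "\<forall>a\<in>range (\<lambda>n::nat. cball (0::'a) (real n)). emeasure M a \<noteq> \<infinity>"
    proof clarify
      fix n :: nat assume "emeasure M (cball 0 (real n)) = \<infinity>"
      moreover have "emeasure M (cball 0 (real n)) < \<infinity>" using assms by (simp add: locally_finite_borel_def)
      ultimately show False by simp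
    qed
    show "countable (range (\<lambda>n::nat. cball (0::'a) (real n)))" by simp
  qed
qed

context
  fixes \<Lambda> L :: "'a::euclidean_space set"
  assumes \<Lambda>: "lattice_in \<Lambda> UNIV" and L: "rational_subspace \<Lambda> L"
begin

private lemma LG: "lattice_in (L \<inter> \<Lambda>) L" and Lsub: "subspace L"
  using L by (auto simp: rational_subspace_def)

private abbreviation "Q \<equiv> quotient_lattice \<Lambda> L"
private abbreviation "mL \<equiv> lattice_measure (L \<inter> \<Lambda>)"
private abbreviation "rep \<equiv> (\<lambda>Y :: 'a set. SOME y. y \<in> Y)"

private lemma countable_Q: "countable Q"
  unfolding quotient_lattice_def by (intro countable_image countable_lattice[OF \<Lambda>])

private lemma sigma_mL: "sigma_finite_measure mL"
  by (intro sigma_finite_locally_finite_borel locally_finite_lattice_measure[OF LG])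

private lemma pair_sigma: "pair_sigma_finite (count_space Q) mL"
  by (intro pair_sigma_finite.intro sigma_mL sigma_finite_measure_count_space_countable countable_Q)

private lemma slice_meas: "(\<lambda>(Y, u). rep Y + u) \<in> borel_measurable (count_space Q \<Otimes>\<^sub>M mL)"
  by (rule measurable_pair_measure_countable1[OF countable_Q]) simp

lemma sets_slice_measure [simp]: "sets (slice_measure \<Lambda> L) = sets borel"
  by (simp add: slice_measure_def)

lemma nn_integral_slice:
  assumes f: "f \<in> borel_measurable borel"
  shows "(\<integral>\<^sup>+x. f x \<partial>slice_measure \<Lambda> L) = (\<integral>\<^sup>+Y. \<integral>\<^sup>+u. f (rep Y + u) \<partial>mL \<partial>count_space Q)"
proof -
  interpret sigma_finite_measure mL by (rule sigma_mL)
  have "(\<integral>\<^sup>+x. f x \<partial>slice_measure \<Lambda> L) = (\<integral>\<^sup>+z. f ((\<lambda>(Y, u). rep Y + u) z) \<partial>(count_space Q \<Otimes>\<^sub>M mL))"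
    unfolding slice_measure_def by (rule nn_integral_distr[OF slice_meas]) (use f in simp)
  also have "\<dots> = (\<integral>\<^sup>+Y. \<integral>\<^sup>+u. f ((\<lambda>(Y, u). rep Y + u) (Y, u)) \<partial>mL \<partial>count_space Q)"
    by (rule nn_integral_fst[symmetric]) (rule measurable_compose[OF slice_meas f])
  finally show ?thesis by simp
qed

text \<open>Translation by a vector of \<open>L\<close> maps each coset to itself and preserves its
  Lebesgue measure.\<close>

lemma slice_translate_L:
  assumes x: "x \<in> L"
  shows "distr (slice_measure \<Lambda> L) borel ((+) x) = slice_measure \<Lambda> L"
proof (rule measure_eqI)
  have m: "(+) x \<in> measurable (slice_measure \<Lambda> L) borel"
    by (subst measurable_cong_sets[OF sets_slice_measure refl]) simp
  fix A assume "A \<in> sets (distr (slice_measure \<Lambda> L) borel ((+) x))"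
  then have A: "A \<in> sets borel" by simp
  have iA: "(indicator A :: 'a \<Rightarrow> ennreal) \<in> borel_measurable borel" using A by simp
  have iA': "(\<lambda>z. indicator A (x + z) :: ennreal) \<in> borel_measurable borel"
    using A by measurable
  have "emeasure (distr (slice_measure \<Lambda> L) borel ((+) x)) A = (\<integral>\<^sup>+z. indicator A z \<partial>distr (slice_measure \<Lambda> L) borel ((+) x))"
    using A by simp
  also have "\<dots> = (\<integral>\<^sup>+z. indicator A (x + z) \<partial>slice_measure \<Lambda> L)"
    by (rule nn_integral_distr[OF m]) (use iA in simp)
  also have "\<dots> = (\<integral>\<^sup>+Y. \<integral>\<^sup>+u. indicator A (x + (rep Y + u)) \<partial>mL \<partial>count_space Q)"
    by (rule nn_integral_slice[OF iA'])
  also have "\<dots> = (\<integral>\<^sup>+Y. \<integral>\<^sup>+u. indicator A (rep Y + u) \<partial>mL \<partial>count_space Q)"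
  proof (rule nn_integral_cong)
    fix Y
    have "invariant_measure L mL"
      unfolding invariant_measure_def using lattice_measure_translate[OF LG] by blast
    moreover have "(\<lambda>u. indicator A (rep Y + u) :: ennreal) \<in> borel_measurable borel"
      using A by measurable
    ultimately have "(\<integral>\<^sup>+u. indicator A (rep Y + (u + x)) \<partial>mL) = (\<integral>\<^sup>+u. indicator A (rep Y + u) \<partial>mL)"
      by (rule nn_integral_invariant[OF _ lattice_measure_sets x])
    then show "(\<integral>\<^sup>+u. indicator A (x + (rep Y + u)) \<partial>mL) = (\<integral>\<^sup>+u. indicator A (rep Y + u) \<partial>mL)"
      by (simp add: add_ac)
  qed
  also have "\<dots> = emeasure (slice_measure \<Lambda> L) A"
    using nn_integral_slice[OF iA] A by simp
  finally show "emeasure (distr (slice_measure \<Lambda> L) borel ((+) x)) A = emeasure (slice_measure \<Lambda> L) A" .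
qed simp

text \<open>The representative \<open>rep\<close> is an arbitrary point of the coset, whereas the
  comparison with \<Lambda> needs one in the lattice. The two differ by an element of
  \<open>L\<close>, which does not affect the slice integral.\<close>

private definition "lrep Y = (SOME y. y \<in> \<Lambda> \<and> Y = (+) y ` L)"

private lemma lrep: "Y \<in> Q \<Longrightarrow> lrep Y \<in> \<Lambda> \<and> Y = (+) (lrep Y) ` L"
  unfolding lrep_def by (rule someI_ex) (auto simp: quotient_lattice_def)

private lemma rep_lrep: "Y \<in> Q \<Longrightarrow> rep Y - lrep Y \<in> L"
proof -
  assume Y: "Y \<in> Q"
  have "lrep Y + 0 \<in> Y" using lrep[OF Y] subspace_0[OF Lsub] by blast
  then have "rep Y \<in> Y" by (rule someI)
  then obtain l where "l \<in> L" "rep Y = lrep Y + l" using lrep[OF Y] by blast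
  then show ?thesis by simp
qed

private lemma coset_eq_iff: "(+) y ` L = (+) z ` L \<longleftrightarrow> y - z \<in> L"
proof
  assume "(+) y ` L = (+) z ` L"
  then have "y + 0 \<in> (+) z ` L" using subspace_0[OF Lsub] by blast
  then obtain l where "l \<in> L" "y + 0 = z + l" by blast
  then show "y - z \<in> L" by (simp add: algebra_simps)
next
  assume yz: "y - z \<in> L"
  have "(+) y ` L \<subseteq> (+) z ` L" if "y - z \<in> L" for y z
  proof clarify
    fix l assume "l \<in> L"
    then have "(y - z) + l \<in> L" by (rule subspace_add[OF Lsub that])
    then show "y + l \<in> (+) z ` L" by (intro image_eqI[of _ _ "(y - z) + l"]) simp_all
  qed
  from this[of y z] this[of z y] yz subspace_neg[OF Lsub yz]
  show "(+) y ` L = (+) z ` L" by auto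
qed

private lemma bij_cosets: "bij_betw (\<lambda>(Y, l). lrep Y + l) (Q \<times> (L \<inter> \<Lambda>)) \<Lambda>"
proof (rule bij_betwI')
  fix a b assume ab: "a \<in> Q \<times> (L \<inter> \<Lambda>)" "b \<in> Q \<times> (L \<inter> \<Lambda>)"
  obtain Y l Y' l' where [simp]: "a = (Y, l)" "b = (Y', l')" by fastforce
  have *: "Y \<in> Q" "Y' \<in> Q" "l \<in> L" "l' \<in> L" using ab by auto
  show "((\<lambda>(Y, l). lrep Y + l) a = (\<lambda>(Y, l). lrep Y + l) b) = (a = b)"
  proof
    assume eq: "(\<lambda>(Y, l). lrep Y + l) a = (\<lambda>(Y, l). lrep Y + l) b"
    then have "lrep Y - lrep Y' = l' - l" by (simp add: algebra_simps)
    then have "lrep Y - lrep Y' \<in> L" using subspace_diff[OF Lsub *(4,3)] by simp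
    then have "Y = Y'" using lrep[OF *(1)] lrep[OF *(2)] coset_eq_iff by metis
    then show "a = b" using eq by simp
  qed simp
next
  fix a assume "a \<in> Q \<times> (L \<inter> \<Lambda>)"
  then show "(\<lambda>(Y, l). lrep Y + l) a \<in> \<Lambda>" using lrep lattice_add[OF \<Lambda>] by auto
next
  fix x assume x: "x \<in> \<Lambda>"
  define Y where "Y = (+) x ` L"
  have Y: "Y \<in> Q" using x by (auto simp: Y_def quotient_lattice_def)
  have "x - lrep Y \<in> L" using lrep[OF Y] coset_eq_iff[of x "lrep Y"] by (simp add: Y_def)
  moreover have "x - lrep Y \<in> \<Lambda>" using lrep[OF Y] x lattice_diff[OF \<Lambda>] by blast
  ultimately show "\<exists>a\<in>Q \<times> (L \<inter> \<Lambda>). x = (\<lambda>(Y, l). lrep Y + l) a"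
    using Y by (intro bexI[of _ "(Y, x - lrep Y)"]) auto
qed

text \<open>Unfolding each coset over \<open>L \<inter> \<Lambda>\<close> and joining the sums over
  cosets and over \<open>L \<inter> \<Lambda>\<close> gives one sum over \<Lambda>. No
  representative is left in this form, so invariance, local finiteness and normalization can all be
  read off.\<close>

lemma nn_integral_slice_unfold:
  assumes f: "f \<in> borel_measurable borel"
  shows "(\<integral>\<^sup>+x. f x \<partial>slice_measure \<Lambda> L)
    = (\<integral>\<^sup>+l. \<integral>\<^sup>+u. f (l + u) * indicator (fundamental_domain (L \<inter> \<Lambda>)) u \<partial>mL \<partial>count_space \<Lambda>)"
proof -
  let ?D = "fundamental_domain (L \<inter> \<Lambda>)"
  let ?g = "\<lambda>l. \<integral>\<^sup>+u. f (l + u) * indicator ?D u \<partial>mL"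
  have inv: "invariant_measure L mL"
    unfolding invariant_measure_def using lattice_measure_translate[OF LG] by blast
  have inv': "invariant_measure (L \<inter> \<Lambda>) mL" using inv by (simp add: invariant_measure_def)
  have sG: "sigma_finite_measure (count_space (L \<inter> \<Lambda>))"
    by (intro sigma_finite_measure_count_space_countable countable_lattice[OF LG])
  have "(\<integral>\<^sup>+u. f (rep Y + u) \<partial>mL) = (\<integral>\<^sup>+l. ?g (lrep Y + l) \<partial>count_space (L \<inter> \<Lambda>))" if Y: "Y \<in> Q" for Y
  proof -
    have m: "(\<lambda>u. f (lrep Y + u)) \<in> borel_measurable borel"
      by (rule measurable_compose[OF _ f]) simp
    have "(\<integral>\<^sup>+u. f (rep Y + u) \<partial>mL) = (\<integral>\<^sup>+u. f (lrep Y + (u + (rep Y - lrep Y))) \<partial>mL)"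
      by (simp add: algebra_simps)
    also have "\<dots> = (\<integral>\<^sup>+u. f (lrep Y + u) \<partial>mL)"
      by (rule nn_integral_invariant[OF inv lattice_measure_sets rep_lrep[OF Y] m])
    also have "\<dots> = (\<integral>\<^sup>+l. \<integral>\<^sup>+u. f (lrep Y + (u + l)) * indicator ?D u \<partial>mL \<partial>count_space (L \<inter> \<Lambda>))"
      by (rule nn_integral_unfold[OF LG inv' lattice_measure_sets AE_lattice_measure[OF LG] m])
    finally show ?thesis by (simp add: add_ac)
  qed
  then have "(\<integral>\<^sup>+x. f x \<partial>slice_measure \<Lambda> L)
      = (\<integral>\<^sup>+Y. \<integral>\<^sup>+l. ?g (lrep Y + l) \<partial>count_space (L \<inter> \<Lambda>) \<partial>count_space Q)"
    unfolding nn_integral_slice[OF f] by (intro nn_integral_cong) simp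
  also have "\<dots> = (\<integral>\<^sup>+Y. \<integral>\<^sup>+l. ?g ((\<lambda>(Y, l). lrep Y + l) (Y, l)) \<partial>count_space (L \<inter> \<Lambda>) \<partial>count_space Q)"
    by simp
  also have "\<dots> = (\<integral>\<^sup>+z. ?g ((\<lambda>(Y, l). lrep Y + l) z) \<partial>(count_space Q \<Otimes>\<^sub>M count_space (L \<inter> \<Lambda>)))"
    by (rule sigma_finite_measure.nn_integral_fst[OF sG])
       (simp add: pair_measure_countable countable_Q countable_lattice[OF LG])
  also have "\<dots> = (\<integral>\<^sup>+z. ?g ((\<lambda>(Y, l). lrep Y + l) z) \<partial>count_space (Q \<times> (L \<inter> \<Lambda>)))"
    by (simp add: pair_measure_countable countable_Q countable_lattice[OF LG])
  also have "\<dots> = (\<integral>\<^sup>+l. ?g l \<partial>count_space \<Lambda>)"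
    by (rule nn_integral_bij_count_space[OF bij_cosets])
  finally show ?thesis .
qed

text \<open>In the unfolded form, translation by a lattice vector only reindexes the sum over
  \<Lambda>.\<close>

lemma slice_invariant: "invariant_measure \<Lambda> (slice_measure \<Lambda> L)"
  unfolding invariant_measure_def
proof
  fix x assume x: "x \<in> \<Lambda>"
  let ?D = "fundamental_domain (L \<inter> \<Lambda>)"
  show "distr (slice_measure \<Lambda> L) borel ((+) x) = slice_measure \<Lambda> L"
  proof (rule measure_eqI)
    have m: "(+) x \<in> measurable (slice_measure \<Lambda> L) borel"
      by (subst measurable_cong_sets[OF sets_slice_measure refl]) simp
    fix A assume "A \<in> sets (distr (slice_measure \<Lambda> L) borel ((+) x))"
    then have A: "A \<in> sets borel" by simp
    have iA: "(indicator A :: 'a \<Rightarrow> ennreal) \<in> borel_measurable borel" using A by simp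
    have iA': "(\<lambda>z. indicator A (x + z) :: ennreal) \<in> borel_measurable borel"
      using A by measurable
    let ?g = "\<lambda>l. \<integral>\<^sup>+u. indicator A (l + u) * indicator ?D u \<partial>mL"
    have bij: "bij_betw ((+) x) \<Lambda> \<Lambda>"
    proof (rule bij_betwI[where g="\<lambda>y. y - x"])
      show "(+) x \<in> \<Lambda> \<rightarrow> \<Lambda>" using lattice_add[OF \<Lambda> x] by auto
      show "(\<lambda>y. y - x) \<in> \<Lambda> \<rightarrow> \<Lambda>" using lattice_diff[OF \<Lambda> _ x] by auto
    qed auto
    have "emeasure (distr (slice_measure \<Lambda> L) borel ((+) x)) A = (\<integral>\<^sup>+z. indicator A z \<partial>distr (slice_measure \<Lambda> L) borel ((+) x))"
      using A by simp
    also have "\<dots> = (\<integral>\<^sup>+z. indicator A (x + z) \<partial>slice_measure \<Lambda> L)"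
      by (rule nn_integral_distr[OF m]) (use iA in simp)
    also have "\<dots> = (\<integral>\<^sup>+l. ?g (x + l) \<partial>count_space \<Lambda>)"
      unfolding nn_integral_slice_unfold[OF iA'] by (simp add: add.assoc)
    also have "\<dots> = (\<integral>\<^sup>+l. ?g l \<partial>count_space \<Lambda>)"
      by (rule nn_integral_bij_count_space[OF bij])
    also have "\<dots> = emeasure (slice_measure \<Lambda> L) A"
      using nn_integral_slice_unfold[OF iA] A by simp
    finally show "emeasure (distr (slice_measure \<Lambda> L) borel ((+) x)) A = emeasure (slice_measure \<Lambda> L) A" .
  qed simp
qed

text \<open>Only lattice points of norm at most \<open>r + R\<close> contribute to the ball, each
  with mass at most that of the fundamental domain of \<open>L \<inter> \<Lambda>\<close>, which is
  1.\<close>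

lemma slice_locally_finite: "locally_finite_borel (slice_measure \<Lambda> L)"
  unfolding locally_finite_borel_def
proof (intro conjI allI sets_slice_measure)
  fix r :: real
  let ?D = "fundamental_domain (L \<inter> \<Lambda>)"
  define R where "R = (\<Sum>b\<in>some_basis (L \<inter> \<Lambda>). norm b)"
  define F where "F = \<Lambda> \<inter> cball 0 (r + R)"
  have F: "finite F" unfolding F_def by (rule finite_lattice_cball[OF \<Lambda>])
  have "emeasure (slice_measure \<Lambda> L) (cball 0 r) = (\<integral>\<^sup>+x. indicator (cball 0 r) x \<partial>slice_measure \<Lambda> L)"
    by simp
  also have "\<dots> = (\<integral>\<^sup>+l. \<integral>\<^sup>+u. indicator (cball 0 r) (l + u) * indicator ?D u \<partial>mL \<partial>count_space \<Lambda>)"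
    by (rule nn_integral_slice_unfold) (intro borel_measurable_indicator; simp)
  also have "\<dots> \<le> (\<integral>\<^sup>+l. indicator F l \<partial>count_space \<Lambda>)"
  proof (rule nn_integral_mono)
    fix l assume "l \<in> space (count_space \<Lambda>)"
    then have l: "l \<in> \<Lambda>" by simp
    have "indicator (cball 0 r) (l + u) * indicator ?D u \<le> (indicator F l * indicator ?D u :: ennreal)" for u
    proof (cases "l + u \<in> cball 0 r \<and> u \<in> ?D")
      case True
      then have "norm u \<le> R" unfolding R_def using fundamental_domain_bounded[OF LG] by blast
      moreover have "norm l \<le> norm (l + u) + norm u" by norm
      ultimately have "l \<in> F" using True l by (simp add: F_def)
      then show ?thesis using True by simp
    qed auto
    then have "(\<integral>\<^sup>+u. indicator (cball 0 r) (l + u) * indicator ?D u \<partial>mL) \<le> (\<integral>\<^sup>+u. indicator F l * indicator ?D u \<partial>mL)"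
      by (intro nn_integral_mono)
    also have "\<dots> = indicator F l * emeasure mL ?D"
      using fundamental_domain_borel[OF LG] by (simp add: nn_integral_cmult)
    finally show "(\<integral>\<^sup>+u. indicator (cball 0 r) (l + u) * indicator ?D u \<partial>mL) \<le> indicator F l"
      by (simp add: emeasure_fundamental_domain[OF LG])
  qed
  also have "\<dots> = emeasure (count_space \<Lambda>) F"
    by (rule nn_integral_indicator) (simp add: F_def)
  also have "\<dots> < \<infinity>" using F by (subst emeasure_count_space_finite) (auto simp: F_def of_nat_less_top)
  finally show "emeasure (slice_measure \<Lambda> L) (cball 0 r) < \<infinity>" .
qed

text \<open>For fixed \<open>u\<close> exactly one lattice translate of \<open>u\<close> lies in the
  fundamental domain of \<Lambda>, so exchanging sum and integral leaves the mass 1 of the smaller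
  domain. This is the Fourier coefficient of the measure at 0.\<close>

lemma slice_fundamental_domain: "emeasure (slice_measure \<Lambda> L) (fundamental_domain \<Lambda>) = 1"
proof -
  let ?D = "fundamental_domain (L \<inter> \<Lambda>)" and ?E = "fundamental_domain \<Lambda>"
  note E = fundamental_domain_borel[OF \<Lambda>]
  have "emeasure (slice_measure \<Lambda> L) ?E = (\<integral>\<^sup>+x. indicator ?E x \<partial>slice_measure \<Lambda> L)"
    using E by simp
  also have "\<dots> = (\<integral>\<^sup>+l. \<integral>\<^sup>+u. indicator ?E (l + u) * indicator ?D u \<partial>mL \<partial>count_space \<Lambda>)"
    by (rule nn_integral_slice_unfold) (use E in simp)
  also have "\<dots> = (\<integral>\<^sup>+u. \<integral>\<^sup>+l. indicator ?E (l + u) * indicator ?D u \<partial>count_space \<Lambda> \<partial>mL)"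
  proof (rule nn_integral_count_space_nn_integral[symmetric, OF countable_lattice[OF \<Lambda>]])
    show "(\<lambda>u. indicator ?E (l + u) * indicator ?D u :: ennreal) \<in> borel_measurable mL" for l
      using E fundamental_domain_borel[OF LG] by simp
  qed
  also have "\<dots> = (\<integral>\<^sup>+u. indicator ?D u \<partial>mL)"
  proof (rule nn_integral_cong)
    fix u :: 'a
    obtain k where k: "k \<in> \<Lambda>" "\<And>l'. l' \<in> \<Lambda> \<Longrightarrow> u - l' \<in> ?E \<longleftrightarrow> l' = k"
      using fundamental_domain_tiling[OF \<Lambda> UNIV_I, of u] by metis
    have iff: "l + u \<in> ?E \<longleftrightarrow> l = - k" if "l \<in> \<Lambda>" for l
      using k(2)[OF lattice_minus[OF \<Lambda> that]] by (auto simp: add.commute)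
    have "(\<integral>\<^sup>+l. indicator ?E (l + u) * indicator ?D u \<partial>count_space \<Lambda>)
        = (\<Sum>l\<in>{- k}. indicator ?E (l + u) * indicator ?D u :: ennreal)"
      using k(1) lattice_minus[OF \<Lambda> k(1)] iff by (intro nn_integral_count_space') auto
    also have "\<dots> = indicator ?D u" using iff[OF lattice_minus[OF \<Lambda> k(1)]] by simp
    finally show "(\<integral>\<^sup>+l. indicator ?E (l + u) * indicator ?D u \<partial>count_space \<Lambda>) = (indicator ?D u :: ennreal)" .
  qed
  also have "\<dots> = 1" using fundamental_domain_borel[OF LG] by (simp add: emeasure_fundamental_domain[OF LG])
  finally show ?thesis .
qed

text \<open>The measure is carried by the cosets through lattice points; \<gamma> vanishes on
  \<open>L\<close> and is integral on \<Lambda>.\<close>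

lemma AE_slice_integer:
  assumes \<gamma>: "\<gamma> \<in> dual_lattice \<Lambda>" "\<gamma> \<in> annihilator L"
  shows "AE x in slice_measure \<Lambda> L. blinfun_apply \<gamma> x \<in> \<int>"
proof -
  let ?A = "{x. blinfun_apply \<gamma> x \<notin> \<int>}"
  let ?D = "fundamental_domain (L \<inter> \<Lambda>)"
  have "closed (blinfun_apply \<gamma> -` \<int>)"
    by (intro closed_vimage closed_Ints linear_continuous_on blinfun.bounded_linear_right)
  then have "open (- (blinfun_apply \<gamma> -` \<int>))" by (rule open_Compl)
  moreover have "?A = - (blinfun_apply \<gamma> -` \<int>)" by auto
  ultimately have A: "?A \<in> sets borel" by (simp only: borel_open)
  have "emeasure (slice_measure \<Lambda> L) ?A = (\<integral>\<^sup>+x. indicator ?A x \<partial>slice_measure \<Lambda> L)"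
    using A by simp
  also have "\<dots> = (\<integral>\<^sup>+l. \<integral>\<^sup>+u. indicator ?A (l + u) * indicator ?D u \<partial>mL \<partial>count_space \<Lambda>)"
    by (rule nn_integral_slice_unfold) (use A in simp)
  also have "\<dots> = (\<integral>\<^sup>+l. 0 \<partial>count_space \<Lambda>)"
  proof (rule nn_integral_cong)
    fix l assume "l \<in> space (count_space \<Lambda>)"
    then have l: "blinfun_apply \<gamma> l \<in> \<int>" using \<gamma>(1) by (simp add: dual_lattice_def)
    have "indicator ?A (l + u) * indicator ?D u = (0 :: ennreal)" for u
    proof (cases "u \<in> ?D")
      case True
      then have "u \<in> L" by (simp add: fundamental_domain_eq[OF LG])
      then have "blinfun_apply \<gamma> (l + u) \<in> \<int>" using l \<gamma>(2) by (simp add: annihilator_def blinfun.add_right)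
      then show ?thesis by simp
    qed simp
    then have "(\<integral>\<^sup>+u. indicator ?A (l + u) * indicator ?D u \<partial>mL) = (\<integral>\<^sup>+u. 0 \<partial>mL)"
      by (rule nn_integral_cong)
    then show "(\<integral>\<^sup>+u. indicator ?A (l + u) * indicator ?D u \<partial>mL) = 0" by simp
  qed
  finally have "emeasure (slice_measure \<Lambda> L) ?A = 0" by simp
  then show ?thesis using A by (intro AE_I[of _ _ ?A]) auto
qed

text \<open>Tonelli and Fubini on the product of the countable set of cosets with \<open>L\<close>:
  absolute convergence of the sum of slice integrals is integrability against the slice
  measure.\<close>

lemma intermediate_sum_slice:
  assumes p: "p \<in> sets borel"
  shows "intermediate_sum_converges \<Lambda> L p \<xi> \<longleftrightarrow> set_integrable (slice_measure \<Lambda> L) p (\<lambda>x. exp (blinfun_apply \<xi> x))"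
    and "intermediate_sum_converges \<Lambda> L p \<xi> \<Longrightarrow>
      intermediate_sum \<Lambda> L p \<xi> = (LINT x:p|slice_measure \<Lambda> L. exp (blinfun_apply \<xi> x))"
proof -
  interpret pair_sigma_finite "count_space Q" mL by (rule pair_sigma)
  define f where "f x = indicator p x *\<^sub>R exp (blinfun_apply \<xi> x)" for x
  have f: "f \<in> borel_measurable borel"
    unfolding f_def using p borel_measurable_continuous_onI[OF continuous_on_cexp_blinfun] by measurable
  let ?F = "\<lambda>(Y, u). f (rep Y + u)"
  have F: "?F \<in> borel_measurable (count_space Q \<Otimes>\<^sub>M mL)"
    using measurable_compose[OF slice_meas f] by (simp add: split_def)
  have coset_meas: "(+) (rep Y) \<in> measurable mL borel" for Y by simp
  have int_coset: "set_integrable (coset_measure \<Lambda> L Y) p (\<lambda>x. exp (blinfun_apply \<xi> x)) \<longleftrightarrow> integrable mL (\<lambda>u. f (rep Y + u))" for Y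
    unfolding set_integrable_def coset_measure_def f_def[symmetric] by (rule integrable_distr_eq[OF coset_meas f])
  have val_coset: "(LINT x:p|coset_measure \<Lambda> L Y. exp (blinfun_apply \<xi> x)) = (LINT u|mL. f (rep Y + u))" for Y
    unfolding set_lebesgue_integral_def coset_measure_def f_def[symmetric] by (rule integral_distr[OF coset_meas f])
  have norm_coset: "(LINT x:p|coset_measure \<Lambda> L Y. norm (exp (blinfun_apply \<xi> x))) = (LINT u|mL. norm (f (rep Y + u)))" for Y
  proof -
    have "(LINT x:p|coset_measure \<Lambda> L Y. norm (exp (blinfun_apply \<xi> x))) = (LINT x|coset_measure \<Lambda> L Y. norm (f x))"
      unfolding set_lebesgue_integral_def f_def by simp
    also have "\<dots> = (LINT u|mL. norm (f (rep Y + u)))"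
      unfolding coset_measure_def using f by (intro integral_distr[OF coset_meas]) simp
    finally show ?thesis .
  qed
  have int_slice: "set_integrable (slice_measure \<Lambda> L) p (\<lambda>x. exp (blinfun_apply \<xi> x)) \<longleftrightarrow> integrable (count_space Q \<Otimes>\<^sub>M mL) ?F"
    unfolding set_integrable_def slice_measure_def f_def[symmetric]
    using integrable_distr_eq[OF slice_meas f] by (simp add: split_def)
  \<comment> \<open>Unconditional summation is translated into integration over a counting measure.
    The terms are nonnegative, so summability and absolute summability coincide.\<close>
  have sum_iff: "(\<lambda>Y. LINT u|mL. norm (f (rep Y + u))) summable_on Q
      \<longleftrightarrow> integrable (count_space Q) (\<lambda>Y. LINT u|mL. norm (f (rep Y + u)))"
    using abs_summable_equivalent[of "\<lambda>Y. LINT u|mL. norm (f (rep Y + u))" Q]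
    by (simp add: Infinite_Set_Sum.abs_summable_on_def)
  have conv: "intermediate_sum_converges \<Lambda> L p \<xi> \<longleftrightarrow>
      (\<forall>Y\<in>Q. integrable mL (\<lambda>u. f (rep Y + u))) \<and> integrable (count_space Q) (\<lambda>Y. LINT u|mL. norm (f (rep Y + u)))"
    unfolding intermediate_sum_converges_def int_coset norm_coset sum_iff ..
  show iff: "intermediate_sum_converges \<Lambda> L p \<xi> \<longleftrightarrow> set_integrable (slice_measure \<Lambda> L) p (\<lambda>x. exp (blinfun_apply \<xi> x))"
    unfolding conv int_slice
  proof
    assume *: "(\<forall>Y\<in>Q. integrable mL (\<lambda>u. f (rep Y + u))) \<and> integrable (count_space Q) (\<lambda>Y. LINT u|mL. norm (f (rep Y + u)))"
    show "integrable (count_space Q \<Otimes>\<^sub>M mL) ?F"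
      using * by (intro Fubini_integrable F) (auto simp: AE_count_space)
  next
    assume *: "integrable (count_space Q \<Otimes>\<^sub>M mL) ?F"
    have "AE Y in count_space Q. integrable mL (\<lambda>u. ?F (Y, u))" by (rule AE_integrable_fst'[OF *])
    moreover have "integrable (count_space Q) (\<lambda>Y. LINT u|mL. norm (?F (Y, u)))"
      using integrable_fst'[OF integrable_norm[OF *]] by simp
    ultimately show "(\<forall>Y\<in>Q. integrable mL (\<lambda>u. f (rep Y + u))) \<and> integrable (count_space Q) (\<lambda>Y. LINT u|mL. norm (f (rep Y + u)))"
      by (auto simp: AE_count_space)
  qed
  assume c: "intermediate_sum_converges \<Lambda> L p \<xi>"
  then have *: "integrable (count_space Q \<Otimes>\<^sub>M mL) ?F" using iff int_slice by simp
  have "intermediate_sum \<Lambda> L p \<xi> = infsum (\<lambda>Y. LINT u|mL. f (rep Y + u)) Q"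
    unfolding intermediate_sum_def val_coset ..
  also have "\<dots> = infsetsum (\<lambda>Y. LINT u|mL. f (rep Y + u)) Q"
    using integrable_fst'[OF *] by (intro infsetsum_infsum[symmetric]) (simp add: Infinite_Set_Sum.abs_summable_on_def)
  also have "\<dots> = (LINT Y|count_space Q. LINT u|mL. ?F (Y, u))"
    by (simp add: infsetsum_def)
  also have "\<dots> = (LINT z|(count_space Q \<Otimes>\<^sub>M mL). ?F z)" by (rule integral_fst'[OF *])
  also have "\<dots> = (LINT x|slice_measure \<Lambda> L. f x)"
    unfolding slice_measure_def using integral_distr[OF slice_meas f] by (simp add: split_def)
  finally show "intermediate_sum \<Lambda> L p \<xi> = (LINT x:p|slice_measure \<Lambda> L. exp (blinfun_apply \<xi> x))"
    by (simp add: set_lebesgue_integral_def f_def)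
qed

end

section \<open>The intermediate valuation\<close>

text \<open>By invariance under \<open>w\<close>, the translation by \<open>w\<close> multiplies the
  transform by \<open>exp (blinfun_apply \<xi> w)\<close>. The function \<open>f\<close> may have
  unbounded support; integrability at the given \<xi> is enough, which covers the indicator of a
  polyhedron.\<close>

lemma integral_bdiff_exp:
  fixes f :: "'a::euclidean_space \<Rightarrow> complex"
  assumes M: "invariant_measure \<Lambda> M" "sets M = sets borel" and ws: "set ws \<subseteq> \<Lambda>"
    and f: "f \<in> borel_measurable borel" "integrable M (\<lambda>x. f x * exp (blinfun_apply \<xi> x))"
  shows "integrable M (\<lambda>x. bdiff ws f x * exp (blinfun_apply \<xi> x)) \<and>
    laplace M (bdiff ws f) \<xi> = (\<Prod>w\<leftarrow>ws. 1 - exp (blinfun_apply \<xi> w)) * (LINT x|M. f x * exp (blinfun_apply \<xi> x))"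
  using ws
proof (induction ws)
  case Nil
  then show ?case using f by (simp add: laplace_def)
next
  case (Cons w ws)
  let ?F = "\<lambda>x. bdiff ws f x * exp (blinfun_apply \<xi> x)"
  have IH: "integrable M ?F"
    "(LINT x|M. ?F x) = (\<Prod>w\<leftarrow>ws. 1 - exp (blinfun_apply \<xi> w)) * (LINT x|M. f x * exp (blinfun_apply \<xi> x))"
    using Cons by (simp_all add: laplace_def)
  have Fm: "?F \<in> borel_measurable borel"
    by (intro borel_measurable_times bdiff_borel f(1) borel_measurable_continuous_onI continuous_on_cexp_blinfun)
  have Fm': "(\<lambda>x. ?F (x - w)) \<in> borel_measurable borel" by (rule measurable_compose[OF _ Fm]) simp
  have w: "w \<in> \<Lambda>" using Cons.prems by simp
  have sh: "integrable M (\<lambda>x. ?F (x - w))" "(LINT x|M. ?F (x - w)) = (LINT x|M. ?F x)"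
    using integral_invariant[OF M w Fm'] IH(1) by simp_all
  have eq: "bdiff (w # ws) f x * exp (blinfun_apply \<xi> x) = ?F x - exp (blinfun_apply \<xi> w) * ?F (x - w)" for x
  proof -
    have "exp (blinfun_apply \<xi> x) = exp (blinfun_apply \<xi> w) * exp (blinfun_apply \<xi> (x - w))"
      by (simp add: blinfun.diff_right flip: exp_add)
    then show ?thesis by (simp add: algebra_simps)
  qed
  have i2: "integrable M (\<lambda>x. exp (blinfun_apply \<xi> w) * ?F (x - w))"
    by (intro integrable_mult_right sh)
  show ?case
  proof
    show "integrable M (\<lambda>x. bdiff (w # ws) f x * exp (blinfun_apply \<xi> x))"
      unfolding eq by (intro Bochner_Integration.integrable_diff IH i2)
    have "laplace M (bdiff (w # ws) f) \<xi> = (LINT x|M. ?F x - exp (blinfun_apply \<xi> w) * ?F (x - w))"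
      unfolding laplace_def eq ..
    also have "\<dots> = (LINT x|M. ?F x) - (LINT x|M. exp (blinfun_apply \<xi> w) * ?F (x - w))"
      by (rule Bochner_Integration.integral_diff[OF IH(1) i2])
    also have "(LINT x|M. exp (blinfun_apply \<xi> w) * ?F (x - w)) = exp (blinfun_apply \<xi> w) * (LINT x|M. ?F (x - w))"
      by (rule integral_mult_right_zero)
    also have "(LINT x|M. ?F x) - \<dots> = (1 - exp (blinfun_apply \<xi> w)) * (LINT x|M. ?F x)"
      by (simp only: sh(2)) (simp add: algebra_simps)
    finally show "laplace M (bdiff (w # ws) f) \<xi> =
      (\<Prod>w\<leftarrow>w # ws. 1 - exp (blinfun_apply \<xi> w)) * (LINT x|M. f x * exp (blinfun_apply \<xi> x))"
      by (simp only: IH(2)) simp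
  qed
qed

lemma bounded_kernel_bdiff: "bounded_kernel g \<Longrightarrow> bounded_kernel (bdiff ws g)"
proof (induction ws)
  case (Cons w ws)
  then have "bounded_kernel (bdiff ws g)" by blast
  from bounded_kernel_diff[OF this bounded_kernel_shift[OF this]] show ?case by simp
qed simp

subsection \<open>The function \<open>z / (1 - exp z)\<close>\<close>

text \<open>Up to sign the generating function of the Bernoulli numbers; \<open>- 1\<close> is the
  limit at the removable singularity.\<close>

definition todd :: "complex \<Rightarrow> complex" where
  "todd z = (if z = 0 then - 1 else z / (1 - exp z))"

text \<open>\<open>(exp z - 1) / z\<close> extends to an entire function with value 1 at 0, so it
  has no zero in a small disc; \<open>todd\<close> is minus its reciprocal. The same disc excludes
  the other zeros of \<open>exp z - 1\<close>.\<close>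

lemma todd_holomorphic:
  obtains r where "0 < r" "todd holomorphic_on ball 0 r"
    "\<And>z :: complex. z \<in> ball 0 r \<Longrightarrow> z \<noteq> 0 \<Longrightarrow> exp z \<noteq> 1"
proof -
  define E :: "complex \<Rightarrow> complex" where "E z = (if z = 0 then 1 else (exp z - 1) / z)" for z
  have E: "E holomorphic_on UNIV"
  proof (rule pole_theorem_open_0[of "\<lambda>z. exp z - 1" UNIV 0 E])
    show "(\<lambda>z::complex. exp z - 1) holomorphic_on UNIV" by (intro holomorphic_intros)
    have "((\<lambda>z::complex. exp z - 1) has_field_derivative 1) (at 0)"
      by (auto intro!: derivative_eq_intros)
    then have "deriv (\<lambda>z::complex. exp z - 1) 0 = 1" by (rule DERIV_imp_deriv)
    then show "E 0 = deriv (\<lambda>z. exp z - 1) 0" by (simp add: E_def)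
  qed (auto simp: E_def)
  then have "continuous_on UNIV E" by (rule holomorphic_on_imp_continuous_on)
  then have "open (E -` (- {0}))" by (intro open_vimage) auto
  moreover have "0 \<in> E -` (- {0})" by (simp add: E_def)
  ultimately obtain r where r: "0 < r" "ball 0 r \<subseteq> E -` (- {0})" by (meson open_contains_ball)
  have nz: "exp z \<noteq> 1" if "z \<in> ball 0 r" "z \<noteq> 0" for z :: complex
  proof -
    have "E z \<noteq> 0" using that r(2) by blast
    then show ?thesis using that by (auto simp: E_def)
  qed
  have "(\<lambda>z. - 1 / E z) holomorphic_on ball 0 r"
    using r(2) by (intro holomorphic_intros holomorphic_on_subset[OF E]) auto
  moreover have "- 1 / E z = todd z" for z
    by (auto simp: E_def todd_def divide_simps)
  ultimately have "todd holomorphic_on ball 0 r" by simp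
  with r(1) nz show thesis by (intro that)
qed

lemma todd_mult: "z \<noteq> 0 \<Longrightarrow> todd z / z = 1 / (1 - exp z)"
  by (simp add: todd_def)

subsection \<open>Germs\<close>

lemma open_off_hyperplanes:
  assumes "finite W" shows "open (off_hyperplanes (W :: 'a::real_normed_vector set))"
proof -
  have "off_hyperplanes W = (\<Inter>w\<in>W. {\<xi>. blinfun_apply \<xi> w \<noteq> 0})" by (auto simp: off_hyperplanes_def)
  moreover have "open {\<xi> :: 'a cdual. blinfun_apply \<xi> w \<noteq> 0}" for w :: 'a
    by (intro open_Collect_neq continuous_intros linear_continuous_on blinfun.bounded_linear_left)
  ultimately show ?thesis using assms by auto
qed

text \<open>A point on a new hyperplane is moved off it by a small multiple of a functional that is
  nonzero at \<open>w\<close>; openness keeps it in the set and off the earlier hyperplanes.\<close>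

lemma open_Int_off_hyperplanes_nonempty:
  fixes W :: "'a::euclidean_space set"
  assumes "finite W" "0 \<notin> W" "open O'" "O' \<noteq> {}"
  shows "O' \<inter> off_hyperplanes W \<noteq> {}"
  using assms
proof (induction W rule: finite_induct)
  case empty
  then show ?case by (auto simp: off_hyperplanes_def)
next
  case (insert w W)
  then have "O' \<inter> off_hyperplanes W \<noteq> {}" by simp
  then obtain \<xi> where \<xi>: "\<xi> \<in> O' \<inter> off_hyperplanes W" by blast
  have op: "open (O' \<inter> off_hyperplanes W)" using insert by (intro open_Int open_off_hyperplanes) auto
  have w: "w \<noteq> 0" using insert.prems by auto
  obtain \<eta> :: "'a cdual" where \<eta>: "blinfun_apply \<eta> w \<noteq> 0"
  proof
    have "bounded_linear (\<lambda>x. complex_of_real (w \<bullet> x))"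
      by (intro bounded_linear_compose[OF bounded_linear_of_real] bounded_linear_inner_right)
    then show "blinfun_apply (Blinfun (\<lambda>x. complex_of_real (w \<bullet> x))) w \<noteq> 0"
      using w by (simp add: bounded_linear_Blinfun_apply)
  qed
  have "((\<lambda>t::real. \<xi> + t *\<^sub>R \<eta>) \<longlongrightarrow> \<xi> + 0 *\<^sub>R \<eta>) (at 0)" by (intro tendsto_intros)
  then have "\<forall>\<^sub>F t::real in at 0. \<xi> + t *\<^sub>R \<eta> \<in> O' \<inter> off_hyperplanes W"
    using op \<xi> by (intro topological_tendstoD) auto
  moreover have "\<forall>\<^sub>F t::real in at 0. t \<noteq> 0" by (simp add: eventually_at_filter)
  ultimately have "\<forall>\<^sub>F t::real in at 0. \<xi> + t *\<^sub>R \<eta> \<in> O' \<inter> off_hyperplanes W \<and> t \<noteq> 0"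
    by (rule eventually_conj)
  then obtain t :: real where t: "\<xi> + t *\<^sub>R \<eta> \<in> O' \<inter> off_hyperplanes W" "t \<noteq> 0"
    using eventually_happens'[OF at_neq_bot] by blast
  show ?case
  proof (cases "blinfun_apply \<xi> w = 0")
    case True
    then have "blinfun_apply (\<xi> + t *\<^sub>R \<eta>) w \<noteq> 0" using t(2) \<eta> by (simp add: blinfun.bilinear_simps)
    then show ?thesis using t(1) by (auto simp: off_hyperplanes_def)
  qed (use \<xi> in \<open>auto simp: off_hyperplanes_def\<close>)
qed

lemma eventually_germ0_off:
  assumes "finite W" "0 \<notin> W" shows "\<forall>\<^sub>F \<xi> in germ0. \<xi> \<in> off_hyperplanes W"
  unfolding eventually_germ0 using assms by (intro exI[of _ UNIV] exI[of _ W]) auto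

lemma eventually_germ0_open:
  assumes "open U" "0 \<in> U" shows "\<forall>\<^sub>F \<xi> in germ0. \<xi> \<in> U"
  unfolding eventually_germ0 using assms by (intro exI[of _ U] exI[of _ "{}"]) auto

lemma open_small_pairings:
  fixes W :: "'a::real_normed_vector set"
  assumes "finite W" "0 < r" shows "open {\<xi> :: 'a cdual. \<forall>w\<in>W. blinfun_apply \<xi> w \<in> ball 0 r}"
    "0 \<in> {\<xi> :: 'a cdual. \<forall>w\<in>W. blinfun_apply \<xi> w \<in> ball 0 r}"
proof -
  have "{\<xi> :: 'a cdual. \<forall>w\<in>W. blinfun_apply \<xi> w \<in> ball 0 r} = (\<Inter>w\<in>W. (\<lambda>\<xi>. blinfun_apply \<xi> w) -` ball 0 r)" by auto
  moreover have "open ((\<lambda>\<xi> :: 'a cdual. blinfun_apply \<xi> w) -` ball 0 r)" for w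
    by (intro open_vimage open_ball linear_continuous_on blinfun.bounded_linear_left)
  ultimately show "open {\<xi> :: 'a cdual. \<forall>w\<in>W. blinfun_apply \<xi> w \<in> ball 0 r}" using assms by auto
qed (use assms in auto)

text \<open>Near 0 the factor \<open>1 - exp (blinfun_apply \<xi> w)\<close> vanishes only on the
  hyperplane of \<open>w\<close>, since the other zeros of \<open>exp z - 1\<close> stay away from
  0.\<close>

lemma eventually_germ0_exp:
  fixes W :: "'a::real_normed_vector set"
  assumes "finite W" "0 \<notin> W"
  shows "\<forall>\<^sub>F \<xi> in germ0. \<forall>w\<in>W. blinfun_apply \<xi> w \<noteq> 0 \<and> exp (blinfun_apply \<xi> w) \<noteq> 1"
proof -
  obtain r where r: "0 < r" "todd holomorphic_on ball 0 r" "\<And>z :: complex. z \<in> ball 0 r \<Longrightarrow> z \<noteq> 0 \<Longrightarrow> exp z \<noteq> 1"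
    by (rule todd_holomorphic) blast
  show ?thesis
    using eventually_germ0_off[OF assms] eventually_germ0_open[OF open_small_pairings[OF assms(1) r(1)]]
  proof eventually_elim
    case (elim \<xi>)
    then show ?case using r(3) unfolding off_hyperplanes_def by blast
  qed
qed

lemma prod_list_ne_0: "(\<And>w. w \<in> set ws \<Longrightarrow> f w \<noteq> (0::complex)) \<Longrightarrow> (\<Prod>w\<leftarrow>ws. f w) \<noteq> 0"
  by (induction ws) auto

lemma prod_list_divide: "(\<Prod>w\<leftarrow>ws. f w / g w) = (\<Prod>w\<leftarrow>ws. f w) / (\<Prod>w\<leftarrow>ws. g w :: complex)"
  by (induction ws) auto

lemma cdual_holomorphic_on_exp_prod:
  "cdual_holomorphic_on (\<lambda>\<xi>. \<Prod>w\<leftarrow>ws. 1 - exp (blinfun_apply \<xi> w)) U"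
proof (rule cdual_holomorphic_on_prod_list)
  show "cdual_holomorphic_on (\<lambda>\<xi>. 1 - exp (blinfun_apply \<xi> w)) U" for w :: 'a
    by (rule cdual_holomorphic_on_compose[of "\<lambda>z. 1 - exp z" UNIV]) (auto intro!: holomorphic_intros)
qed

text \<open>Each factor \<open>1 / (1 - exp z)\<close> is written as \<open>todd z / z\<close>: the
  first part is holomorphic near 0, the second is an admissible pole.\<close>

lemma divide_exp_prod_in_Ml:
  assumes G: "cdual_holomorphic_on G UNIV" and ws: "0 \<notin> set ws"
  shows "(\<lambda>\<xi>. G \<xi> / (\<Prod>w\<leftarrow>ws. 1 - exp (blinfun_apply \<xi> w))) \<in> Ml"
proof -
  obtain r where r: "0 < r" "todd holomorphic_on ball 0 r" by (rule todd_holomorphic)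
  let ?U = "{\<xi> :: 'a cdual. \<forall>w\<in>set ws. blinfun_apply \<xi> w \<in> ball 0 r}"
  let ?\<phi> = "\<lambda>\<xi>. G \<xi> * (\<Prod>w\<leftarrow>ws. todd (blinfun_apply \<xi> w))"
  have hol: "cdual_holomorphic_on ?\<phi> ?U"
    by (intro cdual_holomorphic_on_mult cdual_holomorphic_on_prod_list cdual_holomorphic_on_compose[OF r(2)]
          cdual_holomorphic_on_subset[OF G]) auto
  have "\<forall>\<^sub>F \<xi> in germ0. G \<xi> / (\<Prod>w\<leftarrow>ws. 1 - exp (blinfun_apply \<xi> w)) = ?\<phi> \<xi> / (\<Prod>w\<leftarrow>ws. blinfun_apply \<xi> w)"
    using eventually_germ0_exp[OF finite_set ws]
  proof eventually_elim
    case (elim \<xi>)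
    have "(\<Prod>w\<leftarrow>ws. todd (blinfun_apply \<xi> w)) / (\<Prod>w\<leftarrow>ws. blinfun_apply \<xi> w)
        = (\<Prod>w\<leftarrow>ws. 1 / (1 - exp (blinfun_apply \<xi> w)))"
      unfolding prod_list_divide[symmetric] using elim
      by (intro arg_cong[where f=prod_list] map_cong refl todd_mult) auto
    also have "\<dots> = (\<Prod>w\<leftarrow>ws. 1) / (\<Prod>w\<leftarrow>ws. 1 - exp (blinfun_apply \<xi> w))" by (rule prod_list_divide)
    also have "(\<Prod>w\<leftarrow>ws. 1 :: complex) = 1" by (induction ws) auto
    finally have "(\<Prod>w\<leftarrow>ws. todd (blinfun_apply \<xi> w)) / (\<Prod>w\<leftarrow>ws. blinfun_apply \<xi> w)
        = 1 / (\<Prod>w\<leftarrow>ws. 1 - exp (blinfun_apply \<xi> w))" .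
    then show ?case by (metis times_divide_eq_right mult.right_neutral)
  qed
  then show ?thesis unfolding Ml_def
    using hol ws open_small_pairings[OF finite_set r(1), of ws] by blast
qed

text \<open>With both denominators cleared, the difference \<open>?E\<close> is holomorphic on a
  ball around 0 and vanishes on its part in \<open>R\<close> off finitely many hyperplanes. The size
  of the ball depends on \<open>f\<close>, which is why \<open>R\<close> has to meet every
  neighbourhood of 0.\<close>

lemma Ml_eqI:
  fixes f :: "'a::euclidean_space cdual \<Rightarrow> complex"
  assumes f: "f \<in> Ml" and G: "cdual_holomorphic_on G UNIV" and ws: "0 \<notin> set ws"
    and R: "open R" "\<And>U. open U \<Longrightarrow> 0 \<in> U \<Longrightarrow> U \<inter> R \<noteq> {}"
    and eq: "\<forall>\<^sub>F \<xi> in germ0. \<xi> \<in> R \<longrightarrow> f \<xi> = G \<xi> / (\<Prod>w\<leftarrow>ws. 1 - exp (blinfun_apply \<xi> w))"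
  shows "\<forall>\<^sub>F \<xi> in germ0. f \<xi> = G \<xi> / (\<Prod>w\<leftarrow>ws. 1 - exp (blinfun_apply \<xi> w))"
proof -
  obtain \<phi> U vs where \<phi>: "open U" "0 \<in> U" "cdual_holomorphic_on \<phi> U" "0 \<notin> set vs"
    "\<forall>\<^sub>F \<xi> in germ0. f \<xi> = \<phi> \<xi> / (\<Prod>w\<leftarrow>vs. blinfun_apply \<xi> w)" using f unfolding Ml_def by blast
  define P where "P \<xi> \<longleftrightarrow> f \<xi> = \<phi> \<xi> / (\<Prod>w\<leftarrow>vs. blinfun_apply \<xi> w) \<and>
     (\<xi> \<in> R \<longrightarrow> f \<xi> = G \<xi> / (\<Prod>w\<leftarrow>ws. 1 - exp (blinfun_apply \<xi> w))) \<and>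
     (\<forall>w\<in>set ws. blinfun_apply \<xi> w \<noteq> 0 \<and> exp (blinfun_apply \<xi> w) \<noteq> 1) \<and> \<xi> \<in> off_hyperplanes (set vs)" for \<xi>
  have "\<forall>\<^sub>F \<xi> in germ0. P \<xi>" unfolding P_def
    by (intro eventually_conj \<phi>(5) eq eventually_germ0_exp eventually_germ0_off finite_set ws \<phi>(4))
  then obtain U' W where U': "open U'" "0 \<in> U'" "finite W" "0 \<notin> W" "\<And>\<xi>. \<xi> \<in> U' \<inter> off_hyperplanes W \<Longrightarrow> P \<xi>"
    unfolding eventually_germ0 by blast
  have "open (U \<inter> U')" "0 \<in> U \<inter> U'" using U' \<phi> by auto
  then obtain e where e: "0 < e" "ball 0 e \<subseteq> U \<inter> U'" by (meson open_contains_ball)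
  let ?E = "\<lambda>\<xi>. \<phi> \<xi> * (\<Prod>w\<leftarrow>ws. 1 - exp (blinfun_apply \<xi> w)) - G \<xi> * (\<Prod>w\<leftarrow>vs. blinfun_apply \<xi> w)"
  let ?Q = "ball 0 e \<inter> R \<inter> off_hyperplanes W"
  have E: "cdual_holomorphic_on ?E (ball 0 e)"
    by (intro cdual_holomorphic_on_diff cdual_holomorphic_on_mult cdual_holomorphic_on_exp_prod
         cdual_holomorphic_on_prod_list cdual_holomorphic_on_pairing cdual_holomorphic_on_subset[OF \<phi>(3)]
         cdual_holomorphic_on_subset[OF G]) (use e in auto)
  have Q: "open ?Q" "?Q \<noteq> {}"
    using R(1) U'(3) open_Int_off_hyperplanes_nonempty[OF U'(3,4), of "ball 0 e \<inter> R"] R(2)[of "ball 0 e"] e(1)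
    by (auto intro!: open_Int open_off_hyperplanes)
  have E0: "?E \<xi> = 0" if "\<xi> \<in> ?Q" for \<xi>
  proof -
    have P: "P \<xi>" using that e(2) U'(5) by blast
    then have "\<phi> \<xi> / (\<Prod>w\<leftarrow>vs. blinfun_apply \<xi> w) = G \<xi> / (\<Prod>w\<leftarrow>ws. 1 - exp (blinfun_apply \<xi> w))"
      using that unfolding P_def by auto
    moreover have "(\<Prod>w\<leftarrow>vs. blinfun_apply \<xi> w) \<noteq> 0" "(\<Prod>w\<leftarrow>ws. 1 - exp (blinfun_apply \<xi> w)) \<noteq> 0"
      using P unfolding P_def off_hyperplanes_def by (intro prod_list_ne_0; force)+
    ultimately show ?thesis by (simp add: frac_eq_eq)
  qed
  have all: "?E \<xi> = 0" if "\<xi> \<in> ball 0 e" for \<xi>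
    by (rule cdual_identity[OF E open_ball convex_ball Q _ E0 that]) auto
  show ?thesis unfolding eventually_germ0
  proof (intro exI conjI ballI)
    show "open (ball (0::'a cdual) e)" "(0::'a cdual) \<in> ball 0 e" "finite W" "0 \<notin> W" using e U' by auto
    fix \<xi> :: "'a cdual" assume \<xi>: "\<xi> \<in> ball 0 e \<inter> off_hyperplanes W"
    then have P: "P \<xi>" using e(2) U'(5) by blast
    have "(\<Prod>w\<leftarrow>vs. blinfun_apply \<xi> w) \<noteq> 0" "(\<Prod>w\<leftarrow>ws. 1 - exp (blinfun_apply \<xi> w)) \<noteq> 0"
      using P unfolding P_def off_hyperplanes_def by (intro prod_list_ne_0; force)+
    moreover have "f \<xi> = \<phi> \<xi> / (\<Prod>w\<leftarrow>vs. blinfun_apply \<xi> w)" using P unfolding P_def by blast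
    ultimately show "f \<xi> = G \<xi> / (\<Prod>w\<leftarrow>ws. 1 - exp (blinfun_apply \<xi> w))"
      using all[of \<xi>] \<xi> by (simp add: frac_eq_eq)
  qed
qed

subsection \<open>Existence\<close>

text \<open>The last clause provides the vanishing of the valuation on polyhedra that contain a
  line.\<close>

definition kernel_list :: "'a::euclidean_space set \<Rightarrow> 'a set \<Rightarrow> 'a list \<Rightarrow> bool" where
  "kernel_list \<Lambda> p ws \<longleftrightarrow> set ws \<subseteq> \<Lambda> - {0} \<and> bounded_kernel (bdiff ws (indicator p)) \<and>
     (contains_line p \<longrightarrow> bdiff ws (indicator p :: 'a \<Rightarrow> complex) = (\<lambda>_. 0))"

lemma closed_semi_rational_polyhedron:
  assumes "semi_rational_polyhedron \<Lambda> p" shows "closed p"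
proof -
  obtain H where H: "finite H" "fst ` H \<subseteq> dual_lattice \<Lambda>" "p = {x. \<forall>(\<mu>, b)\<in>H. \<mu> x \<le> b}"
    using assms unfolding semi_rational_polyhedron_def by blast
  have "p = (\<Inter>h\<in>H. {x. blinfun_apply (fst h) x \<le> snd h})" unfolding H(3) by (auto simp: split_beta)
  moreover have "closed {x. blinfun_apply (fst h) x \<le> snd h}" for h :: "('a \<Rightarrow>\<^sub>L real) \<times> real"
    by (intro closed_Collect_le continuous_intros)
  ultimately show ?thesis by (simp only:) (rule closed_INT, simp)
qed

text \<open>Take generators of the recession cone, which \<open>bdiff_polyhedron_support\<close>
  allows. If \<open>p\<close> contains a line, one of these generators lies in the lineality space;
  translation by it preserves \<open>p\<close>, so its factor annihilates the indicator.\<close>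

lemma ex_kernel_list:
  fixes \<Lambda> :: "'a::euclidean_space set"
  assumes \<Lambda>: "lattice_in \<Lambda> UNIV" and p: "semi_rational_polyhedron \<Lambda> p"
  shows "\<exists>ws. kernel_list \<Lambda> p ws"
proof -
  obtain H where H: "finite H" "fst ` H \<subseteq> dual_lattice \<Lambda>" "p = {x. \<forall>(\<mu>, b)\<in>H. \<mu> x \<le> b}"
    using p unfolding semi_rational_polyhedron_def by blast
  have p': "z \<in> p \<longleftrightarrow> (\<forall>(\<mu>, b)\<in>H. blinfun_apply \<mu> z \<le> b)" for z
    unfolding H(3) by (simp add: split_beta)
  obtain W where W: "finite W" "W \<subseteq> \<Lambda> - {0}" "ncone W = {x. \<forall>\<mu>\<in>fst ` H. blinfun_apply \<mu> x \<le> 0}"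
    by (rule rational_cone_generators[OF \<Lambda> finite_imageI[OF H(1)] H(2)])
  obtain ws where ws: "set ws = W" using finite_list[OF W(1)] by blast
  have rec: "{x. \<forall>(\<mu>, b)\<in>H. blinfun_apply \<mu> x \<le> 0} = ncone (set ws)"
    unfolding ws W(3) by (auto simp: split_beta)
  let ?f = "indicator p :: 'a \<Rightarrow> complex"
  have fb: "?f \<in> borel_measurable borel"
    using closed_semi_rational_polyhedron[OF p] by (intro borel_measurable_indicator) simp
  obtain r where r: "\<And>x. bdiff ws ?f x \<noteq> 0 \<Longrightarrow> norm x \<le> r"
    by (rule bdiff_polyhedron_support[OF H(1,3) rec]) blast
  have bk: "bounded_kernel (bdiff ws ?f)"
  proof (rule bounded_kernelI[OF bdiff_borel[OF fb]])
    show "norm (bdiff ws ?f x) \<le> 2 ^ length ws * 1" for x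
      by (rule bdiff_norm_le) (simp add: indicator_def)
  qed (rule r)
  have line: "bdiff ws ?f = (\<lambda>_. 0)" if "contains_line p"
  proof -
    obtain x w where xw: "w \<noteq> 0" "\<And>t. x + t *\<^sub>R w \<in> p" using \<open>contains_line p\<close> unfolding contains_line_def by blast
    have \<mu>w: "blinfun_apply \<mu> w = 0" if "(\<mu>, b) \<in> H" for \<mu> b
    proof (rule ccontr)
      assume "blinfun_apply \<mu> w \<noteq> 0"
      then have "blinfun_apply \<mu> (x + ((b - blinfun_apply \<mu> x + 1) / blinfun_apply \<mu> w) *\<^sub>R w) = b + 1"
        by (simp add: blinfun.bilinear_simps)
      moreover have "blinfun_apply \<mu> (x + ((b - blinfun_apply \<mu> x + 1) / blinfun_apply \<mu> w) *\<^sub>R w) \<le> b"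
        using xw(2) that unfolding p' by fastforce
      ultimately show False by linarith
    qed
    have "w \<in> ncone W" "- w \<in> ncone W" unfolding W(3) using \<mu>w by (auto simp: blinfun.minus_right)
    then obtain s t where s: "w = (\<Sum>v\<in>W. s v *\<^sub>R v)" "\<forall>v\<in>W. 0 \<le> s v"
      and t: "- w = (\<Sum>v\<in>W. t v *\<^sub>R v)" "\<forall>v\<in>W. 0 \<le> t v" unfolding ncone_def by blast
    obtain v where v: "v \<in> W" "s v > 0"
    proof -
      obtain v where "v \<in> W" "s v *\<^sub>R v \<noteq> 0" using xw(1) s(1) by (meson sum.neutral)
      then show thesis using s(2) that[of v] by (auto simp: less_le)
    qed
    \<comment> \<open>Adding the representations of \<open>w\<close> and \<open>- w\<close> gives a
      vanishing combination of the generators. Each constraint is nonpositive on every generator, so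
      it must vanish on those with positive coefficient, in particular on \<open>v\<close>.\<close>
    have \<mu>v: "blinfun_apply \<mu> v = 0" if h: "(\<mu>, b) \<in> H" for \<mu> b
    proof -
      have neg: "blinfun_apply \<mu> u \<le> 0" if "u \<in> W" for u
        using ncone_base[OF W(1) that] h unfolding W(3) by force
      have "(\<Sum>u\<in>W. (s u + t u) * blinfun_apply \<mu> u) = blinfun_apply \<mu> ((\<Sum>v\<in>W. s v *\<^sub>R v) + (\<Sum>v\<in>W. t v *\<^sub>R v))"
        by (simp add: blinfun.sum_right blinfun.bilinear_simps distrib_right sum.distrib)
      also have "\<dots> = 0" unfolding s(1)[symmetric] t(1)[symmetric] by simp
      finally have sum0: "(\<Sum>u\<in>W. - ((s u + t u) * blinfun_apply \<mu> u)) = 0" by (simp add: sum_negf)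
      have "- ((s v + t v) * blinfun_apply \<mu> v) = 0"
        using sum_nonneg_0[OF W(1) _ sum0 v(1)] neg s(2) t(2) by (simp add: mult_nonneg_nonpos)
      moreover have "s v + t v > 0" using v t(2) by (simp add: add_pos_nonneg)
      ultimately show ?thesis by simp
    qed
    have "x' - v \<in> p \<longleftrightarrow> x' \<in> p" for x'
      unfolding p' using \<mu>v by (fastforce simp: blinfun.diff_right)
    then show ?thesis
      using v(1) by (intro ext bdiff_eq_0[of v]) (auto simp: ws indicator_def)
  qed
  show ?thesis
    using W(2) bk line unfolding kernel_list_def ws[symmetric] by blast
qed

text \<open>The list is chosen for each polyhedron separately; compatibility between different
  choices is settled only when a linear relation is checked.\<close>

definition chosen_valuation :: "'a::euclidean_space set \<Rightarrow> 'a measure \<Rightarrow> 'a set \<Rightarrow> 'a cdual \<Rightarrow> complex" where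
  "chosen_valuation \<Lambda> M p \<xi> = (let ws = (SOME ws. kernel_list \<Lambda> p ws) in
     laplace M (bdiff ws (indicator p)) \<xi> / (\<Prod>w\<leftarrow>ws. 1 - exp (blinfun_apply \<xi> w)))"

text \<open>For a linear relation, the concatenation \<open>us\<close> of all chosen lists serves as
  a common denominator: the denominator times the value at \<open>p\<close> is the transform of
  \<open>bdiff us\<close> of the indicator of \<open>p\<close>. Linearity of \<open>bdiff\<close>
  makes the weighted sum the transform of 0. The values on convergent sums come from
  \<open>integral_bdiff_exp\<close>.\<close>

theorem intermediate_valuation_exists:
  fixes \<Lambda> :: "'a::euclidean_space set"
  assumes \<Lambda>: "lattice_in \<Lambda> UNIV" and L: "rational_subspace \<Lambda> L"
  shows "intermediate_valuation \<Lambda> L (chosen_valuation \<Lambda> (slice_measure \<Lambda> L))"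
proof -
  let ?M = "slice_measure \<Lambda> L"
  let ?S = "chosen_valuation \<Lambda> ?M"
  define ws where "ws p = (SOME ws. kernel_list \<Lambda> p ws)" for p
  have kl: "kernel_list \<Lambda> p (ws p)" if "semi_rational_polyhedron \<Lambda> p" for p
    unfolding ws_def by (rule someI_ex[OF ex_kernel_list[OF \<Lambda> that]])
  have S: "?S p \<xi> = laplace ?M (bdiff (ws p) (indicator p)) \<xi> / (\<Prod>w\<leftarrow>ws p. 1 - exp (blinfun_apply \<xi> w))" for p \<xi>
    by (simp add: chosen_valuation_def ws_def Let_def)
  have lf: "locally_finite_borel ?M" and inv: "invariant_measure \<Lambda> ?M"
    using slice_locally_finite[OF \<Lambda> L] slice_invariant[OF \<Lambda> L] by auto
  have sets: "sets ?M = sets borel" by (rule sets_slice_measure[OF \<Lambda> L])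
  show ?thesis unfolding intermediate_valuation_def
  proof (intro conjI allI impI)
    fix p assume p: "semi_rational_polyhedron \<Lambda> p"
    show "?S p \<in> Ml" unfolding S[abs_def]
      using kl[OF p] by (intro divide_exp_prod_in_Ml cdual_holomorphic_on_laplace[OF lf]) (auto simp: kernel_list_def)
  next
    fix \<P> and r :: "'a set \<Rightarrow> real"
    assume "finite \<P> \<and> (\<forall>p\<in>\<P>. semi_rational_polyhedron \<Lambda> p) \<and> (\<forall>x. (\<Sum>p\<in>\<P>. r p * indicator p x) = 0)"
    then have fin: "finite \<P>" and pol: "\<And>p. p \<in> \<P> \<Longrightarrow> semi_rational_polyhedron \<Lambda> p"
      and rel: "\<And>x. (\<Sum>p\<in>\<P>. r p * indicator p x) = 0" by auto
    obtain ps where ps: "set ps = \<P>" using finite_list[OF fin] by blast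
    define us where "us = concat (map ws ps)"
    have us: "set us \<subseteq> \<Lambda> - {0}" using kl pol by (auto simp: us_def ps kernel_list_def)
    \<comment> \<open>The list of \<open>p\<close> is a sub-multiset of \<open>us\<close>; the
      complementary factors \<open>vs\<close> multiply the transform by their own part of the
      denominator.\<close>
    have ext: "\<exists>vs. mset us = mset (vs @ ws p) \<and> set vs \<subseteq> set us" if p: "p \<in> \<P>" for p
    proof -
      obtain as bs where "ps = as @ p # bs" using split_list[of p ps] p ps by blast
      then have "us = concat (map ws as) @ ws p @ concat (map ws bs)" by (simp add: us_def)
      then show ?thesis by (intro exI[of _ "concat (map ws as) @ concat (map ws bs)"]) auto
    qed
    let ?K = "\<lambda>p. bdiff us (indicator p :: 'a \<Rightarrow> complex)"
    have bk: "bounded_kernel (?K p)" and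
      lap: "laplace ?M (?K p) \<xi> = (\<Prod>w\<leftarrow>us. 1 - exp (blinfun_apply \<xi> w)) * ?S p \<xi>"
        if p: "p \<in> \<P>" and nz: "(\<Prod>w\<leftarrow>us. 1 - exp (blinfun_apply \<xi> w)) \<noteq> 0" for p \<xi>
    proof -
      obtain vs where vs: "mset us = mset (vs @ ws p)" "set vs \<subseteq> set us" using ext[OF p] by blast
      have K: "?K p = bdiff vs (bdiff (ws p) (indicator p))"
        using bdiff_mset[OF vs(1)] by (simp add: bdiff_append)
      have bk0: "bounded_kernel (bdiff (ws p) (indicator p))" using kl[OF pol[OF p]] by (simp add: kernel_list_def)
      show "bounded_kernel (?K p)" unfolding K by (rule bounded_kernel_bdiff[OF bk0])
      have "(\<Prod>w\<leftarrow>us. 1 - exp (blinfun_apply \<xi> w)) = prod_mset (image_mset (\<lambda>w. 1 - exp (blinfun_apply \<xi> w)) (mset us))"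
        by (simp add: prod_mset_prod_list flip: mset_map)
      also have "\<dots> = (\<Prod>w\<leftarrow>vs. 1 - exp (blinfun_apply \<xi> w)) * (\<Prod>w\<leftarrow>ws p. 1 - exp (blinfun_apply \<xi> w))"
        unfolding vs(1) by (simp add: prod_mset_prod_list flip: mset_map)
      finally have prod: "(\<Prod>w\<leftarrow>us. 1 - exp (blinfun_apply \<xi> w)) =
        (\<Prod>w\<leftarrow>vs. 1 - exp (blinfun_apply \<xi> w)) * (\<Prod>w\<leftarrow>ws p. 1 - exp (blinfun_apply \<xi> w))" .
      have "laplace ?M (?K p) \<xi> = (\<Prod>w\<leftarrow>vs. 1 - exp (blinfun_apply \<xi> w)) * laplace ?M (bdiff (ws p) (indicator p)) \<xi>"
        unfolding K laplace_def[of _ "bdiff (ws p) (indicator p)"]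
        using vs(2) us by (intro integral_bdiff_exp[OF inv sets, THEN conjunct2] bounded_kernel_borel[OF bk0]
            integrable_bounded_kernel[OF lf] bounded_kernel_exp[OF bk0]) auto
      then show "laplace ?M (?K p) \<xi> = (\<Prod>w\<leftarrow>us. 1 - exp (blinfun_apply \<xi> w)) * ?S p \<xi>"
        using nz unfolding prod S by simp
    qed
    show "\<forall>\<^sub>F \<xi> in germ0. (\<Sum>p\<in>\<P>. complex_of_real (r p) * ?S p \<xi>) = 0"
    proof (rule eventually_mono[OF eventually_germ0_exp[OF finite_set[of us]]])
      show "0 \<notin> set us" using us by auto
      fix \<xi> :: "'a cdual"
      assume "\<forall>w\<in>set us. blinfun_apply \<xi> w \<noteq> 0 \<and> exp (blinfun_apply \<xi> w) \<noteq> 1"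
      then have nz: "(\<Prod>w\<leftarrow>us. 1 - exp (blinfun_apply \<xi> w)) \<noteq> 0" by (intro prod_list_ne_0) force
      have "(\<Prod>w\<leftarrow>us. 1 - exp (blinfun_apply \<xi> w)) * (\<Sum>p\<in>\<P>. complex_of_real (r p) * ?S p \<xi>)
          = (\<Sum>p\<in>\<P>. complex_of_real (r p) * laplace ?M (?K p) \<xi>)"
        by (simp add: lap[OF _ nz] sum_distrib_left mult_ac)
      also have "\<dots> = (\<Sum>p\<in>\<P>. LINT x|?M. complex_of_real (r p) * (?K p x * exp (blinfun_apply \<xi> x)))"
        by (simp add: laplace_def)
      also have "\<dots> = (LINT x|?M. (\<Sum>p\<in>\<P>. complex_of_real (r p) * (?K p x * exp (blinfun_apply \<xi> x))))"
        by (intro Bochner_Integration.integral_sum[symmetric] integrable_mult_right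
            integrable_bounded_kernel[OF lf] bounded_kernel_exp bk[OF _ nz])
      also have "\<dots> = (LINT x|?M. (\<Sum>p\<in>\<P>. complex_of_real (r p) * ?K p x) * exp (blinfun_apply \<xi> x))"
        by (simp add: sum_distrib_right mult.assoc)
      also have "\<dots> = (LINT x|?M. bdiff us (\<lambda>x. \<Sum>p\<in>\<P>. complex_of_real (r p) * indicator p x) x * exp (blinfun_apply \<xi> x))"
        by (simp only: bdiff_sum)
      also have "(\<lambda>x. \<Sum>p\<in>\<P>. complex_of_real (r p) * indicator p x) = (\<lambda>_. 0)"
      proof
        fix x
        have "(\<Sum>p\<in>\<P>. complex_of_real (r p) * indicator p x) = complex_of_real (\<Sum>p\<in>\<P>. r p * indicator p x)"
          by (auto simp: indicator_def of_bool_def intro!: sum.cong)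
        then show "(\<Sum>p\<in>\<P>. complex_of_real (r p) * indicator p x) = 0" by (simp only: rel of_real_0)
      qed
      also have "bdiff us (\<lambda>_. 0) = (\<lambda>_. 0 :: complex)" by (induction us) auto
      finally show "(\<Sum>p\<in>\<P>. complex_of_real (r p) * ?S p \<xi>) = 0" using nz by simp
    qed
  next
    fix p assume "semi_rational_polyhedron \<Lambda> p \<and> contains_line p"
    then have "bdiff (ws p) (indicator p :: 'a \<Rightarrow> complex) = (\<lambda>_. 0)" using kl by (auto simp: kernel_list_def)
    then show "\<forall>\<^sub>F \<xi> in germ0. ?S p \<xi> = 0" by (simp add: S laplace_def)
  next
    fix p assume p: "semi_rational_polyhedron \<Lambda> p"
    have pb: "p \<in> sets borel" using closed_semi_rational_polyhedron[OF p] by simp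
    have k: "set (ws p) \<subseteq> \<Lambda> - {0}" using kl[OF p] by (simp add: kernel_list_def)
    show "\<forall>\<^sub>F \<xi> in germ0. intermediate_sum_converges \<Lambda> L p \<xi> \<longrightarrow> ?S p \<xi> = intermediate_sum \<Lambda> L p \<xi>"
    proof (rule eventually_mono[OF eventually_germ0_exp[OF finite_set[of "ws p"]]])
      show "0 \<notin> set (ws p)" using k by auto
      fix \<xi> :: "'a cdual"
      assume "\<forall>w\<in>set (ws p). blinfun_apply \<xi> w \<noteq> 0 \<and> exp (blinfun_apply \<xi> w) \<noteq> 1"
      then have nz: "(\<Prod>w\<leftarrow>ws p. 1 - exp (blinfun_apply \<xi> w)) \<noteq> 0" by (intro prod_list_ne_0) force
      show "intermediate_sum_converges \<Lambda> L p \<xi> \<longrightarrow> ?S p \<xi> = intermediate_sum \<Lambda> L p \<xi>"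
      proof
        assume c: "intermediate_sum_converges \<Lambda> L p \<xi>"
        have ind: "indicator p x *\<^sub>R exp (blinfun_apply \<xi> x) = indicator p x * exp (blinfun_apply \<xi> x)" for x
          by (simp add: indicator_def)
        have "integrable ?M (\<lambda>x. indicator p x * exp (blinfun_apply \<xi> x))"
          using intermediate_sum_slice(1)[OF \<Lambda> L pb, of \<xi>] c unfolding set_integrable_def ind by blast
        then have "laplace ?M (bdiff (ws p) (indicator p)) \<xi> = (\<Prod>w\<leftarrow>ws p. 1 - exp (blinfun_apply \<xi> w)) *
            (LINT x|?M. indicator p x * exp (blinfun_apply \<xi> x))"
          using k pb by (intro integral_bdiff_exp[OF inv sets, THEN conjunct2]) auto
        moreover have "intermediate_sum \<Lambda> L p \<xi> = (LINT x|?M. indicator p x * exp (blinfun_apply \<xi> x))"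
          using intermediate_sum_slice(2)[OF \<Lambda> L pb c] unfolding set_lebesgue_integral_def ind .
        ultimately show "?S p \<xi> = intermediate_sum \<Lambda> L p \<xi>" using nz by (simp add: S)
      qed
    qed
  qed
qed

lemma intermediate_gf_valuation:
  fixes \<Lambda> :: "'a::euclidean_space set"
  assumes "lattice_in \<Lambda> UNIV" "rational_subspace \<Lambda> L"
  shows "intermediate_valuation \<Lambda> L (intermediate_gf \<Lambda> L)"
  unfolding intermediate_gf_def by (rule someI[of "intermediate_valuation \<Lambda> L", OF intermediate_valuation_exists[OF assms]])

section \<open>Generating functions of cones\<close>

text \<open>The union is that of the translates of \<open>A\<close> by \<open>n\<close> times
  \<open>w\<close>. Each step multiplies the mass weighted by the exponential by the same number
  below 1, and a geometric series bounds the total.\<close>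

lemma nn_integral_exp_translates_finite:
  fixes \<Lambda> :: "'a::euclidean_space set" and \<xi> :: "'a cdual"
  assumes M: "invariant_measure \<Lambda> M" "sets M = sets borel" and \<Lambda>: "lattice_in \<Lambda> UNIV" and w: "w \<in> \<Lambda>"
    and q: "norm (exp (blinfun_apply \<xi> w)) < 1"
    and A: "A \<in> sets borel" "(\<integral>\<^sup>+x. ennreal (norm (exp (blinfun_apply \<xi> x))) * indicator A x \<partial>M) < \<infinity>"
  shows "(\<integral>\<^sup>+x. ennreal (norm (exp (blinfun_apply \<xi> x))) * indicator (\<Union>n::nat. (\<lambda>y. y - real n *\<^sub>R w) -` A) x \<partial>M) < \<infinity>"
proof -
  define g where "g x = ennreal (norm (exp (blinfun_apply \<xi> x)))" for x
  have g: "g \<in> borel_measurable borel"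
    unfolding g_def using borel_measurable_continuous_onI[OF continuous_on_cexp_blinfun, of \<xi>] by measurable
  have gM: "g \<in> borel_measurable M" using g by (simp only: measurable_cong_sets[OF M(2) refl, of borel])
  let ?A = "\<lambda>n::nat. (\<lambda>y. y - real n *\<^sub>R w) -` A"
  have An: "?A n \<in> sets borel" for n
    using measurable_sets[of "\<lambda>y. y - real n *\<^sub>R w" borel borel A] A(1) by simp
  have AnM: "range ?A \<subseteq> sets M" using An M(2) by auto
  let ?N = "density M g"
  have N: "emeasure ?N B = (\<integral>\<^sup>+x. g x * indicator B x \<partial>M)" if "B \<in> sets borel" for B
    using gM that M(2) by (intro emeasure_density) auto
  define q' where "q' = norm (exp (blinfun_apply \<xi> w))"
  have q': "0 \<le> q'" "q' < 1" using q by (auto simp: q'_def)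
  have step: "emeasure ?N (?A n) = ennreal (q' ^ n) * emeasure ?N A" for n
  proof -
    let ?l = "real n *\<^sub>R w"
    have l: "?l \<in> \<Lambda>" using lattice_scale[OF \<Lambda> w, of "int n"] by simp
    have "norm (exp (blinfun_apply \<xi> (x + ?l))) = q' ^ n * norm (exp (blinfun_apply \<xi> x))" for x
    proof -
      have "exp (blinfun_apply \<xi> (x + ?l)) = exp (blinfun_apply \<xi> w) ^ n * exp (blinfun_apply \<xi> x)"
        by (simp add: blinfun.bilinear_simps exp_add scaleR_conv_of_real exp_of_nat_mult)
      then show ?thesis by (simp add: norm_mult norm_power q'_def)
    qed
    then have gs: "g (x + ?l) = ennreal (q' ^ n) * g x" for x
      unfolding g_def using q' by (simp add: ennreal_mult)
    have "(\<lambda>x. g x * indicator (?A n) x) \<in> borel_measurable borel" using g An[of n] by measurable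
    from nn_integral_invariant[OF M l this]
    have "emeasure ?N (?A n) = (\<integral>\<^sup>+x. g (x + ?l) * indicator (?A n) (x + ?l) \<partial>M)" by (simp add: N[OF An])
    also have "\<dots> = (\<integral>\<^sup>+x. ennreal (q' ^ n) * (g x * indicator A x) \<partial>M)"
      unfolding gs by (intro nn_integral_cong) (auto simp: indicator_def mult.assoc)
    also have "\<dots> = ennreal (q' ^ n) * (\<integral>\<^sup>+x. g x * indicator A x \<partial>M)"
    proof (rule nn_integral_cmult)
      have "(\<lambda>x. g x * indicator A x) \<in> borel_measurable borel" using g A(1) by measurable
      then show "(\<lambda>x. g x * indicator A x) \<in> borel_measurable M"
        by (simp only: measurable_cong_sets[OF M(2) refl, of borel])
    qed
    finally show ?thesis by (simp add: N[OF A(1)])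
  qed
  have "emeasure ?N (\<Union>n. ?A n) \<le> (\<Sum>n. emeasure ?N (?A n))"
    using AnM by (intro emeasure_subadditive_countably) simp
  also have "\<dots> = (\<Sum>n. ennreal (q' ^ n)) * emeasure ?N A"
    unfolding step by (simp add: ennreal_suminf_multc)
  also have "(\<Sum>n. ennreal (q' ^ n)) = ennreal (1 / (1 - q'))"
    using q' by (intro suminf_ennreal_eq geometric_sums) auto
  also have "ennreal (1 / (1 - q')) * emeasure ?N A < \<infinity>"
    using A(2) N[OF A(1)] by (simp add: ennreal_mult_less_top g_def)
  finally have "emeasure ?N (\<Union>n. ?A n) < \<infinity>" .
  moreover have "(\<Union>n. ?A n) \<in> sets borel" using An by auto
  ultimately show ?thesis using N unfolding g_def by auto
qed

text \<open>A ball has finite weighted mass. It can be enlarged to a set closed under adding each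
  generator, still of finite mass; taking integer parts of the coefficients shows that this set
  covers the translated cone.\<close>

lemma integrable_exp_ncone:
  fixes \<Lambda> :: "'a::euclidean_space set"
  assumes M: "invariant_measure \<Lambda> M" "locally_finite_borel M" and \<Lambda>: "lattice_in \<Lambda> UNIV"
    and ws: "set ws \<subseteq> \<Lambda>" "\<And>w. w \<in> set ws \<Longrightarrow> Re (blinfun_apply \<xi> w) < 0"
    and p: "p \<in> sets borel" "p \<subseteq> (+) s ` ncone (set ws)"
  shows "integrable M (\<lambda>x. indicator p x * exp (blinfun_apply \<xi> x))"
proof -
  have setsM: "sets M = sets borel" using M(2) by (simp add: locally_finite_borel_def)
  have mM: "borel_measurable M = borel_measurable borel" by (rule measurable_cong_sets[OF setsM refl])
  define J where "J A = (\<integral>\<^sup>+x. ennreal (norm (exp (blinfun_apply \<xi> x))) * indicator A x \<partial>M)" for A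
  \<comment> \<open>Saturating under a further \<open>w\<close> keeps the closure under the earlier
    vectors, because translations commute.\<close>
  have "\<exists>A'. A' \<in> sets borel \<and> J A' < \<infinity> \<and> A \<subseteq> A' \<and> (\<forall>w\<in>set vs. \<forall>x\<in>A'. x + w \<in> A')"
    if "A \<in> sets borel" "J A < \<infinity>" "set vs \<subseteq> set ws" for vs A
    using that
  proof (induction vs)
    case (Cons w vs)
    then obtain A' where A': "A' \<in> sets borel" "J A' < \<infinity>" "A \<subseteq> A'" "\<forall>w\<in>set vs. \<forall>x\<in>A'. x + w \<in> A'" by auto
    let ?A = "\<Union>n::nat. (\<lambda>y. y - real n *\<^sub>R w) -` A'"
    have w: "w \<in> \<Lambda>" "norm (exp (blinfun_apply \<xi> w)) < 1" using Cons.prems(3) ws by auto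
    have 1: "J ?A < \<infinity>"
      using nn_integral_exp_translates_finite[OF M(1) setsM \<Lambda> w A'(1)] A'(2) unfolding J_def .
    have "(\<lambda>y. y - real n *\<^sub>R w) -` A' \<in> sets borel" for n
      using measurable_sets[of "\<lambda>y. y - real n *\<^sub>R w" borel borel A'] A'(1) by simp
    then have 2: "?A \<in> sets borel" by auto
    have 3: "A \<subseteq> ?A"
    proof
      fix x assume "x \<in> A"
      then have "x - real 0 *\<^sub>R w \<in> A'" using A'(3) by auto
      then show "x \<in> ?A" by blast
    qed
    have 4: "x + u \<in> ?A" if "u \<in> set (w # vs)" "x \<in> ?A" for u x
    proof -
      obtain n where n: "x - real n *\<^sub>R w \<in> A'" using \<open>x \<in> ?A\<close> by blast
      show ?thesis
      proof (cases "u = w")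
        case True
        have "x + w - real (Suc n) *\<^sub>R w \<in> A'" using n by (simp add: algebra_simps)
        then show ?thesis unfolding True by blast
      next
        case False
        then have "(x - real n *\<^sub>R w) + u \<in> A'" using that(1) A'(4) n by auto
        then have "x + u - real n *\<^sub>R w \<in> A'" by (simp add: algebra_simps)
        then show ?thesis by blast
      qed
    qed
    show ?case by (intro exI[of _ ?A] conjI ballI 1 2 3 4)
  qed auto
  note closure = this
  \<comment> \<open>Large enough for every \<open>s + \<Sum> t w *\<^sub>R w\<close> with
    coefficients \<open>t w\<close> between 0 and 1, the points left after removing integer
    parts.\<close>
  define R where "R = norm s + (\<Sum>w\<in>set ws. norm w)"
  have "J (cball 0 R) < \<infinity>"
  proof -
    have "bounded_kernel (indicator (cball (0::'a) R))"
      by (rule bounded_kernelI[of _ 1 R]) (auto simp: indicator_def intro!: borel_measurable_indicator)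
    then have "integrable M (\<lambda>x. indicator (cball 0 R) x * exp (blinfun_apply \<xi> x))"
      by (intro integrable_bounded_kernel[OF M(2)] bounded_kernel_exp)
    then have "(\<integral>\<^sup>+x. ennreal (norm (indicator (cball 0 R) x * exp (blinfun_apply \<xi> x))) \<partial>M) < \<infinity>"
      by (simp add: integrable_iff_bounded)
    moreover have "ennreal (norm (indicator (cball 0 R) x * exp (blinfun_apply \<xi> x)))
        = ennreal (norm (exp (blinfun_apply \<xi> x))) * indicator (cball 0 R) x" for x
      by (simp add: indicator_def)
    ultimately show ?thesis by (simp add: J_def)
  qed
  then obtain A where A: "A \<in> sets borel" "J A < \<infinity>" "cball 0 R \<subseteq> A" "\<And>w x. w \<in> set ws \<Longrightarrow> x \<in> A \<Longrightarrow> x + w \<in> A"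
    using closure[of "cball 0 R" ws] by auto
  have An: "x + real n *\<^sub>R w \<in> A" if "w \<in> set ws" "x \<in> A" for w x n
  proof (induction n)
    case (Suc n)
    then have "x + real n *\<^sub>R w + w \<in> A" using A(4)[OF that(1)] by blast
    then show ?case by (simp add: algebra_simps)
  qed (use that in simp)
  have As: "x + (\<Sum>w\<in>W. real (k w) *\<^sub>R w) \<in> A" if "finite W" "W \<subseteq> set ws" "x \<in> A" for W x and k :: "'a \<Rightarrow> nat"
    using that
  proof (induction W arbitrary: x rule: finite_induct)
    case (insert w W)
    then have "x + real (k w) *\<^sub>R w \<in> A" using An by auto
    then have "x + real (k w) *\<^sub>R w + (\<Sum>w\<in>W. real (k w) *\<^sub>R w) \<in> A" using insert by auto
    then show ?case using insert.hyps by (simp add: add.assoc)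
  qed simp
  have "p \<subseteq> A"
  proof
    fix x assume "x \<in> p"
    then obtain t where t: "x = s + (\<Sum>w\<in>set ws. t w *\<^sub>R w)" "\<forall>w\<in>set ws. 0 \<le> t w"
      using p(2) unfolding ncone_def by blast
    define k where "k w = nat \<lfloor>t w\<rfloor>" for w
    have k: "0 \<le> t w - real (k w)" "t w - real (k w) \<le> 1" if "w \<in> set ws" for w
      using t(2) that unfolding k_def by (simp_all add: of_nat_nat) (linarith)+
    have "norm (s + (\<Sum>w\<in>set ws. (t w - real (k w)) *\<^sub>R w)) \<le> R"
      unfolding R_def
    proof (intro norm_triangle_mono order_refl sum_norm_le)
      fix w assume "w \<in> set ws"
      then show "norm ((t w - real (k w)) *\<^sub>R w) \<le> norm w"
        using k[of w] mult_right_mono[of "t w - real (k w)" 1 "norm w"] by simp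
    qed
    then have "s + (\<Sum>w\<in>set ws. (t w - real (k w)) *\<^sub>R w) \<in> A" using A(3) by auto
    then have "s + (\<Sum>w\<in>set ws. (t w - real (k w)) *\<^sub>R w) + (\<Sum>w\<in>set ws. real (k w) *\<^sub>R w) \<in> A"
      by (intro As) auto
    then show "x \<in> A" unfolding t(1) by (simp add: scaleR_left_diff_distrib sum_subtractf)
  qed
  have "(\<integral>\<^sup>+x. ennreal (norm (indicator p x * exp (blinfun_apply \<xi> x))) \<partial>M) \<le> J A"
    unfolding J_def using \<open>p \<subseteq> A\<close> by (intro nn_integral_mono) (auto simp: indicator_def)
  also have "\<dots> < \<infinity>" by (rule A(2))
  finally show ?thesis
    using borel_measurable_continuous_onI[OF continuous_on_cexp_blinfun, of \<xi>] p(1)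
    by (intro integrableI_bounded) (auto simp: mM intro!: borel_measurable_times borel_measurable_indicator)
qed

text \<open>Where the exponential decays along every generator, so that the integrals and sums over
  the cone and its translates converge.\<close>

definition neg_region :: "'a::real_normed_vector list \<Rightarrow> 'a cdual set" where
  "neg_region ws = {\<xi>. \<forall>w\<in>set ws. Re (blinfun_apply \<xi> w) < 0}"

lemma open_neg_region: "open (neg_region ws)"
proof -
  have "neg_region ws = (\<Inter>w\<in>set ws. {\<xi>. Re (blinfun_apply \<xi> w) < 0})" by (auto simp: neg_region_def)
  moreover have "open {\<xi> :: 'a cdual. Re (blinfun_apply \<xi> w) < 0}" for w
    by (intro open_Collect_less continuous_intros linear_continuous_on blinfun.bounded_linear_left)
  ultimately show ?thesis by auto
qed

text \<open>Unlike in \<open>kernel_list\<close>, the vectors must generate the cone exactly and the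
  cone must be pointed; this yields convergence on a set that approaches 0.\<close>

definition cone_list :: "'a::euclidean_space set \<Rightarrow> 'a set \<Rightarrow> 'a list \<Rightarrow> bool" where
  "cone_list \<Lambda> c ws \<longleftrightarrow> rational_cone \<Lambda> c \<and> \<not> contains_line c \<and> set ws \<subseteq> \<Lambda> - {0} \<and> c = ncone (set ws)"

text \<open>The sum of the defining functionals of a pointed cone is negative on every nonzero
  vector of it; small positive multiples of that sum tend to 0.\<close>

lemma neg_region_meets:
  fixes c :: "'a::euclidean_space set"
  assumes c: "cone_list \<Lambda> c ws" and U: "open U" "0 \<in> U"
  shows "U \<inter> neg_region ws \<noteq> {}"
proof -
  obtain H where H: "finite H" "H \<subseteq> dual_lattice \<Lambda>" "c = {x. \<forall>\<mu>\<in>H. blinfun_apply \<mu> x \<le> 0}"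
    using c unfolding cone_list_def rational_cone_def by blast
  define \<mu>0 where "\<mu>0 = complexify (\<Sum>\<mu>\<in>H. \<mu>)"
  have neg: "Re (blinfun_apply \<mu>0 w) < 0" if w: "w \<in> set ws" for w
  proof -
    have wc: "w \<in> c" "w \<noteq> 0" using c w ncone_base[of "set ws" w] by (auto simp: cone_list_def)
    then have le: "blinfun_apply \<mu> w \<le> 0" if "\<mu> \<in> H" for \<mu> using H(3) that by auto
    have "\<exists>\<mu>\<in>H. blinfun_apply \<mu> w \<noteq> 0"
    proof (rule ccontr)
      assume "\<not> ?thesis"
      then have "contains_line c" unfolding contains_line_def H(3) using wc(2)
        by (intro exI[of _ 0] exI[of _ w]) (simp add: blinfun.scaleR_right)
      then show False using c by (simp add: cone_list_def)
    qed
    then obtain \<mu> where \<mu>: "\<mu> \<in> H" "blinfun_apply \<mu> w < 0" using le by (meson less_le)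
    have "(\<Sum>\<mu>\<in>H. blinfun_apply \<mu> w) < 0"
      using sum_strict_mono_ex1[OF H(1), of "\<lambda>\<mu>. blinfun_apply \<mu> w" "\<lambda>_. 0"] le \<mu> by auto
    then show ?thesis by (simp add: \<mu>0_def blinfun.sum_left)
  qed
  have "((\<lambda>t::real. t *\<^sub>R \<mu>0) \<longlongrightarrow> 0 *\<^sub>R \<mu>0) (at_right 0)" by (intro tendsto_intros)
  then have "\<forall>\<^sub>F t::real in at_right 0. t *\<^sub>R \<mu>0 \<in> U" using U by (intro topological_tendstoD) auto
  moreover have "\<forall>\<^sub>F t::real in at_right 0. 0 < t" by (rule eventually_at_right_less)
  ultimately have "\<forall>\<^sub>F t::real in at_right 0. t *\<^sub>R \<mu>0 \<in> U \<and> 0 < t" by (rule eventually_conj)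
  then obtain t :: real where t: "t *\<^sub>R \<mu>0 \<in> U" "0 < t"
    using eventually_happens'[OF trivial_limit_at_right_real] by blast
  have "t *\<^sub>R \<mu>0 \<in> neg_region ws"
    using neg t(2) by (auto simp: neg_region_def blinfun.bilinear_simps mult_pos_neg)
  with t(1) show ?thesis by blast
qed

lemma closed_rational_cone:
  assumes "rational_cone \<Lambda> c" shows "closed c"
proof -
  obtain H where H: "finite H" "H \<subseteq> dual_lattice \<Lambda>" "c = {x. \<forall>\<mu>\<in>H. blinfun_apply \<mu> x \<le> 0}"
    using assms unfolding rational_cone_def by blast
  have "c = (\<Inter>\<mu>\<in>H. {x. blinfun_apply \<mu> x \<le> 0})" unfolding H(3) by auto
  moreover have "closed {x. blinfun_apply \<mu> x \<le> 0}" for \<mu> :: "'a \<Rightarrow>\<^sub>L real"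
    by (intro closed_Collect_le continuous_intros)
  ultimately show ?thesis by (simp only:) (rule closed_INT, simp)
qed

lemma bounded_kernel_cone:
  fixes c :: "'a::euclidean_space set"
  assumes c: "cone_list \<Lambda> c ws"
  shows "bounded_kernel (bdiff ws (indicator c))"
proof -
  obtain H where H: "finite H" "H \<subseteq> dual_lattice \<Lambda>" "c = {x. \<forall>\<mu>\<in>H. blinfun_apply \<mu> x \<le> 0}"
    using c unfolding cone_list_def rational_cone_def by blast
  let ?H = "(\<lambda>\<mu>. (\<mu>, 0::real)) ` H"
  let ?f = "indicator c :: 'a \<Rightarrow> complex"
  have 1: "finite ?H" using H(1) by simp
  have 2: "c = {x. \<forall>(\<mu>, b)\<in>?H. \<mu> x \<le> b}" unfolding H(3) by auto
  have 3: "{x. \<forall>(\<mu>, b)\<in>?H. blinfun_apply \<mu> x \<le> 0} = ncone (set ws)"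
    using c unfolding cone_list_def H(3) by auto
  obtain r where r: "\<And>x. bdiff ws ?f x \<noteq> 0 \<Longrightarrow> norm x \<le> r"
    by (rule bdiff_polyhedron_support[OF 1 2 3]) blast
  have fb: "?f \<in> borel_measurable borel"
    using c unfolding cone_list_def by (intro borel_measurable_indicator borel_closed closed_rational_cone[of \<Lambda>]) blast
  show ?thesis
  proof (rule bounded_kernelI[OF bdiff_borel[OF fb]])
    show "norm (bdiff ws ?f x) \<le> 2 ^ length ws * 1" for x
      by (rule bdiff_norm_le) (simp add: indicator_def)
  qed (rule r)
qed

lemma locally_finite_translate:
  assumes "locally_finite_borel M"
  shows "locally_finite_borel (distr M borel (\<lambda>x. x - s))"
  unfolding locally_finite_borel_def
proof (intro conjI allI)
  fix r :: real
  have m: "(\<lambda>x. x - s) \<in> measurable M borel" by (simp add: locally_finite_borel_measurable[OF assms])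
  have "emeasure (distr M borel (\<lambda>x. x - s)) (cball 0 r) = emeasure M ((\<lambda>x. x - s) -` cball 0 r \<inter> space M)"
    using m by (intro emeasure_distr) auto
  also have "\<dots> \<le> emeasure M (cball 0 (r + norm s))"
  proof (rule emeasure_mono)
    show "(\<lambda>x. x - s) -` cball 0 r \<inter> space M \<subseteq> cball 0 (r + norm s)"
    proof
      fix x assume "x \<in> (\<lambda>x. x - s) -` cball 0 r \<inter> space M"
      then show "x \<in> cball 0 (r + norm s)" using norm_triangle_sub[of x s] by auto
    qed
  qed (use assms in \<open>simp add: locally_finite_borel_def\<close>)
  also have "\<dots> < \<infinity>" using assms by (simp add: locally_finite_borel_def)
  finally show "emeasure (distr M borel (\<lambda>x. x - s)) (cball 0 r) < \<infinity>" .
qed simp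

text \<open>The chosen valuation is known only where the sum converges; membership in
  \<open>Ml\<close> and \<open>Ml_eqI\<close> determine its germ. The factor
  \<open>exp (- \<xi> s)\<close> is absorbed by translating the measure, so the kernel is the same
  for all \<open>s\<close> and only the measure moves.\<close>

lemma shifted_gf_germ:
  fixes \<Lambda> L c :: "'a::euclidean_space set"
  assumes \<Lambda>: "lattice_in \<Lambda> UNIV" and L: "rational_subspace \<Lambda> L" and c: "cone_list \<Lambda> c ws"
  shows "\<forall>\<^sub>F \<xi> in germ0. shifted_gf \<Lambda> L s c \<xi> =
    laplace (distr (slice_measure \<Lambda> L) borel (\<lambda>x. x - s)) (bdiff ws (indicator c)) \<xi> / (\<Prod>w\<leftarrow>ws. 1 - exp (blinfun_apply \<xi> w))"
proof -
  let ?M = "slice_measure \<Lambda> L" and ?p = "(+) s ` c"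
  let ?S = "intermediate_gf \<Lambda> L"
  have lf: "locally_finite_borel ?M" and inv: "invariant_measure \<Lambda> ?M"
    using slice_locally_finite[OF \<Lambda> L] slice_invariant[OF \<Lambda> L] by auto
  have sets: "sets ?M = sets borel" by (rule sets_slice_measure[OF \<Lambda> L])
  obtain H where H: "finite H" "H \<subseteq> dual_lattice \<Lambda>" "c = {x. \<forall>\<mu>\<in>H. blinfun_apply \<mu> x \<le> 0}"
    using c unfolding cone_list_def rational_cone_def by blast
  have memb: "x \<in> ?p \<longleftrightarrow> x - s \<in> c" for x
    by (auto intro!: image_eqI[of x "(+) s" "x - s"])
  have p: "semi_rational_polyhedron \<Lambda> ?p"
    unfolding semi_rational_polyhedron_def
  proof (intro exI[of _ "(\<lambda>\<mu>. (\<mu>, blinfun_apply \<mu> s)) ` H"] conjI)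
    show "?p = {x. \<forall>(\<mu>, b)\<in>(\<lambda>\<mu>. (\<mu>, blinfun_apply \<mu> s)) ` H. \<mu> x \<le> b}"
      using memb unfolding H(3) by (auto simp: blinfun.diff_right)
  qed (use H in auto)
  have pb: "?p \<in> sets borel" using closed_semi_rational_polyhedron[OF p] by simp
  have ws: "0 \<notin> set ws" "set ws \<subseteq> \<Lambda>" and cn: "c = ncone (set ws)" using c by (auto simp: cone_list_def)
  let ?f = "indicator ?p :: 'a \<Rightarrow> complex"
  have shift: "bdiff ws ?f x = bdiff ws (indicator c) (x - s)" for x
  proof -
    have "?f = (\<lambda>x. indicator c (x - s))" by (auto simp: indicator_def memb fun_eq_iff)
    then show ?thesis by (simp only: bdiff_shift)
  qed
  have bk: "bounded_kernel (bdiff ws ?f)"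
    unfolding shift[abs_def] by (rule bounded_kernel_shift[OF bounded_kernel_cone[OF c]])
  have val: "intermediate_valuation \<Lambda> L ?S" by (rule intermediate_gf_valuation[OF \<Lambda> L])
  have "\<forall>\<^sub>F \<xi> in germ0. ?S ?p \<xi> = laplace ?M (bdiff ws ?f) \<xi> / (\<Prod>w\<leftarrow>ws. 1 - exp (blinfun_apply \<xi> w))"
  proof (rule Ml_eqI[OF _ cdual_holomorphic_on_laplace[OF lf bk] ws(1) open_neg_region neg_region_meets[OF c]])
    show "?S ?p \<in> Ml" using val p unfolding intermediate_valuation_def by blast
    have "\<forall>\<^sub>F \<xi> in germ0. intermediate_sum_converges \<Lambda> L ?p \<xi> \<longrightarrow> ?S ?p \<xi> = intermediate_sum \<Lambda> L ?p \<xi>"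
      using val p unfolding intermediate_valuation_def by blast
    then show "\<forall>\<^sub>F \<xi> in germ0. \<xi> \<in> neg_region ws \<longrightarrow>
       ?S ?p \<xi> = laplace ?M (bdiff ws ?f) \<xi> / (\<Prod>w\<leftarrow>ws. 1 - exp (blinfun_apply \<xi> w))"
      using eventually_germ0_exp[OF finite_set ws(1)]
    proof eventually_elim
      case (elim \<xi>)
      have nz: "(\<Prod>w\<leftarrow>ws. 1 - exp (blinfun_apply \<xi> w)) \<noteq> 0" using elim(2) by (intro prod_list_ne_0) force
      have ind: "indicator ?p x *\<^sub>R exp (blinfun_apply \<xi> x) = indicator ?p x * exp (blinfun_apply \<xi> x)" for x
        by (simp add: indicator_def)
      show ?case
      proof
        assume "\<xi> \<in> neg_region ws"
        then have int: "integrable ?M (\<lambda>x. indicator ?p x * exp (blinfun_apply \<xi> x))"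
          using ws(2) pb cn by (intro integrable_exp_ncone[OF inv lf \<Lambda>, of ws \<xi> ?p s]) (auto simp: neg_region_def)
        then have cv: "intermediate_sum_converges \<Lambda> L ?p \<xi>"
          unfolding intermediate_sum_slice(1)[OF \<Lambda> L pb] set_integrable_def ind .
        have "?S ?p \<xi> = (LINT x|?M. indicator ?p x * exp (blinfun_apply \<xi> x))"
          using elim(1) cv intermediate_sum_slice(2)[OF \<Lambda> L pb cv] unfolding set_lebesgue_integral_def ind by simp
        moreover have "laplace ?M (bdiff ws ?f) \<xi> = (\<Prod>w\<leftarrow>ws. 1 - exp (blinfun_apply \<xi> w)) *
          (LINT x|?M. indicator ?p x * exp (blinfun_apply \<xi> x))"
          using pb int by (intro integral_bdiff_exp[OF inv sets ws(2), THEN conjunct2]) auto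
        ultimately show "?S ?p \<xi> = laplace ?M (bdiff ws ?f) \<xi> / (\<Prod>w\<leftarrow>ws. 1 - exp (blinfun_apply \<xi> w))"
          using nz by simp
      qed
    qed
  qed
  then show ?thesis
  proof eventually_elim
    case (elim \<xi>)
    let ?h = "bdiff ws (indicator c) :: 'a \<Rightarrow> complex"
    have m: "(\<lambda>x. x - s) \<in> measurable ?M borel" by (simp add: locally_finite_borel_measurable[OF lf])
    have hm: "(\<lambda>x. ?h x * exp (blinfun_apply \<xi> x)) \<in> borel_measurable borel"
      by (rule bounded_kernel_borel[OF bounded_kernel_exp[OF bounded_kernel_cone[OF c]]])
    have "laplace (distr ?M borel (\<lambda>x. x - s)) ?h \<xi> = (LINT x|?M. ?h (x - s) * exp (blinfun_apply \<xi> (x - s)))"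
      unfolding laplace_def by (rule integral_distr[OF m hm])
    also have "\<dots> = (LINT x|?M. exp (- blinfun_apply \<xi> s) * (bdiff ws ?f x * exp (blinfun_apply \<xi> x)))"
      unfolding shift blinfun.diff_right exp_diff exp_minus
      by (intro Bochner_Integration.integral_cong refl) (simp add: field_simps)
    also have "\<dots> = exp (- blinfun_apply \<xi> s) * laplace ?M (bdiff ws ?f) \<xi>"
      unfolding laplace_def by (rule integral_mult_right_zero)
    finally show ?case using elim by (simp add: shifted_gf_def)
  qed
qed

section \<open>Homogeneous components\<close>

text \<open>These are the numbers \<open>- B_n / n!\<close> with the Bernoulli numbers
  \<open>B_n\<close> normalized by \<open>B_1 = - 1 / 2\<close>.\<close>

definition todd_coeff :: "nat \<Rightarrow> complex" where "todd_coeff n = fps_nth (fps_expansion todd 0) n"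

definition todd_fps :: "'a::real_normed_vector list \<Rightarrow> 'a cdual \<Rightarrow> complex fps" where
  "todd_fps ws \<xi> = (\<Prod>w\<leftarrow>ws. Abs_fps (\<lambda>n. todd_coeff n * blinfun_apply \<xi> w ^ n))"

lemma todd_fps_expansion:
  "(\<lambda>\<tau>. \<Prod>w\<leftarrow>ws. todd (blinfun_apply \<xi> w * \<tau>)) has_fps_expansion todd_fps ws \<xi>"
proof -
  obtain r where r: "0 < r" "todd holomorphic_on ball 0 r" by (rule todd_holomorphic)
  have T: "todd has_fps_expansion fps_expansion todd 0"
    by (rule has_fps_expansion_fps_expansion[OF open_ball _ r(2)]) (use r(1) in simp)
  have "(\<lambda>\<tau>. todd (blinfun_apply \<xi> w * \<tau>)) has_fps_expansion Abs_fps (\<lambda>n. todd_coeff n * blinfun_apply \<xi> w ^ n)" for w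
  proof -
    have "(\<lambda>\<tau>. blinfun_apply \<xi> w * \<tau>) has_fps_expansion (fps_const (blinfun_apply \<xi> w) * fps_X)"
      by (intro fps_expansion_intros)
    from has_fps_expansion_compose[OF T this]
    have "(\<lambda>\<tau>. todd (blinfun_apply \<xi> w * \<tau>)) has_fps_expansion
        fps_compose (fps_expansion todd 0) (fps_const (blinfun_apply \<xi> w) * fps_X)" by (simp add: o_def)
    moreover have "Abs_fps (\<lambda>n. todd_coeff n * blinfun_apply \<xi> w ^ n)
        = fps_compose (fps_expansion todd 0) (fps_const (blinfun_apply \<xi> w) * fps_X)"
      unfolding fps_compose_linear todd_coeff_def by (simp only: mult.commute)
    ultimately show ?thesis by (simp only:)
  qed
  then show ?thesis unfolding todd_fps_def
    by (induction ws) (auto intro!: has_fps_expansion_mult simp del: fps_mult_nth)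
qed

text \<open>A Cauchy product with the Todd series, since \<open>1 / (1 - exp z) = todd z / z\<close>.\<close>

definition laurent_numerator :: "'a::euclidean_space measure \<Rightarrow> ('a \<Rightarrow> complex) \<Rightarrow> 'a list \<Rightarrow> nat \<Rightarrow> 'a cdual \<Rightarrow> complex" where
  "laurent_numerator M g ws k \<xi> = (\<Sum>i=0..k. (LINT x|M. g x * blinfun_apply \<xi> x ^ i / fact i) * fps_nth (todd_fps ws \<xi>) (k - i))"

text \<open>The denominator contributes the power \<tau> to the number \<open>length ws\<close>, so
  degree \<open>m\<close> of the quotient comes from degree \<open>m + length ws\<close> of the
  numerator, with nothing below degree 0. This is a total function of \<xi>, with value 0 on the
  polar hyperplanes.\<close>

definition laurent_coeff :: "'a::euclidean_space measure \<Rightarrow> ('a \<Rightarrow> complex) \<Rightarrow> 'a list \<Rightarrow> int \<Rightarrow> 'a cdual \<Rightarrow> complex" where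
  "laurent_coeff M g ws m \<xi> = (if m + int (length ws) < 0 then 0 else laurent_numerator M g ws (nat (m + int (length ws))) \<xi>)
      / (\<Prod>w\<leftarrow>ws. blinfun_apply \<xi> w)"

lemma laurent_laplace_quotient:
  assumes M: "locally_finite_borel M" and g: "bounded_kernel g" and \<xi>: "\<And>w. w \<in> set ws \<Longrightarrow> blinfun_apply \<xi> w \<noteq> 0"
  obtains F where "(\<lambda>\<tau>. laplace M g (cscale \<tau> \<xi>) / (\<Prod>w\<leftarrow>ws. 1 - exp (\<tau> * blinfun_apply \<xi> w))) has_laurent_expansion F"
    "\<And>m. fls_nth F m = laurent_coeff M g ws m \<xi>"
proof -
  define A where "A = Abs_fps (\<lambda>n. LINT x|M. g x * blinfun_apply \<xi> x ^ n / fact n) * todd_fps ws \<xi>"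
  define P where "P = (\<Prod>w\<leftarrow>ws. blinfun_apply \<xi> w)"
  let ?N = "length ws"
  let ?n = "\<lambda>\<tau>. laplace M g (cscale \<tau> \<xi>) * (\<Prod>w\<leftarrow>ws. todd (blinfun_apply \<xi> w * \<tau>))"
  have "?n has_fps_expansion A" unfolding A_def
    by (intro has_fps_expansion_mult laplace_line_fps_expansion[OF M g] todd_fps_expansion)
  then have "?n has_laurent_expansion fps_to_fls A" by (rule has_laurent_expansion_fps)
  then have "(\<lambda>\<tau>. ?n \<tau> * \<tau> powi (- int ?N)) has_laurent_expansion fls_shift (int ?N) (fps_to_fls A)"
    by (rule has_laurent_expansion_shift')
  then have L: "(\<lambda>\<tau>. inverse P * (?n \<tau> * \<tau> powi (- int ?N))) has_laurent_expansion
      fls_const (inverse P) * fls_shift (int ?N) (fps_to_fls A)"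
    by (rule has_laurent_expansion_cmult_left)
  have ev: "\<forall>\<^sub>F \<tau> in at 0. inverse P * (?n \<tau> * \<tau> powi (- int ?N)) =
      laplace M g (cscale \<tau> \<xi>) / (\<Prod>w\<leftarrow>ws. 1 - exp (\<tau> * blinfun_apply \<xi> w))"
  proof (rule eventually_mono)
    show "\<forall>\<^sub>F \<tau> in at (0::complex). \<tau> \<noteq> 0" by (simp add: eventually_at_filter)
    fix \<tau> :: complex assume \<tau>: "\<tau> \<noteq> 0"
    have PN: "P * \<tau> ^ ?N = (\<Prod>w\<leftarrow>ws. blinfun_apply \<xi> w * \<tau>)"
      unfolding P_def by (induction ws) (auto simp: mult_ac)
    have "inverse P * (?n \<tau> * \<tau> powi (- int ?N)) =
        laplace M g (cscale \<tau> \<xi>) * ((\<Prod>w\<leftarrow>ws. todd (blinfun_apply \<xi> w * \<tau>)) / (P * \<tau> ^ ?N))"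
      by (simp add: power_int_minus field_simps)
    also have "(\<Prod>w\<leftarrow>ws. todd (blinfun_apply \<xi> w * \<tau>)) / (P * \<tau> ^ ?N)
        = (\<Prod>w\<leftarrow>ws. 1 / (1 - exp (\<tau> * blinfun_apply \<xi> w)))"
      unfolding PN prod_list_divide[symmetric] using \<xi> \<tau>
      by (intro arg_cong[where f=prod_list] map_cong refl) (simp add: todd_mult mult.commute[of \<tau>])
    also have "\<dots> = (\<Prod>w\<leftarrow>ws. 1) / (\<Prod>w\<leftarrow>ws. 1 - exp (\<tau> * blinfun_apply \<xi> w))" by (rule prod_list_divide)
    also have "(\<Prod>w\<leftarrow>ws. 1 :: complex) = 1" by (induction ws) auto
    finally show "inverse P * (?n \<tau> * \<tau> powi (- int ?N)) =
      laplace M g (cscale \<tau> \<xi>) / (\<Prod>w\<leftarrow>ws. 1 - exp (\<tau> * blinfun_apply \<xi> w))" by simp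
  qed
  show thesis
  proof (rule that)
    show "(\<lambda>\<tau>. laplace M g (cscale \<tau> \<xi>) / (\<Prod>w\<leftarrow>ws. 1 - exp (\<tau> * blinfun_apply \<xi> w))) has_laurent_expansion
      fls_const (inverse P) * fls_shift (int ?N) (fps_to_fls A)"
      using L has_laurent_expansion_cong[OF ev refl] by blast
    show "fls_nth (fls_const (inverse P) * fls_shift (int ?N) (fps_to_fls A)) m = laurent_coeff M g ws m \<xi>" for m
    proof -
      have "fps_nth A k = laurent_numerator M g ws k \<xi>" for k
        by (simp only: A_def laurent_numerator_def fps_mult_nth fps_nth_Abs_fps)
      then show ?thesis unfolding laurent_coeff_def P_def[symmetric] by (simp add: divide_inverse mult.commute)
    qed
  qed
qed

text \<open>Scaling preserves the complement of hyperplanes through 0 and brings any \<xi> close to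
  0. Agreement of germs therefore gives agreement along the whole punctured line near \<tau> = 0,
  for every \<xi> off the hyperplanes.\<close>

lemma homogeneous_component_germ:
  fixes f :: "'a::euclidean_space cdual \<Rightarrow> complex"
  assumes M: "locally_finite_borel M" and g: "bounded_kernel g" and ws: "0 \<notin> set ws"
    and f: "\<forall>\<^sub>F \<xi> in germ0. f \<xi> = laplace M g \<xi> / (\<Prod>w\<leftarrow>ws. 1 - exp (blinfun_apply \<xi> w))"
  shows "\<forall>\<^sub>F \<xi> in germ0. laurent_coeff M g ws m \<xi> = homogeneous_component m f \<xi>"
proof -
  obtain U W where U: "open U" "0 \<in> U" "finite W" "0 \<notin> W"
    "\<And>\<xi>. \<xi> \<in> U \<inter> off_hyperplanes W \<Longrightarrow> f \<xi> = laplace M g \<xi> / (\<Prod>w\<leftarrow>ws. 1 - exp (blinfun_apply \<xi> w))"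
    using f unfolding eventually_germ0 by blast
  have fin: "finite (W \<union> set ws)" "0 \<notin> W \<union> set ws" using U ws by auto
  show ?thesis
    using eventually_germ0_off[OF fin]
  proof eventually_elim
    case (elim \<xi>)
    then have \<xi>: "\<And>w. w \<in> set ws \<Longrightarrow> blinfun_apply \<xi> w \<noteq> 0" "\<And>w. w \<in> W \<Longrightarrow> blinfun_apply \<xi> w \<noteq> 0"
      by (auto simp: off_hyperplanes_def)
    obtain F where F: "(\<lambda>\<tau>. laplace M g (cscale \<tau> \<xi>) / (\<Prod>w\<leftarrow>ws. 1 - exp (\<tau> * blinfun_apply \<xi> w))) has_laurent_expansion F"
      "\<And>m. fls_nth F m = laurent_coeff M g ws m \<xi>" by (rule laurent_laplace_quotient[OF M g \<xi>(1)]) blast+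
    have "((\<lambda>\<tau>. cscale \<tau> \<xi>) \<longlongrightarrow> cscale 0 \<xi>) (at 0)"
      by (rule bounded_linear.tendsto[OF bounded_linear_cscale_left tendsto_ident_at])
    then have "\<forall>\<^sub>F \<tau> in at 0. cscale \<tau> \<xi> \<in> U" using U by (intro topological_tendstoD) auto
    moreover have "\<forall>\<^sub>F \<tau> in at (0::complex). \<tau> \<noteq> 0" by (simp add: eventually_at_filter)
    ultimately have ev: "\<forall>\<^sub>F \<tau> in at 0. f (cscale \<tau> \<xi>) =
        laplace M g (cscale \<tau> \<xi>) / (\<Prod>w\<leftarrow>ws. 1 - exp (\<tau> * blinfun_apply \<xi> w))"
    proof eventually_elim
      case (elim \<tau>)
      then have "cscale \<tau> \<xi> \<in> U \<inter> off_hyperplanes W" using \<xi>(2) by (auto simp: off_hyperplanes_def)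
      from U(5)[OF this] show ?case by simp
    qed
    have "(\<lambda>\<tau>. f (cscale \<tau> \<xi>)) has_laurent_expansion F"
      using F(1) has_laurent_expansion_cong[OF ev refl] by blast
    then show ?case unfolding homogeneous_component_def by (simp add: laurent_expansion_0_eqI F(2))
  qed
qed

subsection \<open>Membership in the rational function space\<close>

lemma polynomial_fun_sum:
  assumes "finite I" "\<And>i. i \<in> I \<Longrightarrow> polynomial_fun (p i)"
  shows "polynomial_fun (\<lambda>\<xi>. \<Sum>i\<in>I. p i \<xi>)"
  using assms
proof (induction rule: finite_induct)
  case empty
  show ?case by (simp only: sum.empty polynomial_fun.const)
next
  case (insert a I)
  have "polynomial_fun (\<lambda>\<xi>. p a \<xi> + (\<Sum>i\<in>I. p i \<xi>))"
    by (rule polynomial_fun.add) (use insert in blast)+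
  then show ?case by (simp only: sum.insert[OF insert.hyps])
qed

lemma polynomial_fun_power:
  assumes "polynomial_fun p" shows "polynomial_fun (\<lambda>\<xi>. p \<xi> ^ n)"
proof (induction n)
  case 0
  show ?case by (simp only: power_0 polynomial_fun.const)
next
  case (Suc n)
  show ?case unfolding power_Suc by (rule polynomial_fun.mult[OF assms Suc])
qed

text \<open>One factor \<open>blinfun_apply \<xi> x\<close> at a time is expanded in coordinates and
  the coordinate of \<open>x\<close> is absorbed into the kernel, hence the induction over all
  \<open>g\<close>.\<close>

lemma polynomial_fun_moment:
  fixes g :: "'a::euclidean_space \<Rightarrow> complex"
  assumes M: "locally_finite_borel M" and g: "bounded_kernel g"
  shows "polynomial_fun (\<lambda>\<xi>. LINT x|M. g x * blinfun_apply \<xi> x ^ i)"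
  using g
proof (induction i arbitrary: g)
  case 0
  show ?case by (simp only: power_0 polynomial_fun.const)
next
  case (Suc i)
  let ?g = "\<lambda>b x. g x * complex_of_real (x \<bullet> b)"
  have gb: "bounded_kernel (?g b)" for b
    by (rule bounded_kernel_mult[OF Suc.prems]) (intro continuous_intros)
  have eq: "(LINT x|M. g x * blinfun_apply \<xi> x ^ Suc i) =
      (\<Sum>b\<in>Basis. blinfun_apply \<xi> b * (LINT x|M. ?g b x * blinfun_apply \<xi> x ^ i))" for \<xi>
  proof -
    have "blinfun_apply \<xi> x = (\<Sum>b\<in>Basis. complex_of_real (x \<bullet> b) * blinfun_apply \<xi> b)" for x
    proof -
      have "blinfun_apply \<xi> x = blinfun_apply \<xi> (\<Sum>b\<in>Basis. (x \<bullet> b) *\<^sub>R b)" by (simp only: euclidean_representation)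
      then show ?thesis by (simp add: blinfun.sum_right blinfun.scaleR_right scaleR_conv_of_real)
    qed
    note expand = this
    have "g x * blinfun_apply \<xi> x ^ Suc i = (\<Sum>b\<in>Basis. blinfun_apply \<xi> b * (?g b x * blinfun_apply \<xi> x ^ i))" for x
    proof -
      have "g x * blinfun_apply \<xi> x ^ Suc i = (g x * blinfun_apply \<xi> x ^ i) * blinfun_apply \<xi> x"
        by (simp add: mult_ac)
      also have "\<dots> = (g x * blinfun_apply \<xi> x ^ i) * (\<Sum>b\<in>Basis. complex_of_real (x \<bullet> b) * blinfun_apply \<xi> b)"
        by (rule arg_cong[OF expand])
      also have "\<dots> = (\<Sum>b\<in>Basis. (g x * blinfun_apply \<xi> x ^ i) * (complex_of_real (x \<bullet> b) * blinfun_apply \<xi> b))"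
        by (rule sum_distrib_left)
      also have "\<dots> = (\<Sum>b\<in>Basis. blinfun_apply \<xi> b * (?g b x * blinfun_apply \<xi> x ^ i))"
        by (rule sum.cong) (simp_all add: mult_ac)
      finally show ?thesis .
    qed
    then have "(LINT x|M. g x * blinfun_apply \<xi> x ^ Suc i) =
        (LINT x|M. (\<Sum>b\<in>Basis. blinfun_apply \<xi> b * (?g b x * blinfun_apply \<xi> x ^ i)))" by (simp only:)
    also have "\<dots> = (\<Sum>b\<in>Basis. LINT x|M. blinfun_apply \<xi> b * (?g b x * blinfun_apply \<xi> x ^ i))"
      by (intro Bochner_Integration.integral_sum integrable_mult_right integrable_bounded_kernel[OF M] bounded_kernel_pow gb)
    also have "\<dots> = (\<Sum>b\<in>Basis. blinfun_apply \<xi> b * (LINT x|M. ?g b x * blinfun_apply \<xi> x ^ i))"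
      by (simp only: integral_mult_right_zero)
    finally show ?thesis .
  qed
  show ?case unfolding eq
    by (intro polynomial_fun_sum finite_Basis polynomial_fun.mult[OF polynomial_fun.pairing] Suc.IH gb)
qed

lemma polynomial_fun_todd_fps: "polynomial_fun (\<lambda>\<xi>. fps_nth (todd_fps ws \<xi>) n)"
proof (induction ws arbitrary: n)
  case Nil
  show ?case unfolding todd_fps_def by (simp add: polynomial_fun.const)
next
  case (Cons w ws)
  have eq: "fps_nth (todd_fps (w # ws) \<xi>) n =
      (\<Sum>i=0..n. (todd_coeff i * blinfun_apply \<xi> w ^ i) * fps_nth (todd_fps ws \<xi>) (n - i))" for \<xi>
    by (simp add: todd_fps_def fps_mult_nth)
  show ?case unfolding eq
    by (intro polynomial_fun_sum finite_atLeastAtMost)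
       (rule polynomial_fun.mult[OF polynomial_fun.mult[OF polynomial_fun.const polynomial_fun_power[OF polynomial_fun.pairing]] Cons])
qed

lemma todd_fps_scale: "fps_nth (todd_fps ws (cscale \<tau> \<xi>)) n = \<tau> ^ n * fps_nth (todd_fps ws \<xi>) n"
proof (induction ws arbitrary: n)
  case Nil
  show ?case by (simp add: todd_fps_def)
next
  case (Cons w ws)
  have eq: "fps_nth (todd_fps (w # ws) \<xi>) n =
      (\<Sum>i=0..n. (todd_coeff i * blinfun_apply \<xi> w ^ i) * fps_nth (todd_fps ws \<xi>) (n - i))" for \<xi>
    by (simp add: todd_fps_def fps_mult_nth)
  show ?case unfolding eq sum_distrib_left
  proof (rule sum.cong[OF refl])
    fix i assume "i \<in> {0..n}"
    then have "\<tau> ^ n = \<tau> ^ i * \<tau> ^ (n - i)" by (simp flip: power_add)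
    then show "todd_coeff i * blinfun_apply (cscale \<tau> \<xi>) w ^ i * fps_nth (todd_fps ws (cscale \<tau> \<xi>)) (n - i) =
      \<tau> ^ n * (todd_coeff i * blinfun_apply \<xi> w ^ i * fps_nth (todd_fps ws \<xi>) (n - i))"
      by (simp add: Cons power_mult_distrib)
  qed
qed

lemma polynomial_fun_laurent_numerator:
  assumes "locally_finite_borel M" "bounded_kernel g"
  shows "polynomial_fun (laurent_numerator M g ws k)"
proof -
  have eq: "laurent_numerator M g ws k = (\<lambda>\<xi>. \<Sum>i=0..k. (1 / fact i * (LINT x|M. g x * blinfun_apply \<xi> x ^ i)) * fps_nth (todd_fps ws \<xi>) (k - i))"
    by (rule ext) (simp add: laurent_numerator_def)
  show ?thesis unfolding eq
    by (intro polynomial_fun_sum finite_atLeastAtMost)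
       (rule polynomial_fun.mult[OF polynomial_fun.mult[OF polynomial_fun.const polynomial_fun_moment[OF assms]] polynomial_fun_todd_fps])
qed

lemma laurent_numerator_scale: "laurent_numerator M g ws k (cscale \<tau> \<xi>) = \<tau> ^ k * laurent_numerator M g ws k \<xi>"
  unfolding laurent_numerator_def sum_distrib_left
proof (rule sum.cong[OF refl])
  fix i assume "i \<in> {0..k}"
  then have \<tau>: "\<tau> ^ k = \<tau> ^ i * \<tau> ^ (k - i)" by (simp flip: power_add)
  have "(LINT x|M. g x * blinfun_apply (cscale \<tau> \<xi>) x ^ i / fact i) = (LINT x|M. \<tau> ^ i * (g x * blinfun_apply \<xi> x ^ i / fact i))"
    by (simp add: power_mult_distrib mult_ac)
  also have "\<dots> = \<tau> ^ i * (LINT x|M. g x * blinfun_apply \<xi> x ^ i / fact i)" by (rule integral_mult_right_zero)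
  finally show "(LINT x|M. g x * blinfun_apply (cscale \<tau> \<xi>) x ^ i / fact i) * fps_nth (todd_fps ws (cscale \<tau> \<xi>)) (k - i) =
    \<tau> ^ k * ((LINT x|M. g x * blinfun_apply \<xi> x ^ i / fact i) * fps_nth (todd_fps ws \<xi>) (k - i))"
    by (simp only: todd_fps_scale \<tau>) (simp only: mult_ac)
qed

lemma laurent_coeff_scale:
  assumes "\<tau> \<noteq> 0"
  shows "laurent_coeff M g ws m (cscale \<tau> \<xi>) = \<tau> powi m * laurent_coeff M g ws m \<xi>"
proof (cases "m + int (length ws) < 0")
  case False
  have "(\<Prod>w\<leftarrow>ws. blinfun_apply (cscale \<tau> \<xi>) w) = \<tau> ^ length ws * (\<Prod>w\<leftarrow>ws. blinfun_apply \<xi> w)"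
    by (induction ws) (auto simp: mult_ac)
  moreover have "\<tau> ^ nat (m + int (length ws)) = \<tau> powi m * \<tau> ^ length ws"
  proof -
    have "\<tau> ^ nat (m + int (length ws)) = \<tau> powi (m + int (length ws))"
      using False by (simp add: power_int_def)
    also have "\<dots> = \<tau> powi m * \<tau> powi (int (length ws))" using assms by (simp add: power_int_add)
    finally show ?thesis by simp
  qed
  ultimately show ?thesis using False assms by (simp add: laurent_coeff_def laurent_numerator_scale)
qed (simp add: laurent_coeff_def)

text \<open>The denominators formed with the lattice vectors \<open>w j\<close> and with the edge
  generators \<open>v j\<close> differ by the nonzero constant \<open>C\<close>, which moves into
  the polynomial.\<close>

lemma laurent_coeff_in_rational_space:
  assumes M: "locally_finite_borel M" and g: "bounded_kernel g"
    and s: "\<And>j. j \<in> {1..N} \<Longrightarrow> s j \<noteq> 0" "\<And>j. j \<in> {1..N} \<Longrightarrow> v j = s j *\<^sub>R w j"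
  shows "laurent_coeff M g (map w [1..<Suc N]) m \<in> rational_space N v m"
proof -
  let ?ws = "map w [1..<Suc N]"
  have prod: "(\<Prod>w\<leftarrow>?ws. f w) = (\<Prod>j=1..N. f (w j))" for f :: "'a \<Rightarrow> complex"
  proof -
    have "(\<Prod>w\<leftarrow>?ws. f w) = prod (\<lambda>j. f (w j)) (set [1..<Suc N])"
      by (subst prod.distinct_set_conv_list) (simp_all add: o_def del: upt_Suc)
    also have "set [1..<Suc N] = {1..N}" by auto
    finally show ?thesis .
  qed
  define C where "C = (\<Prod>j=1..N. complex_of_real (s j))"
  have C: "C \<noteq> 0" using s(1) by (simp add: C_def)
  have vw: "(\<Prod>j=1..N. blinfun_apply \<xi> (v j)) = C * (\<Prod>w\<leftarrow>?ws. blinfun_apply \<xi> w)" for \<xi> :: "'a cdual"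
  proof -
    have "(\<Prod>j=1..N. blinfun_apply \<xi> (v j)) = (\<Prod>j=1..N. complex_of_real (s j) * blinfun_apply \<xi> (w j))"
      using s(2) by (intro prod.cong) (auto simp: blinfun.scaleR_right scaleR_conv_of_real)
    then show ?thesis unfolding C_def prod by (simp only: prod.distrib)
  qed
  define p where "p = (\<lambda>\<xi>. C * (if m + int (length ?ws) < 0 then 0 else laurent_numerator M g ?ws (nat (m + int (length ?ws))) \<xi>))"
  have "polynomial_fun p"
    unfolding p_def using polynomial_fun.mult[OF polynomial_fun.const polynomial_fun_laurent_numerator[OF M g]] polynomial_fun.const[of 0]
    by (cases "m + int (length ?ws) < 0") auto
  moreover have "laurent_coeff M g ?ws m = (\<lambda>\<xi>. p \<xi> / (\<Prod>j=1..N. blinfun_apply \<xi> (v j)))"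
    unfolding vw p_def laurent_coeff_def using C by (auto simp: fun_eq_iff)
  ultimately show ?thesis unfolding rational_space_def using laurent_coeff_scale by blast
qed

section \<open>The integral over a cone\<close>

lemma invariant_lattice_measure: "lattice_in \<Lambda> UNIV \<Longrightarrow> invariant_measure \<Lambda> (lattice_measure \<Lambda>)"
  unfolding invariant_measure_def using lattice_measure_translate by blast

lemma integrable_lattice_measure_affine:
  fixes \<Gamma> :: "'a::euclidean_space set" and f :: "'a \<Rightarrow> complex"
  assumes \<Gamma>: "lattice_in \<Gamma> L" and x: "x \<in> L" and c: "c \<noteq> 0" and f: "f \<in> borel_measurable borel"
    and int: "integrable (lattice_measure \<Gamma>) f"
  shows "integrable (lattice_measure \<Gamma>) (\<lambda>z. f (x + c *\<^sub>R z))"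
proof -
  let ?k = "\<bar>c\<bar> ^ card (some_basis \<Gamma>)"
  let ?N = "distr (lattice_measure \<Gamma>) borel (\<lambda>z. x + c *\<^sub>R z)"
  have "integrable (density ?N (\<lambda>_. ennreal ?k)) f"
    using int by (simp flip: lattice_measure_affine[OF \<Gamma> x c])
  then have "integrable ?N (\<lambda>z. ?k *\<^sub>R f z)"
    using f by (subst (asm) integrable_density) simp_all
  then have "integrable ?N (\<lambda>z. (1 / ?k) *\<^sub>R ?k *\<^sub>R f z)" by (rule integrable_scaleR_right)
  moreover have "(1 / ?k) *\<^sub>R ?k *\<^sub>R f z = f z" for z using c by simp
  ultimately have "integrable ?N f" by (simp only:)
  then show ?thesis using f by (subst (asm) integrable_distr_eq) simp_all
qed

lemma cone_quotient_identity:
  fixes \<Lambda> c :: "'a::euclidean_space set"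
  assumes \<Lambda>: "lattice_in \<Lambda> UNIV" and c: "cone_list \<Lambda> c ws"
    and int: "set_integrable (lattice_measure \<Lambda>) c (\<lambda>x. exp (blinfun_apply \<xi> x))"
  shows "laplace (lattice_measure \<Lambda>) (bdiff ws (indicator c)) \<xi>
    = (\<Prod>w\<leftarrow>ws. 1 - exp (blinfun_apply \<xi> w)) * (LINT x:c|lattice_measure \<Lambda>. exp (blinfun_apply \<xi> x))"
proof -
  have ind: "indicator c x *\<^sub>R exp (blinfun_apply \<xi> x) = indicator c x * exp (blinfun_apply \<xi> x)" for x
    by (simp add: indicator_def)
  have cb: "(indicator c :: 'a \<Rightarrow> complex) \<in> borel_measurable borel"
    using c unfolding cone_list_def by (intro borel_measurable_indicator borel_closed closed_rational_cone[of \<Lambda>]) blast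
  show ?thesis
    unfolding set_lebesgue_integral_def ind
    using int c unfolding set_integrable_def ind
    by (intro integral_bdiff_exp[OF invariant_lattice_measure[OF \<Lambda>] lattice_measure_sets, THEN conjunct2] cb)
       (auto simp: cone_list_def)
qed

text \<open>Substitute \<open>t *\<^sub>R z\<close> for \<open>x\<close>: the cone is invariant
  under positive dilations and the measure contributes a power of \<open>t\<close>.\<close>

lemma cone_integral_homogeneous:
  fixes \<Lambda> c :: "'a::euclidean_space set"
  assumes \<Lambda>: "lattice_in \<Lambda> UNIV" and c: "cone_list \<Lambda> c ws" and t: "0 < (t::real)"
    and int: "set_integrable (lattice_measure \<Lambda>) c (\<lambda>x. exp (blinfun_apply \<xi> x))"
  shows "set_integrable (lattice_measure \<Lambda>) c (\<lambda>x. exp (blinfun_apply (cscale (of_real t) \<xi>) x))"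
    "(LINT x:c|lattice_measure \<Lambda>. exp (blinfun_apply \<xi> x)) =
      of_real t ^ card (some_basis \<Lambda>) * (LINT x:c|lattice_measure \<Lambda>. exp (blinfun_apply (cscale (of_real t) \<xi>) x))"
proof -
  let ?f = "\<lambda>x. indicator c x *\<^sub>R exp (blinfun_apply \<xi> x)"
  have cb: "c \<in> sets borel"
    using c unfolding cone_list_def by (intro borel_closed closed_rational_cone[of \<Lambda>]) blast
  have fb: "?f \<in> borel_measurable borel"
    by (intro borel_measurable_scaleR borel_measurable_indicator cb borel_measurable_continuous_onI continuous_on_cexp_blinfun)
  have "t *\<^sub>R z \<in> c \<longleftrightarrow> z \<in> c" for z
  proof
    have cn: "c = ncone (set ws)" using c by (simp add: cone_list_def)
    show "t *\<^sub>R z \<in> c \<Longrightarrow> z \<in> c" using ncone_scaleR[of "t *\<^sub>R z" "set ws" "1 / t"] t unfolding cn by simp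
    show "z \<in> c \<Longrightarrow> t *\<^sub>R z \<in> c" using ncone_scaleR[of z "set ws" t] t unfolding cn by simp
  qed
  then have ft: "?f (0 + t *\<^sub>R z) = indicator c z *\<^sub>R exp (blinfun_apply (cscale (of_real t) \<xi>) z)" for z
    by (simp add: indicator_def blinfun.scaleR_right scaleR_conv_of_real)
  show "set_integrable (lattice_measure \<Lambda>) c (\<lambda>x. exp (blinfun_apply (cscale (of_real t) \<xi>) x))"
    using integrable_lattice_measure_affine[OF \<Lambda> UNIV_I _ fb, of t 0] int t
    unfolding set_integrable_def ft by simp
  have "(LINT x|lattice_measure \<Lambda>. ?f x) = \<bar>t\<bar> ^ card (some_basis \<Lambda>) *\<^sub>R (LINT z|lattice_measure \<Lambda>. ?f (0 + t *\<^sub>R z))"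
    using t by (intro integral_lattice_measure_affine[OF \<Lambda> UNIV_I _ fb]) simp
  then show "(LINT x:c|lattice_measure \<Lambda>. exp (blinfun_apply \<xi> x)) =
      of_real t ^ card (some_basis \<Lambda>) * (LINT x:c|lattice_measure \<Lambda>. exp (blinfun_apply (cscale (of_real t) \<xi>) x))"
    unfolding ft set_lebesgue_integral_def using t by (simp add: scaleR_conv_of_real)
qed

text \<open>The integral is homogeneous of degree \<open>- d\<close> in \<open>\<xi>\<close>, hence equal to its own component of that
  degree; this is what makes it a rational function.\<close>

lemma cone_integral_eq_laurent_coeff:
  fixes \<Lambda> c :: "'a::euclidean_space set"
  assumes \<Lambda>: "lattice_in \<Lambda> UNIV" and c: "cone_list \<Lambda> c ws"
    and int: "set_integrable (lattice_measure \<Lambda>) c (\<lambda>x. exp (blinfun_apply \<xi> x))"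
    and \<xi>: "\<And>w. w \<in> set ws \<Longrightarrow> blinfun_apply \<xi> w \<noteq> 0"
  shows "(LINT x:c|lattice_measure \<Lambda>. exp (blinfun_apply \<xi> x))
    = laurent_coeff (lattice_measure \<Lambda>) (bdiff ws (indicator c)) ws (- int (card (some_basis \<Lambda>))) \<xi>"
proof -
  let ?M = "lattice_measure \<Lambda>" and ?h = "bdiff ws (indicator c) :: 'a \<Rightarrow> complex"
  let ?d = "card (some_basis \<Lambda>)"
  define I where "I = (LINT x:c|?M. exp (blinfun_apply \<xi> x))"
  have lf: "locally_finite_borel ?M" by (rule locally_finite_lattice_measure[OF \<Lambda>])
  have bk: "bounded_kernel ?h" by (rule bounded_kernel_cone[OF c])
  let ?P = "\<lambda>\<tau>. \<Prod>w\<leftarrow>ws. 1 - exp (\<tau> * blinfun_apply \<xi> w)"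
  let ?E = "\<lambda>\<tau>. I * ?P \<tau> - \<tau> ^ ?d * laplace ?M ?h (cscale \<tau> \<xi>)"
  have lhol: "(\<lambda>\<tau>. laplace ?M ?h (cscale \<tau> \<xi>)) holomorphic_on UNIV"
    unfolding holomorphic_on_def field_differentiable_def
    by (intro ballI exI) (rule has_field_derivative_laplace_line[OF lf bk])
  have Phol: "?P holomorphic_on UNIV"
    by (induction ws) (auto intro!: holomorphic_intros)
  have E: "?E holomorphic_on UNIV"
    by (intro holomorphic_on_diff holomorphic_on_mult holomorphic_on_const lhol Phol holomorphic_on_power holomorphic_on_ident)
  \<comment> \<open>The substitution is available for positive \<open>t\<close> only; analytic
    continuation from the half-line, which accumulates at 0, extends the identity to all complex
    \<tau>.\<close>
  have E0: "?E (of_real t) = 0" if t: "0 < t" for t :: real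
  proof -
    note h = cone_integral_homogeneous[OF \<Lambda> c t int]
    show ?thesis using cone_quotient_identity[OF \<Lambda> c h(1)] h(2) unfolding I_def[symmetric]
      by (simp add: mult_ac)
  qed
  have isl: "(0::complex) islimpt (of_real ` {0<..})"
    unfolding islimpt_approachable
  proof (intro allI impI)
    fix e :: real assume e: "0 < e"
    show "\<exists>x'\<in>of_real ` {0<..}. x' \<noteq> (0::complex) \<and> dist x' 0 < e"
    proof (rule bexI[of _ "of_real (e / 2)"])
      show "of_real (e / 2) \<noteq> (0::complex) \<and> dist (of_real (e / 2) :: complex) 0 < e"
        using e by (simp add: dist_norm norm_divide)
      show "of_real (e / 2) \<in> (of_real ` {0<..} :: complex set)" using e by (intro imageI) simp
    qed
  qed
  have Eall: "?E \<tau> = 0" for \<tau>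
    by (rule analytic_continuation[OF E open_UNIV connected_UNIV _ _ isl]) (use E0 in auto)
  obtain F where F: "(\<lambda>\<tau>. laplace ?M ?h (cscale \<tau> \<xi>) / ?P \<tau>) has_laurent_expansion F"
    "\<And>m. fls_nth F m = laurent_coeff ?M ?h ws m \<xi>"
    by (rule laurent_laplace_quotient[OF lf bk \<xi>]) blast+
  have ev: "\<forall>\<^sub>F \<tau> in at 0. I * \<tau> powi (- int ?d) = laplace ?M ?h (cscale \<tau> \<xi>) / ?P \<tau>"
  proof -
    obtain r where r: "0 < r" "todd holomorphic_on ball 0 r" "\<And>z :: complex. z \<in> ball 0 r \<Longrightarrow> z \<noteq> 0 \<Longrightarrow> exp z \<noteq> 1"
      by (rule todd_holomorphic) blast
    have "\<forall>\<^sub>F \<tau> in at 0. \<forall>w\<in>set ws. \<tau> * blinfun_apply \<xi> w \<in> ball 0 r"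
    proof (intro eventually_ball_finite finite_set ballI)
      fix w
      have "((\<lambda>\<tau>. \<tau> * blinfun_apply \<xi> w) \<longlongrightarrow> 0 * blinfun_apply \<xi> w) (at 0)" by (intro tendsto_intros)
      then show "\<forall>\<^sub>F \<tau> in at 0. \<tau> * blinfun_apply \<xi> w \<in> ball 0 r" using r(1) by (intro topological_tendstoD) auto
    qed
    moreover have "\<forall>\<^sub>F \<tau> in at (0::complex). \<tau> \<noteq> 0" by (simp add: eventually_at_filter)
    ultimately show ?thesis
    proof eventually_elim
      case (elim \<tau>)
      have "?P \<tau> \<noteq> 0"
      proof (rule prod_list_ne_0)
        fix w assume w: "w \<in> set ws"
        have "exp (\<tau> * blinfun_apply \<xi> w) \<noteq> 1" using r(3) elim w \<xi> by simp
        then show "1 - exp (\<tau> * blinfun_apply \<xi> w) \<noteq> 0" by simp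
      qed
      then show ?case using Eall[of \<tau>] elim(2) by (simp add: power_int_minus field_simps)
    qed
  qed
  \<comment> \<open>The quotient along the line is this single power of \<tau>, so its Laurent
    coefficient in degree minus the dimension is the integral itself.\<close>
  have "(\<lambda>\<tau>. I * \<tau> powi (- int ?d)) has_laurent_expansion fls_const I * fls_shift (int ?d) (fps_to_fls 1)"
  proof -
    have "(\<lambda>\<tau>::complex. 1 * \<tau> powi (- int ?d)) has_laurent_expansion fls_shift (int ?d) 1"
      by (rule has_laurent_expansion_shift'[OF has_laurent_expansion_1])
    then have "(\<lambda>\<tau>. I * (1 * \<tau> powi (- int ?d))) has_laurent_expansion fls_const I * fls_shift (int ?d) 1"
      by (rule has_laurent_expansion_cmult_left)
    then show ?thesis by simp
  qed
  moreover have "(\<lambda>\<tau>. I * \<tau> powi (- int ?d)) has_laurent_expansion F"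
    using F(1) has_laurent_expansion_cong[OF ev refl] by blast
  ultimately have FF: "F = fls_const I * fls_shift (int ?d) (fps_to_fls 1)" by (rule has_laurent_expansion_unique[symmetric])
  have "fls_nth F (- int ?d) = I" unfolding FF by simp
  then show ?thesis using F(2) unfolding I_def by simp
qed

text \<open>The homogeneous component of degree minus the dimension is the witness that a rational
  function with the required values exists.\<close>

lemma is_cone_integral_cone_integral:
  fixes \<Lambda> c :: "'a::euclidean_space set"
  assumes \<Lambda>: "lattice_in \<Lambda> UNIV" and c: "cone_list \<Lambda> c ws"
  shows "is_cone_integral \<Lambda> c (cone_integral \<Lambda> c)"
proof -
  let ?M = "lattice_measure \<Lambda>" and ?h = "bdiff ws (indicator c) :: 'a \<Rightarrow> complex"
  let ?m = "- int (card (some_basis \<Lambda>))"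
  have lf: "locally_finite_borel ?M" by (rule locally_finite_lattice_measure[OF \<Lambda>])
  have bk: "bounded_kernel ?h" by (rule bounded_kernel_cone[OF c])
  define p where "p = (\<lambda>\<xi>. if ?m + int (length ws) < 0 then 0 else laurent_numerator ?M ?h ws (nat (?m + int (length ws))) \<xi>)"
  have "polynomial_fun p"
    unfolding p_def using polynomial_fun_laurent_numerator[OF lf bk] polynomial_fun.const[of 0]
    by (cases "?m + int (length ws) < 0") auto
  moreover have "laurent_coeff ?M ?h ws ?m = (\<lambda>\<xi>. p \<xi> / (\<Prod>w\<leftarrow>ws. blinfun_apply \<xi> w))"
    unfolding p_def laurent_coeff_def by (rule ext) simp
  moreover have "\<forall>\<xi>\<in>off_hyperplanes (set ws). set_integrable ?M c (\<lambda>x. exp (blinfun_apply \<xi> x)) \<longrightarrow>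
      laurent_coeff ?M ?h ws ?m \<xi> = (LINT x:c|?M. exp (blinfun_apply \<xi> x))"
    using cone_integral_eq_laurent_coeff[OF \<Lambda> c] by (auto simp: off_hyperplanes_def)
  moreover have "0 \<notin> set ws" using c by (auto simp: cone_list_def)
  ultimately have "is_cone_integral \<Lambda> c (laurent_coeff ?M ?h ws ?m)" unfolding is_cone_integral_def by blast
  then show ?thesis unfolding cone_integral_def by (rule someI[of "is_cone_integral \<Lambda> c"])
qed

lemma character_conv_exp: "character \<gamma> x = exp (blinfun_apply (cscale (2 * \<i> * pi) (complexify \<gamma>)) x)"
  by (simp add: character_def)

lemma continuous_on_character: "continuous_on A (character \<gamma>)"
  unfolding character_def by (intro continuous_intros)

text \<open>Cleared of denominators, the relation between the cone integral and the transform of the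
  kernel is an identity of entire functions, so it may be evaluated far from 0, at \<xi> + 2 i pi
  \<gamma>. There the exponential denominator is the one at \<xi>, and the kernel acquires a
  character.\<close>

lemma translated_cone_integral_germ:
  fixes \<Lambda> c :: "'a::euclidean_space set"
  assumes \<Lambda>: "lattice_in \<Lambda> UNIV" and c: "cone_list \<Lambda> c ws" and \<gamma>: "\<gamma> \<in> dual_lattice \<Lambda>"
  shows "\<forall>\<^sub>F \<xi> in germ0. translated_cone_integral \<Lambda> c \<gamma> \<xi> =
    laplace (lattice_measure \<Lambda>) (\<lambda>x. bdiff ws (indicator c) x * character \<gamma> x) \<xi> / (\<Prod>w\<leftarrow>ws. 1 - exp (blinfun_apply \<xi> w))"
proof -
  let ?M = "lattice_measure \<Lambda>" and ?h = "bdiff ws (indicator c) :: 'a \<Rightarrow> complex"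
  have lf: "locally_finite_borel ?M" by (rule locally_finite_lattice_measure[OF \<Lambda>])
  have bk: "bounded_kernel ?h" by (rule bounded_kernel_cone[OF c])
  have ws: "0 \<notin> set ws" "set ws \<subseteq> \<Lambda>" and cn: "c = ncone (set ws)" and rc: "rational_cone \<Lambda> c"
    using c by (auto simp: cone_list_def)
  obtain p vs where pvs: "polynomial_fun p" "0 \<notin> set vs"
    "cone_integral \<Lambda> c = (\<lambda>\<xi>. p \<xi> / (\<Prod>w\<leftarrow>vs. blinfun_apply \<xi> w))"
    "\<And>\<xi>. \<xi> \<in> off_hyperplanes (set vs) \<Longrightarrow> set_integrable ?M c (\<lambda>x. exp (blinfun_apply \<xi> x)) \<Longrightarrow>
       cone_integral \<Lambda> c \<xi> = (LINT x:c|?M. exp (blinfun_apply \<xi> x))"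
    using is_cone_integral_cone_integral[OF \<Lambda> c] unfolding is_cone_integral_def by blast
  \<comment> \<open>The list \<open>vs\<close> belongs to the chosen cone integral and is unrelated
    to \<open>ws\<close>.\<close>
  let ?E = "\<lambda>\<xi>. p \<xi> * (\<Prod>w\<leftarrow>ws. 1 - exp (blinfun_apply \<xi> w)) - laplace ?M ?h \<xi> * (\<Prod>w\<leftarrow>vs. blinfun_apply \<xi> w)"
  have E: "cdual_holomorphic_on ?E UNIV"
    by (intro cdual_holomorphic_on_diff cdual_holomorphic_on_mult cdual_holomorphic_on_exp_prod
         cdual_holomorphic_on_prod_list cdual_holomorphic_on_pairing cdual_holomorphic_on_laplace[OF lf bk]
         cdual_holomorphic_on_polynomial_fun pvs(1))
  let ?Q = "neg_region ws \<inter> off_hyperplanes (set vs)"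
  have "neg_region ws \<noteq> {}" using neg_region_meets[OF c open_UNIV] by auto
  then have Q: "open ?Q" "?Q \<noteq> {}"
    using open_Int_off_hyperplanes_nonempty[OF finite_set pvs(2) open_neg_region]
    by (auto intro!: open_Int open_neg_region open_off_hyperplanes)
  have E0: "?E \<xi> = 0" if "\<xi> \<in> ?Q" for \<xi>
  proof -
    have ind: "indicator c x *\<^sub>R exp (blinfun_apply \<xi> x) = indicator c x * exp (blinfun_apply \<xi> x)" for x
      by (simp add: indicator_def)
    have cb: "c \<in> sets borel" by (intro borel_closed closed_rational_cone[OF rc])
    have "integrable ?M (\<lambda>x. indicator c x * exp (blinfun_apply \<xi> x))"
      using that ws(2) cb cn
      by (intro integrable_exp_ncone[OF invariant_lattice_measure[OF \<Lambda>] lf \<Lambda>, of ws \<xi> c 0]) (auto simp: neg_region_def)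
    then have int: "set_integrable ?M c (\<lambda>x. exp (blinfun_apply \<xi> x))" unfolding set_integrable_def ind .
    have "(\<Prod>w\<leftarrow>vs. blinfun_apply \<xi> w) \<noteq> 0"
      using that by (intro prod_list_ne_0) (auto simp: off_hyperplanes_def)
    moreover have "p \<xi> / (\<Prod>w\<leftarrow>vs. blinfun_apply \<xi> w) = (LINT x:c|?M. exp (blinfun_apply \<xi> x))"
      using pvs(4)[OF _ int] that unfolding pvs(3) by blast
    ultimately show ?thesis using cone_quotient_identity[OF \<Lambda> c int] by (auto simp: divide_eq_eq)
  qed
  have all: "?E \<xi> = 0" for \<xi>
    by (rule cdual_identity[OF E open_UNIV convex_UNIV Q subset_UNIV E0 UNIV_I])
  let ?t = "cscale (2 * \<i> * pi) (complexify \<gamma>) :: 'a cdual"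
  \<comment> \<open>A polar hyperplane on whose vector \<gamma> is nonzero is moved away from 0 by
    the translation; the others still pass through 0 and are among those excluded by the germ
    filter.\<close>
  have vs_ev: "\<forall>\<^sub>F \<xi> in germ0. \<forall>w\<in>set vs. blinfun_apply (\<xi> + ?t) w \<noteq> 0"
  proof -
    define V where "V = {w \<in> set vs. blinfun_apply \<gamma> w \<noteq> 0}"
    have "open {\<xi> :: 'a cdual. blinfun_apply (\<xi> + ?t) w \<noteq> 0}" for w
      by (intro open_Collect_neq continuous_intros)
    then have "open (\<Inter>w\<in>V. {\<xi> :: 'a cdual. blinfun_apply (\<xi> + ?t) w \<noteq> 0})"
      by (intro open_INT) (auto simp: V_def)
    then have "\<forall>\<^sub>F \<xi> in germ0. \<xi> \<in> (\<Inter>w\<in>V. {\<xi> :: 'a cdual. blinfun_apply (\<xi> + ?t) w \<noteq> 0})"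
      by (rule eventually_germ0_open) (auto simp: V_def)
    then show ?thesis using eventually_germ0_off[OF finite_set pvs(2)]
    proof eventually_elim
      case (elim \<xi>)
      show ?case
      proof
        fix w assume w: "w \<in> set vs"
        show "blinfun_apply (\<xi> + ?t) w \<noteq> 0"
        proof (cases "blinfun_apply \<gamma> w = 0")
          case True
          then show ?thesis using elim(2) w by (simp add: off_hyperplanes_def blinfun.add_left)
        next
          case False
          then show ?thesis using elim(1) w by (auto simp: V_def)
        qed
      qed
    qed
  qed
  show ?thesis
    using vs_ev eventually_germ0_exp[OF finite_set ws(1)]
  proof eventually_elim
    case (elim \<xi>)
    have v0: "(\<Prod>w\<leftarrow>vs. blinfun_apply (\<xi> + ?t) w) \<noteq> 0" using elim(1) by (intro prod_list_ne_0) blast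
    have w0: "(\<Prod>w\<leftarrow>ws. 1 - exp (blinfun_apply \<xi> w)) \<noteq> 0" using elim(2) by (intro prod_list_ne_0) force
    have "exp (blinfun_apply (\<xi> + ?t) w) = exp (blinfun_apply \<xi> w)" if w: "w \<in> set ws" for w
    proof -
      obtain n where n: "blinfun_apply \<gamma> w = real_of_int n"
      proof -
        have "blinfun_apply \<gamma> w \<in> \<int>" using \<gamma> w ws(2) unfolding dual_lattice_def by blast
        then show thesis by (elim Ints_cases) (rule that)
      qed
      have "exp (2 * \<i> * pi * complex_of_real (real_of_int n)) = 1"
        unfolding exp_eq_1 by (auto intro!: exI[of _ n])
      then show ?thesis by (simp add: blinfun.add_left exp_add n)
    qed
    then have peq: "(\<Prod>w\<leftarrow>ws. 1 - exp (blinfun_apply (\<xi> + ?t) w)) = (\<Prod>w\<leftarrow>ws. 1 - exp (blinfun_apply \<xi> w))"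
      by (intro arg_cong[where f=prod_list] map_cong) auto
    have "laplace ?M ?h (\<xi> + ?t) = laplace ?M (\<lambda>x. ?h x * character \<gamma> x) \<xi>"
      unfolding laplace_def character_conv_exp by (simp add: blinfun.add_left exp_add mult_ac)
    moreover have "p (\<xi> + ?t) * (\<Prod>w\<leftarrow>ws. 1 - exp (blinfun_apply \<xi> w))
        = laplace ?M ?h (\<xi> + ?t) * (\<Prod>w\<leftarrow>vs. blinfun_apply (\<xi> + ?t) w)"
      using all[of "\<xi> + ?t"] unfolding peq by simp
    ultimately show ?case
      unfolding translated_cone_integral_def pvs(3) using v0 w0 by (simp add: frac_eq_eq)
  qed
qed

section \<open>Fourier coefficients of periodizations\<close>

lemma bounded_kernel_indicator:
  assumes "bounded_kernel g" "D \<in> sets borel"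
  shows "bounded_kernel (\<lambda>x. indicator D x * g x)"
proof -
  obtain C r where Cr: "g \<in> borel_measurable borel" "0 \<le> C" "\<And>x. norm (g x) \<le> C" "0 \<le> r"
    "\<And>x. r < norm x \<Longrightarrow> g x = 0" using bounded_kernelE[OF assms(1)] by blast
  show ?thesis
  proof (rule bounded_kernelI)
    show "(\<lambda>x. indicator D x * g x) \<in> borel_measurable borel"
      by (intro borel_measurable_times borel_measurable_indicator assms(2) Cr(1))
    show "norm (indicator D x * g x) \<le> C" for x using Cr(2,3) by (simp add: indicator_def)
    show "norm x \<le> r" if "indicator D x * g x \<noteq> 0" for x using that Cr(5)[of x] by force
  qed
qed

text \<open>A version of unfolding with a finite sum, valid because a kernel of bounded support
  meets finitely many tiles. The set \<open>F\<close> is left to the caller, so that one set can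
  serve a whole family of kernels.\<close>

lemma integral_unfold:
  fixes \<Lambda> :: "'a::euclidean_space set" and g :: "'a \<Rightarrow> complex"
  assumes \<Lambda>: "lattice_in \<Lambda> UNIV" and M: "invariant_measure \<Lambda> M" "locally_finite_borel M" and g: "bounded_kernel g"
    and F: "finite F" "F \<subseteq> \<Lambda>" "\<And>l x. l \<in> \<Lambda> \<Longrightarrow> x \<in> fundamental_domain \<Lambda> \<Longrightarrow> g (x + l) \<noteq> 0 \<Longrightarrow> l \<in> F"
  shows "(LINT x|M. g x) = (\<Sum>l\<in>F. LINT x|M. indicator (fundamental_domain \<Lambda>) x * g (x + l))"
proof -
  let ?D = "fundamental_domain \<Lambda>"
  have D: "?D \<in> sets borel" by (rule fundamental_domain_borel[OF \<Lambda>])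
  have setsM: "sets M = sets borel" using M(2) by (simp add: locally_finite_borel_def)
  have pt: "g x = (\<Sum>l\<in>F. indicator ?D (x - l) * g x)" for x
  proof -
    obtain k where k: "k \<in> \<Lambda>" "\<And>l'. l' \<in> \<Lambda> \<Longrightarrow> x - l' \<in> ?D \<longleftrightarrow> l' = k"
      using fundamental_domain_tiling[OF \<Lambda> UNIV_I, of x] by metis
    have "(\<Sum>l\<in>F. indicator ?D (x - l) * g x) = (\<Sum>l\<in>F. if l = k then g x else 0)"
    proof (rule sum.cong[OF refl])
      fix l assume "l \<in> F"
      then have "x - l \<in> ?D \<longleftrightarrow> l = k" using k(2) F(2) by blast
      then show "indicator ?D (x - l) * g x = (if l = k then g x else 0)" by (simp add: indicator_def)
    qed
    also have "\<dots> = (if k \<in> F then g x else 0)" using F(1) by simp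
    also have "\<dots> = g x"
    proof (cases "g x = 0")
      case False
      have "x - k \<in> ?D" using k by blast
      then have "k \<in> F" using F(3)[OF k(1), of "x - k"] False by simp
      then show ?thesis by simp
    qed simp
    finally show ?thesis by simp
  qed
  have bk: "bounded_kernel (\<lambda>x. indicator ?D (x - l) * g x)" for l
  proof -
    have "(\<lambda>x. x - l) -` ?D \<in> sets borel" using measurable_sets[of "\<lambda>x. x - l" borel borel ?D] D by simp
    from bounded_kernel_indicator[OF g this] show ?thesis by (simp add: indicator_def vimage_def)
  qed
  have "(LINT x|M. g x) = (LINT x|M. (\<Sum>l\<in>F. indicator ?D (x - l) * g x))" by (simp only: pt[symmetric])
  also have "\<dots> = (\<Sum>l\<in>F. LINT x|M. indicator ?D (x - l) * g x)"
    by (intro Bochner_Integration.integral_sum integrable_bounded_kernel[OF M(2)] bk)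
  also have "\<dots> = (\<Sum>l\<in>F. LINT x|M. indicator ?D x * g (x + l))"
  proof (rule sum.cong[OF refl])
    fix l assume "l \<in> F"
    then have l: "l \<in> \<Lambda>" using F(2) by blast
    show "(LINT x|M. indicator ?D (x - l) * g x) = (LINT x|M. indicator ?D x * g (x + l))"
      using integral_invariant(1)[OF M(1) setsM l bounded_kernel_borel[OF bk[of l]]] by simp
  qed
  finally show ?thesis .
qed

lemma bounded_kernel_domain:
  assumes \<Lambda>: "lattice_in \<Lambda> UNIV" and f: "continuous_on UNIV f"
  shows "bounded_kernel (\<lambda>x. indicator (fundamental_domain \<Lambda>) x * f x)"
proof (rule bounded_kernel_mult[OF _ f])
  show "bounded_kernel (indicator (fundamental_domain \<Lambda>))"
    by (rule bounded_kernelI[of _ 1 "\<Sum>b\<in>some_basis \<Lambda>. norm b"])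
       (auto simp: indicator_def fundamental_domain_bounded[OF \<Lambda>] split: if_splits
          intro!: borel_measurable_indicator fundamental_domain_borel[OF \<Lambda>])
qed

section \<open>Characters and their integrals over the torus\<close>

lemma character_add: "character \<gamma> (x + y) = character \<gamma> x * character \<gamma> y"
  by (simp add: character_def blinfun.add_right distrib_left exp_add)

lemma character_mult: "character \<gamma> x * character \<delta> x = character (\<gamma> + \<delta>) x"
  by (simp add: character_def blinfun.add_left distrib_left exp_add)

lemma character_0 [simp]: "character 0 x = 1" "character \<gamma> 0 = 1"
  by (simp_all add: character_def)

lemma character_minus: "character (- \<gamma>) x = cnj (character \<gamma> x)" "character \<gamma> (- x) = cnj (character \<gamma> x)"
  by (simp_all add: character_def blinfun.minus_left blinfun.minus_right exp_cnj)

lemma norm_character [simp]: "norm (character \<gamma> x) = 1"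
  by (simp add: character_def norm_exp_eq_Re)

lemma character_eq_1_iff: "character \<gamma> x = 1 \<longleftrightarrow> blinfun_apply \<gamma> x \<in> \<int>"
proof
  assume "blinfun_apply \<gamma> x \<in> \<int>"
  then obtain n where "blinfun_apply \<gamma> x = real_of_int n" by (elim Ints_cases)
  then show "character \<gamma> x = 1" unfolding character_def exp_eq_1 by (auto intro!: exI[of _ n])
next
  assume "character \<gamma> x = 1"
  then obtain n :: int where "2 * pi * blinfun_apply \<gamma> x = of_int (2 * n) * pi"
    unfolding character_def exp_eq_1 by auto
  then have "blinfun_apply \<gamma> x = of_int n" by simp
  then show "blinfun_apply \<gamma> x \<in> \<int>" by simp
qed

lemma dual_lattice_minus: "\<gamma> \<in> dual_lattice \<Lambda> \<Longrightarrow> - \<gamma> \<in> dual_lattice \<Lambda>"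
  by (simp add: dual_lattice_def blinfun.minus_left)

lemma dual_lattice_add: "\<gamma> \<in> dual_lattice \<Lambda> \<Longrightarrow> \<delta> \<in> dual_lattice \<Lambda> \<Longrightarrow> \<gamma> + \<delta> \<in> dual_lattice \<Lambda>"
  by (simp add: dual_lattice_def blinfun.add_left)

lemma character_lattice: "\<gamma> \<in> dual_lattice \<Lambda> \<Longrightarrow> l \<in> \<Lambda> \<Longrightarrow> character \<gamma> l = 1"
  unfolding character_eq_1_iff by (simp add: dual_lattice_def)

text \<open>The usual argument: translation by \<open>u\<close> multiplies the integral by
  \<open>character \<gamma> u\<close>, which is not 1. As the fundamental domain is not invariant
  under \<open>u\<close>, its translate has to be cut into tiles and reassembled by lattice
  translations, which do not change the character.\<close>

lemma integral_character_eq_0: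
  fixes \<Lambda> :: "'a::euclidean_space set"
  assumes \<Lambda>: "lattice_in \<Lambda> UNIV" and M: "invariant_measure \<Lambda> M" "locally_finite_borel M"
    and \<gamma>: "\<gamma> \<in> dual_lattice \<Lambda>" and u: "distr M borel ((+) u) = M" "character \<gamma> u \<noteq> 1"
  shows "(LINT x|M. indicator (fundamental_domain \<Lambda>) x * character \<gamma> x) = 0"
proof -
  let ?D = "fundamental_domain \<Lambda>"
  have D: "?D \<in> sets borel" by (rule fundamental_domain_borel[OF \<Lambda>])
  have setsM: "sets M = sets borel" using M(2) by (simp add: locally_finite_borel_def)
  let ?f = "\<lambda>x. indicator ?D x * character \<gamma> x"
  define I where "I = (LINT x|M. ?f x)"
  \<comment> \<open>Only the cut-off is translated here, not the character: \<open>?g\<close> is the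
    character restricted to the fundamental domain shifted by \<open>- u\<close>.\<close>
  let ?g = "\<lambda>x. indicator ?D (x + u) * character \<gamma> x"
  have bf: "bounded_kernel ?f" by (rule bounded_kernel_domain[OF \<Lambda> continuous_on_character])
  have g_alt: "?g x = character \<gamma> (- u) * ?f (x + u)" for x
    using character_add[of \<gamma> "x + u" "- u"] by simp
  have bg: "bounded_kernel ?g"
    unfolding g_alt using bounded_kernel_cmult[OF bounded_kernel_shift[OF bf, of "- u"], of "character \<gamma> (- u)"]
    by (simp add: mult.commute)
  have inv_u: "invariant_measure {u} M" using u(1) by (simp add: invariant_measure_def)
  have "(LINT x|M. ?f (x + u)) = I"
    unfolding I_def by (rule integral_invariant(1)[OF inv_u setsM _ bounded_kernel_borel[OF bf]]) simp
  moreover have "(LINT x|M. ?f (x + u)) = character \<gamma> u * (LINT x|M. ?g x)"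
    unfolding integral_mult_right_zero[symmetric]
    by (intro Bochner_Integration.integral_cong refl) (simp add: character_add)
  moreover have "(LINT x|M. ?g x) = I"
  proof -
    define R where "R = (\<Sum>b\<in>some_basis \<Lambda>. norm b)"
    \<comment> \<open>If \<open>x\<close> and \<open>x + l + u\<close> both lie in the fundamental
      domain, of radius at most \<open>R\<close>, then \<open>l\<close> has norm at most
      \<open>2 * R + norm u\<close>.\<close>
    define F where "F = \<Lambda> \<inter> cball 0 (2 * R + norm u)"
    have F: "finite F" "F \<subseteq> \<Lambda>" unfolding F_def using finite_lattice_cball[OF \<Lambda>] by auto
    have inF: "l \<in> F" if "l \<in> \<Lambda>" "x \<in> ?D" "x + l + u \<in> ?D" for l x
    proof -
      have "norm x \<le> R" "norm (x + l + u) \<le> R" unfolding R_def using that fundamental_domain_bounded[OF \<Lambda>] by blast+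
      moreover have "norm l \<le> norm (x + l + u) + norm x + norm u" by norm
      ultimately show ?thesis using that(1) by (simp add: F_def)
    qed
    have "(LINT x|M. ?g x) = (\<Sum>l\<in>F. LINT x|M. indicator ?D x * ?g (x + l))"
      by (rule integral_unfold[OF \<Lambda> M bg F]) (use inF in \<open>auto simp: indicator_def split: if_splits\<close>)
    also have "\<dots> = (LINT x|M. (\<Sum>l\<in>F. indicator ?D x * ?g (x + l)))"
      using bounded_kernel_indicator[OF bounded_kernel_shift[OF bg, of "- _"] D]
      by (intro Bochner_Integration.integral_sum[symmetric] integrable_bounded_kernel[OF M(2)]) simp
    also have "\<dots> = I" unfolding I_def
    proof (intro Bochner_Integration.integral_cong refl)
      fix x
      show "(\<Sum>l\<in>F. indicator ?D x * ?g (x + l)) = ?f x"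
      proof (cases "x \<in> ?D")
        case True
        obtain k where k: "k \<in> \<Lambda>" "\<And>l'. l' \<in> \<Lambda> \<Longrightarrow> (x + u) - l' \<in> ?D \<longleftrightarrow> l' = k"
          using fundamental_domain_tiling[OF \<Lambda> UNIV_I, of "x + u"] by metis
        have iff: "x + l + u \<in> ?D \<longleftrightarrow> l = - k" if "l \<in> \<Lambda>" for l
        proof -
          have "x + l + u = (x + u) - (- l)" by simp
          then have "x + l + u \<in> ?D \<longleftrightarrow> - l = k" using k(2)[OF lattice_minus[OF \<Lambda> that]] by (simp only:)
          then show ?thesis by auto
        qed
        have mk: "- k \<in> F" using inF[OF lattice_minus[OF \<Lambda> k(1)] True] iff[OF lattice_minus[OF \<Lambda> k(1)]] by simp
        have "(\<Sum>l\<in>F. indicator ?D x * ?g (x + l)) = (\<Sum>l\<in>F. if l = - k then character \<gamma> x else 0)"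
        proof (rule sum.cong[OF refl])
          fix l assume "l \<in> F"
          then have l: "l \<in> \<Lambda>" using F(2) by blast
          show "indicator ?D x * ?g (x + l) = (if l = - k then character \<gamma> x else 0)"
            using True iff[OF l] character_lattice[OF \<gamma> l] by (simp add: indicator_def character_add)
        qed
        also have "\<dots> = character \<gamma> x" using F(1) mk by simp
        finally show ?thesis using True by simp
      qed simp
    qed
    finally show ?thesis .
  qed
  ultimately have "I = character \<gamma> u * I" by simp
  then show ?thesis using u(2) unfolding I_def by simp
qed

lemma integral_character_eq_1:
  fixes \<Lambda> :: "'a::euclidean_space set"
  assumes \<Lambda>: "lattice_in \<Lambda> UNIV" and M: "locally_finite_borel M" "emeasure M (fundamental_domain \<Lambda>) = 1"
    and \<gamma>: "AE x in M. blinfun_apply \<gamma> x \<in> \<int>"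
  shows "(LINT x|M. indicator (fundamental_domain \<Lambda>) x * character \<gamma> x) = 1"
proof -
  let ?D = "fundamental_domain \<Lambda>"
  have D: "?D \<in> sets M" using fundamental_domain_borel[OF \<Lambda>] M(1) by (simp add: locally_finite_borel_def)
  have bf: "bounded_kernel (\<lambda>x. indicator ?D x * character \<gamma> x)"
    by (rule bounded_kernel_domain[OF \<Lambda> continuous_on_character])
  have bf1: "bounded_kernel (\<lambda>x. indicator ?D x * (1::complex))"
    by (rule bounded_kernel_domain[OF \<Lambda>]) simp
  have "(LINT x|M. indicator ?D x * character \<gamma> x) = (LINT x|M. indicator ?D x * (1::complex))"
  proof (rule integral_cong_AE)
    show "AE x in M. indicator ?D x * character \<gamma> x = indicator ?D x * (1::complex)"
      using \<gamma> by eventually_elim (simp only: character_eq_1_iff[symmetric])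
  qed (use bf bf1 in \<open>simp_all only: locally_finite_borel_measurable[OF M(1)] bounded_kernel_borel\<close>)
  also have "\<dots> = complex_of_real (LINT x|M. indicator ?D x)"
    by (simp add: indicator_def[abs_def] of_bool_def flip: integral_complex_of_real) (intro Bochner_Integration.integral_cong refl; simp)
  also have "(LINT x|M. indicator ?D x) = measure M (?D \<inter> space M)" by simp
  also have "?D \<inter> space M = ?D" by (simp add: locally_finite_borel_space[OF M(1)])
  also have "measure M ?D = 1" using M(2) by (simp add: measure_def)
  finally show ?thesis by simp
qed

text \<open>On the annihilator of \<open>L\<close> the character is 1 almost everywhere. Otherwise
  some vector of \<open>L\<close> gives the character the value -1, and invariance under
  \<open>L\<close> forces the integral to vanish.\<close>

lemma slice_fourier:
  fixes \<Lambda> L :: "'a::euclidean_space set"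
  assumes \<Lambda>: "lattice_in \<Lambda> UNIV" and L: "rational_subspace \<Lambda> L" and \<gamma>: "\<gamma> \<in> dual_lattice \<Lambda>"
  shows "(LINT x|slice_measure \<Lambda> L. indicator (fundamental_domain \<Lambda>) x * character (- \<gamma>) x)
    = (if \<gamma> \<in> annihilator L then 1 else 0)"
proof (cases "\<gamma> \<in> annihilator L")
  case True
  have "AE x in slice_measure \<Lambda> L. blinfun_apply (- \<gamma>) x \<in> \<int>"
    using AE_slice_integer[OF \<Lambda> L \<gamma> True] by eventually_elim (simp add: blinfun.minus_left)
  from integral_character_eq_1[OF \<Lambda> slice_locally_finite[OF \<Lambda> L] slice_fundamental_domain[OF \<Lambda> L] this]
  show ?thesis using True by simp
next
  case False
  then obtain x where x: "x \<in> L" "blinfun_apply \<gamma> x \<noteq> 0" by (auto simp: annihilator_def)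
  \<comment> \<open>Normalized so that \<gamma> takes the value 1 / 2 at \<open>u\<close>, which is
    not an integer.\<close>
  define u where "u = (1 / (2 * blinfun_apply \<gamma> x)) *\<^sub>R x"
  have "subspace L" using L by (simp add: rational_subspace_def)
  then have "u \<in> L" unfolding u_def using x(1) by (rule subspace_scale)
  have h: "blinfun_apply (- \<gamma>) u = - (1 / 2)" using x(2) by (simp add: u_def blinfun.bilinear_simps)
  have "blinfun_apply (- \<gamma>) u \<notin> \<int>"
  proof
    assume "blinfun_apply (- \<gamma>) u \<in> \<int>"
    then obtain n where "- (1 / 2) = real_of_int n" unfolding h by (elim Ints_cases)
    then have "real_of_int (2 * n) = real_of_int (- 1)" by simp
    then have "2 * n = - 1" by (simp only: of_int_eq_iff)
    then show False by presburger
  qed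
  then have "character (- \<gamma>) u \<noteq> 1" by (simp only: character_eq_1_iff not_False_eq_True)
  then show ?thesis
    using False integral_character_eq_0[OF \<Lambda> slice_invariant[OF \<Lambda> L] slice_locally_finite[OF \<Lambda> L]
        dual_lattice_minus[OF \<gamma>] slice_translate_L[OF \<Lambda> L \<open>u \<in> L\<close>]] by simp
qed

text \<open>Orthogonality of distinct characters; here every translation is available.\<close>

lemma lattice_measure_fourier:
  fixes \<Lambda> :: "'a::euclidean_space set"
  assumes \<Lambda>: "lattice_in \<Lambda> UNIV" and \<gamma>: "\<gamma> \<in> dual_lattice \<Lambda>"
  shows "(LINT x|lattice_measure \<Lambda>. indicator (fundamental_domain \<Lambda>) x * character \<gamma> x) = (if \<gamma> = 0 then 1 else 0)"
proof (cases "\<gamma> = 0")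
  case True
  then show ?thesis
    using integral_character_eq_1[OF \<Lambda> locally_finite_lattice_measure[OF \<Lambda>] emeasure_fundamental_domain[OF \<Lambda>], of 0] by simp
next
  case False
  then obtain x where x: "blinfun_apply \<gamma> x \<noteq> 0" by (metis blinfun_eqI zero_blinfun.rep_eq)
  define u where "u = (1 / (2 * blinfun_apply \<gamma> x)) *\<^sub>R x"
  have h: "blinfun_apply \<gamma> u = 1 / 2" using x by (simp add: u_def blinfun.bilinear_simps)
  have "blinfun_apply \<gamma> u \<notin> \<int>"
  proof
    assume "blinfun_apply \<gamma> u \<in> \<int>"
    then obtain n where "1 / 2 = real_of_int n" unfolding h by (elim Ints_cases)
    then have "real_of_int (2 * n) = real_of_int 1" by simp
    then have "2 * n = 1" by (simp only: of_int_eq_iff)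
    then show False by presburger
  qed
  then have "character \<gamma> u \<noteq> 1" by (simp only: character_eq_1_iff not_False_eq_True)
  then show ?thesis
    using False integral_character_eq_0[OF \<Lambda> invariant_lattice_measure[OF \<Lambda>] locally_finite_lattice_measure[OF \<Lambda>]
        \<gamma> lattice_measure_translate[OF \<Lambda> UNIV_I]] by simp
qed

lemma periodization_borel:
  assumes M: "locally_finite_borel M" and k: "bounded_kernel k"
  shows "(\<lambda>s. LINT x|M. k (x - s)) \<in> borel_measurable borel"
proof -
  interpret sigma_finite_measure M by (rule sigma_finite_locally_finite_borel[OF M])
  have "sets (borel \<Otimes>\<^sub>M M) = sets (borel \<Otimes>\<^sub>M (borel :: 'a measure))"
    by (intro sets_pair_measure_cong refl) (use M in \<open>simp add: locally_finite_borel_def\<close>)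
  then have cong: "measurable (borel \<Otimes>\<^sub>M M) borel = measurable (borel \<Otimes>\<^sub>M (borel :: 'a measure)) (borel :: complex measure)"
    by (intro measurable_cong_sets refl)
  have "(\<lambda>p. k (snd p - fst p)) \<in> borel_measurable (borel \<Otimes>\<^sub>M (borel :: 'a measure))"
    by (rule measurable_compose[OF _ bounded_kernel_borel[OF k]]) simp
  then have "(\<lambda>(s, x). k (x - s)) \<in> borel_measurable (borel \<Otimes>\<^sub>M M)" unfolding cong by (simp add: split_def)
  then show ?thesis by (rule borel_measurable_lebesgue_integral)
qed

lemma periodization_bounded:
  fixes \<Lambda> :: "'a::euclidean_space set"
  assumes \<Lambda>: "lattice_in \<Lambda> UNIV" and M: "locally_finite_borel M" and k: "bounded_kernel k"
  obtains B where "\<And>s. s \<in> fundamental_domain \<Lambda> \<Longrightarrow> norm (LINT x|M. k (x - s)) \<le> B"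
proof -
  obtain C r where Cr: "k \<in> borel_measurable borel" "0 \<le> C" "\<And>x. norm (k x) \<le> C" "0 \<le> r"
    "\<And>x. r < norm x \<Longrightarrow> k x = 0" using bounded_kernelE[OF k] by blast
  define R where "R = (\<Sum>b\<in>some_basis \<Lambda>. norm b)"
  have int: "integrable M (\<lambda>x. C * indicator (cball 0 (r + R)) x :: real)"
    using M by (intro integrable_mult_right integrable_real_indicator) (auto simp: locally_finite_borel_def)
  show thesis
  proof (rule that)
    fix s assume s: "s \<in> fundamental_domain \<Lambda>"
    show "norm (LINT x|M. k (x - s)) \<le> (LINT x|M. C * indicator (cball 0 (r + R)) x)"
    proof (rule Bochner_Integration.integral_norm_bound_integral[OF integrable_bounded_kernel[OF M bounded_kernel_shift[OF k]] int])
      fix x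
      show "norm (k (x - s)) \<le> C * indicator (cball 0 (r + R)) x"
      proof (cases "r < norm (x - s)")
        case False
        have "norm s \<le> R" unfolding R_def using s by (rule fundamental_domain_bounded[OF \<Lambda>])
        then have "norm x \<le> r + R" using False norm_triangle_sub[of x s] by linarith
        then show ?thesis using Cr(3) by simp
      qed (use Cr in auto)
    qed
  qed
qed

text \<open>Unfold the inner integral into finitely many integrals over the fundamental domain,
  exchange the two integrals on the bounded product of domains, and refold the integral over
  \<open>s\<close> into one over the whole space. The substitution of \<open>x - z\<close> for
  \<open>s\<close> then separates the character of \<open>x\<close> from the kernel
  integral.\<close>

lemma fourier_periodization:
  fixes \<Lambda> :: "'a::euclidean_space set"
  assumes \<Lambda>: "lattice_in \<Lambda> UNIV" and M: "invariant_measure \<Lambda> M" "locally_finite_borel M" and k: "bounded_kernel k"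
    and \<gamma>: "\<gamma> \<in> dual_lattice \<Lambda>"
  shows "(LINT s|lattice_measure \<Lambda>. indicator (fundamental_domain \<Lambda>) s * (character (- \<gamma>) s * (LINT x|M. k (x - s))))
    = (LINT x|M. indicator (fundamental_domain \<Lambda>) x * character (- \<gamma>) x) * (LINT z|lattice_measure \<Lambda>. k z * character \<gamma> z)"
proof -
  let ?m = "lattice_measure \<Lambda>" and ?D = "fundamental_domain \<Lambda>"
  let ?e = "character (- \<gamma>)"
  have D: "?D \<in> sets borel" by (rule fundamental_domain_borel[OF \<Lambda>])
  have mlf: "locally_finite_borel ?m" by (rule locally_finite_lattice_measure[OF \<Lambda>])
  have minv: "invariant_measure \<Lambda> ?m" by (rule invariant_lattice_measure[OF \<Lambda>])
  have setsM: "sets M = sets borel" using M(2) by (simp add: locally_finite_borel_def)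
  interpret pair_sigma_finite ?m M
    by (intro pair_sigma_finite.intro sigma_finite_locally_finite_borel mlf M(2))
  obtain C r where Cr: "k \<in> borel_measurable borel" "0 \<le> C" "\<And>x. norm (k x) \<le> C" "0 \<le> r"
    "\<And>x. r < norm x \<Longrightarrow> k x = 0" using bounded_kernelE[OF k] by blast
  define R where "R = (\<Sum>b\<in>some_basis \<Lambda>. norm b)"
  \<comment> \<open>Two points of the fundamental domain contribute \<open>2 * R\<close> and the
    support of \<open>k\<close> contributes \<open>r\<close>; one such set serves both
    unfoldings.\<close>
  define F where "F = \<Lambda> \<inter> cball 0 (r + 2 * R)"
  have F: "finite F" "F \<subseteq> \<Lambda>" unfolding F_def using finite_lattice_cball[OF \<Lambda>] by auto
  have inF: "l \<in> F" if "l \<in> \<Lambda>" "x \<in> ?D" "s \<in> ?D" "k (x + l - s) \<noteq> 0" for l x s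
  proof -
    have "norm x \<le> R" "norm s \<le> R" unfolding R_def using that fundamental_domain_bounded[OF \<Lambda>] by blast+
    moreover have "norm (x + l - s) \<le> r" using that(4) Cr(5) by force
    moreover have "norm l \<le> norm (x + l - s) + norm x + norm s" by norm
    ultimately show ?thesis using that(1) by (simp add: F_def)
  qed
  \<comment> \<open>The two unfoldings shift in opposite directions, so the finite index set has to
    be symmetric.\<close>
  have Fsym: "uminus ` F = F"
  proof -
    have sub: "uminus ` F \<subseteq> F" using lattice_minus[OF \<Lambda>] by (auto simp: F_def)
    then have "uminus ` uminus ` F \<subseteq> uminus ` F" by (rule image_mono)
    then show ?thesis using sub by (auto simp: image_image)
  qed
  let ?\<Phi> = "\<lambda>l s x. (indicator ?D s * ?e s) * (indicator ?D x * k (x + l - s))"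
  have intPhi: "integrable (?m \<Otimes>\<^sub>M M) (\<lambda>(s, x). ?\<Phi> l s x)" for l
  proof -
    have "sets (?m \<Otimes>\<^sub>M M) = sets ((borel :: 'a measure) \<Otimes>\<^sub>M (borel :: 'a measure))"
      by (intro sets_pair_measure_cong setsM) simp
    then have cong: "measurable (?m \<Otimes>\<^sub>M M) borel = measurable ((borel :: 'a measure) \<Otimes>\<^sub>M (borel :: 'a measure)) (borel :: complex measure)"
      by (intro measurable_cong_sets refl)
    have k': "(\<lambda>p. k (snd p + l - fst p)) \<in> borel_measurable ((borel :: 'a measure) \<Otimes>\<^sub>M (borel :: 'a measure))"
      by (rule measurable_compose[OF _ Cr(1)]) simp
    have e': "(\<lambda>p. ?e (fst p)) \<in> borel_measurable ((borel :: 'a measure) \<Otimes>\<^sub>M (borel :: 'a measure))"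
      by (rule measurable_compose[OF measurable_fst borel_measurable_continuous_onI[OF continuous_on_character]])
    have i: "(indicator ?D :: 'a \<Rightarrow> complex) \<in> borel_measurable borel" by (rule borel_measurable_indicator[OF D])
    have meas: "(\<lambda>(s, x). ?\<Phi> l s x) \<in> borel_measurable (?m \<Otimes>\<^sub>M M)"
      unfolding cong split_def
      by (intro borel_measurable_times k' e' measurable_compose[OF measurable_fst i] measurable_compose[OF measurable_snd i])
    have fin: "emeasure (?m \<Otimes>\<^sub>M M) (?D \<times> ?D) < \<infinity>"
    proof -
      have "?D \<subseteq> cball 0 R" using fundamental_domain_bounded[OF \<Lambda>] by (auto simp: R_def)
      then have "emeasure M ?D \<le> emeasure M (cball 0 R)" using setsM by (intro emeasure_mono) auto
      also have "\<dots> < \<infinity>" using M(2) by (simp add: locally_finite_borel_def)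
      finally show ?thesis
        using D setsM by (subst M2.emeasure_pair_measure_Times) (simp_all add: emeasure_fundamental_domain[OF \<Lambda>])
    qed
    have "integrable (?m \<Otimes>\<^sub>M M) (\<lambda>p. C * indicator (?D \<times> ?D) p :: real)"
      using fin D setsM by (intro integrable_mult_right integrable_real_indicator pair_measureI) auto
    then show ?thesis
    proof (rule Bochner_Integration.integrable_bound[OF _ meas])
      show "AE p in ?m \<Otimes>\<^sub>M M. norm (case p of (s, x) \<Rightarrow> ?\<Phi> l s x) \<le> norm (C * indicator (?D \<times> ?D) p)"
        using Cr(2,3) by (intro AE_I2) (auto simp: indicator_def norm_mult)
    qed
  qed
  have unfold1: "indicator ?D s * (?e s * (LINT x|M. k (x - s))) = (\<Sum>l\<in>F. LINT x|M. ?\<Phi> l s x)" for s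
  proof (cases "s \<in> ?D")
    case True
    have "(LINT x|M. k (x - s)) = (\<Sum>l\<in>F. LINT x|M. indicator ?D x * k (x + l - s))"
      by (rule integral_unfold[OF \<Lambda> M bounded_kernel_shift[OF k] F]) (use inF True in blast)
    then show ?thesis using True by (simp add: sum_distrib_left)
  qed simp
  have "(LINT s|?m. indicator ?D s * (?e s * (LINT x|M. k (x - s)))) = (LINT s|?m. (\<Sum>l\<in>F. LINT x|M. ?\<Phi> l s x))"
    by (simp only: unfold1)
  also have "\<dots> = (\<Sum>l\<in>F. LINT s|?m. (LINT x|M. ?\<Phi> l s x))"
    using integrable_fst[OF intPhi] by (intro Bochner_Integration.integral_sum) simp
  also have "\<dots> = (\<Sum>l\<in>F. LINT x|M. (LINT s|?m. ?\<Phi> l s x))"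
    by (intro sum.cong refl Fubini_integral[symmetric] intPhi)
  also have "\<dots> = (LINT x|M. (\<Sum>l\<in>F. (LINT s|?m. ?\<Phi> l s x)))"
    using integrable_snd[OF intPhi] by (intro Bochner_Integration.integral_sum[symmetric]) simp
  also have "\<dots> = (LINT x|M. (indicator ?D x * ?e x) * (LINT z|?m. k z * character \<gamma> z))"
  proof (intro Bochner_Integration.integral_cong refl)
    fix x
    show "(\<Sum>l\<in>F. (LINT s|?m. ?\<Phi> l s x)) = (indicator ?D x * ?e x) * (LINT z|?m. k z * character \<gamma> z)"
    proof (cases "x \<in> ?D")
      case True
      let ?q = "\<lambda>s. k (x - s) * ?e s"
      have bq: "bounded_kernel ?q"
        using bounded_kernel_mult[OF bounded_kernel_affine[OF k, of "-1" x] continuous_on_character[of UNIV "- \<gamma>"]] by simp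
      have "(LINT s|?m. ?q s) = (\<Sum>l\<in>F. LINT s|?m. indicator ?D s * ?q (s + l))"
      proof (rule integral_unfold[OF \<Lambda> minv mlf bq F])
        fix l s assume l: "l \<in> \<Lambda>" and s: "s \<in> ?D" and "?q (s + l) \<noteq> 0"
        then have "k (x + - l - s) \<noteq> 0" by (simp add: algebra_simps)
        then have "- l \<in> F" using inF[OF lattice_minus[OF \<Lambda> l] True s] by blast
        then show "l \<in> F" using Fsym by (metis add.inverse_inverse image_eqI)
      qed
      also have "\<dots> = (\<Sum>l\<in>uminus ` F. LINT s|?m. indicator ?D s * ?q (s + l))" by (simp only: Fsym)
      also have "\<dots> = (\<Sum>l\<in>F. LINT s|?m. indicator ?D s * ?q (s + - l))"
        by (subst sum.reindex) (auto simp: inj_on_def)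
      also have "\<dots> = (\<Sum>l\<in>F. (LINT s|?m. ?\<Phi> l s x))"
      proof (intro sum.cong refl Bochner_Integration.integral_cong)
        fix l s assume "l \<in> F"
        then have "- l \<in> \<Lambda>" using F(2) lattice_minus[OF \<Lambda>] by blast
        then have "?e (s + - l) = ?e s"
          using character_lattice[OF dual_lattice_minus[OF \<gamma>]] by (simp only: character_add mult_1_right)
        then show "indicator ?D s * ?q (s + - l) = ?\<Phi> l s x"
          using True by (simp add: algebra_simps)
      qed
      finally have "(\<Sum>l\<in>F. (LINT s|?m. ?\<Phi> l s x)) = (LINT s|?m. ?q s)" by simp
      \<comment> \<open>The substitution is a reflection about \<open>x\<close>, whose Jacobian has
        absolute value 1.\<close>
      also have "\<dots> = \<bar>- 1\<bar> ^ card (some_basis \<Lambda>) *\<^sub>R (LINT z|?m. ?q (x + (- 1) *\<^sub>R z))"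
        by (rule integral_lattice_measure_affine[OF \<Lambda> UNIV_I _ bounded_kernel_borel[OF bq]]) simp
      also have "\<dots> = (LINT z|?m. ?e x * (k z * character \<gamma> z))"
        using character_add[of "- \<gamma>" x "- _"] by (simp add: character_minus character_add mult_ac)
      also have "\<dots> = ?e x * (LINT z|?m. k z * character \<gamma> z)" by (rule integral_mult_right_zero)
      finally show ?thesis using True by simp
    qed simp
  qed
  also have "\<dots> = (LINT x|M. indicator ?D x * ?e x) * (LINT z|?m. k z * character \<gamma> z)" by (rule integral_mult_left_zero)
  finally show ?thesis .
qed

section \<open>Completeness of the characters\<close>

text \<open>A density instead of a restricted space: functions stay total on the type, and what
  happens off the fundamental domain has measure zero.\<close>

definition torus_measure :: "'a::euclidean_space set \<Rightarrow> 'a measure" where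
  "torus_measure \<Lambda> = density (lattice_measure \<Lambda>) (\<lambda>x. ennreal (indicator (fundamental_domain \<Lambda>) x))"

lemma torus_measure_sets [simp, measurable_cong]: "sets (torus_measure \<Lambda>) = sets borel"
  by (simp add: torus_measure_def)

lemma torus_measure_space [simp]: "space (torus_measure \<Lambda>) = UNIV"
  by (simp add: torus_measure_def)

lemma measurable_torus_measure [simp]: "measurable (torus_measure \<Lambda>) N = measurable borel N"
  by (rule measurable_cong_sets) simp_all

text \<open>A bound is required only on the fundamental domain, where the torus measure lives and
  where periodizations are estimated.\<close>

definition bounded_borel :: "'a::euclidean_space set \<Rightarrow> ('a \<Rightarrow> complex) \<Rightarrow> bool" where
  "bounded_borel \<Lambda> f \<longleftrightarrow> f \<in> borel_measurable borel \<and> (\<exists>B. \<forall>x\<in>fundamental_domain \<Lambda>. norm (f x) \<le> B)"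

inductive trig_poly :: "'a::euclidean_space set \<Rightarrow> ('a \<Rightarrow> complex) \<Rightarrow> bool" for \<Lambda> where
  character: "\<gamma> \<in> dual_lattice \<Lambda> \<Longrightarrow> trig_poly \<Lambda> (\<lambda>s. a * character \<gamma> s)"
| add: "trig_poly \<Lambda> f \<Longrightarrow> trig_poly \<Lambda> g \<Longrightarrow> trig_poly \<Lambda> (\<lambda>s. f s + g s)"

lemma bounded_borelE:
  assumes "bounded_borel \<Lambda> f"
  obtains B where "f \<in> borel_measurable borel" "0 \<le> B" "\<And>x. x \<in> fundamental_domain \<Lambda> \<Longrightarrow> norm (f x) \<le> B"
proof -
  obtain B where B: "f \<in> borel_measurable borel" "\<forall>x\<in>fundamental_domain \<Lambda>. norm (f x) \<le> B"
    using assms unfolding bounded_borel_def by blast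
  show thesis
  proof (rule that[OF B(1), of "max B 0"])
    show "norm (f x) \<le> max B 0" if "x \<in> fundamental_domain \<Lambda>" for x using B(2) that by (simp add: le_max_iff_disj)
  qed simp
qed

lemma bounded_borelI:
  "f \<in> borel_measurable borel \<Longrightarrow> (\<And>x. x \<in> fundamental_domain \<Lambda> \<Longrightarrow> norm (f x) \<le> B) \<Longrightarrow> bounded_borel \<Lambda> f"
  unfolding bounded_borel_def by blast

lemma bounded_borel_add:
  assumes "bounded_borel \<Lambda> f" "bounded_borel \<Lambda> g" shows "bounded_borel \<Lambda> (\<lambda>x. f x + g x)"
proof -
  obtain B where B: "f \<in> borel_measurable borel" "0 \<le> B" "\<And>x. x \<in> fundamental_domain \<Lambda> \<Longrightarrow> norm (f x) \<le> B"
    using bounded_borelE[OF assms(1)] by blast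
  obtain C where C: "g \<in> borel_measurable borel" "0 \<le> C" "\<And>x. x \<in> fundamental_domain \<Lambda> \<Longrightarrow> norm (g x) \<le> C"
    using bounded_borelE[OF assms(2)] by blast
  show ?thesis by (rule bounded_borelI[where B="B + C"]) (intro borel_measurable_add B C norm_triangle_mono; assumption)+
qed

lemma bounded_borel_mult:
  assumes "bounded_borel \<Lambda> f" "bounded_borel \<Lambda> g" shows "bounded_borel \<Lambda> (\<lambda>x. f x * g x)"
proof -
  obtain B where B: "f \<in> borel_measurable borel" "0 \<le> B" "\<And>x. x \<in> fundamental_domain \<Lambda> \<Longrightarrow> norm (f x) \<le> B"
    using bounded_borelE[OF assms(1)] by blast
  obtain C where C: "g \<in> borel_measurable borel" "0 \<le> C" "\<And>x. x \<in> fundamental_domain \<Lambda> \<Longrightarrow> norm (g x) \<le> C"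
    using bounded_borelE[OF assms(2)] by blast
  show ?thesis
  proof (rule bounded_borelI[where B="B * C"])
    show "(\<lambda>x. f x * g x) \<in> borel_measurable borel" by (intro borel_measurable_times B C)
    show "norm (f x * g x) \<le> B * C" if "x \<in> fundamental_domain \<Lambda>" for x
      unfolding norm_mult by (intro mult_mono B C that) simp
  qed
qed

lemma bounded_borel_const: "bounded_borel \<Lambda> (\<lambda>_. a)"
  by (rule bounded_borelI[where B="norm a"]) simp_all

lemma bounded_borel_diff:
  assumes "bounded_borel \<Lambda> f" "bounded_borel \<Lambda> g" shows "bounded_borel \<Lambda> (\<lambda>x. f x - g x)"
  using bounded_borel_add[OF assms(1) bounded_borel_mult[OF bounded_borel_const[of \<Lambda> "-1"] assms(2)]] by simp

lemma bounded_borel_character: "bounded_borel \<Lambda> (character \<gamma>)"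
  by (rule bounded_borelI[where B=1]) (simp_all add: borel_measurable_continuous_onI continuous_on_character)

lemma bounded_borel_trig_poly: "trig_poly \<Lambda> f \<Longrightarrow> bounded_borel \<Lambda> f"
  by (induction rule: trig_poly.induct)
     (rule bounded_borel_mult[OF bounded_borel_const bounded_borel_character] bounded_borel_add; assumption?)+

lemma bounded_borel_cnj:
  assumes "bounded_borel \<Lambda> f" shows "bounded_borel \<Lambda> (\<lambda>x. cnj (f x))"
proof -
  obtain B where B: "f \<in> borel_measurable borel" "0 \<le> B" "\<And>x. x \<in> fundamental_domain \<Lambda> \<Longrightarrow> norm (f x) \<le> B"
    using bounded_borelE[OF assms(1)] by blast
  show ?thesis
  proof (rule bounded_borelI[where B=B])
    show "(\<lambda>x. cnj (f x)) \<in> borel_measurable borel"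
      by (rule measurable_compose[OF B(1) borel_measurable_continuous_onI]) (intro continuous_intros)
  qed (simp add: B)
qed

lemma bounded_borel_indicator: "A \<in> sets borel \<Longrightarrow> bounded_borel \<Lambda> (indicator A)"
  by (rule bounded_borelI[where B=1]) (auto simp: indicator_def intro!: borel_measurable_indicator)

lemma trig_poly_cmult: "trig_poly \<Lambda> f \<Longrightarrow> trig_poly \<Lambda> (\<lambda>s. b * f s)"
proof (induction rule: trig_poly.induct)
  case (character \<gamma> a)
  then show ?case using trig_poly.character[of \<gamma> \<Lambda> "b * a"] by (simp add: mult.assoc)
next
  case (add f g)
  then show ?case using trig_poly.add[OF add.IH] by (simp add: distrib_left)
qed

lemma trig_poly_mult:
  assumes "trig_poly \<Lambda> f" "trig_poly \<Lambda> g" shows "trig_poly \<Lambda> (\<lambda>s. f s * g s)"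
  using assms(1)
proof (induction rule: trig_poly.induct)
  case (character \<gamma> a)
  note \<gamma> = character
  show ?case using assms(2)
  proof (induction rule: trig_poly.induct)
    case (character \<delta> b)
    have "(\<lambda>s. a * character \<gamma> s * (b * character \<delta> s)) = (\<lambda>s. (a * b) * character (\<gamma> + \<delta>) s)"
      by (simp add: fun_eq_iff mult_ac flip: character_mult)
    then show ?case using trig_poly.character[OF dual_lattice_add[OF \<gamma> character], of "a * b"] by (simp only:)
  next
    case (add f g)
    then show ?case using trig_poly.add[OF add.IH] by (simp add: distrib_left)
  qed
next
  case (add f h)
  then show ?case using trig_poly.add[OF add.IH] by (simp add: distrib_right)
qed

lemma zero_dual_lattice: "0 \<in> dual_lattice \<Lambda>"
  by (simp add: dual_lattice_def)

lemma trig_poly_const: "trig_poly \<Lambda> (\<lambda>_. a)"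
  using trig_poly.character[OF zero_dual_lattice, of \<Lambda> a] by simp

lemma trig_poly_sum:
  assumes "finite I" "\<And>i. i \<in> I \<Longrightarrow> trig_poly \<Lambda> (f i)"
  shows "trig_poly \<Lambda> (\<lambda>s. \<Sum>i\<in>I. f i s)"
  using assms
proof (induction rule: finite_induct)
  case empty
  show ?case by (simp only: sum.empty trig_poly_const)
next
  case (insert a I)
  have "trig_poly \<Lambda> (\<lambda>\<xi>. f a \<xi> + (\<Sum>i\<in>I. f i \<xi>))"
    by (rule trig_poly.add) (use insert in blast)+
  then show ?case by (simp only: sum.insert[OF insert.hyps])
qed

lemma trig_poly_representation:
  assumes "trig_poly \<Lambda> f"
  obtains T c where "finite T" "T \<subseteq> dual_lattice \<Lambda>" "f = (\<lambda>s. \<Sum>\<gamma>\<in>T. c \<gamma> * character \<gamma> s)"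
proof -
  have "\<exists>T c. finite T \<and> T \<subseteq> dual_lattice \<Lambda> \<and> f = (\<lambda>s. \<Sum>\<gamma>\<in>T. c \<gamma> * character \<gamma> s)"
    using assms
  proof (induction rule: trig_poly.induct)
    case (character \<gamma> a)
    then show ?case by (intro exI[of _ "{\<gamma>}"] exI[of _ "\<lambda>_. a"]) simp
  next
    case (add f g)
    then obtain T c T' c' where T: "finite T" "T \<subseteq> dual_lattice \<Lambda>" "f = (\<lambda>s. \<Sum>\<gamma>\<in>T. c \<gamma> * character \<gamma> s)"
      "finite T'" "T' \<subseteq> dual_lattice \<Lambda>" "g = (\<lambda>s. \<Sum>\<gamma>\<in>T'. c' \<gamma> * character \<gamma> s)" by blast
    let ?c = "\<lambda>\<gamma>. (if \<gamma> \<in> T then c \<gamma> else 0) + (if \<gamma> \<in> T' then c' \<gamma> else 0)"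
    have 1: "f s = (\<Sum>\<gamma>\<in>T \<union> T'. (if \<gamma> \<in> T then c \<gamma> else 0) * character \<gamma> s)" for s
      unfolding T(3) using T(1,4) by (intro sum.mono_neutral_cong_left) auto
    have 2: "g s = (\<Sum>\<gamma>\<in>T \<union> T'. (if \<gamma> \<in> T' then c' \<gamma> else 0) * character \<gamma> s)" for s
      unfolding T(6) using T(1,4) by (intro sum.mono_neutral_cong_left) auto
    have "(\<lambda>s. f s + g s) = (\<lambda>s. \<Sum>\<gamma>\<in>T \<union> T'. ?c \<gamma> * character \<gamma> s)"
      unfolding 1 2 by (simp only: distrib_right sum.distrib)
    then show ?case using T(1,2,4,5) by (intro exI[of _ "T \<union> T'"] exI[of _ ?c]) auto
  qed
  then show thesis using that by blast
qed

section \<open>Trigonometric polynomials are dense in \<open>L\<^sup>2\<close> of the torus; Fourier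
  sums are best approximations\<close>

context
  fixes \<Lambda> :: "'a::euclidean_space set"
  assumes \<Lambda>: "lattice_in \<Lambda> UNIV"
begin

private abbreviation "D \<equiv> fundamental_domain \<Lambda>"
private abbreviation "\<mu> \<equiv> torus_measure \<Lambda>"
private abbreviation "B \<equiv> some_basis \<Lambda>"

private lemma D: "D \<in> sets borel" by (rule fundamental_domain_borel[OF \<Lambda>])

private lemma B: "finite B" "independent B" "span B = UNIV" using some_basis[OF \<Lambda>] by blast+

lemma emeasure_torus_measure: "A \<in> sets borel \<Longrightarrow> emeasure \<mu> A = emeasure (lattice_measure \<Lambda>) (A \<inter> D)"
proof -
  assume A: "A \<in> sets borel"
  have "emeasure \<mu> A = (\<integral>\<^sup>+x. ennreal (indicator D x) * indicator A x \<partial>lattice_measure \<Lambda>)"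
    unfolding torus_measure_def using A D by (intro emeasure_density) simp_all
  also have "\<dots> = (\<integral>\<^sup>+x. indicator (A \<inter> D) x \<partial>lattice_measure \<Lambda>)"
    by (intro nn_integral_cong) (auto simp: indicator_def)
  also have "\<dots> = emeasure (lattice_measure \<Lambda>) (A \<inter> D)" using A D by simp
  finally show ?thesis .
qed

lemma finite_torus_measure: "finite_measure \<mu>"
  by (rule finite_measureI) (simp add: emeasure_torus_measure emeasure_fundamental_domain[OF \<Lambda>])

lemma AE_torus_measure: "AE x in \<mu>. x \<in> D"
proof (rule AE_I[of _ _ "- D"])
  show "emeasure \<mu> (- D) = 0" by (simp add: emeasure_torus_measure[OF borel_comp[OF D]])
qed (use D in auto)

lemma integral_torus_measure:
  fixes f :: "'a \<Rightarrow> 'b::{banach, second_countable_topology}"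
  assumes "f \<in> borel_measurable borel"
  shows "(LINT x|\<mu>. f x) = (LINT x:D|lattice_measure \<Lambda>. f x)"
  unfolding torus_measure_def set_lebesgue_integral_def using assms D by (intro integral_density) auto

lemma integrable_torus_measure:
  fixes f :: "'a \<Rightarrow> 'b::{banach, second_countable_topology}"
  assumes "f \<in> borel_measurable borel"
  shows "integrable \<mu> f \<longleftrightarrow> set_integrable (lattice_measure \<Lambda>) D f"
  unfolding torus_measure_def set_integrable_def using assms D by (intro integrable_density) auto

lemma integrable_bounded_borel:
  assumes "bounded_borel \<Lambda> f" shows "integrable \<mu> f"
proof -
  interpret finite_measure \<mu> by (rule finite_torus_measure)
  obtain C where C: "f \<in> borel_measurable borel" "0 \<le> C" "\<And>x. x \<in> D \<Longrightarrow> norm (f x) \<le> C"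
    using bounded_borelE[OF assms(1)] by blast
  show ?thesis
    by (rule integrable_const_bound[where B=C]) (use AE_torus_measure C in \<open>auto elim!: eventually_mono\<close>)
qed

text \<open>The square of the norm. Avoiding the root costs a factor 2 in the triangle inequality,
  hence the fractions \<open>e / 4\<close> in the approximations.\<close>

private definition nrm :: "('a \<Rightarrow> complex) \<Rightarrow> real" where "nrm f = (LINT x|\<mu>. (norm (f x))\<^sup>2)"

private lemma integrable_nrm:
  assumes "bounded_borel \<Lambda> f" shows "integrable \<mu> (\<lambda>x. (norm (f x))\<^sup>2)"
proof -
  have "integrable \<mu> (\<lambda>x. norm (f x * f x))"
    by (intro integrable_norm integrable_bounded_borel bounded_borel_mult assms)
  then show ?thesis by (simp add: norm_mult power2_eq_square)
qed

private lemma nrm_nonneg: "0 \<le> nrm f"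
  unfolding nrm_def by (intro Bochner_Integration.integral_nonneg) simp

private lemma nrm_add_le:
  assumes f: "bounded_borel \<Lambda> f" and g: "bounded_borel \<Lambda> g"
  shows "nrm (\<lambda>x. f x + g x) \<le> 2 * nrm f + 2 * nrm g"
proof -
  have "nrm (\<lambda>x. f x + g x) \<le> (LINT x|\<mu>. 2 * (norm (f x))\<^sup>2 + 2 * (norm (g x))\<^sup>2)"
    unfolding nrm_def
  proof (rule integral_mono)
    show "integrable \<mu> (\<lambda>x. (norm (f x + g x))\<^sup>2)" by (intro integrable_nrm bounded_borel_add f g)
    show "integrable \<mu> (\<lambda>x. 2 * (norm (f x))\<^sup>2 + 2 * (norm (g x))\<^sup>2)"
      by (intro Bochner_Integration.integrable_add integrable_mult_right integrable_nrm f g)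
    show "(norm (f x + g x))\<^sup>2 \<le> 2 * (norm (f x))\<^sup>2 + 2 * (norm (g x))\<^sup>2" for x
    proof -
      have "(norm (f x + g x))\<^sup>2 \<le> (norm (f x) + norm (g x))\<^sup>2"
        by (intro power_mono norm_triangle_ineq) simp
      also have "\<dots> \<le> 2 * (norm (f x))\<^sup>2 + 2 * (norm (g x))\<^sup>2"
        using sum_squares_bound[of "norm (f x)" "norm (g x)"] by (simp add: power2_sum)
      finally show ?thesis .
    qed
  qed
  also have "\<dots> = 2 * nrm f + 2 * nrm g"
    unfolding nrm_def by (subst Bochner_Integration.integral_add) (intro integrable_mult_right integrable_nrm f g | simp)+
  finally show ?thesis .
qed

private definition App :: "('a \<Rightarrow> complex) \<Rightarrow> bool" where
  "App f \<longleftrightarrow> bounded_borel \<Lambda> f \<and> (\<forall>e>0. \<exists>P. trig_poly \<Lambda> P \<and> nrm (\<lambda>x. f x - P x) < e)"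

private lemma App_limit:
  assumes f: "bounded_borel \<Lambda> f" and g: "\<And>e. 0 < e \<Longrightarrow> \<exists>g. App g \<and> nrm (\<lambda>x. f x - g x) < e"
  shows "App f"
  unfolding App_def
proof (intro conjI f allI impI)
  fix e :: real assume e: "0 < e"
  then obtain g where g: "App g" "nrm (\<lambda>x. f x - g x) < e / 4" using assms(2)[of "e / 4"] by auto
  then obtain P where P: "trig_poly \<Lambda> P" "nrm (\<lambda>x. g x - P x) < e / 4" using e unfolding App_def by (metis zero_less_divide_iff zero_less_numeral)
  have "nrm (\<lambda>x. (f x - g x) + (g x - P x)) \<le> 2 * nrm (\<lambda>x. f x - g x) + 2 * nrm (\<lambda>x. g x - P x)"
    using g P f by (intro nrm_add_le bounded_borel_diff) (auto simp: App_def bounded_borel_trig_poly)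
  also have "\<dots> < e" using g P by simp
  finally show "\<exists>P. trig_poly \<Lambda> P \<and> nrm (\<lambda>x. f x - P x) < e" using P(1) by auto
qed

private lemma App_add:
  assumes f: "App f" and g: "App g" shows "App (\<lambda>x. f x + g x)"
  unfolding App_def
proof (intro conjI allI impI)
  show "bounded_borel \<Lambda> (\<lambda>x. f x + g x)" using f g by (intro bounded_borel_add) (auto simp: App_def)
  fix e :: real assume e: "0 < e"
  then have e4: "0 < e / 4" by simp
  obtain P where P: "trig_poly \<Lambda> P" "nrm (\<lambda>x. f x - P x) < e / 4" using f e4 unfolding App_def by blast
  obtain Q where Q: "trig_poly \<Lambda> Q" "nrm (\<lambda>x. g x - Q x) < e / 4" using g e4 unfolding App_def by blast
  have "nrm (\<lambda>x. (f x - P x) + (g x - Q x)) \<le> 2 * nrm (\<lambda>x. f x - P x) + 2 * nrm (\<lambda>x. g x - Q x)"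
    using f g P Q by (intro nrm_add_le bounded_borel_diff) (auto simp: App_def bounded_borel_trig_poly)
  also have "\<dots> < e" using P Q by simp
  finally have "nrm (\<lambda>x. (f x + g x) - (P x + Q x)) < e" by (simp add: algebra_simps)
  then show "\<exists>P. trig_poly \<Lambda> P \<and> nrm (\<lambda>x. f x + g x - P x) < e"
    using trig_poly.add[OF P(1) Q(1)] by (intro exI[of _ "\<lambda>x. P x + Q x"]) simp
qed

private lemma App_trig: "trig_poly \<Lambda> P \<Longrightarrow> App P"
  unfolding App_def by (auto intro!: bounded_borel_trig_poly exI[of _ P] simp: nrm_def)

private lemma App_cmult:
  assumes f: "App f" shows "App (\<lambda>x. b * f x)"
proof (cases "b = 0")
  case True
  then show ?thesis using App_trig[OF trig_poly_const[of \<Lambda> 0]] by simp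
next
  case False
  show ?thesis unfolding App_def
  proof (intro conjI allI impI)
    show "bounded_borel \<Lambda> (\<lambda>x. b * f x)"
      using f by (intro bounded_borel_mult bounded_borel_const) (simp add: App_def)
    fix e :: real assume e: "0 < e"
    then have "0 < e / (norm b)\<^sup>2" using False by simp
    then obtain P where P: "trig_poly \<Lambda> P" "nrm (\<lambda>x. f x - P x) < e / (norm b)\<^sup>2" using f unfolding App_def by blast
    have "nrm (\<lambda>x. b * f x - b * P x) = (norm b)\<^sup>2 * nrm (\<lambda>x. f x - P x)"
      unfolding nrm_def by (simp add: norm_mult power_mult_distrib flip: right_diff_distrib)
    also have "\<dots> < e" using P(2) False by (simp add: pos_less_divide_eq mult.commute)
    finally show "\<exists>P. trig_poly \<Lambda> P \<and> nrm (\<lambda>x. b * f x - P x) < e"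
      using trig_poly_cmult[OF P(1), of b] by (intro exI[of _ "\<lambda>x. b * P x"]) simp
  qed
qed

private lemma App_sum:
  assumes "finite I" "\<And>i. i \<in> I \<Longrightarrow> App (f i)"
  shows "App (\<lambda>s. \<Sum>i\<in>I. f i s)"
  using assms
proof (induction rule: finite_induct)
  case empty
  show ?case by (simp only: sum.empty App_trig[OF trig_poly_const])
next
  case (insert a I)
  have "App (\<lambda>\<xi>. f a \<xi> + (\<Sum>i\<in>I. f i \<xi>))"
    by (rule App_add) (use insert in blast)+
  then show ?case by (simp only: sum.insert[OF insert.hyps])
qed

text \<open>Cosines and sines of the coordinates embed the torus into a Euclidean space, where polynomials
  are dense.\<close>

private definition \<Phi> :: "'a \<Rightarrow> 'a \<times> 'a" where
  "\<Phi> s = (\<Sum>b\<in>B. cos (2 * pi * coord B b s) *\<^sub>R b, \<Sum>b\<in>B. sin (2 * pi * coord B b s) *\<^sub>R b)"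

private lemma continuous_on_coord: "continuous_on A (coord B b)"
  using coord(1)[OF B(2)] by (intro linear_continuous_on) (simp add: linear_conv_bounded_linear)

private lemma continuous_on_Phi: "continuous_on A \<Phi>"
  unfolding \<Phi>_def by (intro continuous_intros continuous_on_coord)

private lemma Phi_bounded: "norm (\<Phi> s) \<le> (\<Sum>b\<in>B. norm b) + (\<Sum>b\<in>B. norm b)"
proof -
  have "norm (\<Sum>b\<in>B. c b *\<^sub>R b) \<le> (\<Sum>b\<in>B. norm b)" if "\<And>b. \<bar>c b\<bar> \<le> 1" for c
    using that by (intro sum_norm_le) (simp add: mult_left_le_one_le)
  then have "norm (fst (\<Phi> s)) \<le> (\<Sum>b\<in>B. norm b)" "norm (snd (\<Phi> s)) \<le> (\<Sum>b\<in>B. norm b)"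
    unfolding \<Phi>_def by simp_all
  then show ?thesis using norm_Pair_le[of "fst (\<Phi> s)" "snd (\<Phi> s)"] by simp
qed

text \<open>Equal cosines and sines mean that coordinates differ by integers; on the half-open
  domain such a difference is less than 1 in absolute value.\<close>

private lemma Phi_inj: "inj_on \<Phi> D"
proof (rule inj_onI)
  fix s t assume s: "s \<in> D" and t: "t \<in> D" and eq: "\<Phi> s = \<Phi> t"
  have "coord B b s = coord B b t" if b: "b \<in> B" for b
  proof -
    have "(\<Sum>b\<in>B. cos (2 * pi * coord B b s) *\<^sub>R b) = (\<Sum>b\<in>B. cos (2 * pi * coord B b t) *\<^sub>R b)"
      "(\<Sum>b\<in>B. sin (2 * pi * coord B b s) *\<^sub>R b) = (\<Sum>b\<in>B. sin (2 * pi * coord B b t) *\<^sub>R b)"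
      using eq by (simp_all only: \<Phi>_def prod.inject)
    then have "cos (2 * pi * coord B b s) = cos (2 * pi * coord B b t)"
      "sin (2 * pi * coord B b s) = sin (2 * pi * coord B b t)"
      using coord_sum[OF B(2,1) b, of "\<lambda>b. cos (2 * pi * coord B b s)"] coord_sum[OF B(2,1) b, of "\<lambda>b. cos (2 * pi * coord B b t)"]
        coord_sum[OF B(2,1) b, of "\<lambda>b. sin (2 * pi * coord B b s)"] coord_sum[OF B(2,1) b, of "\<lambda>b. sin (2 * pi * coord B b t)"]
      by simp_all
    then obtain n :: int where n: "2 * pi * coord B b s = 2 * pi * coord B b t + 2 * pi * n"
      using sin_cos_eq_iff by metis
    have "2 * pi * (coord B b s - coord B b t - n) = 0" using n by (simp add: algebra_simps)
    then have n: "coord B b s - coord B b t = n" by simp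
    moreover have "0 \<le> coord B b s" "coord B b s < 1" "0 \<le> coord B b t" "coord B b t < 1"
      using s t b by (simp_all add: fundamental_domain_eq[OF \<Lambda>])
    ultimately have "\<bar>real_of_int n\<bar> < 1" by linarith
    then have "n = 0" by linarith
    then show ?thesis using n by simp
  qed
  then have "(\<Sum>b\<in>B. coord B b s *\<^sub>R b) = (\<Sum>b\<in>B. coord B b t *\<^sub>R b)" by (intro sum.cong) simp_all
  then show "s = t" using sum_coord[OF B(2,1)] B(3) by simp
qed

text \<open>A coordinate functional belongs to the dual lattice, and its cosine and sine are
  combinations of the two opposite characters.\<close>

private lemma trig_coord:
  assumes b: "b \<in> B"
  shows "trig_poly \<Lambda> (\<lambda>s. complex_of_real (cos (2 * pi * coord B b s)))"
    "trig_poly \<Lambda> (\<lambda>s. complex_of_real (sin (2 * pi * coord B b s)))"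
proof -
  have bl: "bounded_linear (coord B b)" using coord(1)[OF B(2)] by (simp add: linear_conv_bounded_linear)
  define \<gamma> where "\<gamma> = Blinfun (coord B b)"
  have \<gamma>: "blinfun_apply \<gamma> = coord B b" unfolding \<gamma>_def by (rule bounded_linear_Blinfun_apply[OF bl])
  have dual: "\<gamma> \<in> dual_lattice \<Lambda>"
    unfolding dual_lattice_def
  proof (intro CollectI ballI)
    fix x assume "x \<in> \<Lambda>"
    then obtain k :: "'a \<Rightarrow> int" where "x = (\<Sum>b\<in>B. real_of_int (k b) *\<^sub>R b)" by (rule some_basis_memE[OF \<Lambda>])
    then show "blinfun_apply \<gamma> x \<in> \<int>" unfolding \<gamma> using coord_sum[OF B(2,1) b, of "\<lambda>b. real_of_int (k b)"] by simp
  qed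
  have e: "character \<gamma> s = cis (2 * pi * coord B b s)" for s
    unfolding character_def cis_conv_exp \<gamma> by (intro arg_cong[where f=exp]) simp
  have e': "character (- \<gamma>) s = cis (- (2 * pi * coord B b s))" for s
    unfolding character_minus(1) e by (simp add: cis_cnj)
  have c: "complex_of_real (cos (2 * pi * coord B b s)) = (1 / 2) * character \<gamma> s + (1 / 2) * character (- \<gamma>) s" for s
    unfolding e e' by (simp add: complex_eq_iff)
  have s: "complex_of_real (sin (2 * pi * coord B b s)) = (- \<i> / 2) * character \<gamma> s + (\<i> / 2) * character (- \<gamma>) s" for s
    unfolding e e' by (simp add: complex_eq_iff)
  note tp = trig_poly.add[OF trig_poly.character[OF dual] trig_poly.character[OF dual_lattice_minus[OF dual]]]
  show "trig_poly \<Lambda> (\<lambda>s. complex_of_real (cos (2 * pi * coord B b s)))" unfolding c by (rule tp)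
  show "trig_poly \<Lambda> (\<lambda>s. complex_of_real (sin (2 * pi * coord B b s)))" unfolding s by (rule tp)
qed

private lemma trig_poly_Phi:
  fixes p :: "'a \<times> 'a \<Rightarrow> real"
  assumes "real_polynomial_function p"
  shows "trig_poly \<Lambda> (\<lambda>s. complex_of_real (p (\<Phi> s)))"
  using assms
proof (induction rule: real_polynomial_function.induct)
  case (linear f)
  have l: "linear f" using linear by (rule bounded_linear.linear)
  have "f (\<Phi> s) = (\<Sum>b\<in>B. f (b, 0) * cos (2 * pi * coord B b s)) + (\<Sum>b\<in>B. f (0, b) * sin (2 * pi * coord B b s))" for s
  proof -
    have eq: "\<Phi> s = (\<Sum>b\<in>B. cos (2 * pi * coord B b s) *\<^sub>R (b, 0)) + (\<Sum>b\<in>B. sin (2 * pi * coord B b s) *\<^sub>R (0, b))"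
      unfolding \<Phi>_def by (simp add: prod_eq_iff fst_sum snd_sum)
    show ?thesis
      unfolding eq linear_add[OF l] linear_sum[OF l] linear_scale[OF l] real_scaleR_def by (simp only: mult.commute)
  qed
  then have "(\<lambda>s. complex_of_real (f (\<Phi> s))) = (\<lambda>s. (\<Sum>b\<in>B. of_real (f (b, 0)) * complex_of_real (cos (2 * pi * coord B b s)))
      + (\<Sum>b\<in>B. of_real (f (0, b)) * complex_of_real (sin (2 * pi * coord B b s))))"
    by (simp only: of_real_add of_real_sum of_real_mult)
  then show ?case
    by (simp only:) (intro trig_poly.add trig_poly_sum B(1) trig_poly_cmult trig_coord)
next
  case (const c)
  show ?case by (rule trig_poly_const)
next
  case (add f g)
  then show ?case using trig_poly.add[OF add.IH] by simp
next
  case (mult f g)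
  then show ?case using trig_poly_mult[OF mult.IH] by simp
qed

private lemma nrm_less_of_bound:
  assumes f: "f \<in> borel_measurable borel" and e: "\<And>x. norm (f x) \<le> e"
  shows "nrm f \<le> e\<^sup>2"
proof -
  interpret finite_measure \<mu> by (rule finite_torus_measure)
  have e0: "0 \<le> e" using e[of 0] norm_ge_zero order_trans by blast
  have bb: "bounded_borel \<Lambda> f" using f e by (rule bounded_borelI)
  have "nrm f \<le> (LINT x|\<mu>. e\<^sup>2)"
    unfolding nrm_def using e e0 by (intro integral_mono integrable_nrm[OF bb]) (auto intro: power_mono)
  also have "\<dots> = e\<^sup>2"
    using emeasure_torus_measure[of UNIV] emeasure_fundamental_domain[OF \<Lambda>] by (simp add: measure_def)
  finally show ?thesis .
qed

text \<open>Stone-Weierstrass on a ball containing the range of \<Phi> approximates \<open>g\<close>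
  uniformly by polynomials, whose pull-backs are trigonometric polynomials. The total mass is 1, so
  uniform closeness bounds \<open>nrm\<close>.\<close>

private lemma App_continuous_Phi:
  fixes g :: "'a \<times> 'a \<Rightarrow> real"
  assumes g: "continuous_on UNIV g"
  shows "App (\<lambda>s. complex_of_real (g (\<Phi> s)))"
proof -
  let ?R = "(\<Sum>b\<in>B. norm b) + (\<Sum>b\<in>B. norm b)"
  have gP: "(\<lambda>s. complex_of_real (g (\<Phi> s))) \<in> borel_measurable borel"
    by (intro borel_measurable_continuous_onI continuous_intros continuous_on_compose2[OF g continuous_on_Phi]) auto
  have "compact (g ` cball 0 ?R)" using g by (intro compact_continuous_image) (auto intro: continuous_on_subset)
  then have "bounded (g ` cball 0 ?R)" by (rule compact_imp_bounded)
  then obtain C where C: "\<forall>y\<in>g ` cball 0 ?R. norm y \<le> C" unfolding bounded_iff by blast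
  have bb: "bounded_borel \<Lambda> (\<lambda>s. complex_of_real (g (\<Phi> s)))"
  proof (rule bounded_borelI[OF gP])
    show "norm (complex_of_real (g (\<Phi> s))) \<le> C" for s using C Phi_bounded[of s] by simp
  qed
  show ?thesis
    unfolding App_def
  proof (intro conjI bb allI impI)
    fix e :: real assume e: "0 < e"
    \<comment> \<open>As \<open>nrm\<close> is a squared norm, \<open>d\<^sup>2\<close> has to be
      below \<open>e\<close>; the bounds \<open>d \<le> 1\<close> and \<open>d \<le> e / 2\<close>
      give this.\<close>
    define d where "d = min 1 (e / 2)"
    have d: "0 < d" "d\<^sup>2 < e"
    proof -
      show "0 < d" using e by (simp add: d_def)
      then have "d * d \<le> 1 * d" by (intro mult_right_mono) (auto simp: d_def)
      then show "d\<^sup>2 < e" using e by (simp add: d_def power2_eq_square)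
    qed
    obtain p where p: "real_polynomial_function p" "\<And>z. z \<in> cball 0 ?R \<Longrightarrow> \<bar>g z - p z\<bar> < d"
      using Stone_Weierstrass_real_polynomial_function[OF compact_cball continuous_on_subset[OF g subset_UNIV] d(1), of 0 ?R] by metis
    have tp: "trig_poly \<Lambda> (\<lambda>s. complex_of_real (p (\<Phi> s)))" by (rule trig_poly_Phi[OF p(1)])
    have "nrm (\<lambda>s. complex_of_real (g (\<Phi> s)) - complex_of_real (p (\<Phi> s))) \<le> d\<^sup>2"
    proof (rule nrm_less_of_bound)
      show "(\<lambda>s. complex_of_real (g (\<Phi> s)) - complex_of_real (p (\<Phi> s))) \<in> borel_measurable borel"
        using bounded_borel_trig_poly[OF tp] gP by (intro borel_measurable_diff) (auto simp: bounded_borel_def)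
      show "norm (complex_of_real (g (\<Phi> s)) - complex_of_real (p (\<Phi> s))) \<le> d" for s
        using p(2)[of "\<Phi> s"] Phi_bounded[of s] by (simp add: less_imp_le flip: of_real_diff)
    qed
    then show "\<exists>P. trig_poly \<Lambda> P \<and> nrm (\<lambda>s. complex_of_real (g (\<Phi> s)) - P s) < e" using tp d(2) by force
  qed
qed

private lemma nrm_tendsto_0:
  assumes f: "\<And>n. bounded_borel \<Lambda> (f n)" and C: "\<And>n x. x \<in> D \<Longrightarrow> norm (f n x) \<le> C"
    and lim: "\<And>x. x \<in> D \<Longrightarrow> (\<lambda>n::nat. f n x) \<longlonglongrightarrow> 0"
  shows "(\<lambda>n. nrm (f n)) \<longlonglongrightarrow> 0"
proof -
  interpret finite_measure \<mu> by (rule finite_torus_measure)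
  have "(\<lambda>n. LINT x|\<mu>. (norm (f n x))\<^sup>2) \<longlonglongrightarrow> (LINT x|\<mu>. 0)"
  proof (rule integral_dominated_convergence[where w="\<lambda>_. C\<^sup>2"])
    show "(\<lambda>x. (norm (f n x))\<^sup>2) \<in> borel_measurable \<mu>" for n
      using integrable_nrm[OF f[of n]] by (rule borel_measurable_integrable)
    show "AE x in \<mu>. (\<lambda>n. (norm (f n x))\<^sup>2) \<longlonglongrightarrow> 0"
      using AE_torus_measure
    proof eventually_elim
      case (elim x)
      then have "(\<lambda>n. (norm (f n x))\<^sup>2) \<longlonglongrightarrow> 0\<^sup>2" by (intro tendsto_power tendsto_norm_zero lim)
      then show ?case by simp
    qed
    show "AE x in \<mu>. norm ((norm (f n x))\<^sup>2) \<le> C\<^sup>2" for n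
      using AE_torus_measure by eventually_elim (simp add: C power_mono)
  qed simp_all
  then show ?thesis by (simp add: nrm_def)
qed

private lemma App_sequence:
  assumes f: "bounded_borel \<Lambda> f" and g: "\<And>n::nat. App (g n)" and C: "\<And>n x. x \<in> D \<Longrightarrow> norm (f x - g n x) \<le> C"
    and lim: "\<And>x. x \<in> D \<Longrightarrow> (\<lambda>n. g n x) \<longlonglongrightarrow> f x"
  shows "App f"
proof (rule App_limit[OF f])
  fix e :: real assume "0 < e"
  have "(\<lambda>n. nrm (\<lambda>x. f x - g n x)) \<longlonglongrightarrow> 0"
  proof (rule nrm_tendsto_0[where C=C])
    show "bounded_borel \<Lambda> (\<lambda>x. f x - g n x)" for n using f g by (intro bounded_borel_diff) (auto simp: App_def)
    show "(\<lambda>n. f x - g n x) \<longlonglongrightarrow> 0" if "x \<in> D" for x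
      using tendsto_diff[OF tendsto_const[of "f x"] lim[OF that]] by simp
  qed (rule C)
  then have "\<forall>\<^sub>F n in sequentially. nrm (\<lambda>x. f x - g n x) < e" using \<open>0 < e\<close> by (rule order_tendstoD)
  then obtain n where "nrm (\<lambda>x. f x - g n x) < e" using eventually_happens'[OF sequentially_bot] by blast
  then show "\<exists>g. App g \<and> nrm (\<lambda>x. f x - g x) < e" using g by blast
qed

text \<open>The functions \<open>max 0 (1 - n * dist)\<close> of the distance to the compact set
  \<Phi>(K) decrease to its indicator. Injectivity of \<Phi> on the fundamental domain identifies
  the pull-back of this indicator with that of \<open>K\<close>, and dominated convergence does the
  rest.\<close>

private lemma App_compact:
  assumes K: "compact K" "K \<subseteq> D" shows "App (indicator K)"
proof (cases "K = {}")
  case True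
  then show ?thesis using App_trig[OF trig_poly_const[of \<Lambda> 0]] by (simp add: indicator_def[abs_def])
next
  case False
  let ?K = "\<Phi> ` K"
  have cK: "compact ?K" by (intro compact_continuous_image continuous_on_Phi K(1))
  have cl: "closed ?K" by (rule compact_imp_closed[OF cK])
  let ?g = "\<lambda>n z. max 0 (1 - real n * infdist z ?K)"
  have cont: "continuous_on UNIV (?g n)" for n by (intro continuous_intros)
  show ?thesis
  proof (rule App_sequence[where g="\<lambda>n s. complex_of_real (?g n (\<Phi> s))" and C=1])
    show "bounded_borel \<Lambda> (indicator K)"
      using compact_imp_closed[OF K(1)] by (intro bounded_borel_indicator) simp
    show "App (\<lambda>s. complex_of_real (?g n (\<Phi> s)))" for n by (rule App_continuous_Phi[OF cont])
    fix x assume x: "x \<in> D"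
    have mem: "\<Phi> x \<in> ?K \<longleftrightarrow> x \<in> K" using Phi_inj x K(2) by (auto simp: inj_on_def)
    have g01: "0 \<le> ?g n (\<Phi> x)" "?g n (\<Phi> x) \<le> 1" for n using infdist_nonneg[of "\<Phi> x" ?K] by auto
    have gK: "?g n (\<Phi> x) = 1" if "x \<in> K" for n using that mem by simp
    show "norm (indicator K x - complex_of_real (?g n (\<Phi> x))) \<le> 1" for n
    proof (cases "x \<in> K")
      case True
      then show ?thesis using gK[OF True, of n] by (simp only: indicator_simps of_real_1) simp
    next
      case False
      then have i0: "indicator K x = (0 :: complex)" by simp
      have "norm (indicator K x - complex_of_real (?g n (\<Phi> x))) = \<bar>?g n (\<Phi> x)\<bar>"
        unfolding i0 diff_0 norm_minus_cancel norm_of_real ..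
      then show ?thesis using g01[of n] by linarith
    qed
    show "(\<lambda>n. complex_of_real (?g n (\<Phi> x))) \<longlonglongrightarrow> indicator K x"
    proof (cases "x \<in> K")
      case True
      then show ?thesis using gK[OF True] by (simp only: indicator_simps of_real_1 tendsto_const)
    next
      case nK: False
      have "infdist (\<Phi> x) ?K > 0"
        using mem nK cl False by (simp add: infdist_pos_not_in_closed)
      then obtain m :: nat where m: "1 < real m * infdist (\<Phi> x) ?K" using reals_Archimedean3 by blast
      have "\<forall>\<^sub>F n in sequentially. complex_of_real (?g n (\<Phi> x)) = indicator K x"
        using eventually_ge_at_top[of m]
      proof eventually_elim
        case (elim n)
        then have "real m * infdist (\<Phi> x) ?K \<le> real n * infdist (\<Phi> x) ?K"
          using infdist_nonneg by (intro mult_right_mono) auto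
        then have "?g n (\<Phi> x) = 0" using m by simp
        moreover have "indicator K x = (0 :: complex)" using nK by simp
        ultimately show ?case by (simp only: of_real_0)
      qed
      then show ?thesis by (rule tendsto_eventually)
    qed
  qed
qed

text \<open>Inner regularity of a finite Borel measure supplies a compact subset of the part in the
  fundamental domain that misses less than \<open>e\<close> of the measure; for indicators
  \<open>nrm\<close> of the difference is exactly the missing measure.\<close>

private lemma App_indicator:
  assumes A: "A \<in> sets borel" shows "App (indicator A)"
proof (rule App_limit[OF bounded_borel_indicator[OF A]])
  interpret finite_measure \<mu> by (rule finite_torus_measure)
  fix e :: real assume e: "0 < e"
  let ?A = "A \<inter> D"
  have AD: "?A \<in> sets borel" using A D by simp
  have "emeasure \<mu> ?A = (SUP K\<in>{K. K \<subseteq> ?A \<and> compact K}. emeasure \<mu> K)"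
    using AD by (intro inner_regular) (auto simp: emeasure_eq_measure)
  moreover have "emeasure \<mu> ?A < emeasure \<mu> ?A + ennreal e"
    using e by (simp add: emeasure_eq_measure ennreal_less_iff flip: ennreal_plus)
  ultimately obtain K where K: "K \<subseteq> ?A" "compact K" "emeasure \<mu> ?A < emeasure \<mu> K + ennreal e"
  proof -
    assume *: "emeasure \<mu> ?A = (SUP K\<in>{K. K \<subseteq> ?A \<and> compact K}. emeasure \<mu> K)" "\<And>K. K \<subseteq> ?A \<Longrightarrow> compact K \<Longrightarrow> emeasure \<mu> ?A < emeasure \<mu> K + ennreal e \<Longrightarrow> thesis"
    show thesis
    proof (rule ccontr)
      assume "\<not> thesis"
      then have "emeasure \<mu> K + ennreal e \<le> emeasure \<mu> ?A" if "K \<subseteq> ?A" "compact K" for K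
        using *(2)[OF that] by (meson not_le)
      then have le: "measure \<mu> K \<le> measure \<mu> ?A - e" if "K \<subseteq> ?A" "compact K" for K
      proof -
        have "emeasure \<mu> K + ennreal e = ennreal (measure \<mu> K + e)"
          using e by (simp add: emeasure_eq_measure)
        then have "ennreal (measure \<mu> K + e) \<le> ennreal (measure \<mu> ?A)"
          using \<open>\<And>K. K \<subseteq> ?A \<Longrightarrow> compact K \<Longrightarrow> emeasure \<mu> K + ennreal e \<le> emeasure \<mu> ?A\<close>[OF that]
          by (simp add: emeasure_eq_measure)
        then have "measure \<mu> K + e \<le> measure \<mu> ?A" by (subst (asm) ennreal_le_iff) simp_all
        then show ?thesis by simp
      qed
      have "0 \<le> measure \<mu> ?A - e" using le[of "{}"] by simp
      have "(SUP K\<in>{K. K \<subseteq> ?A \<and> compact K}. emeasure \<mu> K) \<le> ennreal (measure \<mu> ?A - e)"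
        by (rule SUP_least) (auto simp: emeasure_eq_measure intro!: ennreal_leI le)
      then have "emeasure \<mu> ?A \<le> ennreal (measure \<mu> ?A - e)" by (simp only: *(1)[symmetric])
      then have "measure \<mu> ?A \<le> measure \<mu> ?A - e"
        unfolding emeasure_eq_measure using \<open>0 \<le> measure \<mu> ?A - e\<close> by (subst (asm) ennreal_le_iff)
      then show False using e by simp
    qed
  qed
  have Kb: "K \<in> sets borel" using compact_imp_closed[OF K(2)] by simp
  have "nrm (\<lambda>x. indicator A x - indicator K x) = (LINT x|\<mu>. indicator (?A - K) x)"
    unfolding nrm_def
  proof (rule integral_cong_AE)
    show "AE x in \<mu>. (norm (indicator A x - indicator K x :: complex))\<^sup>2 = indicator (?A - K) x"
      using AE_torus_measure by eventually_elim (use K(1) in \<open>auto simp: indicator_def\<close>)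
    show "(\<lambda>x. (norm (indicator A x - indicator K x :: complex))\<^sup>2) \<in> borel_measurable \<mu>"
      by (rule borel_measurable_integrable[OF integrable_nrm[OF bounded_borel_diff[OF bounded_borel_indicator[OF A] bounded_borel_indicator[OF Kb]]]])
  qed (use AD Kb in simp)
  also have "\<dots> = measure \<mu> (?A - K)" by simp
  also have "\<dots> = measure \<mu> ?A - measure \<mu> K" using AD Kb K(1) by (intro finite_measure_Diff) auto
  also have "\<dots> < e"
  proof -
    have "ennreal (measure \<mu> ?A) < ennreal (measure \<mu> K + e)"
      using K(3) e by (simp add: emeasure_eq_measure)
    then have "measure \<mu> ?A < measure \<mu> K + e" by (simp add: ennreal_less_iff)
    then show ?thesis by simp
  qed
  finally have "nrm (\<lambda>x. indicator A x - indicator K x) < e" .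
  moreover have "App (indicator K)" using K by (intro App_compact) auto
  ultimately show "\<exists>g. App g \<and> nrm (\<lambda>x. indicator A x - g x) < e" by blast
qed

text \<open>Simple functions converge pointwise to \<open>f\<close> and are dominated by twice its
  modulus, so the error is at most three times the bound of \<open>f\<close>, as
  \<open>App_sequence\<close> requires.\<close>

private lemma App_bounded_borel:
  assumes f: "bounded_borel \<Lambda> f" shows "App f"
proof -
  obtain C where C: "f \<in> borel_measurable borel" "0 \<le> C" "\<And>x. x \<in> D \<Longrightarrow> norm (f x) \<le> C"
    using bounded_borelE[OF f] by blast
  obtain F where F: "\<And>i. simple_function borel (F i)" "\<And>x. (\<lambda>i. F i x) \<longlonglongrightarrow> f x" "\<And>i x. dist (F i x) 0 \<le> 2 * dist (f x) 0"
    using borel_measurable_implies_sequence_metric[OF C(1), of 0] by auto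
  show ?thesis
  proof (rule App_sequence[OF f, where g=F and C="3 * C"])
    fix n
    have fin: "finite (range (F n))" using simple_functionD(1)[OF F(1)[of n]] by simp
    have "App (\<lambda>x. \<Sum>y\<in>range (F n). y * indicator (F n -` {y}) x)"
    proof (intro App_sum fin App_cmult App_indicator)
      fix y
      show "F n -` {y} \<in> sets borel" using simple_functionD(2)[OF F(1)[of n], of "{y}"] by simp
    qed
    moreover have "(\<lambda>x. \<Sum>y\<in>range (F n). y * indicator (F n -` {y}) x) = F n"
    proof
      fix x
      have "(\<Sum>y\<in>range (F n). y * indicator (F n -` {y}) x) = (\<Sum>y\<in>range (F n). if y = F n x then y else 0)"
        by (intro sum.cong refl) (auto simp: indicator_def)
      then show "(\<Sum>y\<in>range (F n). y * indicator (F n -` {y}) x) = F n x" using fin by simp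
    qed
    ultimately show "App (F n)" by simp
    fix x assume x: "x \<in> D"
    have "norm (f x - F n x) \<le> norm (f x) + norm (F n x)" by (rule norm_triangle_ineq4)
    also have "\<dots> \<le> 3 * C" using F(3)[of n x] C(3)[OF x] by simp
    finally show "norm (f x - F n x) \<le> 3 * C" .
  qed (rule F(2))
qed

lemma integral_torus_character:
  assumes "\<gamma> \<in> dual_lattice \<Lambda>"
  shows "(LINT x|\<mu>. character \<gamma> x) = (if \<gamma> = 0 then 1 else 0)"
proof -
  have "(LINT x|\<mu>. character \<gamma> x) = (LINT x|lattice_measure \<Lambda>. indicator D x * character \<gamma> x)"
    by (subst integral_torus_measure[OF borel_measurable_continuous_onI[OF continuous_on_character]])
       (auto simp: set_lebesgue_integral_def indicator_def intro!: Bochner_Integration.integral_cong)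
  then show ?thesis by (simp only: lattice_measure_fourier[OF \<Lambda> assms])
qed

text \<open>Pythagoras: \<open>u\<close>, the error of the Fourier sum, is orthogonal to the
  characters of \<open>T\<close>, and any other combination differs from the Fourier sum by a
  combination \<open>v\<close> of these characters, so its squared error exceeds that of
  \<open>u\<close> by \<open>nrm v\<close>.\<close>

private lemma best_approximation:
  assumes f: "bounded_borel \<Lambda> f" and T: "finite T" "T \<subseteq> dual_lattice \<Lambda>"
    and a: "\<And>\<gamma>. \<gamma> \<in> T \<Longrightarrow> a \<gamma> = (LINT x|\<mu>. character (- \<gamma>) x * f x)"
  shows "nrm (\<lambda>x. f x - (\<Sum>\<gamma>\<in>T. a \<gamma> * character \<gamma> x)) \<le> nrm (\<lambda>x. f x - (\<Sum>\<gamma>\<in>T. c \<gamma> * character \<gamma> x))"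
proof -
  let ?S = "\<lambda>x. \<Sum>\<gamma>\<in>T. a \<gamma> * character \<gamma> x"
  define u where "u x = f x - ?S x" for x
  define v where "v x = (\<Sum>\<gamma>\<in>T. (a \<gamma> - c \<gamma>) * character \<gamma> x)" for x
  have tS: "trig_poly \<Lambda> ?S" using T by (intro trig_poly_sum trig_poly.character) auto
  have bu: "bounded_borel \<Lambda> u" unfolding u_def by (intro bounded_borel_diff f bounded_borel_trig_poly tS)
  have "trig_poly \<Lambda> v" unfolding v_def using T by (intro trig_poly_sum trig_poly.character) auto
  then have bv: "bounded_borel \<Lambda> v" by (rule bounded_borel_trig_poly)
  have orth: "(LINT x|\<mu>. character (- \<gamma>) x * u x) = 0" if \<gamma>: "\<gamma> \<in> T" for \<gamma>
  proof -
    have i1: "integrable \<mu> (\<lambda>x. character (- \<gamma>) x * f x)"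
      by (intro integrable_bounded_borel bounded_borel_mult bounded_borel_character f)
    have i2: "integrable \<mu> (\<lambda>x. a \<delta> * character (- \<gamma> + \<delta>) x)" for \<delta>
      by (intro integrable_mult_right integrable_bounded_borel bounded_borel_character)
    have "character (- \<gamma>) x * u x = character (- \<gamma>) x * f x - (\<Sum>\<delta>\<in>T. a \<delta> * character (- \<gamma> + \<delta>) x)" for x
      unfolding u_def right_diff_distrib sum_distrib_left character_mult[symmetric] by (simp only: mult_ac)
    then have "(LINT x|\<mu>. character (- \<gamma>) x * u x) = (LINT x|\<mu>. character (- \<gamma>) x * f x - (\<Sum>\<delta>\<in>T. a \<delta> * character (- \<gamma> + \<delta>) x))"
      by (simp only:)
    also have "\<dots> = a \<gamma> - (LINT x|\<mu>. (\<Sum>\<delta>\<in>T. a \<delta> * character (- \<gamma> + \<delta>) x))"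
      unfolding a[OF \<gamma>] by (intro Bochner_Integration.integral_diff i1 Bochner_Integration.integrable_sum i2)
    also have "(LINT x|\<mu>. (\<Sum>\<delta>\<in>T. a \<delta> * character (- \<gamma> + \<delta>) x)) = (\<Sum>\<delta>\<in>T. LINT x|\<mu>. a \<delta> * character (- \<gamma> + \<delta>) x)"
      by (intro Bochner_Integration.integral_sum i2)
    also have "\<dots> = (\<Sum>\<delta>\<in>T. if \<delta> = \<gamma> then a \<delta> else 0)"
    proof (rule sum.cong[OF refl])
      fix \<delta> assume "\<delta> \<in> T"
      then have "- \<gamma> + \<delta> \<in> dual_lattice \<Lambda>" using T(2) \<gamma> by (intro dual_lattice_add dual_lattice_minus) auto
      then have "(LINT x|\<mu>. a \<delta> * character (- \<gamma> + \<delta>) x) = a \<delta> * (if - \<gamma> + \<delta> = 0 then 1 else 0)"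
        by (simp only: integral_mult_right_zero integral_torus_character)
      also have "\<dots> = (if \<delta> = \<gamma> then a \<delta> else 0)"
        by (simp add: add.commute[of "- \<gamma>"])
      finally show "(LINT x|\<mu>. a \<delta> * character (- \<gamma> + \<delta>) x) = (if \<delta> = \<gamma> then a \<delta> else 0)" .
    qed
    also have "\<dots> = a \<gamma>" using T(1) \<gamma> by simp
    finally show ?thesis by simp
  qed
  have iuv: "integrable \<mu> (\<lambda>x. u x * cnj (v x))"
    by (intro integrable_bounded_borel bounded_borel_mult bu bounded_borel_cnj bv)
  have "(LINT x|\<mu>. u x * cnj (v x)) = 0"
  proof -
    have "u x * cnj (v x) = (\<Sum>\<gamma>\<in>T. cnj (a \<gamma> - c \<gamma>) * (character (- \<gamma>) x * u x))" for x
      by (simp add: v_def sum_distrib_left character_minus mult_ac)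
    then have "(LINT x|\<mu>. u x * cnj (v x)) = (LINT x|\<mu>. (\<Sum>\<gamma>\<in>T. cnj (a \<gamma> - c \<gamma>) * (character (- \<gamma>) x * u x)))"
      by (simp only:)
    also have "\<dots> = (\<Sum>\<gamma>\<in>T. LINT x|\<mu>. cnj (a \<gamma> - c \<gamma>) * (character (- \<gamma>) x * u x))"
      by (intro Bochner_Integration.integral_sum integrable_mult_right integrable_bounded_borel bounded_borel_mult bounded_borel_character bu)
    also have "\<dots> = (\<Sum>\<gamma>\<in>T. 0)" by (intro sum.cong refl) (simp only: integral_mult_right_zero orth mult_zero_right)
    finally show ?thesis by simp
  qed
  then have re0: "(LINT x|\<mu>. Re (u x * cnj (v x))) = 0" using integral_Re[OF iuv] by simp
  have "nrm (\<lambda>x. f x - (\<Sum>\<gamma>\<in>T. c \<gamma> * character \<gamma> x)) = nrm (\<lambda>x. u x + v x)"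
    unfolding u_def v_def by (simp add: left_diff_distrib sum_subtractf)
  also have "\<dots> = (LINT x|\<mu>. ((norm (u x))\<^sup>2 + (norm (v x))\<^sup>2) + 2 * Re (u x * cnj (v x)))"
    unfolding nrm_def
    by (intro Bochner_Integration.integral_cong refl) (simp add: cmod_power2, simp add: power2_eq_square algebra_simps)
  also have "\<dots> = (LINT x|\<mu>. (norm (u x))\<^sup>2 + (norm (v x))\<^sup>2) + (LINT x|\<mu>. 2 * Re (u x * cnj (v x)))"
    by (intro Bochner_Integration.integral_add Bochner_Integration.integrable_add integrable_nrm bu bv
        integrable_mult_right integrable_Re iuv)
  also have "(LINT x|\<mu>. (norm (u x))\<^sup>2 + (norm (v x))\<^sup>2) = nrm u + nrm v"
    unfolding nrm_def by (intro Bochner_Integration.integral_add integrable_nrm bu bv)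
  also have "(LINT x|\<mu>. 2 * Re (u x * cnj (v x))) = 0"
    by (simp only: integral_mult_right_zero re0 mult_zero_right)
  finally have "nrm (\<lambda>x. f x - (\<Sum>\<gamma>\<in>T. c \<gamma> * character \<gamma> x)) = nrm u + nrm v" by simp
  then show ?thesis using nrm_nonneg[of v] unfolding u_def by simp
qed

text \<open>Coefficients outside \<open>A\<close> vanish, so adding them to a partial sum over \<open>T \<subseteq> A\<close> changes nothing.\<close>

theorem L2_has_fourier_sum_bounded:
  assumes f: "bounded_borel \<Lambda> f" and A: "A \<subseteq> dual_lattice \<Lambda>"
    and coeff: "\<And>\<gamma>. \<gamma> \<in> dual_lattice \<Lambda> \<Longrightarrow> fourier_coefficient \<Lambda> f \<gamma> = (if \<gamma> \<in> A then a \<gamma> else 0)"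
  shows "L2_has_fourier_sum \<Lambda> a A f"
  unfolding L2_has_fourier_sum_def
proof
  have fm: "f \<in> borel_measurable borel" using f by (simp add: bounded_borel_def)
  have meas2: "(\<lambda>s. (norm (h s))\<^sup>2) \<in> borel_measurable borel" if "bounded_borel \<Lambda> h" for h
    using borel_measurable_integrable[OF integrable_nrm[OF that]] by simp
  show "square_integrable_torus \<Lambda> f"
    unfolding square_integrable_torus_def
    using fm integrable_nrm[OF f] integrable_torus_measure[OF meas2[OF f]] by simp
  define b where "b \<gamma> = (if \<gamma> \<in> A then a \<gamma> else 0)" for \<gamma>
  have b: "b \<gamma> = (LINT x|\<mu>. character (- \<gamma>) x * f x)" if "\<gamma> \<in> dual_lattice \<Lambda>" for \<gamma>
  proof -
    have "(\<lambda>x. character (- \<gamma>) x * f x) \<in> borel_measurable borel"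
      using bounded_borel_mult[OF bounded_borel_character f] by (simp add: bounded_borel_def)
    then show ?thesis using coeff[OF that] by (simp add: b_def fourier_coefficient_def integral_torus_measure)
  qed
  let ?N = "\<lambda>T. nrm (\<lambda>s. f s - (\<Sum>\<gamma>\<in>T. b \<gamma> * character \<gamma> s))"
  have lim: "(?N \<longlongrightarrow> 0) (finite_subsets_at_top A)"
  proof (rule tendstoI)
    fix e :: real assume e: "0 < e"
    then obtain P where P: "trig_poly \<Lambda> P" "nrm (\<lambda>x. f x - P x) < e"
      using App_bounded_borel[OF f] unfolding App_def by blast
    obtain T0 c where T0: "finite T0" "T0 \<subseteq> dual_lattice \<Lambda>" "P = (\<lambda>s. \<Sum>\<gamma>\<in>T0. c \<gamma> * character \<gamma> s)"
      by (rule trig_poly_representation[OF P(1)])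
    show "\<forall>\<^sub>F T in finite_subsets_at_top A. dist (?N T) 0 < e"
      unfolding eventually_finite_subsets_at_top
    proof (intro exI[of _ "T0 \<inter> A"] conjI allI impI)
      fix T assume T: "finite T \<and> T0 \<inter> A \<subseteq> T \<and> T \<subseteq> A"
      \<comment> \<open>The approximating polynomial may use frequencies outside \<open>A\<close>.
        Since \<open>b\<close> vanishes there, the partial sum over \<open>T\<close> is also the
        Fourier sum over the larger set and competes with \<open>P\<close> on equal terms.\<close>
      let ?T = "T \<union> T0"
      have fin: "finite ?T" "?T \<subseteq> dual_lattice \<Lambda>" using T T0 A by auto
      have 1: "(\<Sum>\<gamma>\<in>T. b \<gamma> * character \<gamma> s) = (\<Sum>\<gamma>\<in>?T. b \<gamma> * character \<gamma> s)" for s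
        using T fin(1) by (intro sum.mono_neutral_left) (auto simp: b_def)
      have 2: "P s = (\<Sum>\<gamma>\<in>?T. (if \<gamma> \<in> T0 then c \<gamma> else 0) * character \<gamma> s)" for s
        unfolding T0(3) using fin(1) by (intro sum.mono_neutral_cong_left) auto
      have "?N T \<le> nrm (\<lambda>x. f x - P x)"
        unfolding 1 2 using b fin(2) by (intro best_approximation[OF f fin]) blast
      then show "dist (?N T) 0 < e" using P(2) nrm_nonneg[of "\<lambda>s. f s - (\<Sum>\<gamma>\<in>T. b \<gamma> * character \<gamma> s)"] by simp
    qed (use T0 in auto)
  qed
  have "\<forall>\<^sub>F T in finite_subsets_at_top A. ?N T = (LINT s:D|lattice_measure \<Lambda>. (norm (f s - (\<Sum>\<gamma>\<in>T. character \<gamma> s * a \<gamma>)))\<^sup>2)"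
  proof (rule eventually_mono[OF eventually_finite_subsets_at_top_weakI[of A "\<lambda>T. finite T \<and> T \<subseteq> A"]])
    fix T assume T: "finite T \<and> T \<subseteq> A"
    then have "(\<Sum>\<gamma>\<in>T. character \<gamma> s * a \<gamma>) = (\<Sum>\<gamma>\<in>T. b \<gamma> * character \<gamma> s)" for s
      by (intro sum.cong refl) (auto simp: b_def)
    then have eq: "(\<lambda>s. f s - (\<Sum>\<gamma>\<in>T. character \<gamma> s * a \<gamma>)) = (\<lambda>s. f s - (\<Sum>\<gamma>\<in>T. b \<gamma> * character \<gamma> s))" by simp
    have "trig_poly \<Lambda> (\<lambda>s. \<Sum>\<gamma>\<in>T. b \<gamma> * character \<gamma> s)" using T A by (intro trig_poly_sum trig_poly.character) auto
    then have "bounded_borel \<Lambda> (\<lambda>s. f s - (\<Sum>\<gamma>\<in>T. b \<gamma> * character \<gamma> s))"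
      by (intro bounded_borel_diff f bounded_borel_trig_poly)
    from integral_torus_measure[OF meas2[OF this]]
    show "?N T = (LINT s:D|lattice_measure \<Lambda>. (norm (f s - (\<Sum>\<gamma>\<in>T. character \<gamma> s * a \<gamma>)))\<^sup>2)"
      unfolding nrm_def by (simp only: fun_cong[OF eq])
  qed simp
  from Lim_transform_eventually[OF lim this]
  show "((\<lambda>T. LINT s:D|lattice_measure \<Lambda>. (norm (f s - (\<Sum>\<gamma>\<in>T. character \<gamma> s * a \<gamma>)))\<^sup>2) \<longlongrightarrow> 0) (finite_subsets_at_top A)" .
qed

end

section \<open>The Fourier series\<close>

text \<open>For fixed \<xi> the finite sum of moments is a single integral of \<open>g\<close>
  against a polynomial in \<open>x\<close> that does not depend on the measure. This exhibits each
  homogeneous component as a periodization.\<close>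

lemma laurent_coeff_eq_integral:
  assumes M: "locally_finite_borel M" and g: "bounded_kernel g"
  shows "laurent_coeff M g ws m \<xi> = (LINT x|M. g x * ((if m + int (length ws) < 0 then 0
      else \<Sum>i=0..nat (m + int (length ws)). blinfun_apply \<xi> x ^ i / fact i * fps_nth (todd_fps ws \<xi>) (nat (m + int (length ws)) - i))
      / (\<Prod>w\<leftarrow>ws. blinfun_apply \<xi> w)))"
proof -
  let ?k = "nat (m + int (length ws))"
  let ?P = "\<Prod>w\<leftarrow>ws. blinfun_apply \<xi> w"
  have int: "integrable M (\<lambda>x. (g x * blinfun_apply \<xi> x ^ i) * (fps_nth (todd_fps ws \<xi>) (?k - i) / (fact i * ?P)))" for i
    by (intro integrable_mult_left integrable_bounded_kernel[OF M] bounded_kernel_pow g)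
  have "laurent_numerator M g ws ?k \<xi> / ?P =
      (\<Sum>i=0..?k. LINT x|M. (g x * blinfun_apply \<xi> x ^ i) * (fps_nth (todd_fps ws \<xi>) (?k - i) / (fact i * ?P)))"
    unfolding laurent_numerator_def sum_divide_distrib integral_mult_left_zero by (intro sum.cong refl) simp
  also have "\<dots> = (LINT x|M. (\<Sum>i=0..?k. (g x * blinfun_apply \<xi> x ^ i) * (fps_nth (todd_fps ws \<xi>) (?k - i) / (fact i * ?P))))"
    by (intro Bochner_Integration.integral_sum[symmetric] int)
  also have "\<dots> = (LINT x|M. g x * ((\<Sum>i=0..?k. blinfun_apply \<xi> x ^ i / fact i * fps_nth (todd_fps ws \<xi>) (?k - i)) / ?P))"
    by (intro Bochner_Integration.integral_cong refl) (simp add: sum_distrib_left sum_divide_distrib mult.assoc)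
  finally show ?thesis by (cases "m + int (length ws) < 0") (simp_all add: laurent_coeff_def)
qed

theorem theorem32:
  fixes \<Lambda> L c :: "'a::euclidean_space set" and N :: nat and v :: "nat \<Rightarrow> 'a" and m :: int
  assumes "lattice_in \<Lambda> UNIV"
    and "rational_subspace \<Lambda> L"
    and "rational_cone \<Lambda> c" and "\<not> contains_line c" and "aff_dim c = int DIM('a)"
    and "edge_generators c N v"
  shows "\<exists>F G.
    (\<forall>s. F s \<in> rational_space N v m \<and>
         (\<forall>\<^sub>F \<xi> in germ0. F s \<xi> = homogeneous_component m (shifted_gf \<Lambda> L s c) \<xi>)) \<and>
    (\<forall>\<gamma>\<in>dual_lattice \<Lambda>. G \<gamma> \<in> rational_space N v m \<and>
         (\<forall>\<^sub>F \<xi> in germ0. G \<gamma> \<xi> = homogeneous_component m (translated_cone_integral \<Lambda> c \<gamma>) \<xi>)) \<and>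
    (\<forall>s. \<forall>x\<in>\<Lambda>. F (s + x) = F s) \<and>
    (\<forall>\<gamma>\<in>dual_lattice \<Lambda>. \<forall>\<xi>. fourier_coefficient \<Lambda> (\<lambda>s. F s \<xi>) \<gamma> =
         (if \<gamma> \<in> annihilator L then G \<gamma> \<xi> else 0)) \<and>
    (\<forall>\<xi>. L2_has_fourier_sum \<Lambda> (\<lambda>\<gamma>. G \<gamma> \<xi>) (dual_lattice \<Lambda> \<inter> annihilator L) (\<lambda>s. F s \<xi>))"
proof -
  note \<Lambda> = assms(1) and L = assms(2)
  obtain w \<sigma> where w: "\<And>j. j \<in> {1..N} \<Longrightarrow> w j \<in> \<Lambda> - {0}" "\<And>j. j \<in> {1..N} \<Longrightarrow> 0 < \<sigma> j"
    "\<And>j. j \<in> {1..N} \<Longrightarrow> v j = \<sigma> j *\<^sub>R w j" "c = ncone (w ` {1..N})"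
    by (rule edge_generators_lattice[OF \<Lambda> assms(3,4,6)]) blast
  define ws where "ws = map w [1..<Suc N]"
  have setws: "set ws = w ` {1..N}" unfolding ws_def by (auto simp del: upt_Suc)
  have c: "cone_list \<Lambda> c ws" unfolding cone_list_def setws using w(1,4) assms(3,4) by auto
  have ws0: "0 \<notin> set ws" using c by (auto simp: cone_list_def)
  let ?\<nu> = "slice_measure \<Lambda> L" and ?m = "lattice_measure \<Lambda>"
  let ?h = "bdiff ws (indicator c) :: 'a \<Rightarrow> complex"
  have h: "bounded_kernel ?h" by (rule bounded_kernel_cone[OF c])
  have \<nu>: "invariant_measure \<Lambda> ?\<nu>" "locally_finite_borel ?\<nu>"
    by (rule slice_invariant[OF \<Lambda> L], rule slice_locally_finite[OF \<Lambda> L])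
  have sets\<nu>: "sets ?\<nu> = sets borel" by (rule sets_slice_measure[OF \<Lambda> L])
  have mlf: "locally_finite_borel ?m" by (rule locally_finite_lattice_measure[OF \<Lambda>])
  \<comment> \<open>The dependence on \<open>s\<close> sits entirely in the translated measure; the
    kernel and the denominator are fixed.\<close>
  define F where "F s = laurent_coeff (distr ?\<nu> borel (\<lambda>x. x - s)) ?h ws m" for s
  define G where "G \<gamma> = laurent_coeff ?m (\<lambda>x. ?h x * character \<gamma> x) ws m" for \<gamma>
  have hc: "bounded_kernel (\<lambda>x. ?h x * character \<gamma> x)" for \<gamma>
    by (rule bounded_kernel_mult[OF h continuous_on_character])
  have \<sigma>: "\<sigma> j \<noteq> 0" if "j \<in> {1..N}" for j using w(2)[OF that] by simp
  have F1: "F s \<in> rational_space N v m" for s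
    unfolding F_def ws_def by (rule laurent_coeff_in_rational_space[OF locally_finite_translate[OF \<nu>(2)] h[unfolded ws_def] \<sigma> w(3)])
  have F2: "\<forall>\<^sub>F \<xi> in germ0. F s \<xi> = homogeneous_component m (shifted_gf \<Lambda> L s c) \<xi>" for s
    unfolding F_def by (rule homogeneous_component_germ[OF locally_finite_translate[OF \<nu>(2)] h ws0 shifted_gf_germ[OF \<Lambda> L c]])
  have G1: "G \<gamma> \<in> rational_space N v m" for \<gamma>
    unfolding G_def ws_def by (rule laurent_coeff_in_rational_space[OF mlf hc[unfolded ws_def] \<sigma> w(3)])
  have G2: "\<forall>\<^sub>F \<xi> in germ0. G \<gamma> \<xi> = homogeneous_component m (translated_cone_integral \<Lambda> c \<gamma>) \<xi>"
    if "\<gamma> \<in> dual_lattice \<Lambda>" for \<gamma>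
    unfolding G_def by (rule homogeneous_component_germ[OF mlf hc ws0 translated_cone_integral_germ[OF \<Lambda> c that]])
  \<comment> \<open>The polynomial weight in \<open>x\<close> common to \<open>F\<close> and
    \<open>G\<close>. On a polar hyperplane of \<xi> it is 0 by the convention for division,
    consistently with \<open>laurent_coeff\<close>, so the Fourier statements hold for every
    \<xi>.\<close>
  define B where "B \<xi> x = (if m + int (length ws) < 0 then 0
      else \<Sum>i=0..nat (m + int (length ws)). blinfun_apply \<xi> x ^ i / fact i * fps_nth (todd_fps ws \<xi>) (nat (m + int (length ws)) - i))
      / (\<Prod>w\<leftarrow>ws. blinfun_apply \<xi> w)" for \<xi> :: "'a cdual" and x
  define k where "k \<xi> x = ?h x * B \<xi> x" for \<xi> x
  have contB: "continuous_on UNIV (B \<xi>)" for \<xi>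
  proof (cases "m + int (length ws) < 0")
    case True
    then have "B \<xi> = (\<lambda>_. 0)" by (simp add: B_def fun_eq_iff)
    then show ?thesis by simp
  next
    case False
    then have "B \<xi> = (\<lambda>x. (\<Sum>i=0..nat (m + int (length ws)). blinfun_apply \<xi> x ^ i * inverse (fact i) *
        fps_nth (todd_fps ws \<xi>) (nat (m + int (length ws)) - i)) * inverse (\<Prod>w\<leftarrow>ws. blinfun_apply \<xi> w))"
      by (simp add: B_def fun_eq_iff divide_inverse)
    then show ?thesis by (simp only:) (intro continuous_intros)
  qed
  have kb: "bounded_kernel (k \<xi>)" for \<xi> unfolding k_def by (rule bounded_kernel_mult[OF h contB])
  have Fk: "F s \<xi> = (LINT x|?\<nu>. k \<xi> (x - s))" for s \<xi>
  proof -
    have "F s \<xi> = (LINT x|distr ?\<nu> borel (\<lambda>x. x - s). k \<xi> x)"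
      unfolding F_def laurent_coeff_eq_integral[OF locally_finite_translate[OF \<nu>(2)] h] k_def B_def ..
    also have "\<dots> = (LINT x|?\<nu>. k \<xi> (x - s))"
      by (rule integral_distr[OF _ bounded_kernel_borel[OF kb]]) (simp add: locally_finite_borel_measurable[OF \<nu>(2)])
    finally show ?thesis .
  qed
  have Gk: "G \<gamma> \<xi> = (LINT x|?m. k \<xi> x * character \<gamma> x)" for \<gamma> \<xi>
    unfolding G_def laurent_coeff_eq_integral[OF mlf hc] k_def B_def
    by (intro Bochner_Integration.integral_cong refl) (simp only: mult_ac)
  \<comment> \<open>Periodicity is invariance of the slice measure under the lattice vector
    \<open>x\<close>, applied to the periodization.\<close>
  have per: "F (s + x) = F s" if "x \<in> \<Lambda>" for s x
  proof
    fix \<xi>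
    have m: "(\<lambda>y. k \<xi> (y - (s + x))) \<in> borel_measurable borel"
      by (rule bounded_kernel_borel[OF bounded_kernel_shift[OF kb]])
    show "F (s + x) \<xi> = F s \<xi>"
      unfolding Fk using integral_invariant(1)[OF \<nu>(1) sets\<nu> that m] by simp
  qed
  have coeff: "fourier_coefficient \<Lambda> (\<lambda>s. F s \<xi>) \<gamma> = (if \<gamma> \<in> annihilator L then G \<gamma> \<xi> else 0)"
    if \<gamma>: "\<gamma> \<in> dual_lattice \<Lambda>" for \<gamma> \<xi>
  proof -
    have "fourier_coefficient \<Lambda> (\<lambda>s. F s \<xi>) \<gamma> =
        (LINT s|?m. indicator (fundamental_domain \<Lambda>) s * (character (- \<gamma>) s * (LINT x|?\<nu>. k \<xi> (x - s))))"
      unfolding fourier_coefficient_def set_lebesgue_integral_def Fk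
      by (intro Bochner_Integration.integral_cong refl) (simp add: indicator_def)
    \<comment> \<open>The coefficient factors into that of the slice measure, which selects the
      annihilator of \<open>L\<close>, and the transform of the kernel, which is the component of
      the translated cone integral.\<close>
    also have "\<dots> = (if \<gamma> \<in> annihilator L then 1 else 0) * G \<gamma> \<xi>"
      unfolding fourier_periodization[OF \<Lambda> \<nu> kb \<gamma>] slice_fourier[OF \<Lambda> L \<gamma>] Gk ..
    finally show ?thesis by simp
  qed
  have L2: "L2_has_fourier_sum \<Lambda> (\<lambda>\<gamma>. G \<gamma> \<xi>) (dual_lattice \<Lambda> \<inter> annihilator L) (\<lambda>s. F s \<xi>)" for \<xi>
  proof (rule L2_has_fourier_sum_bounded[OF \<Lambda>])
    obtain C where C: "\<And>s. s \<in> fundamental_domain \<Lambda> \<Longrightarrow> norm (LINT x|?\<nu>. k \<xi> (x - s)) \<le> C"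
      by (rule periodization_bounded[OF \<Lambda> \<nu>(2) kb]) blast
    show "bounded_borel \<Lambda> (\<lambda>s. F s \<xi>)"
      unfolding Fk by (rule bounded_borelI[OF periodization_borel[OF \<nu>(2) kb] C])
    show "fourier_coefficient \<Lambda> (\<lambda>s. F s \<xi>) \<gamma> = (if \<gamma> \<in> dual_lattice \<Lambda> \<inter> annihilator L then G \<gamma> \<xi> else 0)"
      if "\<gamma> \<in> dual_lattice \<Lambda>" for \<gamma>
      using coeff[OF that] that by simp
  qed simp
  show ?thesis
    by (intro exI[of _ F] exI[of _ G] conjI allI ballI F1 F2 G1 G2 per coeff L2)
qed

end
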